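(* Let $V$ be a simple real Jordan algebra with simple $V^+$ and split rank $r_0>1$, and suppose that $\mathfrak g=\mathfrak{co}(V)\not\cong\mathfrak{so}(p,q)$ with $p+q$ odd, $p,q\ge3$. Let $\lambda=\lambda_1=\frac{r_0d}{2r}$ and $\mathcal B=\mathcal B_{\lambda}$. Then the ring of differential operators on $\mathcal O$ generated by the Bessel operators ${}_\phi\mathcal B:=\langle\phi,\mathcal B\rangle$, $\phi\in V^*$, is isomorphic to the ring of functions on $\mathcal O$ which are restrictions of polynomials on $V$.
   Context: $V$ is a finite-dimensional simple real Jordan algebra with unit $\mathbf e$ (complex simple Jordan algebras, viewed as real, are allowed); $n=\dim_{\mathbb R}V$; $r$ is its rank (degree of a generic minimal polynomial); $L(x)$ is multiplication by $x$; $P(x,y)=L(x)L(y)+L(y)L(x)-L(xy)$, $P(x)=P(x,x)$; $\mathrm{tr}(x)=\frac rn\mathrm{Tr}\,L(x)$; $\det$ is the Jordan determinant; $\tau(x,y)=\mathrm{tr}(xy)$. Fix a Cartan involution $\vartheta$ of $V$, i.e. an involutive automorphism such that $(x|y)=\tau(x,\vartheta y)$ is positive definite; $V^+$ is its $+1$-eigenspace, and the split rank $r_0$ is the rank of $V^+$. Fix a Jordan frame $c_1,\dots,c_{r_0}$ of $V^+$ (orthogonal primitive idempotents with sum $\mathbf e$), and let $d=\dim V_{ij}$ for $i<j$, where $V_{ij}=\{x\in V:L(c_k)x=\frac{\delta_{ik}+\delta_{jk}}2x\ \forall k\}$. $\mathrm{Str}(V)$ is the group of $g\in GL(V)$ with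 $\det(gx)=\chi(g)\det(x)$ for all $x$ and some constant $\chi(g)\ne0$; $L$ is its identity component; $\mathcal O=L\cdot c_1$ (the minimal non-zero $L$-orbit in the closure of $L\cdot\mathbf e$). $\mathfrak{co}(V)$ is the Lie algebra of the conformal group $\mathrm{Co}(V)$, the group of rational transformations of $V$ generated by translations, $\mathrm{Str}(V)$ and $x\mapsto-x^{-1}$; it consists of the vector fields $z\mapsto u+Tz-P(z)v$ with $u,v\in V$, $T\in\mathrm{Lie}(\mathrm{Str}(V))$. For a basis $(e_\alpha)$ of $V$ with $\tau$-dual basis $(\bar e_\alpha)$ and coordinates $x_\alpha$, the $V$-valued Bessel operator is $\mathcal B_\lambda f(x)=\sum_{\alpha,\beta}\frac{\partial^2f}{\partial x_\alpha\partial x_\beta}P(\bar e_\alpha,\bar e_\beta)x+\lambda\sum_\alpha\frac{\partial f}{\partial x_\alpha}\bar e_\alpha$. For $\lambda=\lambda_1$ it is tangential to $\mathcal O$ and so induces differential operators ${}_\phi\mathcal B$ on $\mathcal O$; these operators commute. *)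

theory Defs
  imports
    "HOL-Analysis.Analysis"
    "HOL-Algebra.QuotRing"
    "HOL-Algebra.Generated_Rings"
    "HOL-Computational_Algebra.Polynomial"
    "Jordan_Normal_Form.Matrix"
begin

section \<open>Unital real Jordan algebras\<close>

text \<open>The underlying vector space is a Euclidean space type. Its inner product and the set
  \<open>Basis\<close> only serve to provide the topology of a finite-dimensional real vector space, the
  dimension, and a reference basis for expressions that do not depend on the choice of basis.\<close>

record 'a jalg =
  jmult :: "'a \<Rightarrow> 'a \<Rightarrow> 'a"
  junit :: 'a

definition jordan_algebra :: "'a::euclidean_space jalg \<Rightarrow> bool" where
  "jordan_algebra V \<longleftrightarrow>
     bilinear (jmult V) \<and>
     (\<forall>x y. jmult V x y = jmult V y x) \<and>
     (\<forall>x. jmult V (junit V) x = x) \<and>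
     (\<forall>x y. jmult V x (jmult V (jmult V x x) y) = jmult V (jmult V x x) (jmult V x y))"

definition jideal_in :: "'a::euclidean_space jalg \<Rightarrow> 'a set \<Rightarrow> 'a set \<Rightarrow> bool" where
  "jideal_in V S I \<longleftrightarrow> subspace I \<and> I \<subseteq> S \<and> (\<forall>x\<in>S. \<forall>y\<in>I. jmult V x y \<in> I)"

text \<open>Simplicity of a subalgebra \<open>S\<close> containing the unit, so that the product on \<open>S\<close> is
  non-zero as soon as \<open>S\<close> is.\<close>

definition jsimple_on :: "'a::euclidean_space jalg \<Rightarrow> 'a set \<Rightarrow> bool" where
  "jsimple_on V S \<longleftrightarrow> S \<noteq> {0} \<and> (\<forall>I. jideal_in V S I \<longrightarrow> I = {0} \<or> I = S)"

definition simple_jordan_algebra :: "'a::euclidean_space jalg \<Rightarrow> bool" where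
  "simple_jordan_algebra V \<longleftrightarrow> jordan_algebra V \<and> jsimple_on V UNIV"

section \<open>Minimal polynomial, rank, determinant, trace\<close>

definition jpow :: "'a::euclidean_space jalg \<Rightarrow> 'a \<Rightarrow> nat \<Rightarrow> 'a" where
  "jpow V x k = (jmult V x ^^ k) (junit V)"

definition jpoly :: "'a::euclidean_space jalg \<Rightarrow> real poly \<Rightarrow> 'a \<Rightarrow> 'a" where
  "jpoly V p x = (\<Sum>k\<le>Polynomial.degree p. Polynomial.coeff p k *\<^sub>R jpow V x k)"

definition min_poly :: "'a::euclidean_space jalg \<Rightarrow> 'a \<Rightarrow> real poly" where
  "min_poly V x = (THE p. lead_coeff p = 1 \<and> jpoly V p x = 0 \<and>
     (\<forall>q. q \<noteq> 0 \<longrightarrow> jpoly V q x = 0 \<longrightarrow> Polynomial.degree p \<le> Polynomial.degree q))"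

text \<open>The generic minimal polynomial of a subalgebra \<open>S\<close> (with the same unit) is the minimal
  polynomial of the regular elements, i.e. of those whose minimal polynomial has maximal
  degree.\<close>

definition jrank_on :: "'a::euclidean_space jalg \<Rightarrow> 'a set \<Rightarrow> nat" where
  "jrank_on V S = Max ((\<lambda>x. Polynomial.degree (min_poly V x)) ` S)"

definition jrank :: "'a::euclidean_space jalg \<Rightarrow> nat" where
  "jrank V = jrank_on V UNIV"

text \<open>With the generic minimal polynomial written as
  \<open>T^r - a\<^sub>1(x) T^(r-1) + \<dots> + (-1)^r a\<^sub>r(x)\<close>, the determinant is the polynomial function \<open>a\<^sub>r\<close>;
  regular elements are dense, so it is determined by its values there.\<close>

definition jdet :: "'a::euclidean_space jalg \<Rightarrow> 'a \<Rightarrow> real" where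
  "jdet V = (THE D. real_polynomial_function D \<and>
     (\<forall>x. Polynomial.degree (min_poly V x) = jrank V \<longrightarrow>
        D x = (- 1) ^ jrank V * Polynomial.coeff (min_poly V x) 0))"

definition linear_trace :: "('a::euclidean_space \<Rightarrow> 'a) \<Rightarrow> real" where
  "linear_trace T = (\<Sum>b\<in>Basis. inner (T b) b)"

definition jtr :: "'a::euclidean_space jalg \<Rightarrow> 'a \<Rightarrow> real" where
  "jtr V x = real (jrank V) / real DIM('a) * linear_trace (jmult V x)"

definition jtau :: "'a::euclidean_space jalg \<Rightarrow> 'a \<Rightarrow> 'a \<Rightarrow> real" where
  "jtau V x y = jtr V (jmult V x y)"

definition jP :: "'a::euclidean_space jalg \<Rightarrow> 'a \<Rightarrow> 'a \<Rightarrow> 'a \<Rightarrow> 'a" where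
  "jP V x y z =
     jmult V x (jmult V y z) + jmult V y (jmult V x z) - jmult V (jmult V x y) z"

section \<open>Cartan involution, Jordan frame, Peirce spaces\<close>

definition cartan_involution :: "'a::euclidean_space jalg \<Rightarrow> ('a \<Rightarrow> 'a) \<Rightarrow> bool" where
  "cartan_involution V \<theta> \<longleftrightarrow>
     linear \<theta> \<and> (\<forall>x y. \<theta> (jmult V x y) = jmult V (\<theta> x) (\<theta> y)) \<and> (\<forall>x. \<theta> (\<theta> x) = x) \<and>
     (\<forall>x. x \<noteq> 0 \<longrightarrow> jtau V x (\<theta> x) > 0)"

definition plus_space :: "('a \<Rightarrow> 'a) \<Rightarrow> 'a set" where
  "plus_space \<theta> = {x. \<theta> x = x}"

definition split_rank :: "'a::euclidean_space jalg \<Rightarrow> ('a \<Rightarrow> 'a) \<Rightarrow> nat" where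
  "split_rank V \<theta> = jrank_on V (plus_space \<theta>)"

definition jidempotent :: "'a::euclidean_space jalg \<Rightarrow> 'a \<Rightarrow> bool" where
  "jidempotent V c \<longleftrightarrow> jmult V c c = c"

definition primitive_idempotent_on :: "'a::euclidean_space jalg \<Rightarrow> 'a set \<Rightarrow> 'a \<Rightarrow> bool" where
  "primitive_idempotent_on V S c \<longleftrightarrow>
     c \<in> S \<and> c \<noteq> 0 \<and> jidempotent V c \<and>
     \<not> (\<exists>a\<in>S. \<exists>b\<in>S. a \<noteq> 0 \<and> b \<noteq> 0 \<and> jidempotent V a \<and> jidempotent V b \<and>
          jmult V a b = 0 \<and> c = a + b)"

definition jordan_frame_on :: "'a::euclidean_space jalg \<Rightarrow> 'a set \<Rightarrow> nat \<Rightarrow> (nat \<Rightarrow> 'a) \<Rightarrow> bool" where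
  "jordan_frame_on V S m c \<longleftrightarrow>
     (\<forall>i\<in>{1..m}. primitive_idempotent_on V S (c i)) \<and>
     (\<forall>i\<in>{1..m}. \<forall>j\<in>{1..m}. i \<noteq> j \<longrightarrow> jmult V (c i) (c j) = 0) \<and>
     (\<Sum>i\<in>{1..m}. c i) = junit V"

definition peirce_space ::
  "'a::euclidean_space jalg \<Rightarrow> nat \<Rightarrow> (nat \<Rightarrow> 'a) \<Rightarrow> nat \<Rightarrow> nat \<Rightarrow> 'a set" where
  "peirce_space V m c i j =
     {x. \<forall>k\<in>{1..m}. jmult V (c k) x = ((of_bool (i = k) + of_bool (j = k)) / 2) *\<^sub>R x}"

section \<open>Structure group and the minimal orbit\<close>

definition Str :: "'a::euclidean_space jalg \<Rightarrow> ('a \<Rightarrow>\<^sub>L 'a) set" where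
  "Str V = {g. bij (blinfun_apply g) \<and>
     (\<exists>k. k \<noteq> 0 \<and> (\<forall>x. jdet V (blinfun_apply g x) = k * jdet V x))}"

definition Str_id :: "'a::euclidean_space jalg \<Rightarrow> ('a \<Rightarrow>\<^sub>L 'a) set" where
  "Str_id V = connected_component_set (Str V) id_blinfun"

definition Str_orbit :: "'a::euclidean_space jalg \<Rightarrow> 'a \<Rightarrow> 'a set" where
  "Str_orbit V x = (\<lambda>g. blinfun_apply g x) ` Str_id V"

section \<open>The conformal Lie algebra\<close>

text \<open>The Lie algebra of the closed subgroup \<open>Str V\<close> of the general linear group, as the set of
  generators of its one-parameter subgroups.\<close>

definition Lie_Str :: "'a::euclidean_space jalg \<Rightarrow> ('a \<Rightarrow>\<^sub>L 'a) set" where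
  "Lie_Str V = {T. \<exists>\<gamma> :: real \<Rightarrow> 'a \<Rightarrow>\<^sub>L 'a.
     (\<forall>t. \<gamma> t \<in> Str V) \<and> (\<forall>s t. \<gamma> (s + t) = \<gamma> s o\<^sub>L \<gamma> t) \<and>
     (\<gamma> has_vector_derivative T) (at 0)}"

record 'g real_lie_algebra =
  lcarrier :: "'g set"
  ladd :: "'g \<Rightarrow> 'g \<Rightarrow> 'g"
  lscale :: "real \<Rightarrow> 'g \<Rightarrow> 'g"
  lbracket :: "'g \<Rightarrow> 'g \<Rightarrow> 'g"

definition lie_isomorphic :: "'g real_lie_algebra \<Rightarrow> 'h real_lie_algebra \<Rightarrow> bool" where
  "lie_isomorphic \<gg> \<hh> \<longleftrightarrow> (\<exists>\<Phi>. bij_betw \<Phi> (lcarrier \<gg>) (lcarrier \<hh>) \<and>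
     (\<forall>X\<in>lcarrier \<gg>. \<forall>Y\<in>lcarrier \<gg>. \<Phi> (ladd \<gg> X Y) = ladd \<hh> (\<Phi> X) (\<Phi> Y)) \<and>
     (\<forall>a. \<forall>X\<in>lcarrier \<gg>. \<Phi> (lscale \<gg> a X) = lscale \<hh> a (\<Phi> X)) \<and>
     (\<forall>X\<in>lcarrier \<gg>. \<forall>Y\<in>lcarrier \<gg>. \<Phi> (lbracket \<gg> X Y) = lbracket \<hh> (\<Phi> X) (\<Phi> Y)))"

definition conformal_algebra :: "'a::euclidean_space jalg \<Rightarrow> ('a \<Rightarrow> 'a) real_lie_algebra" where
  "conformal_algebra V = \<lparr>
     lcarrier = {(\<lambda>z. u + blinfun_apply T z - jP V z z v) | u T v. T \<in> Lie_Str V},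
     ladd = (\<lambda>X Y z. X z + Y z),
     lscale = (\<lambda>a X z. a *\<^sub>R X z),
     lbracket = (\<lambda>X Y z. frechet_derivative Y (at z) (X z) - frechet_derivative X (at z) (Y z)) \<rparr>"

definition signature_mat :: "nat \<Rightarrow> nat \<Rightarrow> real mat" where
  "signature_mat p q =
     Matrix.mat (p + q) (p + q) (\<lambda>(i, j). if i \<noteq> j then 0 else if i < p then 1 else - 1)"

definition so_algebra :: "nat \<Rightarrow> nat \<Rightarrow> real mat real_lie_algebra" where
  "so_algebra p q = \<lparr>
     lcarrier = {X \<in> carrier_mat (p + q) (p + q).
       transpose_mat X * signature_mat p q + signature_mat p q * X = 0\<^sub>m (p + q) (p + q)},
     ladd = (\<lambda>X Y. X + Y),
     lscale = (\<lambda>a X. a \<cdot>\<^sub>m X),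
     lbracket = (\<lambda>X Y. X * Y - Y * X) \<rparr>"

section \<open>The Bessel operator\<close>

definition dir_deriv :: "'a::euclidean_space \<Rightarrow> ('a \<Rightarrow> real) \<Rightarrow> 'a \<Rightarrow> real" where
  "dir_deriv v f x = frechet_derivative f (at x) v"

definition dual_basis :: "'a::euclidean_space jalg \<Rightarrow> 'a \<Rightarrow> 'a" where
  "dual_basis V b = (THE y. \<forall>b'\<in>Basis. jtau V b' y = of_bool (b' = b))"

definition bessel :: "'a::euclidean_space jalg \<Rightarrow> real \<Rightarrow> ('a \<Rightarrow> real) \<Rightarrow> 'a \<Rightarrow> 'a" where
  "bessel V l f x =
     (\<Sum>a\<in>Basis. \<Sum>b\<in>Basis.
        dir_deriv a (dir_deriv b f) x *\<^sub>R jP V (dual_basis V a) (dual_basis V b) x)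
     + l *\<^sub>R (\<Sum>a\<in>Basis. dir_deriv a f x *\<^sub>R dual_basis V a)"

section \<open>Smooth functions and operators on an embedded submanifold\<close>

primrec Ck_on :: "nat \<Rightarrow> 'a::euclidean_space set \<Rightarrow> ('a \<Rightarrow> real) \<Rightarrow> bool" where
  "Ck_on 0 U f \<longleftrightarrow> continuous_on U f"
| "Ck_on (Suc k) U f \<longleftrightarrow>
     (\<forall>x\<in>U. f differentiable (at x)) \<and> (\<forall>v. Ck_on k U (dir_deriv v f))"

definition smooth_on :: "'a::euclidean_space set \<Rightarrow> ('a \<Rightarrow> real) \<Rightarrow> bool" where
  "smooth_on U f \<longleftrightarrow> open U \<and> (\<forall>k. Ck_on k U f)"

definition local_extension ::
  "'a::euclidean_space set \<Rightarrow> ('a \<Rightarrow> real) \<Rightarrow> 'a \<Rightarrow> ('a \<Rightarrow> real) \<Rightarrow> bool" where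
  "local_extension M f x F \<longleftrightarrow>
     (\<exists>U. x \<in> U \<and> smooth_on U F \<and> (\<forall>y\<in>U \<inter> M. F y = f y))"

text \<open>Functions on \<open>M\<close> are extensional. For an embedded (locally closed) submanifold, such as an
  orbit of the identity component of a real algebraic group acting linearly, smoothness on \<open>M\<close>
  is the existence of local smooth extensions to the ambient space.\<close>

definition smooth_functions :: "'a::euclidean_space set \<Rightarrow> ('a \<Rightarrow> real) set" where
  "smooth_functions M = {f \<in> extensional M. \<forall>x\<in>M. \<exists>F. local_extension M f x F}"

definition operator_ring :: "'a::euclidean_space set \<Rightarrow> (('a \<Rightarrow> real) \<Rightarrow> 'a \<Rightarrow> real) ring" where
  "operator_ring M = \<lparr>
     carrier = {D \<in> smooth_functions M \<rightarrow>\<^sub>E smooth_functions M.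
       \<forall>f\<in>smooth_functions M. \<forall>g\<in>smooth_functions M. \<forall>a b.
         D (\<lambda>x\<in>M. a * f x + b * g x) = (\<lambda>x\<in>M. a * D f x + b * D g x)},
     monoid.mult = (\<lambda>D E. compose (smooth_functions M) D E),
     one = (\<lambda>f\<in>smooth_functions M. f),
     zero = (\<lambda>f\<in>smooth_functions M. \<lambda>x\<in>M. 0),
     add = (\<lambda>D E. \<lambda>f\<in>smooth_functions M. \<lambda>x\<in>M. D f x + E f x) \<rparr>"

definition scalar_operator :: "'a::euclidean_space set \<Rightarrow> real \<Rightarrow> ('a \<Rightarrow> real) \<Rightarrow> 'a \<Rightarrow> real" where
  "scalar_operator M a = (\<lambda>f\<in>smooth_functions M. \<lambda>x\<in>M. a * f x)"

text \<open>The operator induced on \<open>M\<close> by \<open>\<langle>\<phi>, B\<rangle>\<close>: when \<open>B\<close> is tangential to \<open>M\<close>, the value at \<open>x\<close>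
  does not depend on the local extension.\<close>

definition bessel_operator ::
  "'a::euclidean_space jalg \<Rightarrow> real \<Rightarrow> 'a set \<Rightarrow> ('a \<Rightarrow> real) \<Rightarrow> ('a \<Rightarrow> real) \<Rightarrow> 'a \<Rightarrow> real" where
  "bessel_operator V l M \<phi> =
     (\<lambda>f\<in>smooth_functions M. \<lambda>x\<in>M.
        THE y. \<forall>F. local_extension M f x F \<longrightarrow> y = \<phi> (bessel V l F x))"

text \<open>Rings of real differential operators contain the real constants, hence the scalar operators
  among the generators.\<close>

definition bessel_ring ::
  "'a::euclidean_space jalg \<Rightarrow> real \<Rightarrow> 'a set \<Rightarrow> (('a \<Rightarrow> real) \<Rightarrow> 'a \<Rightarrow> real) ring" where
  "bessel_ring V l M = (operator_ring M)\<lparr> carrier :=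
     generate_ring (operator_ring M)
       (range (scalar_operator M) \<union> {bessel_operator V l M \<phi> | \<phi>. linear \<phi>}) \<rparr>"

definition polynomial_restrictions :: "'a::euclidean_space set \<Rightarrow> ('a \<Rightarrow> real) ring" where
  "polynomial_restrictions M = \<lparr>
     carrier = {restrict p M | p. real_polynomial_function p},
     monoid.mult = (\<lambda>f g. \<lambda>x\<in>M. f x * g x),
     one = (\<lambda>x\<in>M. 1),
     zero = (\<lambda>x\<in>M. 0),
     add = (\<lambda>f g. \<lambda>x\<in>M. f x + g x) \<rparr>"

end

theory Submission
  imports Defs
    "Jordan_Normal_Form.Char_Poly"
    "HOL-Computational_Algebra.Polynomial_Factorial"
    "HOL-Computational_Algebra.Field_as_Ring"
    "HOL-Computational_Algebra.Fundamental_Theorem_Algebra"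
    "HOL-Computational_Algebra.Polynomial_FPS"
begin

text \<open>For \<open>z \<in> V\<close> let \<open>X\<^sub>z\<close> be multiplication by the linear function
\<open>\<tau>(z, \<cdot>)\<close>, let \<open>B\<^sub>z = \<tau>(z, B)\<close>, and let \<open>T\<^sub>z = 2
\<partial>\<^sub>x\<^sub>z + \<lambda> \<tau>(z, e)\<close>, all acting on smooth functions of
\<open>x\<close>. For every \<open>\<lambda>\<close> one has \<open>[B\<^sub>e, X\<^sub>z] =
T\<^sub>z\<close>, \<open>[B\<^sub>e, T\<^sub>z] = 2 B\<^sub>z\<close>, \<open>[B\<^sub>e, B\<^sub>z] =
0\<close>, and dually \<open>[X\<^sub>e, B\<^sub>z] = - T\<^sub>z\<close>, \<open>[X\<^sub>e, - T\<^sub>z] = 2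
X\<^sub>z\<close>, \<open>[X\<^sub>e, X\<^sub>z] = 0\<close>. These are relations of the conformal Lie
algebra, where \<open>X\<close>, \<open>T\<close>, \<open>B\<close> lie in degrees 1, 0, -1 of its three-term
grading, and they are all that the final argument uses.

Suppose that a non-commutative polynomial \<open>\<Sum> c\<^sub>w X\<^sup>w\<close> of degree \<open>m\<close>
vanishes as an operator on the orbit. Each application of \<open>ad(B\<^sub>e)\<close> produces another
vanishing operator, and after \<open>2m\<close> of them only the words of length \<open>m\<close> survive,
each \<open>X\<^sub>z\<close> turned into a multiple of \<open>B\<^sub>z\<close>; thus the part of degree
\<open>m\<close> vanishes in the \<open>B\<^sub>z\<close>. By the dual relations it then vanishes in the
\<open>X\<^sub>z\<close>, may be subtracted, and an induction on the degree shows that \<open>\<Sum> c\<^sub>w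
X\<^sup>w = 0\<close> implies \<open>\<Sum> c\<^sub>w B\<^sup>w = 0\<close>, and conversely
(\<open>annihilates_iff\<close>). So restrictions of polynomials and Bessel operators generate quotients of
one free algebra by one and the same ideal (\<open>bessel_ring_iso\<close>).

It remains to see that for \<open>\<lambda> = \<lambda>\<^sub>1\<close> the operators act on functions on the
orbit at all: if a smooth \<open>F\<close> vanishes on the orbit, so does \<open>BF\<close>
(\<open>bessel_tangential\<close>). Differentiating \<open>F\<close> along \<open>g P(e + s x) P(e + t y)
c\<close> expresses the second derivatives in tangential directions at \<open>g c\<close> through the first
ones, and turns \<open>BF(g c)\<close> into a trace over the Peirce space \<open>V\<^sub>h(c)\<close> for the
eigenvalue \<open>1/2\<close>. It cancels the first-order term because on \<open>V\<^sub>0(c)\<close> the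
trace of \<open>L(u)\<close> over \<open>V\<^sub>h(c)\<close> is \<open>\<lambda>\<^sub>1 tr(u)\<close>
(\<open>mixed_trace_eq_jtr\<close>). This is where simplicity of \<open>V\<^sup>+\<close> enters: it makes any
two members of a frame exchangeable by an automorphism.

These curves have to stay in the orbit, so \<open>P(e + s x)\<close> must preserve \<open>det\<close> up to a
factor, with \<open>det\<close> given by the generic minimal polynomial. For this the coefficients of that
polynomial are shown to be polynomial functions, they are differentiated, and the generic trace is identified
with \<open>tr\<close> by simplicity of \<open>V\<close>. The same derivatives show that an element of the
structure group and its adjoint intertwine the quadratic representation (\<open>Str_adjoint\<close>), which
moves computations at \<open>g c\<close> to \<open>c\<close>.\<close>

section \<open>Unital Jordan algebras\<close>

locale jordan_alg =
  fixes V :: "'a::euclidean_space jalg"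
  assumes jordan_alg: "jordan_algebra V"
begin

abbreviation mul :: "'a \<Rightarrow> 'a \<Rightarrow> 'a" (infixl \<open>\<star>\<close> 70) where "x \<star> y \<equiv> jmult V x y"
abbreviation unit_elt :: 'a (\<open>\<ee>\<close>) where "\<ee> \<equiv> junit V"

lemma mul_bilinear: "bilinear (jmult V)"
  using jordan_alg by (simp add: jordan_algebra_def)

lemma mul_bounded_bilinear: "bounded_bilinear (jmult V)"
  using mul_bilinear by (simp add: bilinear_conv_bounded_bilinear)

lemma mul_commute: "x \<star> y = y \<star> x"
  using jordan_alg by (simp add: jordan_algebra_def)

lemma unit_mul [simp]: "\<ee> \<star> x = x" "x \<star> \<ee> = x"
proof -
  show "\<ee> \<star> x = x" using jordan_alg unfolding jordan_algebra_def by blast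
  then show "x \<star> \<ee> = x" by (metis mul_commute)
qed

lemma jordan_identity: "x \<star> ((x \<star> x) \<star> y) = (x \<star> x) \<star> (x \<star> y)"
  using jordan_alg unfolding jordan_algebra_def by blast

lemmas mul_simps =
  bilinear_ladd[OF mul_bilinear] bilinear_radd[OF mul_bilinear]
  bilinear_lsub[OF mul_bilinear] bilinear_rsub[OF mul_bilinear]
  bilinear_lneg[OF mul_bilinear] bilinear_rneg[OF mul_bilinear]
  bilinear_lmul[OF mul_bilinear] bilinear_rmul[OF mul_bilinear]
  bilinear_lzero[OF mul_bilinear] bilinear_rzero[OF mul_bilinear]

lemma linear_mul_right: "linear (\<lambda>y. x \<star> y)" and linear_mul_left: "linear (\<lambda>x. x \<star> y)"
  using mul_bilinear by (simp_all add: bilinear_def)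

lemma mul_sum_right: "x \<star> (\<Sum>i\<in>I. f i) = (\<Sum>i\<in>I. x \<star> f i)"
  and mul_sum_left: "(\<Sum>i\<in>I. f i) \<star> y = (\<Sum>i\<in>I. f i \<star> y)"
  using linear_sum[OF linear_mul_right] linear_sum[OF linear_mul_left] by auto

section \<open>Linearised Jordan identities\<close>

text \<open>The Jordan identity is cubic in its first argument; its part of degree one in a perturbation \<open>z\<close>
is obtained by comparing the identity at \<open>x + z\<close> and \<open>x - z\<close>.\<close>

lemma jordan_lin1:
  "2 *\<^sub>R (x \<star> ((x \<star> z) \<star> y)) + z \<star> ((x \<star> x) \<star> y) = 2 *\<^sub>R ((x \<star> z) \<star> (x \<star> y)) + (x \<star> x) \<star> (z \<star> y)"
    (is "?L = ?R")
proof -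
  have "2 *\<^sub>R (?L - ?R) =
      ((x + z) \<star> (((x + z) \<star> (x + z)) \<star> y) - ((x + z) \<star> (x + z)) \<star> ((x + z) \<star> y))
    - ((x - z) \<star> (((x - z) \<star> (x - z)) \<star> y) - ((x - z) \<star> (x - z)) \<star> ((x - z) \<star> y))
    - 2 *\<^sub>R (z \<star> ((z \<star> z) \<star> y) - (z \<star> z) \<star> (z \<star> y))"
    by (simp only: mul_simps mul_commute[of z x]) (simp add: algebra_simps scaleR_2)
  also have "\<dots> = 0" by (simp add: jordan_identity)
  finally show ?thesis by simp
qed

lemma jordan_lin2:
  "x \<star> ((w \<star> z) \<star> y) + w \<star> ((x \<star> z) \<star> y) + z \<star> ((x \<star> w) \<star> y)
   = (x \<star> z) \<star> (w \<star> y) + (w \<star> z) \<star> (x \<star> y) + (x \<star> w) \<star> (z \<star> y)" (is "?L = ?R")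
proof -
  have "2 *\<^sub>R (?L - ?R) =
      (2 *\<^sub>R ((x+w) \<star> (((x+w) \<star> z) \<star> y)) + z \<star> (((x+w) \<star> (x+w)) \<star> y)
        - (2 *\<^sub>R (((x+w) \<star> z) \<star> ((x+w) \<star> y)) + ((x+w) \<star> (x+w)) \<star> (z \<star> y)))
    - (2 *\<^sub>R (x \<star> ((x \<star> z) \<star> y)) + z \<star> ((x \<star> x) \<star> y) - (2 *\<^sub>R ((x \<star> z) \<star> (x \<star> y)) + (x \<star> x) \<star> (z \<star> y)))
    - (2 *\<^sub>R (w \<star> ((w \<star> z) \<star> y)) + z \<star> ((w \<star> w) \<star> y) - (2 *\<^sub>R ((w \<star> z) \<star> (w \<star> y)) + (w \<star> w) \<star> (z \<star> y)))"
    by (simp only: mul_simps mul_commute[of w x]) (simp add: algebra_simps scaleR_2)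
  also have "\<dots> = 0" by (simp only: jordan_lin1) simp
  finally show ?thesis by simp
qed

text \<open>The full linearisation read as an identity of operators acting on \<open>z\<close>. Everything about Jordan
multiplication below comes from this form.\<close>

lemma jordan_op:
  "x \<star> (y \<star> (w \<star> z)) + w \<star> (y \<star> (x \<star> z)) + ((x \<star> w) \<star> y) \<star> z
   = (w \<star> y) \<star> (x \<star> z) + (x \<star> y) \<star> (w \<star> z) + (x \<star> w) \<star> (y \<star> z)"
  using jordan_lin2[of x w z y]
  by (simp add: mul_commute[of "w \<star> z" y] mul_commute[of "x \<star> z" y] mul_commute[of z "(x \<star> w) \<star> y"]
      mul_commute[of z y] mul_commute[of "x \<star> z" "w \<star> y"] mul_commute[of "w \<star> z" "x \<star> y"] algebra_simps)

lemma jordan_op_square: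
  "2 *\<^sub>R (x \<star> (y \<star> (x \<star> z))) + ((x \<star> x) \<star> y) \<star> z = 2 *\<^sub>R ((x \<star> y) \<star> (x \<star> z)) + (x \<star> x) \<star> (y \<star> z)"
  using jordan_op[of x y x z] by (simp add: scaleR_2)

text \<open>The commutator \<open>[L(w), L(y)]\<close> of two multiplications.\<close>

definition inner_deriv :: "'a \<Rightarrow> 'a \<Rightarrow> 'a \<Rightarrow> 'a" where
  "inner_deriv w y x = w \<star> (y \<star> x) - y \<star> (w \<star> x)"

lemma linear_inner_deriv: "linear (inner_deriv w y)"
  by (rule linearI) (simp_all add: inner_deriv_def mul_simps algebra_simps)

text \<open>The right-hand side of the operator identity is symmetric in \<open>w\<close> and \<open>y\<close>, so exchanging them on the
left gives two expressions with the same value; their difference is the Leibniz rule.\<close>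

lemma inner_deriv_mul: "inner_deriv w y (x \<star> z) = inner_deriv w y x \<star> z + x \<star> inner_deriv w y z"
proof -
  have rearrange: "p2 - q2 = (q3 - p3) + (q1 - p1)"
    if "p1 + p2 + p3 = r" "q1 + q2 + q3 = r" for p1 p2 p3 q1 q2 q3 r :: 'a
    using that by (auto simp: algebra_simps)
  have 1: "x \<star> (y \<star> (w \<star> z)) + w \<star> (y \<star> (x \<star> z)) + ((x \<star> w) \<star> y) \<star> z
      = (w \<star> y) \<star> (x \<star> z) + (x \<star> y) \<star> (w \<star> z) + (x \<star> w) \<star> (y \<star> z)"
    by (rule jordan_op)
  have 2: "x \<star> (w \<star> (y \<star> z)) + y \<star> (w \<star> (x \<star> z)) + ((x \<star> y) \<star> w) \<star> z
      = (w \<star> y) \<star> (x \<star> z) + (x \<star> y) \<star> (w \<star> z) + (x \<star> w) \<star> (y \<star> z)"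
    using jordan_op[of x w y z] by (simp only: mul_commute[of y w] ac_simps)
  have "w \<star> (y \<star> x) = (x \<star> y) \<star> w" "y \<star> (w \<star> x) = (x \<star> w) \<star> y"
    by (metis mul_commute)+
  then show ?thesis using rearrange[OF 1 2] by (simp add: inner_deriv_def mul_simps)
qed

section \<open>Power associativity\<close>

definition op_commute :: "'a \<Rightarrow> 'a \<Rightarrow> bool" where
  "op_commute a b \<longleftrightarrow> (\<forall>z. a \<star> (b \<star> z) = b \<star> (a \<star> z))"

lemma op_commuteD: "op_commute a b \<Longrightarrow> a \<star> (b \<star> z) = b \<star> (a \<star> z)"
  by (simp add: op_commute_def)

lemma op_commute_sym: "op_commute a b \<Longrightarrow> op_commute b a"
  by (simp add: op_commute_def)

lemma op_commute_self_square: "op_commute x (x \<star> x)"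
  by (simp add: op_commute_def jordan_identity)

lemma op_commute_unit: "op_commute x \<ee>" "op_commute \<ee> x"
  by (simp_all add: op_commute_def)

lemma op_commute_add: "op_commute a b \<Longrightarrow> op_commute a c \<Longrightarrow> op_commute a (b + c)"
  and op_commute_scaleR: "op_commute a b \<Longrightarrow> op_commute a (t *\<^sub>R b)"
  and op_commute_zero: "op_commute a 0"
  by (simp_all add: op_commute_def mul_simps)

lemma op_commute_sum: "(\<And>i. i \<in> I \<Longrightarrow> op_commute a (f i)) \<Longrightarrow> op_commute a (\<Sum>i\<in>I. f i)"
  by (induction I rule: infinite_finite_induct) (auto simp: op_commute_zero op_commute_add)

abbreviation pw :: "'a \<Rightarrow> nat \<Rightarrow> 'a" where "pw x k \<equiv> jpow V x k"

lemma pw_0 [simp]: "pw x 0 = \<ee>" and pw_Suc: "pw x (Suc k) = x \<star> pw x k"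
  by (simp_all add: jpow_def)

lemma square_mul_pw: "(x \<star> x) \<star> pw x n = pw x (n + 2)"
proof (induction n)
  case (Suc n)
  have "(x \<star> x) \<star> pw x (Suc n) = x \<star> ((x \<star> x) \<star> pw x n)"
    by (simp add: pw_Suc jordan_identity)
  with Suc show ?case by (simp add: pw_Suc)
qed (simp add: pw_Suc numeral_2_eq_2)

text \<open>The operator identity writes \<open>L(x\<^sup>n)\<close> in terms of \<open>L(x)\<close>, \<open>L(x\<^sup>2)\<close> and multiplications by lower
powers, so commuting with the first two suffices. This yields power associativity.\<close>

lemma op_commute_pw_aux:
  assumes "op_commute a x" "op_commute a (x \<star> x)"
  shows "op_commute a (pw x n)"
proof (induction n rule: less_induct)
  case (less n)
  consider "n = 0" | "n = 1" | m where "n = m + 2"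
    by (metis One_nat_def add_2_eq_Suc' not0_implies_Suc)
  then show ?case
  proof cases
    case (3 m)
    have IH: "op_commute a (pw x m)" "op_commute a (pw x (Suc m))" using less 3 by auto
    have eq: "pw x n \<star> z = 2 *\<^sub>R (pw x (Suc m) \<star> (x \<star> z)) + (x \<star> x) \<star> (pw x m \<star> z)
        - 2 *\<^sub>R (x \<star> (pw x m \<star> (x \<star> z)))" for z
      using jordan_op_square[of x "pw x m" z] square_mul_pw[of x m] 3
      by (simp add: pw_Suc algebra_simps eq_diff_eq)
    show ?thesis unfolding op_commute_def eq
      using IH assms by (simp add: mul_simps op_commute_def)
  qed (auto simp: op_commute_unit pw_Suc assms)
qed

lemma op_commute_pw: "op_commute (pw x m) (pw x n)"
proof -
  have 1: "op_commute x (pw x n)" for n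
    by (rule op_commute_pw_aux[OF _ op_commute_self_square]) (simp add: op_commute_def)
  have 2: "op_commute (x \<star> x) (pw x n)" for n
    by (rule op_commute_pw_aux[OF op_commute_sym[OF op_commute_self_square]]) (simp add: op_commute_def)
  show ?thesis by (rule op_commute_pw_aux) (use 1 2 op_commute_sym in blast)+
qed

lemma op_commute_self_pw: "op_commute x (pw x n)"
  using op_commute_pw[of x 1 n] by (simp add: pw_Suc)

lemma pw_add: "pw x m \<star> pw x n = pw x (m + n)"
proof (induction m)
  case (Suc m)
  have "pw x (Suc m) \<star> pw x n = pw x n \<star> (x \<star> pw x m)" by (metis mul_commute pw_Suc)
  also have "\<dots> = x \<star> (pw x n \<star> pw x m)"
    using op_commute_self_pw op_commute_def by metis
  finally show ?case using Suc by (metis mul_commute add_Suc pw_Suc)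
qed simp

abbreviation pl :: "real poly \<Rightarrow> 'a \<Rightarrow> 'a" where "pl p x \<equiv> jpoly V p x"

lemma pl_bound: "Polynomial.degree p \<le> N \<Longrightarrow> pl p x = (\<Sum>k\<le>N. Polynomial.coeff p k *\<^sub>R pw x k)"
  unfolding jpoly_def
  by (rule sum.mono_neutral_left) (auto simp: coeff_eq_0)

lemma pl_add: "pl (p + q) x = pl p x + pl q x"
proof -
  let ?N = "max (Polynomial.degree p) (Polynomial.degree q)"
  show ?thesis
    using pl_bound[of p ?N x] pl_bound[of q ?N x] pl_bound[of "p + q" ?N x]
    by (simp add: degree_add_le_max scaleR_add_left sum.distrib)
qed

lemma pl_smult: "pl (Polynomial.smult a p) x = a *\<^sub>R pl p x"
  using pl_bound[of "Polynomial.smult a p" "Polynomial.degree p" x]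
  by (simp add: jpoly_def scaleR_sum_right)

lemma pl_0 [simp]: "pl 0 x = 0" by (simp add: jpoly_def)

lemma pl_diff: "pl (p - q) x = pl p x - pl q x"
  using pl_add[of p "Polynomial.smult (-1) q" x] pl_smult[of "-1" q x] by simp

lemma pl_pCons: "pl (pCons a p) x = a *\<^sub>R \<ee> + x \<star> pl p x"
proof -
  have "pl (pCons a p) x = (\<Sum>k\<le>Suc (Polynomial.degree p). Polynomial.coeff (pCons a p) k *\<^sub>R pw x k)"
    by (rule pl_bound) (simp add: degree_pCons_le)
  also have "\<dots> = a *\<^sub>R \<ee> + (\<Sum>k\<le>Polynomial.degree p. Polynomial.coeff p k *\<^sub>R pw x (Suc k))"
    by (subst sum.atMost_Suc_shift) simp
  finally show ?thesis by (simp add: jpoly_def mul_sum_right mul_simps pw_Suc)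
qed

lemma pl_1 [simp]: "pl 1 x = \<ee>"
  using pl_pCons[of 1 0 x] by (simp add: one_pCons mul_simps)

lemma pl_X [simp]: "pl [:0, 1:] x = x"
  by (simp add: pl_pCons mul_simps)

lemma pl_const: "pl [:a:] x = a *\<^sub>R \<ee>"
  by (simp add: pl_pCons mul_simps)

lemma op_commute_pl: "op_commute (pl p x) (pl q x)"
proof -
  have "op_commute (pl p x) (pw x k)" for k
    unfolding jpoly_def
    by (rule op_commute_sym) (auto intro!: op_commute_sum op_commute_scaleR op_commute_pw)
  then show ?thesis
    unfolding jpoly_def[of V q x] by (auto intro!: op_commute_sum op_commute_scaleR)
qed

lemma op_commute_self_pl: "op_commute x (pl q x)"
  using op_commute_pl[of "[:0,1:]" x q] by simp

lemma pl_mult: "pl (p * q) x = pl p x \<star> pl q x"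
proof (induction p)
  case (pCons a p)
  have "x \<star> (pl p x \<star> pl q x) = (x \<star> pl p x) \<star> pl q x"
    using op_commute_self_pl[of x q] by (metis op_commute_def mul_commute)
  with pCons show ?case
    by (simp add: pl_add pl_smult pl_pCons mul_simps)
qed (simp add: mul_simps)

lemma pl_pcompose: "pl (pcompose p q) x = pl p (pl q x)"
  by (induction p) (simp_all add: pcompose_pCons pl_add pl_mult pl_pCons pl_const mul_simps)

lemma pl_monom: "pl (Polynomial.monom a k) x = a *\<^sub>R pw x k"
proof -
  have "pl (Polynomial.monom 1 k) x = pw x k"
    by (induction k) (simp_all add: monom_Suc pl_pCons pw_Suc)
  then show ?thesis using pl_smult[of a "Polynomial.monom 1 k" x] by (simp add: smult_monom)
qed

section \<open>Quadratic operators and inverses\<close>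

abbreviation Pop :: "'a \<Rightarrow> 'a \<Rightarrow> 'a" where "Pop x z \<equiv> jP V x x z"

lemma Pop_eq: "Pop x z = 2 *\<^sub>R (x \<star> (x \<star> z)) - (x \<star> x) \<star> z"
  by (simp add: jP_def scaleR_2)

lemma jP_add1: "jP V (x + x') y z = jP V x y z + jP V x' y z"
  and jP_add2: "jP V x (y + y') z = jP V x y z + jP V x y' z"
  and jP_add3: "jP V x y (z + z') = jP V x y z + jP V x y z'"
  and jP_scale1: "jP V (t *\<^sub>R x) y z = t *\<^sub>R jP V x y z"
  and jP_scale2: "jP V x (t *\<^sub>R y) z = t *\<^sub>R jP V x y z"
  and jP_scale3: "jP V x y (t *\<^sub>R z) = t *\<^sub>R jP V x y z"
  by (simp_all add: jP_def mul_simps algebra_simps)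

lemma jP_sym: "jP V x y z = jP V y x z"
  by (simp add: jP_def mul_commute[of x y])

lemma linear_jP1: "linear (\<lambda>x. jP V x y z)" and linear_jP2: "linear (\<lambda>y. jP V x y z)"
  and linear_jP3: "linear (\<lambda>z. jP V x y z)"
  by (auto intro!: linearI simp: jP_add1 jP_add2 jP_add3 jP_scale1 jP_scale2 jP_scale3)

lemma Pop_add: "Pop (x + y) z = Pop x z + 2 *\<^sub>R jP V x y z + Pop y z"
  by (simp add: jP_add1 jP_add2 jP_sym[of y x] scaleR_2)

lemma Pop_scale: "Pop (t *\<^sub>R x) z = (t * t) *\<^sub>R Pop x z"
  by (simp add: jP_scale1 jP_scale2)

lemma jP_unit [simp]: "jP V \<ee> x z = x \<star> z" "jP V x \<ee> z = x \<star> z"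
  by (simp_all add: jP_def)

text \<open>Requiring the inverse to be a polynomial in \<open>a\<close> makes the multiplications by \<open>a\<close> and \<open>b\<close> commute;
the bare equation \<open>a b = e\<close> does not.\<close>

definition inverse_pair :: "'a \<Rightarrow> 'a \<Rightarrow> bool" where
  "inverse_pair a b \<longleftrightarrow> a \<star> b = \<ee> \<and> (\<exists>q. b = pl q a)"

lemma inverse_pairD:
  assumes "inverse_pair a b"
  shows "a \<star> b = \<ee>" "op_commute a b" "op_commute a (b \<star> b)" "op_commute (a \<star> a) b"
    "op_commute (a \<star> a) (b \<star> b)" "(a \<star> a) \<star> b = a" "a \<star> (b \<star> b) = b" "(a \<star> a) \<star> (b \<star> b) = \<ee>"
proof -
  obtain q where b: "b = pl q a" and ab: "a \<star> b = \<ee>" using assms by (auto simp: inverse_pair_def)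
  have aa: "a \<star> a = pl ([:0,1:] * [:0,1:]) a" by (simp only: pl_mult pl_X)
  have bb: "b \<star> b = pl (q * q) a" by (simp only: pl_mult b)
  show "a \<star> b = \<ee>" by fact
  show c: "op_commute a b" unfolding b by (rule op_commute_self_pl)
  show "op_commute a (b \<star> b)" unfolding bb by (rule op_commute_self_pl)
  show "op_commute (a \<star> a) b" unfolding b aa by (rule op_commute_pl)
  show "op_commute (a \<star> a) (b \<star> b)" unfolding bb aa by (rule op_commute_pl)
  show aab: "(a \<star> a) \<star> b = a"
    using op_commuteD[OF c, of a] ab by (metis mul_commute unit_mul(2))
  show abb: "a \<star> (b \<star> b) = b"
    using op_commuteD[OF c, of b] ab by (metis unit_mul(2))
  have "(a \<star> a) \<star> (b \<star> b) = pl ([:0,1:] * q) a \<star> pl ([:0,1:] * q) a"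
    unfolding aa bb by (simp only: pl_mult[symmetric] ac_simps)
  also have "\<dots> = \<ee>" by (simp only: pl_mult pl_X b[symmetric] ab unit_mul)
  finally show "(a \<star> a) \<star> (b \<star> b) = \<ee>" .
qed

text \<open>The operator identity for \<open>a, a, b\<close> becomes the standard relation \<open>P(a) L(a\<^sup>-\<^sup>1) = L(a)\<close>.\<close>

lemma Pop_mul_inverse:
  assumes "inverse_pair a b" shows "Pop a (b \<star> z) = a \<star> z"
proof -
  note D = inverse_pairD[OF assms]
  have "2 *\<^sub>R (a \<star> (a \<star> (b \<star> z))) + a \<star> z = 2 *\<^sub>R (a \<star> z) + (a \<star> a) \<star> (b \<star> z)"
    using jordan_op_square[of a b z] D by (simp add: op_commute_def)
  then show ?thesis by (simp add: Pop_eq algebra_simps scaleR_2)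
qed

lemma mul_inverse_Pop:
  assumes "inverse_pair a b" shows "b \<star> Pop a z = a \<star> z"
proof -
  note D = inverse_pairD[OF assms]
  have "b \<star> Pop a z = Pop a (b \<star> z)"
    using D by (simp add: Pop_eq mul_simps op_commute_def)
  then show ?thesis using Pop_mul_inverse[OF assms] by simp
qed

lemma Pop_inverse:
  assumes "inverse_pair a b" shows "Pop a (Pop b z) = z"
proof -
  note D = inverse_pairD[OF assms]
  have "2 *\<^sub>R (a \<star> (a \<star> ((b \<star> b) \<star> z))) + z = 2 *\<^sub>R (b \<star> (a \<star> z)) + (a \<star> a) \<star> ((b \<star> b) \<star> z)"
    using jordan_op_square[of a "b \<star> b" z] D by (simp add: op_commute_def)
  then have 1: "Pop a ((b \<star> b) \<star> z) = 2 *\<^sub>R (b \<star> (a \<star> z)) - z"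
    by (simp add: Pop_eq algebra_simps)
  have "Pop a (Pop b z) = 2 *\<^sub>R Pop a (b \<star> (b \<star> z)) - Pop a ((b \<star> b) \<star> z)"
    unfolding Pop_eq[of b] by (simp add: linear_diff[OF linear_jP3] jP_scale3)
  then show ?thesis using Pop_mul_inverse[OF assms, of "b \<star> z"] 1 op_commuteD[OF D(2), of z] by simp
qed

lemma Pop_inverse':
  assumes "inverse_pair a b" shows "Pop b (Pop a z) = z"
proof -
  note D = inverse_pairD[OF assms]
  obtain q where b: "b = pl q a" using assms by (auto simp: inverse_pair_def)
  have bb: "b \<star> b = pl (q * q) a" by (simp only: pl_mult b)
  have aa: "a \<star> a = pl ([:0,1:] * [:0,1:]) a" by (simp only: pl_mult pl_X)
  have c: "(b \<star> b) \<star> (a \<star> v) = a \<star> ((b \<star> b) \<star> v)" "b \<star> ((a \<star> a) \<star> v) = (a \<star> a) \<star> (b \<star> v)"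
    "b \<star> (a \<star> v) = a \<star> (b \<star> v)" "(b \<star> b) \<star> ((a \<star> a) \<star> v) = (a \<star> a) \<star> ((b \<star> b) \<star> v)" for v
    using D by (simp_all add: op_commute_def)
  have "Pop b (Pop a z) = Pop a (Pop b z)"
    by (simp add: Pop_eq mul_simps c scaleR_diff_right)
  then show ?thesis using Pop_inverse[OF assms] by simp
qed

text \<open>Along a line through the unit the derivative of \<open>P(a)\<close> factors through \<open>P(a)\<close>. It makes the
logarithmic derivative of \<open>det P(a) z\<close> independent of \<open>z\<close>.\<close>

lemma jP_curve:
  assumes "inverse_pair a b" and a: "a = \<ee> + s *\<^sub>R x"
  shows "jP V a x z = (b \<star> x) \<star> Pop a z"
proof (cases "s = 0")
  case True
  then have "b = \<ee>" using inverse_pairD(1)[OF assms(1)] a by simp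
  with True a show ?thesis by simp
next
  case False
  have "s *\<^sub>R (b \<star> x) = b \<star> (a - \<ee>)" using a by (simp add: mul_simps)
  also have "\<dots> = \<ee> - b" using inverse_pairD(1)[OF assms(1)] by (simp add: mul_simps mul_commute)
  finally have w: "s *\<^sub>R (b \<star> x) = \<ee> - b" .
  have "s *\<^sub>R jP V a x z = jP V a (a - \<ee>) z" using a by (simp add: jP_scale2)
  also have "\<dots> = Pop a z - a \<star> z" by (simp add: linear_diff[OF linear_jP2])
  also have "\<dots> = (\<ee> - b) \<star> Pop a z" using mul_inverse_Pop[OF assms(1)] by (simp add: mul_simps)
  also have "\<dots> = s *\<^sub>R ((b \<star> x) \<star> Pop a z)" by (simp add: w[symmetric] mul_simps)
  finally show ?thesis using False by simp
qed

text \<open>The cubic identity behind the commutativity of the Bessel operators: after polarization it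
cancels the third-order part of their commutator.\<close>

lemma jP_square_mul: "jP V (x \<star> x) x z = x \<star> Pop x z"
proof -
  have "((x \<star> x) \<star> x) \<star> z = 2 *\<^sub>R ((x \<star> x) \<star> (x \<star> z)) + (x \<star> x) \<star> (x \<star> z) - 2 *\<^sub>R (x \<star> (x \<star> (x \<star> z)))"
    using jordan_op_square[of x x z] by (simp add: algebra_simps eq_diff_eq)
  then show ?thesis
    by (simp add: jP_def Pop_eq mul_simps jordan_identity algebra_simps scaleR_2)
qed

end

text \<open>Tests an equation of vectors against the inner product, which reduces linear identities with
numerical coefficients to arithmetic.\<close>

lemma vector_eqI_inner: "(\<And>u. inner v u = inner (w :: 'a::real_inner) u) \<Longrightarrow> v = w"
  by (metis vector_eq_rdot)

section \<open>Traces of linear maps\<close>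

lemma linear_trace_add: "linear_trace (\<lambda>x. S x + T x) = linear_trace S + linear_trace T"
  and linear_trace_diff: "linear_trace (\<lambda>x. S x - T x) = linear_trace S - linear_trace T"
  and linear_trace_scaleR: "linear_trace (\<lambda>x. a *\<^sub>R T x) = a * linear_trace T"
  by (simp_all add: linear_trace_def inner_add_left inner_diff_left sum.distrib sum_subtractf sum_distrib_left)

lemma linear_expand_Basis: "linear A \<Longrightarrow> A (x::'a::euclidean_space) = (\<Sum>c\<in>Basis. (x \<bullet> c) *\<^sub>R A c)"
  by (subst (1) euclidean_representation[of x, symmetric]) (simp add: linear_sum linear_scale)

lemma linear_trace_comp_commute:
  fixes A B :: "'a::euclidean_space \<Rightarrow> 'a"
  assumes "linear A" "linear B"
  shows "linear_trace (\<lambda>x. A (B x)) = linear_trace (\<lambda>x. B (A x))"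
proof -
  have 1: "linear_trace (\<lambda>x. A (B x)) = (\<Sum>b\<in>Basis. \<Sum>c\<in>Basis. (B b \<bullet> c) * (A c \<bullet> b))"
    unfolding linear_trace_def
    by (rule sum.cong[OF refl], subst linear_expand_Basis[OF assms(1)]) (simp add: inner_sum_left)
  have 2: "linear_trace (\<lambda>x. B (A x)) = (\<Sum>b\<in>Basis. \<Sum>c\<in>Basis. (A b \<bullet> c) * (B c \<bullet> b))"
    unfolding linear_trace_def
    by (rule sum.cong[OF refl], subst linear_expand_Basis[OF assms(2)]) (simp add: inner_sum_left)
  show ?thesis unfolding 1 2 by (subst sum.swap) (simp add: mult.commute)
qed

text \<open>The trace of a projection counts dimensions; this is how the multiplicity \<open>d\<close> enters trace
computations.\<close>

lemma linear_trace_projection: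
  fixes E :: "'a::euclidean_space \<Rightarrow> 'a"
  assumes "linear E" and idem: "\<And>x. E (E x) = E x"
  shows "linear_trace E = real (dim (range E))"
proof -
  have sub: "subspace (range E)" by (simp add: assms(1) linear_subspace_image)
  obtain B where B: "B \<subseteq> range E" "pairwise Linear_Algebra.orthogonal B" "\<And>x. x \<in> B \<Longrightarrow> norm x = 1"
     "independent B" "card B = dim (range E)" "span B = range E"
    using orthonormal_basis_subspace[OF sub] by blast
  have fin: "finite B" using B(4) by (simp add: independent_imp_finite)
  have rep: "y = (\<Sum>s\<in>B. (y \<bullet> s) *\<^sub>R s)" if "y \<in> range E" for y
  proof -
    have "y \<in> range (\<lambda>u. \<Sum>s\<in>B. u s *\<^sub>R s)" using that B(6) span_finite[OF fin] by simp
    then obtain u where u: "y = (\<Sum>s\<in>B. u s *\<^sub>R s)" by (rule rangeE)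
    have "y \<bullet> s = u s" if "s \<in> B" for s
    proof -
      have "(u t *\<^sub>R t) \<bullet> s = (if t = s then u s else 0)" if "t \<in> B" for t
        using B(2,3) \<open>s \<in> B\<close> that by (auto simp: pairwise_def Linear_Algebra.orthogonal_def norm_eq_1)
      then have "y \<bullet> s = (\<Sum>t\<in>B. if t = s then u s else 0)"
        unfolding u inner_sum_left by (intro sum.cong) auto
      then show ?thesis using fin that by simp
    qed
    then show ?thesis using u by (metis (no_types, lifting) sum.cong)
  qed
  have "linear_trace E = (\<Sum>b\<in>Basis. \<Sum>s\<in>B. (E b \<bullet> s) * (s \<bullet> b))"
    unfolding linear_trace_def
    by (rule sum.cong[OF refl], subst rep) (auto simp: inner_sum_left)
  also have "\<dots> = (\<Sum>s\<in>B. (\<Sum>b\<in>Basis. (s \<bullet> b) *\<^sub>R E b) \<bullet> s)"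
    by (subst sum.swap) (simp add: inner_sum_left mult.commute)
  also have "\<dots> = (\<Sum>s\<in>B. E s \<bullet> s)" by (simp add: linear_expand_Basis[OF assms(1), symmetric])
  also have "\<dots> = (\<Sum>s\<in>B. 1)"
  proof (rule sum.cong[OF refl])
    fix s assume s: "s \<in> B"
    then obtain z where "s = E z" using B(1) by blast
    then have "E s = s" using idem by simp
    then show "E s \<bullet> s = 1" using B(3)[OF s] by (simp add: norm_eq_1)
  qed
  finally show ?thesis using B(5) by simp
qed

context jordan_alg begin

section \<open>Associative trace forms\<close>

definition trL :: "'a \<Rightarrow> real" where "trL x = linear_trace (\<lambda>z. x \<star> z)"

lemma linear_trL: "linear trL"
  by (rule linearI) (simp_all add: trL_def mul_simps linear_trace_add linear_trace_scaleR)

lemma trL_inner_deriv: "trL (inner_deriv w y z) = 0"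
proof -
  have "trL (inner_deriv w y z) = linear_trace (\<lambda>v. inner_deriv w y (z \<star> v) - z \<star> inner_deriv w y v)"
    unfolding trL_def by (simp add: inner_deriv_mul)
  also have "\<dots> = 0"
    by (simp only: linear_trace_diff)
       (simp add: linear_trace_comp_commute[OF linear_inner_deriv linear_mul_right])
  finally show ?thesis .
qed

text \<open>Vanishing on the values of inner derivations is exactly what makes \<open>f(x y)\<close> an associative form.\<close>

definition trace_functional :: "('a \<Rightarrow> real) \<Rightarrow> bool" where
  "trace_functional f \<longleftrightarrow> linear f \<and> (\<forall>w y z. f (inner_deriv w y z) = 0)"

lemma trace_functional_assoc:
  assumes "trace_functional f" shows "f ((x \<star> y) \<star> z) = f (x \<star> (y \<star> z))"
proof -
  have "f (z \<star> (x \<star> y)) - f (x \<star> (z \<star> y)) = 0"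
    using assms unfolding trace_functional_def inner_deriv_def by (metis linear_diff)
  then show ?thesis by (simp add: mul_commute[of _ z])
qed

lemma trace_functional_jtr: "trace_functional (jtr V)"
proof -
  have eq: "jtr V = (\<lambda>x. (real (jrank V) / real DIM('a)) *\<^sub>R trL x)"
    by (rule ext) (simp add: jtr_def trL_def)
  show ?thesis
    unfolding trace_functional_def eq
    by (auto intro!: linearI simp: trL_inner_deriv linear_add[OF linear_trL] linear_scale[OF linear_trL] algebra_simps
        add_divide_distrib)
qed

lemma linear_jtr: "linear (jtr V)" using trace_functional_jtr by (simp add: trace_functional_def)

abbreviation tau :: "'a \<Rightarrow> 'a \<Rightarrow> real" where "tau \<equiv> jtau V"

lemma tau_commute: "tau x y = tau y x" by (simp add: jtau_def mul_commute)

lemma tau_simps: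
  "tau (x + x') y = tau x y + tau x' y" "tau x (y + y') = tau x y + tau x y'"
  "tau (x - x') y = tau x y - tau x' y" "tau x (y - y') = tau x y - tau x y'"
  "tau (- x) y = - tau x y" "tau x (- y) = - tau x y"
  "tau (a *\<^sub>R x) y = a * tau x y" "tau x (a *\<^sub>R y) = a * tau x y"
  "tau 0 y = 0" "tau x 0 = 0"
  by (simp_all add: jtau_def mul_simps linear_add[OF linear_jtr] linear_diff[OF linear_jtr]
      linear_neg[OF linear_jtr] linear_scale[OF linear_jtr] linear_0[OF linear_jtr])

lemma bilinear_tau: "bilinear tau"
  by (auto simp: bilinear_def tau_simps intro!: linearI)

lemma tau_sum: "tau (\<Sum>i\<in>I. f i) y = (\<Sum>i\<in>I. tau (f i) y)" "tau x (\<Sum>i\<in>I. f i) = (\<Sum>i\<in>I. tau x (f i))"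
  by (induction I rule: infinite_finite_induct) (auto simp: tau_simps)

lemma tau_assoc: "tau (x \<star> y) z = tau x (y \<star> z)"
  using trace_functional_assoc[OF trace_functional_jtr] by (simp add: jtau_def)

lemma tau_mul: "tau (x \<star> y) z = tau y (x \<star> z)"
  using tau_assoc[of y x z] by (simp add: mul_commute)

lemma tau_jP: "tau (jP V x y z) w = tau z (jP V x y w)"
  by (simp add: jP_def tau_simps tau_mul)

section \<open>Peirce decomposition\<close>

abbreviation peirce :: "'a \<Rightarrow> real \<Rightarrow> 'a set" where
  "peirce c l \<equiv> {x. c \<star> x = l *\<^sub>R x}"

text \<open>The three projections are the Lagrange interpolation polynomials in \<open>L(c)\<close> for the eigenvalues
\<open>1\<close>, \<open>1/2\<close>, \<open>0\<close>.\<close>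

definition Pi1 :: "'a \<Rightarrow> 'a \<Rightarrow> 'a" where "Pi1 c z = 2 *\<^sub>R (c \<star> (c \<star> z)) - c \<star> z"
definition Pih :: "'a \<Rightarrow> 'a \<Rightarrow> 'a" where "Pih c z = 4 *\<^sub>R (c \<star> z) - 4 *\<^sub>R (c \<star> (c \<star> z))"
definition Pi0 :: "'a \<Rightarrow> 'a \<Rightarrow> 'a" where "Pi0 c z = z - 3 *\<^sub>R (c \<star> z) + 2 *\<^sub>R (c \<star> (c \<star> z))"

lemma linear_Pi: "linear (Pi1 c)" "linear (Pih c)" "linear (Pi0 c)"
  by (auto intro!: linearI simp: Pi1_def Pih_def Pi0_def mul_simps algebra_simps)

lemma Pi_sum: "Pi1 c z + Pih c z + Pi0 c z = z"
proof -
  have "Pi1 c z + Pih c z + Pi0 c z = z + (2 + 2 - 4) *\<^sub>R (c \<star> (c \<star> z)) + (4 - 1 - 3) *\<^sub>R (c \<star> z)"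
    unfolding Pi1_def Pih_def Pi0_def scaleR_left_diff_distrib scaleR_left_distrib by simp
  then show ?thesis by simp
qed

lemma tau_Pi: "tau (Pi1 c x) y = tau x (Pi1 c y)" "tau (Pih c x) y = tau x (Pih c y)"
   "tau (Pi0 c x) y = tau x (Pi0 c y)"
  by (simp_all add: Pi1_def Pih_def Pi0_def tau_simps tau_mul)

lemma Pi_on_eigen:
  assumes "c \<star> x = l *\<^sub>R x"
  shows "Pi1 c x = (2 * l * l - l) *\<^sub>R x" "Pih c x = (4 * l - 4 * l * l) *\<^sub>R x"
    "Pi0 c x = (1 - 3 * l + 2 * l * l) *\<^sub>R x"
  unfolding Pi1_def Pih_def Pi0_def assms mul_simps
  by (simp_all add: scaleR_left_diff_distrib scaleR_left_distrib)

lemma Pi_on_peirce: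
  "x \<in> peirce c 1 \<Longrightarrow> Pi1 c x = x \<and> Pih c x = 0 \<and> Pi0 c x = 0"
  "x \<in> peirce c (1/2) \<Longrightarrow> Pi1 c x = 0 \<and> Pih c x = x \<and> Pi0 c x = 0"
  "x \<in> peirce c 0 \<Longrightarrow> Pi1 c x = 0 \<and> Pih c x = 0 \<and> Pi0 c x = x"
  using Pi_on_eigen[of c x 1] Pi_on_eigen[of c x "1/2"] Pi_on_eigen[of c x 0] by simp_all

lemma peirce_add: "x \<in> peirce c l \<Longrightarrow> y \<in> peirce c l \<Longrightarrow> x + y \<in> peirce c l"
  and peirce_scale: "x \<in> peirce c l \<Longrightarrow> t *\<^sub>R x \<in> peirce c l"
  and peirce_zero: "0 \<in> peirce c l"
  by (simp_all add: mul_simps algebra_simps)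

lemma subspace_peirce: "subspace (peirce c l)"
  using peirce_add peirce_scale peirce_zero unfolding subspace_def by blast

context
  fixes c assumes idem: "c \<star> c = c"
begin

text \<open>The operator identity at \<open>c, c\<close> gives the cubic equation with roots \<open>0\<close>, \<open>1/2\<close>, \<open>1\<close> for \<open>L(c)\<close>.\<close>

lemma idem_cubic: "2 *\<^sub>R (c \<star> (c \<star> (c \<star> z))) = 3 *\<^sub>R (c \<star> (c \<star> z)) - c \<star> z"
proof -
  have "2 *\<^sub>R (c \<star> (c \<star> (c \<star> z))) + c \<star> z = 2 *\<^sub>R (c \<star> (c \<star> z)) + c \<star> (c \<star> z)"
    using jordan_op_square[of c c z] idem by simp
  moreover have "2 *\<^sub>R (c \<star> (c \<star> z)) + c \<star> (c \<star> z) = (2 + 1) *\<^sub>R (c \<star> (c \<star> z))"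
    by (simp only: scaleR_left_distrib scaleR_one)
  ultimately show ?thesis by (simp add: eq_diff_eq)
qed

lemma Pi_mem: "Pi1 c z \<in> peirce c 1" "Pih c z \<in> peirce c (1/2)" "Pi0 c z \<in> peirce c 0"
proof -
  let ?a = "c \<star> z" and ?b = "c \<star> (c \<star> z)" and ?d = "c \<star> (c \<star> (c \<star> z))"
  have d: "?d = (3/2) *\<^sub>R ?b - (1/2) *\<^sub>R ?a"
    using arg_cong[OF idem_cubic[of z], of "\<lambda>v. (1/2) *\<^sub>R v"] by (simp add: scaleR_diff_right)
  show "Pi1 c z \<in> peirce c 1" "Pih c z \<in> peirce c (1/2)" "Pi0 c z \<in> peirce c 0"
    unfolding Pi1_def Pih_def Pi0_def mem_Collect_eq mul_simps d
    by (rule vector_eqI_inner, simp add: inner_simps algebra_simps)+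
qed

text \<open>The operator identity gives \<open>(2m - 1) (c (y z) - l y z) = 0\<close>; all multiplication rules with a factor
in the spaces for \<open>0\<close> or \<open>1\<close> are instances.\<close>

lemma peirce_mult_aux:
  assumes "y \<in> peirce c l" "z \<in> peirce c m" "m \<noteq> 1/2"
  shows "y \<star> z \<in> peirce c l"
proof -
  have "2 *\<^sub>R (c \<star> (y \<star> (c \<star> z))) + (c \<star> y) \<star> z = 2 *\<^sub>R ((c \<star> y) \<star> (c \<star> z)) + c \<star> (y \<star> z)"
    using jordan_op_square[of c y z] idem by simp
  then have "(2 * m - 1) *\<^sub>R (c \<star> (y \<star> z)) = (2 * m - 1) *\<^sub>R (l *\<^sub>R (y \<star> z))"
    using assms by (simp add: mul_simps algebra_simps)
  then show ?thesis unfolding scaleR_cancel_left using assms(3) by auto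
qed

lemma peirce_1_1: "y \<in> peirce c 1 \<Longrightarrow> z \<in> peirce c 1 \<Longrightarrow> y \<star> z \<in> peirce c 1"
  and peirce_0_0: "y \<in> peirce c 0 \<Longrightarrow> z \<in> peirce c 0 \<Longrightarrow> y \<star> z \<in> peirce c 0"
  and peirce_h_1: "y \<in> peirce c (1/2) \<Longrightarrow> z \<in> peirce c 1 \<Longrightarrow> y \<star> z \<in> peirce c (1/2)"
  and peirce_h_0: "y \<in> peirce c (1/2) \<Longrightarrow> z \<in> peirce c 0 \<Longrightarrow> y \<star> z \<in> peirce c (1/2)"
  using peirce_mult_aux[of y 1 z 1] peirce_mult_aux[of y 0 z 0]
    peirce_mult_aux[of y "1/2" z 1] peirce_mult_aux[of y "1/2" z 0] by simp_all

lemma peirce_1_h: "y \<in> peirce c 1 \<Longrightarrow> z \<in> peirce c (1/2) \<Longrightarrow> y \<star> z \<in> peirce c (1/2)"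
  and peirce_0_h: "y \<in> peirce c 0 \<Longrightarrow> z \<in> peirce c (1/2) \<Longrightarrow> y \<star> z \<in> peirce c (1/2)"
  using peirce_h_1[of z y] peirce_h_0[of z y] by (simp_all add: mul_commute[of y z])

lemma peirce_1_0: "y \<in> peirce c 1 \<Longrightarrow> z \<in> peirce c 0 \<Longrightarrow> y \<star> z = 0"
  using peirce_mult_aux[of y 1 z 0] peirce_mult_aux[of z 0 y 1] by (simp add: mul_commute)

lemma peirce_h_h:
  assumes "x \<in> peirce c (1/2)" "y \<in> peirce c (1/2)" shows "Pih c (x \<star> y) = 0"
proof -
  have sq: "Pih c (x \<star> x) = 0" if x: "x \<in> peirce c (1/2)" for x
  proof -
    have "2 *\<^sub>R (x \<star> ((x \<star> c) \<star> c)) + c \<star> ((x \<star> x) \<star> c) = 2 *\<^sub>R ((x \<star> c) \<star> (x \<star> c)) + (x \<star> x) \<star> (c \<star> c)"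
      by (rule jordan_lin1)
    moreover have xc: "x \<star> c = (1/2) *\<^sub>R x" using x by (simp add: mul_commute[of x c])
    ultimately have "c \<star> (c \<star> (x \<star> x)) + (1/2) *\<^sub>R (x \<star> x) = (1/2) *\<^sub>R (x \<star> x) + c \<star> (x \<star> x)"
      by (simp add: xc idem mul_simps mul_commute[of "x \<star> x" c])
    then have "c \<star> (c \<star> (x \<star> x)) = c \<star> (x \<star> x)" by simp
    then show ?thesis by (simp add: Pih_def)
  qed
  have "2 *\<^sub>R Pih c (x \<star> y) = Pih c ((x + y) \<star> (x + y)) - Pih c (x \<star> x) - Pih c (y \<star> y)"
    by (simp add: mul_simps linear_add[OF linear_Pi(2)] mul_commute[of y x] scaleR_2)
  also have "\<dots> = 0" using sq[OF assms(1)] sq[OF assms(2)] sq[OF peirce_add[OF assms]] by simp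
  finally show ?thesis by simp
qed

text \<open>Up to a factor 2, the 0-space acts on the 1/2-space by a Jordan representation.\<close>

lemma peirce_0_rep:
  assumes "u \<in> peirce c 0" "w \<in> peirce c 0" "v \<in> peirce c (1/2)"
  shows "(u \<star> w) \<star> v = u \<star> (w \<star> v) + w \<star> (u \<star> v)"
proof -
  have h: "w \<star> v \<in> peirce c (1/2)" "u \<star> v \<in> peirce c (1/2)"
    using peirce_0_h[OF assms(2,3)] peirce_0_h[OF assms(1,3)] .
  have "c \<star> (u \<star> (w \<star> v)) + w \<star> (u \<star> (c \<star> v)) + ((c \<star> w) \<star> u) \<star> v
     = (w \<star> u) \<star> (c \<star> v) + (c \<star> u) \<star> (w \<star> v) + (c \<star> w) \<star> (u \<star> v)"
    by (rule jordan_op)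
  moreover have "u \<star> (w \<star> v) \<in> peirce c (1/2)" using peirce_0_h[OF assms(1) h(1)] .
  ultimately have "(1/2) *\<^sub>R (u \<star> (w \<star> v) + w \<star> (u \<star> v)) = (1/2) *\<^sub>R ((u \<star> w) \<star> v)"
    using assms by (simp add: mul_simps mul_commute[of w u] scaleR_add_right)
  then show ?thesis by simp
qed

lemma unit_minus_idem: "(\<ee> - c) \<star> (\<ee> - c) = \<ee> - c" "c \<star> (\<ee> - c) = 0"
  by (simp_all add: mul_simps idem)

lemma op_commute_1_0:
  assumes "a \<in> peirce c 1" "b \<in> peirce c 0" shows "op_commute a b"
  unfolding op_commute_def
proof
  fix z
  have "inner_deriv a b z = 0"
  proof -
    have e: "a \<star> b = 0" "c \<star> b = 0" "c \<star> a = a" using peirce_1_0[OF assms] assms by simp_all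
    \<comment> \<open>Expand \<open>[L(a), L(b)]\<close> with \<open>a = c a\<close> by the cyclic identity for the triple \<open>c, a, b\<close>.\<close>
    have "c \<star> ((a \<star> b) \<star> z) + a \<star> ((c \<star> b) \<star> z) + b \<star> ((c \<star> a) \<star> z)
       = (c \<star> b) \<star> (a \<star> z) + (a \<star> b) \<star> (c \<star> z) + (c \<star> a) \<star> (b \<star> z)"
      by (rule jordan_lin2)
    then have "b \<star> (a \<star> z) = a \<star> (b \<star> z)" unfolding e by (simp add: mul_simps)
    then show ?thesis by (simp add: inner_deriv_def)
  qed
  then show "a \<star> (b \<star> z) = b \<star> (a \<star> z)" by (simp add: inner_deriv_def)
qed

text \<open>The Peirce reflection, \<open>-1\<close> on the 1/2-space and \<open>1\<close> on the other two. It equals \<open>P(2c - e)\<close>, but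
the multiplication rules show directly that it is an automorphism.\<close>

definition reflect :: "'a \<Rightarrow> 'a" where "reflect z = z - 2 *\<^sub>R Pih c z"

lemma linear_reflect: "linear reflect"
  by (rule linearI) (simp_all add: reflect_def linear_add[OF linear_Pi(2)] linear_scale[OF linear_Pi(2)] algebra_simps)

lemma reflect_mul: "reflect (x \<star> y) = reflect x \<star> reflect y"
proof -
  define ev where "ev z = Pi1 c z + Pi0 c z" for z
  have dec: "z = ev z + Pih c z" for z using Pi_sum[of c z] by (simp add: ev_def algebra_simps)
  have ev_ev: "Pih c (ev x \<star> ev y) = 0"
  proof -
    have "ev x \<star> ev y = Pi1 c x \<star> Pi1 c y + Pi0 c x \<star> Pi0 c y"
      using peirce_1_0[OF Pi_mem(1) Pi_mem(3), of x y] peirce_1_0[OF Pi_mem(1) Pi_mem(3), of y x]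
      by (simp add: ev_def mul_simps mul_commute[of "Pi0 c x" "Pi1 c y"])
    then show ?thesis
      using Pi_on_peirce(1)[OF peirce_1_1[OF Pi_mem(1) Pi_mem(1)], of x y]
        Pi_on_peirce(3)[OF peirce_0_0[OF Pi_mem(3) Pi_mem(3)], of x y]
      by (simp add: linear_add[OF linear_Pi(2)])
  qed
  have od_ev: "Pih c (Pih c x \<star> ev y) = Pih c x \<star> ev y" for x y
  proof -
    have "Pih c x \<star> ev y \<in> peirce c (1/2)"
      unfolding ev_def mul_simps
      by (rule peirce_add[OF peirce_h_1[OF Pi_mem(2) Pi_mem(1)] peirce_h_0[OF Pi_mem(2) Pi_mem(3)]])
    from Pi_on_peirce(2)[OF this] show ?thesis by (rule conjunct1[OF conjunct2])
  qed
  have od_od: "Pih c (Pih c x \<star> Pih c y) = 0" by (rule peirce_h_h[OF Pi_mem(2) Pi_mem(2)])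
  have r: "reflect z = ev z - Pih c z" for z
  proof -
    have "reflect z = (ev z + Pih c z) - 2 *\<^sub>R Pih c z" by (simp only: reflect_def dec[symmetric])
    then show ?thesis by (simp add: scaleR_2)
  qed
  have "x \<star> y = (ev x + Pih c x) \<star> (ev y + Pih c y)" by (simp only: dec[symmetric])
  also have "\<dots> = ev x \<star> ev y + Pih c y \<star> ev x + Pih c x \<star> ev y + Pih c x \<star> Pih c y"
    by (simp add: mul_simps mul_commute[of "ev x" "Pih c y"])
  finally have xy: "x \<star> y = ev x \<star> ev y + Pih c y \<star> ev x + Pih c x \<star> ev y + Pih c x \<star> Pih c y" .
  have "Pih c (x \<star> y) = Pih c y \<star> ev x + Pih c x \<star> ev y"
    unfolding xy by (simp add: linear_add[OF linear_Pi(2)] ev_ev od_ev od_od)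
  then show ?thesis unfolding r[of x] r[of y] unfolding reflect_def
    by (simp add: xy mul_simps mul_commute[of "ev x" "Pih c y"] scaleR_2 algebra_simps)
qed

lemma reflect_reflect: "reflect (reflect z) = z"
proof -
  have "Pih c (Pih c z) = Pih c z" by (rule conjunct1[OF conjunct2[OF Pi_on_peirce(2)[OF Pi_mem(2)]]])
  then show ?thesis
    by (simp add: reflect_def linear_diff[OF linear_Pi(2)] linear_scale[OF linear_Pi(2)])
       (rule vector_eqI_inner, simp add: inner_simps)
qed

end

end

section \<open>Polynomial functions on a Euclidean space\<close>

lemma real_polynomial_function_sum' [intro]:
  "(\<And>i. i \<in> I \<Longrightarrow> real_polynomial_function (f i)) \<Longrightarrow> real_polynomial_function (\<lambda>x. \<Sum>i\<in>I. f i x)"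
  by (induction I rule: infinite_finite_induct) auto

lemma real_polynomial_function_prod' [intro]:
  "(\<And>i. i \<in> I \<Longrightarrow> real_polynomial_function (f i)) \<Longrightarrow> real_polynomial_function (\<lambda>x. \<Prod>i\<in>I. f i x)"
  by (induction I rule: infinite_finite_induct) auto

lemma real_polynomial_function_cmult: "real_polynomial_function f \<Longrightarrow> real_polynomial_function (\<lambda>x. c * f x)"
  using real_polynomial_function.intros(4)[OF real_polynomial_function.intros(2)] .

text \<open>Taylor expansion at a point: the restriction to a line has coefficients that are themselves polynomial
in the direction, of uniformly bounded degree.\<close>

lemma real_polynomial_function_line:
  assumes "real_polynomial_function f"
  obtains K F where "\<And>k. real_polynomial_function (F k)"
    "\<And>t y. f (x0 + t *\<^sub>R y) = (\<Sum>k\<le>(K::nat). F k y * t ^ k)" "\<And>k y. k > K \<Longrightarrow> F k y = 0" "\<And>y. F 0 y = f x0"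
proof -
  have "\<exists>K F. (\<forall>k. real_polynomial_function (F k)) \<and>
    (\<forall>t y. f (x0 + t *\<^sub>R y) = (\<Sum>k\<le>(K::nat). F k y * t ^ k)) \<and> (\<forall>k y. k > K \<longrightarrow> F k y = 0)"
    using assms
  proof (induction f rule: real_polynomial_function.induct)
    case (linear f)
    have "real_polynomial_function (\<lambda>y. if k = 0 then f x0 else if k = 1 then f y else 0)" for k :: nat
      using real_polynomial_function.intros(1)[OF linear] real_polynomial_function.intros(2)
      by (cases "k = 0"; cases "k = 1") simp_all
    then show ?case
      using linear by (intro exI[of _ 1] exI[of _ "\<lambda>k y. if k = 0 then f x0 else if k = 1 then f y else 0"])
        (auto simp: linear_add linear_scale bounded_linear.linear)
  next
    case (const c)
    have "real_polynomial_function (\<lambda>y. if k = 0 then c else 0)" for k :: nat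
      using real_polynomial_function.intros(2) by (cases "k = 0") simp_all
    then show ?case
      by (intro exI[of _ 0] exI[of _ "\<lambda>k y. if k = 0 then c else 0"]) auto
  next
    case (add f g)
    then obtain K F L G where F: "\<And>k. real_polynomial_function (F k)"
      "\<And>t y. f (x0 + t *\<^sub>R y) = (\<Sum>k\<le>(K::nat). F k y * t ^ k)" "\<And>k y. k > K \<Longrightarrow> F k y = 0"
      and G: "\<And>k. real_polynomial_function (G k)"
      "\<And>t y. g (x0 + t *\<^sub>R y) = (\<Sum>k\<le>(L::nat). G k y * t ^ k)" "\<And>k y. k > L \<Longrightarrow> G k y = 0"
      by blast
    have 1: "(\<Sum>k\<le>K. F k y * t ^ k) = (\<Sum>k\<le>max K L. F k y * t ^ k)" for t y
      by (rule sum.mono_neutral_left) (auto simp: F(3))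
    have 2: "(\<Sum>k\<le>L. G k y * t ^ k) = (\<Sum>k\<le>max K L. G k y * t ^ k)" for t y
      by (rule sum.mono_neutral_left) (auto simp: G(3))
    show ?case
      by (intro exI[of _ "max K L"] exI[of _ "\<lambda>k y. F k y + G k y"])
         (auto simp: F G 1 2 sum.distrib distrib_right)
  next
    case (mult f g)
    then obtain K F L G where F: "\<And>k. real_polynomial_function (F k)"
      "\<And>t y. f (x0 + t *\<^sub>R y) = (\<Sum>k\<le>(K::nat). F k y * t ^ k)" "\<And>k y. k > K \<Longrightarrow> F k y = 0"
      and G: "\<And>k. real_polynomial_function (G k)"
      "\<And>t y. g (x0 + t *\<^sub>R y) = (\<Sum>k\<le>(L::nat). G k y * t ^ k)" "\<And>k y. k > L \<Longrightarrow> G k y = 0"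
      by blast
    have "f (x0 + t *\<^sub>R y) * g (x0 + t *\<^sub>R y) = (\<Sum>k\<le>K + L. (\<Sum>i\<le>k. F i y * G (k - i) y) * t ^ k)" for t y
      unfolding F(2) G(2) by (rule polynomial_product) (auto simp: F(3) G(3))
    moreover have "(\<Sum>i\<le>k. F i y * G (k - i) y) = 0" if "k > K + L" for k y
      by (rule sum.neutral) (use that F(3) G(3) in \<open>metis add_mono_thms_linordered_semiring(1) le_add_diff_inverse
        linorder_not_le mult_eq_0_iff atMost_iff\<close>)
    moreover have "real_polynomial_function (\<lambda>y. \<Sum>i\<le>k. F i y * G (k - i) y)" for k
      by (intro real_polynomial_function_sum' real_polynomial_function.intros(4) F G)
    ultimately show ?case
      by (intro exI[of _ "K + L"] exI[of _ "\<lambda>k y. \<Sum>i\<le>k. F i y * G (k - i) y"]) auto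
  qed
  then obtain K F where F: "\<And>k. real_polynomial_function (F k)"
      "\<And>t y. f (x0 + t *\<^sub>R y) = (\<Sum>k\<le>(K::nat). F k y * t ^ k)" "\<And>k y. k > K \<Longrightarrow> F k y = 0" by blast
  moreover have "F 0 y = f x0" for y
  proof -
    have "f x0 = (\<Sum>k\<le>K. F k y * 0 ^ k)" using F(2)[of 0 y] by simp
    also have "\<dots> = (\<Sum>k\<le>K. if k = 0 then F 0 y else 0)" by (rule sum.cong) auto
    finally show ?thesis by simp
  qed
  ultimately show thesis using that by blast
qed

lemma poly_sum_monom:
  fixes a :: "nat \<Rightarrow> real"
  shows "poly (\<Sum>k\<le>K. Polynomial.monom (a k) k) t = (\<Sum>k\<le>K. a k * t ^ k)"
  by (simp add: poly_sum Polynomial.poly_monom)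

lemma coeff_sum_monom: "Polynomial.coeff (\<Sum>k\<le>K. Polynomial.monom (a k) k) j = (if j \<le> K then a j else 0)"
  by (simp add: coeff_sum)

lemma real_polynomial_function_line_poly:
  assumes "real_polynomial_function f"
  obtains F where "\<And>t. f (x0 + t *\<^sub>R y) = poly F t"
proof -
  obtain K F where "\<And>t y. f (x0 + t *\<^sub>R y) = (\<Sum>k\<le>(K::nat). F k y * t ^ k)"
    by (rule real_polynomial_function_line[OF assms, of x0]) blast
  then show thesis using that[of "\<Sum>k\<le>K. Polynomial.monom (F k y) k"] by (simp add: poly_sum_monom)
qed

lemma poly_eq_0_of_all: "(\<And>t::real. poly p t = 0) \<Longrightarrow> p = 0"
  using poly_all_0_iff_0 by blast

text \<open>Polynomial functions form an integral domain: on the line from \<open>x0\<close> to \<open>x\<close> the product is the zero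
polynomial in one variable.\<close>

lemma real_polynomial_function_domain:
  assumes "real_polynomial_function f" "real_polynomial_function g"
    and "\<And>x. f x \<noteq> 0 \<Longrightarrow> g x = 0" and "f x0 \<noteq> 0"
  shows "g x = 0"
proof -
  obtain F where F: "\<And>t. f (x0 + t *\<^sub>R (x - x0)) = poly F t" using real_polynomial_function_line_poly[OF assms(1)] by blast
  obtain G where G: "\<And>t. g (x0 + t *\<^sub>R (x - x0)) = poly G t" using real_polynomial_function_line_poly[OF assms(2)] by blast
  have "poly (F * G) t = 0" for t using assms(3)[of "x0 + t *\<^sub>R (x - x0)"] F G by auto
  then have "F * G = 0" by (rule poly_eq_0_of_all)
  moreover have "F \<noteq> 0" using F[of 0] assms(4) by auto
  ultimately have "G = 0" by simp
  then show ?thesis using G[of 1] by simp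
qed

text \<open>A quotient of polynomial functions that is polynomial along all lines through one point is
polynomial: its Taylor coefficients at that point are found by power series division.\<close>

lemma real_polynomial_function_divide:
  fixes N Q :: "'a::euclidean_space \<Rightarrow> real"
  assumes N: "real_polynomial_function N" and Q: "real_polynomial_function Q" and "Q x0 \<noteq> 0"
    and line: "\<And>y. \<exists>h. \<forall>t. poly h t * Q (x0 + t *\<^sub>R y) = N (x0 + t *\<^sub>R y)"
  obtains D where "real_polynomial_function D" "\<And>x. D x * Q x = N x"
proof -
  obtain K Fn where Fn: "\<And>k. real_polynomial_function (Fn k)"
    "\<And>t y. N (x0 + t *\<^sub>R y) = (\<Sum>k\<le>(K::nat). Fn k y * t ^ k)" "\<And>k y. k > K \<Longrightarrow> Fn k y = 0"
    by (rule real_polynomial_function_line[OF N, of x0]) blast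
  obtain L Fq where Fq: "\<And>k. real_polynomial_function (Fq k)"
    "\<And>t y. Q (x0 + t *\<^sub>R y) = (\<Sum>k\<le>(L::nat). Fq k y * t ^ k)" "\<And>k y. k > L \<Longrightarrow> Fq k y = 0"
    "\<And>y. Fq 0 y = Q x0"
    by (rule real_polynomial_function_line[OF Q, of x0]) blast
  define h where "h y = (SOME h. \<forall>t. poly h t * Q (x0 + t *\<^sub>R y) = N (x0 + t *\<^sub>R y))" for y
  have h: "poly (h y) t * Q (x0 + t *\<^sub>R y) = N (x0 + t *\<^sub>R y)" for y t
    using someI_ex[OF line[of y]] unfolding h_def by blast
  define qp where "qp y = (\<Sum>k\<le>L. Polynomial.monom (Fq k y) k)" for y
  define np where "np y = (\<Sum>k\<le>K. Polynomial.monom (Fn k y) k)" for y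
  have cq: "Polynomial.coeff (qp y) j = Fq j y" for j y unfolding qp_def coeff_sum_monom using Fq(3) by auto
  have cn: "Polynomial.coeff (np y) j = Fn j y" for j y unfolding np_def coeff_sum_monom using Fn(3) by auto
  have eq: "h y * qp y = np y" for y
  proof -
    have "poly (h y * qp y - np y) t = 0" for t
      using h[of y t] Fn(2)[of t y] Fq(2)[of t y] by (simp add: qp_def np_def poly_sum_monom)
    then show ?thesis using poly_eq_0_of_all[of "h y * qp y - np y"] by simp
  qed
  have qnz: "qp y \<noteq> 0" for y using cq[of y 0] Fq(4) assms(3) by auto
  have degh: "Polynomial.degree (h y) \<le> K" for y
  proof (cases "h y = 0")
    case False
    then have "Polynomial.degree (h y) \<le> Polynomial.degree (np y)"
      using eq[of y] qnz[of y] by (metis degree_mult_eq le_add1)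
    also have "\<dots> \<le> K" by (rule degree_le) (auto simp: cn Fn(3))
    finally show ?thesis .
  qed simp
  have pol: "real_polynomial_function (\<lambda>y. Polynomial.coeff (h y) k)" for k
  proof (induction k rule: less_induct)
    case (less k)
    have "Polynomial.coeff (h y) k = (1 / Q x0) * (Fn k y + (-1) * (\<Sum>i<k. Polynomial.coeff (h y) i * Fq (k - i) y))" for y
    proof -
      have "Fn k y = (\<Sum>i\<le>k. Polynomial.coeff (h y) i * Fq (k - i) y)"
        using arg_cong[OF eq[of y], of "\<lambda>p. Polynomial.coeff p k"] by (simp add: Polynomial.coeff_mult cq cn)
      also have "\<dots> = (\<Sum>i<k. Polynomial.coeff (h y) i * Fq (k - i) y) + Polynomial.coeff (h y) k * Q x0"
        by (simp add: lessThan_Suc_atMost[symmetric] Fq(4))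
      finally show ?thesis using assms(3) by (simp add: field_simps)
    qed
    moreover have "real_polynomial_function
        (\<lambda>y. (1 / Q x0) * (Fn k y + (-1) * (\<Sum>i<k. Polynomial.coeff (h y) i * Fq (k - i) y)))"
      by (intro real_polynomial_function.intros(2-4) real_polynomial_function_sum' Fn Fq less) auto
    ultimately show ?case by simp
  qed
  define D where "D x = poly (h (x - x0)) 1" for x
  have shift: "real_polynomial_function (\<lambda>x. f (x - x0))" if "real_polynomial_function f" for f :: "'a \<Rightarrow> real"
    using that
  proof (induction f rule: real_polynomial_function.induct)
    case (linear f)
    then have "(\<lambda>x. f (x - x0)) = (\<lambda>x. f x + - f x0)" by (auto simp: linear_diff bounded_linear.linear)
    with linear show ?case by auto
  qed auto
  have "D = (\<lambda>x. \<Sum>k\<le>K. Polynomial.coeff (h (x - x0)) k)"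
  proof
    fix x
    have "D x = (\<Sum>k\<le>Polynomial.degree (h (x - x0)). Polynomial.coeff (h (x - x0)) k)"
      by (simp add: D_def poly_altdef)
    also have "\<dots> = (\<Sum>k\<le>K. Polynomial.coeff (h (x - x0)) k)"
      by (rule sum.mono_neutral_left) (use degh in \<open>auto simp: coeff_eq_0\<close>)
    finally show "D x = (\<Sum>k\<le>K. Polynomial.coeff (h (x - x0)) k)" .
  qed
  then have "real_polynomial_function D" using shift[OF pol] by auto
  moreover have "D x * Q x = N x" for x using h[of "x - x0" 1] by (simp add: D_def)
  ultimately show thesis using that by blast
qed

section \<open>Gauss' lemma for a factor of a monic polynomial\<close>

lemma monic_content: "lead_coeff (p :: real poly poly) = 1 \<Longrightarrow> content p = 1"
  by (metis content_dvd_coeff is_unit_content_iff)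

text \<open>A monic multiple has content 1, so up to its content the factor \<open>M\<close> divides a monic polynomial and
has a unit as leading coefficient.\<close>

lemma lead_coeff_dvd_of_monic_multiple:
  fixes M K X :: "real poly poly"
  assumes "Polynomial.smult q X = M * K" "lead_coeff X = 1" "q \<noteq> 0"
  shows "lead_coeff M dvd Polynomial.coeff M j"
proof -
  let ?M = "primitive_part M" and ?K = "primitive_part K"
  have "normalize q = content M * content K"
    using arg_cong[OF assms(1), of content] monic_content[OF assms(2)] by (simp add: content_mult)
  then have q: "q = unit_factor q * (content M * content K)" by (metis unit_factor_mult_normalize)
  have nz: "content M * content K \<noteq> 0" using q assms(3) by (metis mult_zero_right)
  have "Polynomial.smult (content M * content K) (Polynomial.smult (unit_factor q) X) = M * K"
    using assms(1) q by (metis mult.commute smult_smult)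
  also have "\<dots> = Polynomial.smult (content M) ?M * Polynomial.smult (content K) ?K" by simp
  also have "\<dots> = Polynomial.smult (content M * content K) (?M * ?K)"
    by (simp only: mult_smult_left mult_smult_right smult_smult mult.commute)
  finally have "Polynomial.smult (content M * content K) (Polynomial.smult (unit_factor q) X - ?M * ?K) = 0"
    by (simp add: smult_diff_right)
  then have "Polynomial.smult (unit_factor q) X = ?M * ?K" using nz by (simp add: smult_eq_0_iff)
  from arg_cong[OF this, of lead_coeff] have "unit_factor q = lead_coeff ?M * lead_coeff ?K"
    by (simp only: lead_coeff_mult lead_coeff_smult assms(2) mult_1_right)
  moreover have "unit_factor q dvd 1" using assms(3) by (rule unit_factor_is_unit)
  ultimately have unit: "lead_coeff ?M dvd 1" by (metis dvd_mult_left)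
  have M: "M = Polynomial.smult (content M) ?M" by simp
  have l: "lead_coeff M = content M * lead_coeff ?M"
    using arg_cong[OF M, of lead_coeff] by (simp only: lead_coeff_smult)
  have c: "Polynomial.coeff M j = content M * Polynomial.coeff ?M j"
    using arg_cong[OF M, of "\<lambda>p. Polynomial.coeff p j"] by (simp only: coeff_smult)
  have "lead_coeff ?M dvd Polynomial.coeff ?M j" using unit by (rule unit_imp_dvd)
  then show ?thesis unfolding l c by (rule mult_dvd_mono[OF dvd_refl])
qed

section \<open>A monic annihilator along a line of linear maps\<close>

text \<open>The operator \<open>p(A)\<close> applied to a vector.\<close>

definition pact :: "('a::euclidean_space \<Rightarrow> 'a) \<Rightarrow> real poly \<Rightarrow> 'a \<Rightarrow> 'a" where
  "pact A p v = (\<Sum>k\<le>Polynomial.degree p. Polynomial.coeff p k *\<^sub>R (A ^^ k) v)"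

lemma pact_0 [simp]: "pact A 0 v = 0" by (simp add: pact_def)

lemma pact_bound:
  "Polynomial.degree p \<le> N \<Longrightarrow> pact A p v = (\<Sum>k\<le>N. Polynomial.coeff p k *\<^sub>R (A ^^ k) v)"
  unfolding pact_def by (rule sum.mono_neutral_left) (auto simp: coeff_eq_0)

context
  fixes A :: "'a::euclidean_space \<Rightarrow> 'a" assumes A: "linear A"
begin

lemma pact_pCons: "pact A (pCons a p) v = a *\<^sub>R v + A (pact A p v)"
proof -
  have "pact A (pCons a p) v = (\<Sum>k\<le>Suc (Polynomial.degree p). Polynomial.coeff (pCons a p) k *\<^sub>R (A ^^ k) v)"
    by (rule pact_bound) (simp add: degree_pCons_le)
  also have "\<dots> = a *\<^sub>R v + (\<Sum>k\<le>Polynomial.degree p. Polynomial.coeff p k *\<^sub>R (A ^^ Suc k) v)"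
    by (subst sum.atMost_Suc_shift) simp
  finally show ?thesis by (simp add: pact_def linear_sum[OF A] linear_scale[OF A])
qed

lemma pact_add: "pact A (p + q) v = pact A p v + pact A q v"
proof -
  let ?N = "max (Polynomial.degree p) (Polynomial.degree q)"
  show ?thesis
    using pact_bound[of p ?N A v] pact_bound[of q ?N A v] pact_bound[of "p + q" ?N A v]
    by (simp add: degree_add_le_max scaleR_add_left sum.distrib)
qed

lemma pact_smult: "pact A (Polynomial.smult a p) v = a *\<^sub>R pact A p v"
  using pact_bound[of "Polynomial.smult a p" "Polynomial.degree p" A v]
  by (simp add: pact_def scaleR_sum_right)

lemma pact_sum: "pact A (\<Sum>i\<in>I. p i) v = (\<Sum>i\<in>I. pact A (p i) v)"
  by (induction I rule: infinite_finite_induct) (auto simp: pact_add)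

lemma linear_pact: "linear (pact A p)"
proof (induction p)
  case 0 then show ?case by (auto intro!: linearI)
next
  case (pCons a p)
  then show ?case
    by (intro linearI) (simp_all add: pact_pCons linear_add[OF A] linear_scale[OF A] linear_add[of "pact A p"]
       linear_scale[of "pact A p"] algebra_simps)
qed

lemma pact_mult: "pact A (p * q) v = pact A p (pact A q v)"
  by (induction p) (simp_all add: pact_pCons pact_add pact_smult linear_0[OF A])

end

text \<open>Specialises the parameter \<open>t\<close> in a polynomial whose coefficients are polynomials in \<open>t\<close>.\<close>

definition eval_coeffs :: "real \<Rightarrow> real poly poly \<Rightarrow> real poly" where
  "eval_coeffs t = map_poly (\<lambda>c. poly c t)"

lemma coeff_eval_coeffs: "Polynomial.coeff (eval_coeffs t p) k = poly (Polynomial.coeff p k) t"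
  by (simp add: eval_coeffs_def Polynomial.coeff_map_poly)

lemma eval_coeffs_add: "eval_coeffs t (p + q) = eval_coeffs t p + eval_coeffs t q"
  and eval_coeffs_smult: "eval_coeffs t (Polynomial.smult a p) = Polynomial.smult (poly a t) (eval_coeffs t p)"
  and eval_coeffs_pCons: "eval_coeffs t (pCons a p) = pCons (poly a t) (eval_coeffs t p)"
  and eval_coeffs_0: "eval_coeffs t 0 = 0"
  by (rule poly_eqI; simp add: coeff_eval_coeffs coeff_pCons split: nat.splits)+

lemma eval_coeffs_mult: "eval_coeffs t (p * q) = eval_coeffs t p * eval_coeffs t q"
  by (rule poly_eqI) (simp add: coeff_eval_coeffs Polynomial.coeff_mult poly_sum)

lemma eval_coeffs_sum: "eval_coeffs t (\<Sum>i\<in>I. p i) = (\<Sum>i\<in>I. eval_coeffs t (p i))"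
  by (induction I rule: infinite_finite_induct) (auto simp: eval_coeffs_0 eval_coeffs_add)

text \<open>The Cayley-Hamilton theorem for a line of linear maps, with the parameter kept as an
indeterminate: the adjugate of the characteristic matrix turns it into a scalar. It is monic over
the ring of polynomials in the parameter, as Gauss' lemma requires.\<close>

lemma monic_annihilator_line:
  fixes A0 A1 :: "'a::euclidean_space \<Rightarrow> 'a"
  assumes "linear A0" "linear A1"
  obtains X :: "real poly poly" where "lead_coeff X = 1"
    "\<And>t v. pact (\<lambda>v. A0 v + t *\<^sub>R A1 v) (eval_coeffs t X) v = 0"
proof -
  let ?n = "DIM('a)"
  obtain b :: "nat \<Rightarrow> 'a" where b: "bij_betw b {..<?n} Basis"
    using bij_betw_from_nat_into_finite ex_bij_betw_nat_finite[OF finite_Basis] by (metis atLeast0LessThan)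
  define M where "M = Matrix.mat ?n ?n (\<lambda>(i, j). [: inner (A0 (b j)) (b i), inner (A1 (b j)) (b i) :])"
  have M: "M \<in> carrier_mat ?n ?n" by (simp add: M_def)
  define C where "C = char_poly_matrix M"
  have C: "C \<in> carrier_mat ?n ?n" using M by (simp add: C_def)
  define G where "G = adj_mat C"
  have G: "G \<in> carrier_mat ?n ?n" and CG: "C * G = char_poly M \<cdot>\<^sub>m 1\<^sub>m ?n"
    using adj_mat[OF C] by (simp_all add: G_def C_def char_poly_def)
  have Cij: "C $$ (i, j) = (if i = j then [:0, 1:] else 0) + [: - [: inner (A0 (b j)) (b i), inner (A1 (b j)) (b i) :] :]"
    if "i < ?n" "j < ?n" for i j
    using that M by (simp add: C_def char_poly_matrix_def M_def)
  have lead: "lead_coeff (char_poly M) = 1" using degree_monic_char_poly[OF M] by auto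
  have "pact (\<lambda>v. A0 v + t *\<^sub>R A1 v) (eval_coeffs t (char_poly M)) v = 0" for t v
  proof -
    define A where "A = (\<lambda>v. A0 v + t *\<^sub>R A1 v)"
    have A: "linear A" unfolding A_def
      by (intro linear_compose_add linear_compose_scale_right assms)
    define act where "act w v = pact A (eval_coeffs t w) v" for w v
    note act_simps = act_def eval_coeffs_mult pact_mult[OF A] eval_coeffs_add pact_add[OF A] eval_coeffs_sum pact_sum[OF A]
    have lin: "linear (act w)" for w unfolding act_def using linear_pact[OF A] by (simp add: eta_contract_eq)
    have comm: "act (p * q) v = act q (act p v)" for p q v
      by (subst mult.commute) (simp add: act_simps)
    have expand: "v = (\<Sum>i<?n. inner v (b i) *\<^sub>R b i)" for v
      using sum.reindex_bij_betw[OF b, of "\<lambda>c. inner v c *\<^sub>R c"] by (simp add: euclidean_representation)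
    have col: "(\<Sum>i<?n. act (C $$ (i, j)) (b i)) = 0" if "j < ?n" for j
    proof -
      have "act (C $$ (i, j)) (b i) = (if i = j then A (b j) else 0) - inner (A (b j)) (b i) *\<^sub>R b i" if "i < ?n" for i
        unfolding Cij[OF that \<open>j < ?n\<close>] act_def
        by (auto simp: eval_coeffs_pCons eval_coeffs_add eval_coeffs_0 pact_add[OF A] pact_pCons[OF A] linear_0[OF A] A_def[symmetric]
            inner_simps algebra_simps) (simp_all add: A_def inner_simps algebra_simps)
      then have "(\<Sum>i<?n. act (C $$ (i, j)) (b i)) = (\<Sum>i<?n. (if i = j then A (b j) else 0)) - (\<Sum>i<?n. inner (A (b j)) (b i) *\<^sub>R b i)"
        by (simp add: sum_subtractf)
      then show ?thesis using that expand[of "A (b j)"] by simp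
    qed
    have X0: "act (char_poly M) (b k) = 0" if k: "k < ?n" for k
    proof -
      have "act ((C * G) $$ (i, k)) (b i) = (if i = k then act (char_poly M) (b k) else 0)" if "i < ?n" for i
        unfolding CG using that k by (simp add: act_def eval_coeffs_0)
      then have "act (char_poly M) (b k) = (\<Sum>i<?n. act ((C * G) $$ (i, k)) (b i))" using k by simp
      also have "\<dots> = (\<Sum>i<?n. \<Sum>j<?n. act (G $$ (j, k)) (act (C $$ (i, j)) (b i)))"
      proof (rule sum.cong[OF refl])
        fix i assume "i \<in> {..<?n}"
        then have "(C * G) $$ (i, k) = (\<Sum>j<?n. C $$ (i, j) * G $$ (j, k))"
          using C G k by (simp add: scalar_prod_def atLeast0LessThan)
        then show "act ((C * G) $$ (i, k)) (b i) = (\<Sum>j<?n. act (G $$ (j, k)) (act (C $$ (i, j)) (b i)))"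
          by (simp only: comm[symmetric]) (simp only: act_def eval_coeffs_sum pact_sum[OF A])
      qed
      also have "\<dots> = (\<Sum>j<?n. act (G $$ (j, k)) (\<Sum>i<?n. act (C $$ (i, j)) (b i)))"
        by (subst sum.swap) (simp add: linear_sum[OF lin])
      also have "\<dots> = 0" using col by (simp add: linear_0[OF lin])
      finally show ?thesis .
    qed
    have "act (char_poly M) v = (\<Sum>i<?n. inner v (b i) *\<^sub>R act (char_poly M) (b i))"
      by (subst expand) (simp add: linear_sum[OF lin] linear_scale[OF lin])
    then show ?thesis using X0 by (simp add: act_def A_def)
  qed
  with lead show thesis using that by blast
qed

context jordan_alg begin

section \<open>Minimal polynomials and regular elements\<close>

abbreviation mp :: "'a \<Rightarrow> real poly" where "mp x \<equiv> min_poly V x"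
abbreviation reg :: "'a \<Rightarrow> bool" where "reg x \<equiv> Polynomial.degree (mp x) = jrank V"

text \<open>There are more powers up to \<open>DIM('a)\<close> than the dimension allows to be independent.\<close>

lemma ex_annihilator: "\<exists>p. p \<noteq> 0 \<and> Polynomial.degree p \<le> DIM('a) \<and> pl p x = 0"
proof (cases "inj_on (pw x) {..DIM('a)}")
  case True
  let ?S = "pw x ` {..DIM('a)}"
  have "dependent ?S" by (rule dependent_biggerset) (use True in \<open>simp add: card_image\<close>)
  then obtain u where u: "(\<Sum>v\<in>?S. u v *\<^sub>R v) = 0" "\<exists>v\<in>?S. u v \<noteq> 0"
    by (auto simp: dependent_finite)
  define p where "p = (\<Sum>k\<le>DIM('a). Polynomial.monom (u (pw x k)) k)"
  have c: "Polynomial.coeff p k = (if k \<le> DIM('a) then u (pw x k) else 0)" for k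
    unfolding p_def by (rule coeff_sum_monom)
  have d: "Polynomial.degree p \<le> DIM('a)" by (rule degree_le) (simp add: c)
  have "pl p x = 0" using u(1) True by (simp add: pl_bound[OF d] c sum.reindex)
  moreover have "p \<noteq> 0" using u(2) c by (metis atMost_iff coeff_0 imageE)
  ultimately show ?thesis using d by blast
next
  case False
  then obtain i j where ij: "i \<le> DIM('a)" "j \<le> DIM('a)" "i \<noteq> j" "pw x i = pw x j"
    unfolding inj_on_def by auto
  let ?p = "Polynomial.monom 1 i - Polynomial.monom (1::real) j"
  have "Polynomial.coeff ?p i = 1" using ij by simp
  then have "?p \<noteq> 0" by (metis coeff_0 zero_neq_one)
  moreover have "Polynomial.degree ?p \<le> DIM('a)"
    using ij by (intro degree_diff_le) (auto intro: order_trans[OF degree_monom_le])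
  moreover have "pl ?p x = 0" using ij by (simp add: pl_diff pl_monom)
  ultimately show ?thesis by blast
qed

lemma monic_minimal_unique:
  fixes p q :: "real poly"
  assumes "lead_coeff p = 1" "lead_coeff q = 1" "pl p x = 0" "pl q x = 0"
    "Polynomial.degree p = Polynomial.degree q"
    "\<And>q. q \<noteq> 0 \<Longrightarrow> pl q x = 0 \<Longrightarrow> Polynomial.degree p \<le> Polynomial.degree q"
  shows "p = q"
proof (rule ccontr)
  assume "p \<noteq> q"
  then have nz: "p - q \<noteq> 0" by simp
  have "Polynomial.degree p \<le> Polynomial.degree (p - q)" using assms(6)[OF nz] assms by (simp add: pl_diff)
  moreover have "Polynomial.degree (p - q) \<le> Polynomial.degree p" using assms(5) by (intro degree_diff_le) auto
  ultimately have d: "Polynomial.degree (p - q) = Polynomial.degree p" by simp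
  have c: "Polynomial.coeff p (Polynomial.degree p) = 1" "Polynomial.coeff q (Polynomial.degree p) = 1"
    using assms(1,2,5) by auto
  have "lead_coeff (p - q) = 0" unfolding d using c by simp
  then show False using nz by (simp only: leading_coeff_0_iff)
qed

lemma min_poly_prop:
  "lead_coeff (mp x) = 1" "pl (mp x) x = 0"
  "\<And>q. q \<noteq> 0 \<Longrightarrow> pl q x = 0 \<Longrightarrow> Polynomial.degree (mp x) \<le> Polynomial.degree q"
proof -
  let ?P = "\<lambda>p. lead_coeff p = 1 \<and> pl p x = 0 \<and>
     (\<forall>q. q \<noteq> 0 \<longrightarrow> pl q x = 0 \<longrightarrow> Polynomial.degree p \<le> Polynomial.degree q)"
  have "\<exists>p. p \<noteq> 0 \<and> pl p x = 0" using ex_annihilator by blast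
  then obtain p where p: "p \<noteq> 0" "pl p x = 0"
     "\<And>q. q \<noteq> 0 \<Longrightarrow> pl q x = 0 \<Longrightarrow> Polynomial.degree p \<le> Polynomial.degree q"
    using ex_has_least_nat[of "\<lambda>p. p \<noteq> 0 \<and> pl p x = 0" _ Polynomial.degree] by metis
  let ?q = "Polynomial.smult (1 / lead_coeff p) p"
  have "?P ?q" using p by (simp add: pl_smult)
  moreover have "p' = ?q" if "?P p'" for p'
  proof -
    have dq: "Polynomial.degree p' = Polynomial.degree ?q"
    proof -
      have "p' \<noteq> 0" using that by auto
      then have "Polynomial.degree p \<le> Polynomial.degree p'" using p(3)[of p'] that by blast
      moreover have "Polynomial.degree p' \<le> Polynomial.degree p" using that p(1,2) by blast
      ultimately have "Polynomial.degree p' = Polynomial.degree p" by simp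
      moreover have "1 / lead_coeff p \<noteq> 0" using p(1) by simp
      ultimately show ?thesis unfolding degree_smult_eq by (simp only: if_False)
    qed
    show ?thesis using monic_minimal_unique[of p' ?q x, OF _ _ _ _ dq] that \<open>?P ?q\<close> by blast
  qed
  ultimately have "\<exists>!p. ?P p" by (rule ex1I)
  then have "?P (mp x)" unfolding min_poly_def by (rule theI')
  note P = this
  show "lead_coeff (mp x) = 1" by (rule conjunct1[OF P])
  show "pl (mp x) x = 0" by (rule conjunct1[OF conjunct2[OF P]])
  show "\<And>q. q \<noteq> 0 \<Longrightarrow> pl q x = 0 \<Longrightarrow> Polynomial.degree (mp x) \<le> Polynomial.degree q"
    by (rule conjunct2[OF conjunct2[OF P], rule_format])
qed

lemma min_poly_nonzero: "mp x \<noteq> 0"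
  using min_poly_prop(1)[of x] by (metis leading_coeff_0_iff zero_neq_one)

lemma min_polyI:
  assumes "lead_coeff p = 1" "pl p x = 0" "Polynomial.degree p \<le> Polynomial.degree (mp x)"
  shows "mp x = p"
proof -
  have "p \<noteq> 0" using assms(1) by (metis leading_coeff_0_iff zero_neq_one)
  then have "Polynomial.degree (mp x) = Polynomial.degree p"
    using min_poly_prop(3)[of p x] assms by simp
  then show ?thesis using monic_minimal_unique[of "mp x" p x] assms min_poly_prop by blast
qed

lemma finite_degrees: "finite ((\<lambda>x. Polynomial.degree (mp x)) ` S)"
proof (rule finite_subset)
  show "(\<lambda>x. Polynomial.degree (mp x)) ` S \<subseteq> {..DIM('a)}"
  proof
    fix d assume "d \<in> (\<lambda>x. Polynomial.degree (mp x)) ` S"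
    then obtain x where d: "d = Polynomial.degree (mp x)" by (rule imageE)
    obtain p where "p \<noteq> 0" "Polynomial.degree p \<le> DIM('a)" "pl p x = 0" using ex_annihilator by blast
    then show "d \<in> {..DIM('a)}" using min_poly_prop(3)[of p x] d by simp
  qed
qed simp

lemma degree_min_poly_le: "Polynomial.degree (mp x) \<le> jrank V"
  unfolding jrank_def jrank_on_def by (rule Max_ge[OF finite_degrees]) simp

lemma ex_reg: "\<exists>x. reg x"
proof -
  have "jrank V \<in> (\<lambda>x. Polynomial.degree (mp x)) ` UNIV"
    unfolding jrank_def jrank_on_def by (rule Max_in[OF finite_degrees]) simp
  then show ?thesis by auto
qed

lemma regI:
  assumes "\<And>q. q \<noteq> 0 \<Longrightarrow> pl q x = 0 \<Longrightarrow> jrank V \<le> Polynomial.degree q" shows "reg x"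
  using assms[OF min_poly_nonzero min_poly_prop(2)] degree_min_poly_le[of x] by simp

lemma regD: "reg x \<Longrightarrow> pl q x = 0 \<Longrightarrow> Polynomial.degree q < jrank V \<Longrightarrow> q = 0"
  using min_poly_prop(3)[of q x] by (metis linorder_not_less)

lemma unit_nonzero: "\<ee> \<noteq> 0"
proof
  assume "\<ee> = 0"
  then have "x = 0" for x :: 'a using unit_mul(1)[of x] by (simp add: mul_simps)
  then show False by (metis nonempty_Basis nonzero_Basis ex_in_conv)
qed

lemma degree_min_poly_pos: "Polynomial.degree (mp x) > 0"
proof (rule ccontr)
  assume "\<not> ?thesis"
  then obtain a where "mp x = [:a:]" by (metis degree_eq_zeroE gr0I)
  then show False using min_poly_prop(1,2)[of x] unit_nonzero by (simp add: pl_const)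
qed

lemma jrank_pos: "jrank V > 0"
  using degree_min_poly_pos ex_reg by metis

section \<open>Gram-Schmidt on the powers\<close>

text \<open>Gram-Schmidt orthogonalisation of the powers of \<open>x\<close>, with all denominators cleared so that every
vector is polynomial in \<open>x\<close>.\<close>

fun gs :: "nat \<Rightarrow> 'a \<Rightarrow> 'a" where
  "gs k x = (\<Prod>j\<in>{..<k}. inner (gs j x) (gs j x)) *\<^sub>R pw x k
     - (\<Sum>j\<in>{..<k}. (inner (pw x k) (gs j x) * (\<Prod>i\<in>{..<k} - {j}. inner (gs i x) (gs i x))) *\<^sub>R gs j x)"

declare gs.simps [simp del]

text \<open>The leading coefficient of \<open>gs k x\<close> with respect to the powers of \<open>x\<close>.\<close>

definition gsQ :: "nat \<Rightarrow> 'a \<Rightarrow> real" where "gsQ k x = (\<Prod>j\<in>{..<k}. inner (gs j x) (gs j x))"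

lemma gs_orthogonal: "i < k \<Longrightarrow> inner (gs k x) (gs i x) = 0"
proof (induction k arbitrary: i rule: less_induct)
  case (less k)
  have orth: "inner (gs j x) (gs i x) = 0" if "j < k" "j \<noteq> i" for j
    using less that by (metis inner_commute linorder_neqE_nat)
  have "inner (gs k x) (gs i x) = gsQ k x * inner (pw x k) (gs i x) -
     (\<Sum>j\<in>{..<k}. (inner (pw x k) (gs j x) * (\<Prod>l\<in>{..<k} - {j}. inner (gs l x) (gs l x))) * inner (gs j x) (gs i x))"
    by (subst gs.simps) (simp add: inner_simps inner_sum_left gsQ_def)
  also have "(\<Sum>j\<in>{..<k}. (inner (pw x k) (gs j x) * (\<Prod>l\<in>{..<k} - {j}. inner (gs l x) (gs l x))) * inner (gs j x) (gs i x))
     = (\<Sum>j\<in>{..<k}. if j = i then inner (pw x k) (gs i x) * (\<Prod>l\<in>{..<k} - {i}. inner (gs l x) (gs l x)) * inner (gs i x) (gs i x) else 0)"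
    using orth by (intro sum.cong) auto
  also have "\<dots> = inner (pw x k) (gs i x) * gsQ k x"
    using less.prems by (simp add: gsQ_def prod.remove[of "{..<k}" i])
  finally show ?case by simp
qed

lemma real_polynomial_function_pw: "real_polynomial_function (\<lambda>x. inner (pw x k) b)"
proof (induction k arbitrary: b)
  case (Suc k)
  have eq: "inner (pw x (Suc k)) b = (\<Sum>c\<in>Basis. \<Sum>d\<in>Basis. (inner x c * inner (pw x k) d) * inner (c \<star> d) b)" for x
  proof -
    have "x \<star> pw x k = (\<Sum>c\<in>Basis. inner x c *\<^sub>R c) \<star> (\<Sum>d\<in>Basis. inner (pw x k) d *\<^sub>R d)"
      by (simp add: euclidean_representation)
    also have "\<dots> = (\<Sum>c\<in>Basis. \<Sum>d\<in>Basis. (inner x c * inner (pw x k) d) *\<^sub>R (c \<star> d))"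
      by (simp add: mul_sum_left mul_sum_right mul_simps scaleR_sum_right) (subst sum.swap, simp add: mult.commute)
    finally show ?thesis by (simp add: pw_Suc inner_sum_left)
  qed
  show ?case unfolding eq
    by (intro real_polynomial_function_sum' real_polynomial_function.intros(4) Suc real_polynomial_function.intros(2))
       (intro real_polynomial_function.intros(1) bounded_linear_inner_left)
qed (simp add: real_polynomial_function.intros)

lemma gs_expansion:
  "\<exists>c. (\<forall>j. real_polynomial_function (c j)) \<and> (\<forall>x. gs k x = (\<Sum>j\<le>k. c j x *\<^sub>R pw x j)) \<and>
     (\<forall>x. c k x = gsQ k x) \<and> (\<forall>b. real_polynomial_function (\<lambda>x. inner (gs k x) b))"
proof (induction k rule: less_induct)
  case (less k)
  define c where "c m = (SOME c. (\<forall>j. real_polynomial_function (c j)) \<and> (\<forall>x. gs m x = (\<Sum>j\<le>m. c j x *\<^sub>R pw x j)) \<and>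
     (\<forall>x. c m x = gsQ m x) \<and> (\<forall>b. real_polynomial_function (\<lambda>x. inner (gs m x) b)))" for m
  have c: "real_polynomial_function (c m j)" "gs m x = (\<Sum>j\<le>m. c m j x *\<^sub>R pw x j)"
     "real_polynomial_function (\<lambda>x. inner (gs m x) b)" if "m < k" for m j x b
    using someI_ex[OF less[OF that]] unfolding c_def[symmetric] by blast+
  have ip: "real_polynomial_function (\<lambda>x. inner (f x) (g x))"
    if "\<And>b. real_polynomial_function (\<lambda>x. inner (f x) b)" "\<And>b. real_polynomial_function (\<lambda>x. inner (g x) b)" for f g :: "'a \<Rightarrow> 'a"
  proof -
    have eq: "(\<lambda>x. inner (f x) (g x)) = (\<lambda>x. \<Sum>b\<in>Basis. inner (f x) b * inner (g x) b)"
      by (rule ext) (rule euclidean_inner)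
    show ?thesis unfolding eq
      by (rule real_polynomial_function_sum', rule real_polynomial_function.intros(4), rule that(1), rule that(2))
  qed
  define a where "a m x = - (inner (pw x k) (gs m x) * (\<Prod>i\<in>{..<k} - {m}. inner (gs i x) (gs i x)))" for m x
  define d where "d j x = (if j = k then gsQ k x else (\<Sum>m\<in>{..<k}. a m x * (if j \<le> m then c m j x else 0)))" for j x
  have gsQp: "real_polynomial_function (gsQ k)"
    unfolding gsQ_def by (rule real_polynomial_function_prod', rule ip; rule c(3); simp)
  have ap: "real_polynomial_function (a m)" if "m < k" for m
  proof -
    have eq: "a m = (\<lambda>x. (-1) * (inner (pw x k) (gs m x) * (\<Prod>i\<in>{..<k} - {m}. inner (gs i x) (gs i x))))"
      by (auto simp: a_def)
    show ?thesis unfolding eq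
      by (rule real_polynomial_function_cmult, rule real_polynomial_function.intros(4), rule ip,
          rule real_polynomial_function_pw, rule c(3)[OF that], rule real_polynomial_function_prod', rule ip; rule c(3); simp)
  qed
  have dp: "real_polynomial_function (d j)" for j
  proof (cases "j = k")
    case True then have "d j = gsQ k" by (auto simp: d_def)
    then show ?thesis using gsQp by simp
  next
    case False
    then have eq: "d j = (\<lambda>x. \<Sum>m\<in>{..<k}. a m x * (if j \<le> m then c m j x else 0))" by (auto simp: d_def)
    have "real_polynomial_function (\<lambda>x. if j \<le> m then c m j x else 0)" if "m < k" for m
      using c(1)[OF that, of j] real_polynomial_function.intros(2)[of 0] by (cases "j \<le> m") simp_all
    then show ?thesis unfolding eq
      by (intro real_polynomial_function_sum' real_polynomial_function.intros(4) ap) auto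
  qed
  have rep: "gs k x = (\<Sum>j\<le>k. d j x *\<^sub>R pw x j)" for x
  proof -
    have 1: "(\<Sum>m\<in>{..<k}. a m x *\<^sub>R gs m x) = (\<Sum>j\<in>{..<k}. d j x *\<^sub>R pw x j)"
    proof -
      have "gs m x = (\<Sum>j\<in>{..<k}. (if j \<le> m then c m j x else 0) *\<^sub>R pw x j)" if "m < k" for m
        unfolding c(2)[OF that] by (rule sum.mono_neutral_cong_left) (use that in auto)
      then have "(\<Sum>m\<in>{..<k}. a m x *\<^sub>R gs m x)
         = (\<Sum>m\<in>{..<k}. \<Sum>j\<in>{..<k}. (a m x * (if j \<le> m then c m j x else 0)) *\<^sub>R pw x j)"
        by (simp add: scaleR_sum_right)
      also have "\<dots> = (\<Sum>j\<in>{..<k}. (\<Sum>m\<in>{..<k}. a m x * (if j \<le> m then c m j x else 0)) *\<^sub>R pw x j)"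
        by (subst sum.swap) (simp add: scaleR_sum_left)
      finally show ?thesis by (simp add: d_def)
    qed
    have "gs k x = gsQ k x *\<^sub>R pw x k + (\<Sum>m\<in>{..<k}. a m x *\<^sub>R gs m x)"
      by (subst gs.simps) (simp add: a_def gsQ_def sum_negf)
    then show ?thesis unfolding 1 by (simp add: lessThan_Suc_atMost[symmetric] d_def add.commute)
  qed
  have "real_polynomial_function (\<lambda>x. inner (gs k x) b)" for b
    unfolding rep inner_sum_left inner_scaleR_left
    by (intro real_polynomial_function_sum' real_polynomial_function.intros(4) dp real_polynomial_function_pw)
  moreover have "d k x = gsQ k x" for x by (simp add: d_def)
  ultimately show ?case using dp rep by blast
qed

lemma gs_expansionE:
  obtains c where "\<And>j. real_polynomial_function (c j)" "\<And>x. gs k x = (\<Sum>j\<le>k. c j x *\<^sub>R pw x j)"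
    "\<And>x. c k x = gsQ k x"
proof -
  from gs_expansion[of k] obtain c where c: "\<forall>j. real_polynomial_function (c j)"
    "\<forall>x. gs k x = (\<Sum>j\<le>k. c j x *\<^sub>R pw x j)" "\<forall>x. c k x = gsQ k x" by (elim exE conjE)
  show thesis by (rule that[of c]) (use c in simp_all)
qed

lemma pw_orthogonal_gs:
  assumes "gsQ m x \<noteq> 0" "j < m" shows "inner (pw x j) (gs m x) = 0"
proof -
  have "gsQ j x \<noteq> 0" using assms by (simp add: gsQ_def)
  have "gs j x = gsQ j x *\<^sub>R pw x j - (\<Sum>i\<in>{..<j}. (inner (pw x j) (gs i x) * (\<Prod>l\<in>{..<j} - {i}. inner (gs l x) (gs l x))) *\<^sub>R gs i x)"
    by (subst gs.simps) (simp add: gsQ_def)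
  then have "inner (gs j x) (gs m x) = gsQ j x * inner (pw x j) (gs m x) -
      (\<Sum>i\<in>{..<j}. (inner (pw x j) (gs i x) * (\<Prod>l\<in>{..<j} - {i}. inner (gs l x) (gs l x))) * inner (gs i x) (gs m x))"
    by (simp add: inner_simps inner_sum_left)
  moreover have "inner (gs i x) (gs m x) = 0" if "i \<le> j" for i
    using gs_orthogonal[of i m x] that assms by (simp add: inner_commute)
  ultimately have "gsQ j x * inner (pw x j) (gs m x) = 0" by simp
  then show ?thesis using \<open>gsQ j x \<noteq> 0\<close> by simp
qed

text \<open>Orthogonal non-zero vectors are independent, so regular elements are the non-zero locus of a
polynomial function.\<close>

lemma reg_iff_gsQ: "reg x \<longleftrightarrow> gsQ (jrank V) x \<noteq> 0"
proof
  assume Q: "gsQ (jrank V) x \<noteq> 0"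
  show "reg x"
  proof (rule regI, rule ccontr)
    fix q assume q: "q \<noteq> 0" "pl q x = 0" "\<not> jrank V \<le> Polynomial.degree q"
    define m where "m = Polynomial.degree q"
    obtain c where c: "gs m x = (\<Sum>j\<le>m. c j x *\<^sub>R pw x j)" "c m x = gsQ m x" by (rule gs_expansionE[of m]) blast
    have "m < jrank V" using q(3) by (simp add: m_def)
    have Qm: "gsQ m x \<noteq> 0" and gm: "gs m x \<noteq> 0" using Q \<open>m < jrank V\<close> by (auto simp: gsQ_def)
    have "0 = inner (pl q x) (gs m x)" using q by simp
    also have "\<dots> = (\<Sum>j<m. Polynomial.coeff q j * inner (pw x j) (gs m x)) + lead_coeff q * inner (pw x m) (gs m x)"
      by (simp add: jpoly_def m_def[symmetric] inner_sum_left inner_add_left lessThan_Suc_atMost[symmetric])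
    also have "\<dots> = lead_coeff q * inner (pw x m) (gs m x)" using pw_orthogonal_gs[OF Qm] by simp
    finally have "inner (pw x m) (gs m x) = 0" using q(1) by simp
    then have "inner (gs m x) (gs m x) = 0"
      unfolding c(1) inner_sum_left inner_scaleR_left unfolding c(1)[symmetric]
      using pw_orthogonal_gs[OF Qm] by (intro sum.neutral) (metis atMost_iff le_neq_implies_less mult_zero_right)
    then show False using gm by simp
  qed
next
  assume r: "reg x"
  have "gs k x \<noteq> 0" if "k < jrank V" for k
    using that
  proof (induction k rule: less_induct)
    case (less k)
    obtain c where c: "gs k x = (\<Sum>j\<le>k. c j x *\<^sub>R pw x j)" "c k x = gsQ k x" by (rule gs_expansionE[of k]) blast
    have "gsQ k x \<noteq> 0" using less by (auto simp: gsQ_def)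
    define p where "p = (\<Sum>j\<le>k. Polynomial.monom (c j x) j)"
    have cp: "Polynomial.coeff p j = (if j \<le> k then c j x else 0)" for j unfolding p_def by (rule coeff_sum_monom)
    have dp: "Polynomial.degree p \<le> k" by (rule degree_le) (simp add: cp)
    have "p \<noteq> 0" using cp[of k] c(2) \<open>gsQ k x \<noteq> 0\<close> by auto
    moreover have "pl p x = gs k x" unfolding pl_bound[OF dp] c(1) by (simp add: cp)
    ultimately show ?case using regD[OF r, of p] dp less.prems by auto
  qed
  then show "gsQ (jrank V) x \<noteq> 0" by (simp add: gsQ_def)
qed

text \<open>At a regular element the power of exponent \<open>jrank V\<close> depends on the lower ones. Dividing \<open>gs\<close> by its
leading coefficient thus gives the minimal polynomial, with rational functions as coefficients.\<close>

lemma gs_jrank_eq_0: assumes "reg x" shows "gs (jrank V) x = 0"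
proof -
  let ?r = "jrank V"
  obtain c where c: "gs ?r x = (\<Sum>j\<le>?r. c j x *\<^sub>R pw x j)" "c ?r x = gsQ ?r x" by (rule gs_expansionE[of ?r]) blast
  have Q: "gsQ ?r x \<noteq> 0" using assms reg_iff_gsQ by simp
  have "0 = inner (pl (mp x) x) (gs ?r x)" using min_poly_prop(2) by simp
  also have "\<dots> = (\<Sum>j<?r. Polynomial.coeff (mp x) j * inner (pw x j) (gs ?r x)) + lead_coeff (mp x) * inner (pw x ?r) (gs ?r x)"
    using assms by (simp add: jpoly_def inner_sum_left inner_add_left lessThan_Suc_atMost[symmetric])
  also have "\<dots> = inner (pw x ?r) (gs ?r x)" using pw_orthogonal_gs[OF Q] min_poly_prop(1) by simp
  finally have "inner (pw x ?r) (gs ?r x) = 0" by simp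
  then have "inner (gs ?r x) (gs ?r x) = 0"
    unfolding c(1) inner_sum_left inner_scaleR_left unfolding c(1)[symmetric]
    using pw_orthogonal_gs[OF Q] by (intro sum.neutral) (metis atMost_iff le_neq_implies_less mult_zero_right)
  then show ?thesis by simp
qed

lemma real_polynomial_function_gsQ: "real_polynomial_function (gsQ k)"
proof -
  obtain c where c: "\<And>j. real_polynomial_function (c j)" "\<And>x. c k x = gsQ k x" by (rule gs_expansionE[of k]) blast
  have "c k = gsQ k" using c(2) by (rule ext)
  then show ?thesis using c(1)[of k] by simp
qed

text \<open>Regular elements form the non-zero locus of a polynomial function, and polynomial functions form a
domain; hence polynomial identities need only be checked there.\<close>

lemma poly_identity_reg:
  assumes "real_polynomial_function f" "real_polynomial_function g" "\<And>x. reg x \<Longrightarrow> f x = g x"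
  shows "f x = g x"
proof -
  obtain x0 where "reg x0" using ex_reg by blast
  have "real_polynomial_function (\<lambda>x. f x + (-1) * g x)"
    using assms by (intro real_polynomial_function.intros(3) real_polynomial_function_cmult)
  then have "f x + (-1) * g x = 0"
    by (rule real_polynomial_function_domain[OF real_polynomial_function_gsQ[of "jrank V"]])
       (use assms(3) reg_iff_gsQ \<open>reg x0\<close> in auto)
  then show ?thesis by simp
qed

section \<open>The coefficients of the generic minimal polynomial are polynomial functions\<close>

lemma pl_eq_pact: "pl p z = pact (\<lambda>v. z \<star> v) p \<ee>"
  by (induction p) (simp_all add: pl_pCons pact_pCons[OF linear_mul_right])

text \<open>The coefficients are rational functions with denominator \<open>gsQ\<close>. Along a line through a regular point
the polynomial with cleared denominators divides a multiple of the monic characteristic polynomial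
of multiplication, so by Gauss' lemma the denominator cancels on every such line, and therefore
globally.\<close>

lemma generic_coefficient:
  obtains D where "real_polynomial_function D" "\<And>x. reg x \<Longrightarrow> Polynomial.coeff (mp x) j = D x"
proof (cases "j \<le> jrank V")
  case False
  have "Polynomial.coeff (mp x) j = 0" for x using degree_min_poly_le[of x] False by (intro coeff_eq_0) simp
  then show thesis using that[of "\<lambda>_. 0"] real_polynomial_function.intros(2) by blast
next
  case j: True
  let ?r = "jrank V"
  obtain c where c: "\<And>j. real_polynomial_function (c j)" "\<And>x. gs ?r x = (\<Sum>j\<le>?r. c j x *\<^sub>R pw x j)" "\<And>x. c ?r x = gsQ ?r x"
    by (rule gs_expansionE[of ?r]) blast
  obtain x0 where x0: "reg x0" using ex_reg by blast
  have Q0: "gsQ ?r x0 \<noteq> 0" using x0 reg_iff_gsQ by simp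
  have "\<exists>h. \<forall>t. poly h t * gsQ ?r (x0 + t *\<^sub>R y) = c j (x0 + t *\<^sub>R y)" for y
  proof -
    define Np where "Np i = (SOME F. \<forall>t. c i (x0 + t *\<^sub>R y) = poly F t)" for i
    have Np: "c i (x0 + t *\<^sub>R y) = poly (Np i) t" for i t
    proof -
      have "\<exists>F. \<forall>t. c i (x0 + t *\<^sub>R y) = poly F t"
        by (rule real_polynomial_function_line_poly[OF c(1)[of i], of x0 y]) blast
      from someI_ex[OF this] show ?thesis unfolding Np_def by blast
    qed
    define M where "M = (\<Sum>i\<le>?r. Polynomial.monom (Np i) i)"
    have cM: "Polynomial.coeff M i = (if i \<le> ?r then Np i else 0)" for i unfolding M_def by (rule coeff_sum_monom)
    have nz: "Np ?r \<noteq> 0" using Np[of ?r 0] c(3) Q0 by auto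
    have degM: "Polynomial.degree M = ?r"
    proof (rule antisym)
      show "Polynomial.degree M \<le> ?r" by (rule degree_le) (simp add: cM)
      show "?r \<le> Polynomial.degree M" by (rule le_degree) (simp add: cM nz)
    qed
    have leadM: "lead_coeff M = Np ?r" by (simp add: degM cM)
    have M0: "M \<noteq> 0" using leadM nz by auto
    obtain X where X: "lead_coeff X = 1"
      "\<And>t v. pact (\<lambda>v. x0 \<star> v + t *\<^sub>R (y \<star> v)) (eval_coeffs t X) v = 0"
      by (rule monic_annihilator_line[OF linear_mul_right[of x0] linear_mul_right[of y]]) blast
    have plX: "pl (eval_coeffs t X) (x0 + t *\<^sub>R y) = 0" for t
    proof -
      have "(\<lambda>v. (x0 + t *\<^sub>R y) \<star> v) = (\<lambda>v. x0 \<star> v + t *\<^sub>R (y \<star> v))" by (rule ext) (simp add: mul_simps)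
      then show ?thesis unfolding pl_eq_pact using X(2)[of t \<ee>] by (simp only:)
    qed
    \<comment> \<open>The remainder vanishes at all regular points of the line by minimality, hence identically.\<close>
    obtain K R where KR: "pseudo_divmod X M = (K, R)" by (cases "pseudo_divmod X M")
    define q where "q = lead_coeff M ^ (Suc (Polynomial.degree X) - Polynomial.degree M)"
    have div: "Polynomial.smult q X = M * K + R" "R = 0 \<or> Polynomial.degree R < Polynomial.degree M"
      using pseudo_divmod[OF M0 KR] by (simp_all add: q_def)
    have "R = 0"
    proof (rule poly_eqI)
      fix i
      have "poly (Np ?r * Polynomial.coeff R i) t = 0" for t
      proof (cases "poly (Np ?r) t = 0")
        case False
        let ?z = "x0 + t *\<^sub>R y"
        have rz: "reg ?z" using False Np[of ?r t] c(3) reg_iff_gsQ by simp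
        have dM: "Polynomial.degree (eval_coeffs t M) \<le> ?r" by (rule degree_le) (simp add: coeff_eval_coeffs cM)
        have "pl (eval_coeffs t M) ?z = gs ?r ?z"
          unfolding pl_bound[OF dM] c(2) by (simp add: coeff_eval_coeffs cM Np)
        also have "\<dots> = 0" by (rule gs_jrank_eq_0[OF rz])
        finally have "pl (eval_coeffs t M) ?z = 0" .
        moreover have "pl (eval_coeffs t (Polynomial.smult q X)) ?z = 0" by (simp add: eval_coeffs_smult pl_smult plX)
        ultimately have "pl (eval_coeffs t R) ?z = 0"
          unfolding div(1) by (simp add: eval_coeffs_add eval_coeffs_mult pl_add pl_mult mul_simps)
        moreover have "Polynomial.degree (eval_coeffs t R) < ?r"
        proof (cases "R = 0")
          case True then show ?thesis using jrank_pos by (simp add: eval_coeffs_0)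
        next
          case False
          then have "Polynomial.degree R < ?r" using div(2) degM by simp
          moreover have "Polynomial.degree (eval_coeffs t R) \<le> Polynomial.degree R"
            by (rule degree_le) (simp add: coeff_eval_coeffs coeff_eq_0)
          ultimately show ?thesis by simp
        qed
        ultimately have "eval_coeffs t R = 0" using regD[OF rz] by blast
        then show ?thesis using coeff_eval_coeffs[of t R i] by simp
      qed simp
      then have "Np ?r * Polynomial.coeff R i = 0" by (rule poly_eq_0_of_all)
      then show "Polynomial.coeff R i = Polynomial.coeff 0 i" using nz by simp
    qed
    then have "Polynomial.smult q X = M * K" using div by simp
    moreover have "q \<noteq> 0" using nz leadM by (simp add: q_def)
    ultimately have "lead_coeff M dvd Polynomial.coeff M j" using X(1) by (intro lead_coeff_dvd_of_monic_multiple)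
    then obtain h where "Np j = Np ?r * h" using leadM cM[of j] j by (auto elim: dvdE)
    then have "poly h t * gsQ ?r (x0 + t *\<^sub>R y) = c j (x0 + t *\<^sub>R y)" for t
      using Np[of j t] Np[of ?r t] c(3)[of "x0 + t *\<^sub>R y"] by (simp add: mult.commute)
    then show ?thesis by blast
  qed
  then obtain D where D: "real_polynomial_function D" "\<And>x. D x * gsQ ?r x = c j x"
    using real_polynomial_function_divide[OF c(1)[of j] real_polynomial_function_gsQ Q0] by blast
  have "Polynomial.coeff (mp x) j = D x" if "reg x" for x
  proof -
    have Q: "gsQ ?r x \<noteq> 0" using that reg_iff_gsQ by simp
    define p where "p = (\<Sum>i\<le>?r. Polynomial.monom (c i x / gsQ ?r x) i)"
    have cp: "Polynomial.coeff p i = (if i \<le> ?r then c i x / gsQ ?r x else 0)" for i unfolding p_def by (rule coeff_sum_monom)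
    have dp: "Polynomial.degree p \<le> ?r" by (rule degree_le) (simp add: cp)
    have "Polynomial.coeff p ?r = 1" using cp c(3) Q by simp
    moreover have "Polynomial.degree p = ?r" using dp le_degree[of p ?r] \<open>Polynomial.coeff p ?r = 1\<close> by simp
    moreover have "pl p x = (1 / gsQ ?r x) *\<^sub>R gs ?r x"
      unfolding pl_bound[OF dp] c(2) by (simp add: cp scaleR_sum_right)
    ultimately have "mp x = p" using gs_jrank_eq_0[OF that] that by (intro min_polyI) simp_all
    then show ?thesis using cp[of j] j D(2)[of x, symmetric] Q by simp
  qed
  with D(1) show thesis by (rule that)
qed

end

section \<open>Power sums of roots\<close>

text \<open>The logarithmic derivative of \<open>\<Prod> (1 - \<rho>\<^sub>i T)\<close> is minus the sum of the geometric series of the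
\<open>\<rho>\<^sub>i\<close>; Newton's identities compare coefficients.\<close>

lemma newton_identity:
  fixes \<rho> :: "nat \<Rightarrow> complex"
  defines "P \<equiv> \<lambda>n. \<Prod>i<n. [:1, - \<rho> i:]"
  shows "of_nat (Suc k) * Polynomial.coeff (P n) (Suc k)
     = - (\<Sum>i\<le>k. Polynomial.coeff (P n) (k - i) * (\<Sum>j<n. \<rho> j ^ Suc i))"
proof -
  define S where "S n = Abs_fps (\<lambda>i. \<Sum>j<n. \<rho> j ^ Suc i)" for n
  have geo: "fps_of_poly [:1, - a:] * Abs_fps (\<lambda>i. a ^ Suc i) = fps_const a" for a :: complex
  proof (rule fps_ext)
    fix m
    have "fps_nth (fps_of_poly [:1, - a:] * Abs_fps (\<lambda>i. a ^ Suc i)) m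
        = (\<Sum>i=0..m. Polynomial.coeff [:1, - a:] i * a ^ Suc (m - i))"
      by (simp add: fps_mult_nth)
    also have "\<dots> = fps_nth (fps_const a) m"
    proof (cases m)
      case (Suc l)
      have "(\<Sum>i=0..m. Polynomial.coeff [:1, - a:] i * a ^ Suc (m - i))
          = (\<Sum>i\<in>{0,1}. Polynomial.coeff [:1, - a:] i * a ^ Suc (m - i))"
        by (rule sum.mono_neutral_right) (use Suc in \<open>auto simp: coeff_pCons split: nat.splits\<close>)
      then show ?thesis using Suc by simp
    qed simp
    finally show "fps_nth (fps_of_poly [:1, - a:] * Abs_fps (\<lambda>i. a ^ Suc i)) m = fps_nth (fps_const a) m" .
  qed
  have "fps_deriv (fps_of_poly (P n)) = - (fps_of_poly (P n) * S n)"
  proof (induction n)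
    case 0
    have "S 0 = 0" by (rule fps_ext) (simp add: S_def)
    then show ?case by (simp add: P_def)
  next
    case (Suc n)
    let ?L = "fps_of_poly [:1, - \<rho> n:]" and ?G = "Abs_fps (\<lambda>i. \<rho> n ^ Suc i)" and ?F = "fps_of_poly (P n)"
    have S: "S (Suc n) = S n + ?G" by (rule fps_ext) (simp add: S_def)
    have P: "fps_of_poly (P (Suc n)) = ?F * ?L" by (simp add: P_def fps_of_poly_mult)
    have d: "fps_deriv ?L = - fps_const (\<rho> n)"
      by (rule fps_ext) (auto simp: fps_deriv_nth coeff_pCons split: nat.splits)
    have "fps_deriv (?F * ?L) = - (?F * S n) * ?L - ?F * fps_const (\<rho> n)"
      by (simp add: Suc d)
    also have "\<dots> = - (?F * S n) * ?L - ?F * (?L * ?G)" by (simp only: geo)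
    also have "\<dots> = - ((?F * ?L) * (S n + ?G))" by (simp add: algebra_simps)
    finally show ?case unfolding P S .
  qed
  then have "fps_deriv (fps_of_poly (P n)) = - (S n * fps_of_poly (P n))" by (simp only: mult.commute)
  from arg_cong[OF this, of "\<lambda>f. fps_nth f k"]
  have "of_nat (Suc k) * Polynomial.coeff (P n) (Suc k)
     = - (\<Sum>i\<le>k. (\<Sum>j<n. \<rho> j ^ Suc i) * Polynomial.coeff (P n) (k - i))"
    by (simp add: fps_mult_nth S_def atLeast0AtMost del: of_nat_Suc)
  then show ?thesis by (simp only: mult.commute)
qed

definition cpoly :: "real poly \<Rightarrow> complex poly" where "cpoly = map_poly complex_of_real"

lemma coeff_cpoly [simp]: "Polynomial.coeff (cpoly p) k = complex_of_real (Polynomial.coeff p k)"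
  by (simp add: cpoly_def Polynomial.coeff_map_poly)

lemma degree_cpoly [simp]: "Polynomial.degree (cpoly p) = Polynomial.degree p"
  by (simp add: cpoly_def degree_map_poly)

text \<open>Applied with the real and the imaginary part, this transports annihilating complex polynomials back to
real ones.\<close>

definition rpoly :: "(complex \<Rightarrow> real) \<Rightarrow> complex poly \<Rightarrow> real poly" where "rpoly f = map_poly f"

lemma coeff_rpoly: "f 0 = 0 \<Longrightarrow> Polynomial.coeff (rpoly f p) k = f (Polynomial.coeff p k)"
  by (simp add: rpoly_def Polynomial.coeff_map_poly)

lemma rpoly_cpoly_mult:
  assumes "linear f" "\<And>a z. f (complex_of_real a * z) = a * f z"
  shows "rpoly f (cpoly p * q) = p * rpoly f q"
  by (rule poly_eqI) (simp add: coeff_rpoly linear_0[OF assms(1)] Polynomial.coeff_mult linear_sum[OF assms(1)] assms(2))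

lemma rpoly_pcompose:
  assumes "linear f" "\<And>a z. f (complex_of_real a * z) = a * f z"
  shows "rpoly f (pcompose R (cpoly q)) = pcompose (rpoly f R) q"
proof (induction R)
  case 0
  have "rpoly f 0 = 0" by (rule poly_eqI) (simp add: coeff_rpoly linear_0[OF assms(1)])
  then show ?case by simp
next
  case (pCons a R)
  have add: "rpoly f (u + v) = rpoly f u + rpoly f v" for u v
    by (rule poly_eqI) (simp add: coeff_rpoly linear_0[OF assms(1)] linear_add[OF assms(1)])
  have pc: "rpoly f (pCons b u) = pCons (f b) (rpoly f u)" for b u
    by (rule poly_eqI) (simp add: coeff_rpoly linear_0[OF assms(1)] coeff_pCons split: nat.splits)
  have z: "rpoly f 0 = 0" by (rule poly_eqI) (simp add: coeff_rpoly linear_0[OF assms(1)])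
  show ?case by (simp add: pcompose_pCons add pc z rpoly_cpoly_mult[OF assms] pCons.IH)
qed

context jordan_alg begin

section \<open>Coefficients of the generic minimal polynomial\<close>

text \<open>The coefficient of \<open>T\<^sup>r\<^sup>-\<^sup>k\<close> in the generic minimal polynomial, as a polynomial function on all of \<open>V\<close>.\<close>

definition bc :: "nat \<Rightarrow> 'a \<Rightarrow> real" where
  "bc k = (SOME D. real_polynomial_function D \<and> (\<forall>x. reg x \<longrightarrow> Polynomial.coeff (mp x) (jrank V - k) = D x))"

lemma bc_poly: "real_polynomial_function (bc k)"
  and bc_reg: "reg x \<Longrightarrow> bc k x = Polynomial.coeff (mp x) (jrank V - k)"
proof -
  have "\<exists>D. real_polynomial_function D \<and> (\<forall>x. reg x \<longrightarrow> Polynomial.coeff (mp x) (jrank V - k) = D x)"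
    by (rule generic_coefficient[of "jrank V - k"]) blast
  from someI_ex[OF this] have b: "real_polynomial_function (bc k) \<and> (\<forall>x. reg x \<longrightarrow> Polynomial.coeff (mp x) (jrank V - k) = bc k x)"
    unfolding bc_def .
  show "real_polynomial_function (bc k)" using b by (rule conjunct1)
  show "reg x \<Longrightarrow> bc k x = Polynomial.coeff (mp x) (jrank V - k)" using b by simp
qed

lemma bc_0: "bc 0 x = 1"
proof (rule poly_identity_reg[OF bc_poly real_polynomial_function.intros(2)])
  fix x assume "reg x"
  then show "bc 0 x = 1" using bc_reg[of x 0] min_poly_prop(1)[of x] by simp
qed

lemma jdet_prop: "real_polynomial_function (jdet V)"
    "reg x \<Longrightarrow> jdet V x = (- 1) ^ jrank V * Polynomial.coeff (mp x) 0"
proof -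
  let ?P = "\<lambda>D. real_polynomial_function D \<and> (\<forall>x. reg x \<longrightarrow> D x = (- 1) ^ jrank V * Polynomial.coeff (mp x) 0)"
  have "?P (\<lambda>x. (- 1) ^ jrank V * bc (jrank V) x)"
    using real_polynomial_function_cmult[OF bc_poly] bc_reg[of _ "jrank V"] by simp
  moreover have "D = (\<lambda>x. (- 1) ^ jrank V * bc (jrank V) x)" if "?P D" for D
    using poly_identity_reg[of D "\<lambda>x. (- 1) ^ jrank V * bc (jrank V) x"] that calculation by auto
  ultimately have "\<exists>!D. ?P D" by (rule ex1I)
  from theI'[OF this] have P: "?P (jdet V)" unfolding jdet_def .
  show "real_polynomial_function (jdet V)" using P by (rule conjunct1)
  show "reg x \<Longrightarrow> jdet V x = (- 1) ^ jrank V * Polynomial.coeff (mp x) 0" using P by simp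
qed

lemma jdet_bc: "jdet V x = (- 1) ^ jrank V * bc (jrank V) x"
  by (rule poly_identity_reg[OF jdet_prop(1) real_polynomial_function_cmult[OF bc_poly]])
     (simp add: jdet_prop(2) bc_reg)

lemma real_polynomial_function_linear_comp:
  fixes f :: "'a \<Rightarrow> real" and g :: "'a \<Rightarrow> 'a"
  assumes "linear f" "\<And>b. real_polynomial_function (\<lambda>x. inner (g x) b)"
  shows "real_polynomial_function (\<lambda>x. f (g x))"
proof -
  have eq: "(\<lambda>x. f (g x)) = (\<lambda>x. \<Sum>b\<in>Basis. inner (g x) b * f b)"
  proof
    fix x
    have "f (g x) = f (\<Sum>b\<in>Basis. inner (g x) b *\<^sub>R b)" by (simp add: euclidean_representation)
    then show "f (g x) = (\<Sum>b\<in>Basis. inner (g x) b * f b)" by (simp only: linear_sum[OF assms(1)] linear_scale[OF assms(1)]) simp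
  qed
  show ?thesis unfolding eq
    by (intro real_polynomial_function_sum' real_polynomial_function.intros(4) assms(2) real_polynomial_function.intros(2))
qed

text \<open>At regular elements this is the minimal polynomial; it extends to all of \<open>V\<close> as a polynomial identity.\<close>

lemma generic_cayley_hamilton: "(\<Sum>k\<le>jrank V. bc k x *\<^sub>R pw x (jrank V - k)) = 0"
proof (rule vector_eqI_inner)
  fix b
  have "(\<Sum>k\<le>jrank V. bc k x * inner (pw x (jrank V - k)) b) = 0"
  proof (rule poly_identity_reg[of "\<lambda>x. \<Sum>k\<le>jrank V. bc k x * inner (pw x (jrank V - k)) b" "\<lambda>_. 0" x])
    show "real_polynomial_function (\<lambda>x. \<Sum>k\<le>jrank V. bc k x * inner (pw x (jrank V - k)) b)"
      by (intro real_polynomial_function_sum' real_polynomial_function.intros(4) bc_poly real_polynomial_function_pw)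
    fix x assume r: "reg x"
    have "(\<Sum>k\<le>jrank V. bc k x *\<^sub>R pw x (jrank V - k)) = (\<Sum>k\<le>jrank V. Polynomial.coeff (mp x) k *\<^sub>R pw x k)"
      by (rule sum.reindex_bij_witness[of _ "\<lambda>k. jrank V - k" "\<lambda>k. jrank V - k"]) (use bc_reg[OF r] in auto)
    also have "\<dots> = pl (mp x) x" using r by (simp add: jpoly_def)
    finally have "(\<Sum>k\<le>jrank V. bc k x *\<^sub>R pw x (jrank V - k)) = 0" using min_poly_prop(2) by simp
    from arg_cong[OF this, of "\<lambda>v. inner v b"]
    show "(\<Sum>k\<le>jrank V. bc k x * inner (pw x (jrank V - k)) b) = 0" by (simp add: inner_sum_left)
  qed (rule real_polynomial_function.intros(2))
  then show "inner (\<Sum>k\<le>jrank V. bc k x *\<^sub>R pw x (jrank V - k)) b = inner 0 b" by (simp add: inner_sum_left)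
qed

section \<open>Roots\<close>

definition has_roots :: "'a \<Rightarrow> (nat \<Rightarrow> complex) \<Rightarrow> bool" where
  "has_roots x \<rho> \<longleftrightarrow> cpoly (mp x) = (\<Prod>i<jrank V. [:- \<rho> i, 1:])"

lemma ex_roots: "reg x \<Longrightarrow> \<exists>\<rho>. has_roots x \<rho>"
proof -
  assume r: "reg x"
  obtain \<rho> where "Polynomial.smult (lead_coeff (cpoly (mp x))) (\<Prod>i<Polynomial.degree (cpoly (mp x)). [:- \<rho> i, 1:]) = cpoly (mp x)"
    by (rule complex_poly_decompose'[of "cpoly (mp x)"]) blast
  then have "has_roots x \<rho>" using r min_poly_prop(1)[of x] by (simp add: has_roots_def)
  then show ?thesis by blast
qed

text \<open>The monic polynomial whose roots are the values of \<open>q\<close> at the roots of \<open>x\<close> annihilates \<open>q(x)\<close> and has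
degree \<open>jrank V\<close>; when \<open>q(x)\<close> is regular it must be the minimal polynomial.\<close>

lemma has_roots_pl:
  assumes x: "has_roots x \<rho>" and "reg x" and w: "reg (pl q x)"
  shows "has_roots (pl q x) (\<lambda>i. poly (cpoly q) (\<rho> i))"
proof -
  let ?r = "jrank V" and ?w = "pl q x"
  define R where "R = (\<Prod>i<?r. [:- poly (cpoly q) (\<rho> i), 1:])"
  have lead: "lead_coeff R = 1" unfolding R_def by (simp add: lead_coeff_prod)
  have degR: "Polynomial.degree R = ?r" unfolding R_def by (subst degree_prod_eq_sum_degree) auto
  have "cpoly (mp x) dvd pcompose R (cpoly q)"
  proof -
    have "[:- \<rho> i, 1:] dvd pcompose [:- poly (cpoly q) (\<rho> i), 1:] (cpoly q)" for i
      by (simp add: poly_eq_0_iff_dvd[symmetric] poly_pcompose)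
    then have "(\<Prod>i<?r. [:- \<rho> i, 1:]) dvd (\<Prod>i<?r. pcompose [:- poly (cpoly q) (\<rho> i), 1:] (cpoly q))"
      by (rule prod_dvd_prod)
    then show ?thesis using x by (simp add: has_roots_def R_def pcompose_prod)
  qed
  then obtain H where H: "pcompose R (cpoly q) = cpoly (mp x) * H" by (rule dvdE)
  have ann: "pl (rpoly f R) ?w = 0" if f: "linear f" "\<And>a z. f (complex_of_real a * z) = a * f z" for f
  proof -
    have "pcompose (rpoly f R) q = mp x * rpoly f H"
      using arg_cong[OF H, of "rpoly f"] by (simp add: rpoly_cpoly_mult[OF f] rpoly_pcompose[OF f])
    then have "pl (rpoly f R) (pl q x) = pl (mp x) x \<star> pl (rpoly f H) x" by (metis pl_pcompose pl_mult)
    then show ?thesis using min_poly_prop(2) by (simp add: mul_simps)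
  qed
  have re: "linear Re" "linear Im" using bounded_linear_Re bounded_linear_Im bounded_linear.linear by blast+
  have "rpoly Im R = 0"
  proof (rule regD[OF w ann[OF re(2)]])
    have "Polynomial.coeff (rpoly Im R) k = 0" if "k \<ge> ?r" for k
    proof (cases "k = ?r")
      case True then show ?thesis using lead degR by (simp add: coeff_rpoly)
    next
      case False then show ?thesis using degR that by (simp add: coeff_rpoly coeff_eq_0)
    qed
    then have "Polynomial.degree (rpoly Im R) \<le> ?r - 1" using jrank_pos by (intro degree_le) auto
    then show "Polynomial.degree (rpoly Im R) < ?r" using jrank_pos by simp
  qed simp
  then have im: "Im (Polynomial.coeff R k) = 0" for k
    using coeff_rpoly[of Im R k] by simp
  have RR: "R = cpoly (rpoly Re R)"
    by (rule poly_eqI) (simp add: coeff_rpoly complex_eq_iff im)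
  have degRe: "Polynomial.degree (rpoly Re R) = ?r" using RR degR by (metis degree_cpoly)
  have "mp ?w = rpoly Re R"
  proof (rule min_polyI)
    show "lead_coeff (rpoly Re R) = 1" using lead degR by (simp add: degRe coeff_rpoly)
  qed (use ann[OF re(1)] degRe w in auto)
  then show ?thesis using RR by (simp add: has_roots_def R_def)
qed

lemma bc_roots:
  assumes "has_roots x \<rho>" "reg x" "k \<le> jrank V"
  shows "complex_of_real (bc k x) = Polynomial.coeff (\<Prod>i<jrank V. [:1, - \<rho> i:]) k"
proof -
  have "reflect_poly (cpoly (mp x)) = (\<Prod>i<jrank V. [:1, - \<rho> i:])"
  proof -
    have "reflect_poly (\<Prod>i<n. [:- \<rho> i, 1:]) = (\<Prod>i<n. [:1, - \<rho> i:])" for n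
    proof (induction n)
      case (Suc n)
      have "reflect_poly [:- \<rho> n, 1:] = [:1, - \<rho> n:]"
        by (rule poly_eqI) (auto simp: coeff_reflect_poly coeff_pCons split: nat.splits)
      with Suc show ?case by (simp only: prod.lessThan_Suc reflect_poly_mult)
    qed simp
    then show ?thesis using assms(1) by (simp add: has_roots_def)
  qed
  then have "Polynomial.coeff (\<Prod>i<jrank V. [:1, - \<rho> i:]) k = Polynomial.coeff (cpoly (mp x)) (jrank V - k)"
    using assms(2,3) coeff_reflect_poly[of "cpoly (mp x)" k] by (simp only: degree_cpoly split: if_splits) simp
  then show ?thesis using bc_reg[OF assms(2)] by simp
qed

section \<open>The generic trace\<close>

definition gtr :: "'a \<Rightarrow> real" where "gtr x = - bc 1 x"

lemma gtr_poly: "real_polynomial_function gtr"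
  using real_polynomial_function_cmult[OF bc_poly, of "-1" 1] by (simp add: gtr_def[abs_def])

lemma gtr_roots: "has_roots x \<rho> \<Longrightarrow> reg x \<Longrightarrow> complex_of_real (gtr x) = (\<Sum>i<jrank V. \<rho> i)"
proof -
  assume x: "has_roots x \<rho>" "reg x"
  have "complex_of_real (bc 1 x) = Polynomial.coeff (\<Prod>i<jrank V. [:1, - \<rho> i:]) 1"
    using bc_roots[OF x, of 1] jrank_pos by simp
  also have "\<dots> = - (\<Sum>i<jrank V. \<rho> i)"
  proof -
    have "Polynomial.coeff (\<Prod>i<n. [:1, - \<rho> i:]) 0 = 1" for n :: nat
      by (induction n) (simp_all add: Polynomial.coeff_mult)
    then show ?thesis using newton_identity[of 0 \<rho> "jrank V"] by simp
  qed
  finally show ?thesis by (simp add: gtr_def)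
qed

text \<open>A substitution that preserves degrees transports annihilating polynomials of \<open>q(x)\<close> to polynomials of
the same degree annihilating \<open>x\<close>.\<close>

lemma reg_pl_of_degree:
  assumes "reg x" "\<And>p. p \<noteq> 0 \<Longrightarrow> pcompose p q \<noteq> 0 \<and> Polynomial.degree (pcompose p q) = Polynomial.degree p"
  shows "reg (pl q x)"
  by (rule regI) (metis assms min_poly_prop(3) pl_pcompose)

lemma reg_scale: assumes "reg x" "s \<noteq> 0" shows "reg (s *\<^sub>R x)"
proof -
  have "reg (pl [:0, s:] x)"
  proof (rule reg_pl_of_degree[OF assms(1)])
    fix p :: "real poly" assume "p \<noteq> 0"
    have d: "Polynomial.degree (pcompose p [:0, s:]) = Polynomial.degree p" using assms(2) by (simp add: degree_pcompose)
    have "lead_coeff (pcompose p [:0, s:]) \<noteq> 0"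
      using assms(2) \<open>p \<noteq> 0\<close> lead_coeff_comp[of "[:0, s:]" p] by simp
    then show "pcompose p [:0, s:] \<noteq> 0 \<and> Polynomial.degree (pcompose p [:0, s:]) = Polynomial.degree p" using d by auto
  qed
  moreover have "pl [:0, s:] x = s *\<^sub>R x" by (simp add: pl_pCons mul_simps)
  ultimately show ?thesis by simp
qed

text \<open>The generic trace is a polynomial function homogeneous of degree one, hence equal to its derivative
at the origin.\<close>

lemma linear_gtr: "linear gtr"
proof -
  have sc: "gtr (s *\<^sub>R x) = s * gtr x" if "s \<noteq> 0" for s x
  proof (rule poly_identity_reg[of "\<lambda>x. gtr (s *\<^sub>R x)" "\<lambda>x. s * gtr x" x])
    have "real_polynomial_function (\<lambda>x. f (s *\<^sub>R x))" if "real_polynomial_function f" for f :: "'a \<Rightarrow> real"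
      using that
    proof (induction f rule: real_polynomial_function.induct)
      case (linear f)
      then have "(\<lambda>x. f (s *\<^sub>R x)) = (\<lambda>x. s * f x)" by (auto simp: linear_scale bounded_linear.linear)
      with linear show ?case by (auto intro: real_polynomial_function_cmult)
    qed auto
    then show "real_polynomial_function (\<lambda>x. gtr (s *\<^sub>R x))" using gtr_poly by blast
    show "real_polynomial_function (\<lambda>x. s * gtr x)" by (intro real_polynomial_function_cmult gtr_poly)
    fix x assume r: "reg x"
    obtain \<rho> where \<rho>: "has_roots x \<rho>" using ex_roots[OF r] by blast
    have e: "pl [:0, s:] x = s *\<^sub>R x" by (simp add: pl_pCons mul_simps)
    have c: "cpoly [:0, s:] = [:0, complex_of_real s:]" by (rule poly_eqI) (simp add: coeff_pCons split: nat.splits)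
    have "has_roots (s *\<^sub>R x) (\<lambda>i. complex_of_real s * \<rho> i)"
      using has_roots_pl[OF \<rho> r, of "[:0, s:]"] reg_scale[OF r that] unfolding e c
      by (simp add: mult.commute)
    then have "complex_of_real (gtr (s *\<^sub>R x)) = complex_of_real (s * gtr x)"
      using gtr_roots[OF _ reg_scale[OF r that]] gtr_roots[OF \<rho> r] by (simp add: sum_distrib_left)
    then show "gtr (s *\<^sub>R x) = s * gtr x" by (simp only: of_real_eq_iff)
  qed
  obtain D where D: "(gtr has_derivative D) (at 0)"
    using differentiable_at_real_polynomial_function[OF gtr_poly] unfolding differentiable_def by blast
  have z: "gtr 0 = 0" using sc[of 2 0] by simp
  have "gtr y = D y" for y
  proof -
    have l: "((\<lambda>s::real. s *\<^sub>R y) has_derivative (\<lambda>s. s *\<^sub>R y)) (at 0)"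
      by (auto intro!: derivative_eq_intros)
    have "((\<lambda>s. gtr (s *\<^sub>R y)) has_derivative (\<lambda>s. D (s *\<^sub>R y))) (at (0::real))"
      by (rule has_derivative_compose[OF l]) (use D in simp)
    moreover have "(\<lambda>s. gtr (s *\<^sub>R y)) = (\<lambda>s. s * gtr y)"
    proof
      fix s :: real show "gtr (s *\<^sub>R y) = s * gtr y" by (cases "s = 0") (simp_all add: z sc)
    qed
    ultimately have "((\<lambda>s. s * gtr y) has_derivative (\<lambda>s. D (s *\<^sub>R y))) (at (0::real))" by simp
    moreover have "((\<lambda>s. s * gtr y) has_derivative (\<lambda>s. s * gtr y)) (at (0::real))"
      by (auto intro!: derivative_eq_intros)
    ultimately have "(\<lambda>s. D (s *\<^sub>R y)) = (\<lambda>s. s * gtr y)" by (rule has_derivative_unique)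
    from fun_cong[OF this, of 1] show ?thesis by simp
  qed
  then have "gtr = D" by (rule ext)
  then show ?thesis using D has_derivative_linear by blast
qed

text \<open>The elements \<open>x + s q(x)\<close> are regular for almost all \<open>s\<close>, and the roots of these are known; linearity
then isolates the trace of \<open>q(x)\<close>, which need not be regular itself.\<close>

lemma gtr_pl_roots:
  assumes \<rho>: "has_roots x \<rho>" and r: "reg x"
  shows "complex_of_real (gtr (pl q x)) = (\<Sum>i<jrank V. poly (cpoly q) (\<rho> i))"
proof -
  \<comment> \<open>For all but finitely many \<open>s\<close> the element \<open>x + s q(x)\<close> is regular; the trace is linear.\<close>
  obtain G where G: "\<And>s. gsQ (jrank V) (x + s *\<^sub>R pl q x) = poly G s"
    by (rule real_polynomial_function_line_poly[OF real_polynomial_function_gsQ]) blast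
  have "poly G 0 \<noteq> 0" using G[of 0] r reg_iff_gsQ by simp
  then have "G \<noteq> 0" by auto
  then have "finite ({s. poly G s = 0} \<union> {0})" using poly_roots_finite by simp
  then obtain s where s: "s \<notin> {s. poly G s = 0} \<union> {0}" using ex_new_if_finite infinite_UNIV_char_0 by blast
  have e: "pl ([:0, 1:] + Polynomial.smult s q) x = x + s *\<^sub>R pl q x" by (simp add: pl_add pl_smult)
  have r': "reg (pl ([:0, 1:] + Polynomial.smult s q) x)" using s G reg_iff_gsQ unfolding e by simp
  have "complex_of_real (gtr (x + s *\<^sub>R pl q x)) = (\<Sum>i<jrank V. \<rho> i + complex_of_real s * poly (cpoly q) (\<rho> i))"
  proof -
    have "cpoly ([:0, 1:] + Polynomial.smult s q) = [:0, 1:] + Polynomial.smult (complex_of_real s) (cpoly q)"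
      by (rule poly_eqI) (simp add: coeff_pCons split: nat.splits)
    then show ?thesis using gtr_roots[OF has_roots_pl[OF \<rho> r r'] r'] unfolding e by simp
  qed
  then have "complex_of_real s * complex_of_real (gtr (pl q x)) = complex_of_real s * (\<Sum>i<jrank V. poly (cpoly q) (\<rho> i))"
    using gtr_roots[OF \<rho> r] by (simp add: linear_add[OF linear_gtr] linear_scale[OF linear_gtr] sum.distrib sum_distrib_left)
  then show ?thesis using s by simp
qed

text \<open>Power sums of the roots are generic traces of powers.\<close>

lemma generic_newton:
  assumes "k < jrank V"
  shows "real (Suc k) * bc (Suc k) x = - (\<Sum>i\<le>k. bc (k - i) x * gtr (pw x (Suc i)))"
proof (rule poly_identity_reg[of "\<lambda>x. real (Suc k) * bc (Suc k) x" "\<lambda>x. - (\<Sum>i\<le>k. bc (k - i) x * gtr (pw x (Suc i)))" x])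
  show "real_polynomial_function (\<lambda>x. real (Suc k) * bc (Suc k) x)" by (intro real_polynomial_function_cmult bc_poly)
  have "real_polynomial_function (\<lambda>x. (-1) * (\<Sum>i\<le>k. bc (k - i) x * gtr (pw x (Suc i))))"
    by (intro real_polynomial_function_cmult real_polynomial_function_sum' real_polynomial_function.intros(4) bc_poly
       real_polynomial_function_linear_comp[OF linear_gtr] real_polynomial_function_pw)
  then show "real_polynomial_function (\<lambda>x. - (\<Sum>i\<le>k. bc (k - i) x * gtr (pw x (Suc i))))" by simp
  fix x assume r: "reg x"
  obtain \<rho> where \<rho>: "has_roots x \<rho>" using ex_roots[OF r] by blast
  have s: "complex_of_real (gtr (pw x m)) = (\<Sum>j<jrank V. \<rho> j ^ m)" for m
  proof -
    have "pl (Polynomial.monom 1 m) x = pw x m" by (simp add: pl_monom)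
    moreover have "cpoly (Polynomial.monom 1 m) = Polynomial.monom 1 m"
      by (rule poly_eqI) simp
    ultimately show ?thesis using gtr_pl_roots[OF \<rho> r, of "Polynomial.monom 1 m"] by (simp add: Polynomial.poly_monom)
  qed
  have b: "complex_of_real (bc i x) = Polynomial.coeff (\<Prod>i<jrank V. [:1, - \<rho> i:]) i" if "i \<le> Suc k" for i
    using bc_roots[OF \<rho> r, of i] assms that by simp
  have "complex_of_real (real (Suc k) * bc (Suc k) x) = complex_of_real (- (\<Sum>i\<le>k. bc (k - i) x * gtr (pw x (Suc i))))"
    using newton_identity[of k \<rho> "jrank V"] by (simp add: b s del: of_nat_Suc power_Suc)
  then show "real (Suc k) * bc (Suc k) x = - (\<Sum>i\<le>k. bc (k - i) x * gtr (pw x (Suc i)))" by (simp only: of_real_eq_iff)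
qed

end

context jordan_alg begin

section \<open>Derivatives of the generic coefficients\<close>

text \<open>The derivative of \<open>x \<mapsto> x\<^sup>m\<close> in direction \<open>u\<close>.\<close>

fun Dpw :: "nat \<Rightarrow> 'a \<Rightarrow> 'a \<Rightarrow> 'a" where
  "Dpw 0 x u = 0"
| "Dpw (Suc m) x u = u \<star> pw x m + x \<star> Dpw m x u"

lemma has_derivative_pw: "((\<lambda>x. pw x m) has_derivative Dpw m x) (at x)"
proof (induction m)
  case 0 then show ?case by (simp add: Dpw.simps[abs_def])
next
  case (Suc m)
  have "((\<lambda>x. x \<star> pw x m) has_derivative (\<lambda>u. x \<star> Dpw m x u + u \<star> pw x m)) (at x)"
    by (rule bounded_bilinear.FDERIV[OF mul_bounded_bilinear has_derivative_ident Suc])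
  moreover have "Dpw (Suc m) x = (\<lambda>u. x \<star> Dpw m x u + u \<star> pw x m)"
    by (rule ext) (simp add: add.commute)
  ultimately show ?case by (simp add: pw_Suc)
qed

definition Dbc :: "nat \<Rightarrow> 'a \<Rightarrow> 'a \<Rightarrow> real" where "Dbc k x = frechet_derivative (bc k) (at x)"

lemma has_derivative_bc: "(bc k has_derivative Dbc k x) (at x)"
  unfolding Dbc_def using differentiable_at_real_polynomial_function[OF bc_poly]
  by (simp add: frechet_derivative_works)

lemma Dbc_0: "Dbc 0 x u = 0"
proof -
  have "bc 0 = (\<lambda>_. 1)" by (rule ext) (rule bc_0)
  then have "(bc 0 has_derivative (\<lambda>_. 0)) (at x)" by simp
  then have "Dbc 0 x = (\<lambda>_. 0)" using has_derivative_bc has_derivative_unique by blast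
  then show ?thesis by simp
qed

lemma Dbc_1: "Dbc 1 x u = - gtr u"
proof -
  have "bc 1 = (\<lambda>x. - gtr x)" by (rule ext) (simp add: gtr_def)
  moreover have "((\<lambda>x. - gtr x) has_derivative (\<lambda>u. - gtr u)) (at x)"
    by (rule has_derivative_minus, rule linear_imp_has_derivative, rule linear_gtr)
  ultimately have "(bc 1 has_derivative (\<lambda>u. - gtr u)) (at x)" by simp
  then have "Dbc 1 x = (\<lambda>u. - gtr u)" using has_derivative_bc has_derivative_unique by blast
  then show ?thesis by simp
qed

lemma derivative_cayley_hamilton:
  "(\<Sum>k\<le>jrank V. bc k x *\<^sub>R Dpw (jrank V - k) x u + Dbc k x u *\<^sub>R pw x (jrank V - k)) = 0"
proof -
  have "((\<lambda>x. \<Sum>k\<le>jrank V. bc k x *\<^sub>R pw x (jrank V - k)) has_derivative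
     (\<lambda>u. \<Sum>k\<le>jrank V. bc k x *\<^sub>R Dpw (jrank V - k) x u + Dbc k x u *\<^sub>R pw x (jrank V - k))) (at x)"
    by (rule has_derivative_sum, rule has_derivative_scaleR[OF has_derivative_bc has_derivative_pw])
  moreover have "(\<lambda>x. \<Sum>k\<le>jrank V. bc k x *\<^sub>R pw x (jrank V - k)) = (\<lambda>x. 0)"
    by (rule ext) (rule generic_cayley_hamilton)
  ultimately have "((\<lambda>x. 0 :: 'a) has_derivative
     (\<lambda>u. \<Sum>k\<le>jrank V. bc k x *\<^sub>R Dpw (jrank V - k) x u + Dbc k x u *\<^sub>R pw x (jrank V - k))) (at x)"
    by simp
  then have "(\<lambda>u. \<Sum>k\<le>jrank V. bc k x *\<^sub>R Dpw (jrank V - k) x u + Dbc k x u *\<^sub>R pw x (jrank V - k)) = (\<lambda>u. 0)"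
    by (rule has_derivative_unique) simp
  then show ?thesis by (rule fun_cong)
qed

lemma Dpw_inner_deriv: "Dpw m x (inner_deriv w y x) = inner_deriv w y (pw x m)"
proof (induction m)
  case 0 show ?case by (simp add: inner_deriv_def mul_commute)
next
  case (Suc m) then show ?case by (simp add: pw_Suc inner_deriv_mul)
qed

text \<open>Along a derivation the generic Cayley-Hamilton identity differentiates to a relation of
degree below the rank, which is trivial at a regular element.\<close>

lemma Dbc_inner_deriv:
  assumes "reg x" "k \<le> jrank V" shows "Dbc k x (inner_deriv w y x) = 0"
proof -
  let ?r = "jrank V" and ?u = "inner_deriv w y x"
  have "(\<Sum>k\<le>?r. bc k x *\<^sub>R Dpw (?r - k) x ?u) = inner_deriv w y (\<Sum>k\<le>?r. bc k x *\<^sub>R pw x (?r - k))"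
    by (simp add: Dpw_inner_deriv linear_sum[OF linear_inner_deriv] linear_scale[OF linear_inner_deriv])
  also have "\<dots> = 0" by (simp add: generic_cayley_hamilton linear_0[OF linear_inner_deriv])
  finally have s: "(\<Sum>k\<le>?r. Dbc k x ?u *\<^sub>R pw x (?r - k)) = 0"
    using derivative_cayley_hamilton[of x ?u] by (simp add: sum.distrib)
  define p where "p = (\<Sum>k\<le>?r. Polynomial.monom (Dbc (?r - k) x ?u) k)"
  have cp: "Polynomial.coeff p j = (if j \<le> ?r then Dbc (?r - j) x ?u else 0)" for j unfolding p_def by (rule coeff_sum_monom)
  have "Polynomial.degree p \<le> ?r - 1"
  proof (rule degree_le, intro allI impI)
    fix i assume "?r - 1 < i"
    then show "Polynomial.coeff p i = 0" by (cases "i = ?r") (auto simp: cp Dbc_0)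
  qed
  then have d: "Polynomial.degree p < ?r" using jrank_pos by simp
  have "pl p x = (\<Sum>k\<le>?r. Polynomial.coeff p k *\<^sub>R pw x k)" by (rule pl_bound) (use d in simp)
  also have "\<dots> = (\<Sum>k\<le>?r. Dbc k x ?u *\<^sub>R pw x (?r - k))"
    by (rule sum.reindex_bij_witness[of _ "\<lambda>k. ?r - k" "\<lambda>k. ?r - k"]) (auto simp: cp)
  finally have "p = 0" using s d regD[OF assms(1)] by simp
  then show ?thesis using cp[of "?r - k"] assms(2) by simp
qed

lemma trace_functional_gtr: "trace_functional gtr"
  unfolding trace_functional_def
proof (intro conjI allI)
  show "linear gtr" by (rule linear_gtr)
  fix w y z
  show "gtr (inner_deriv w y z) = 0"
  proof (rule poly_identity_reg[of "\<lambda>z. gtr (inner_deriv w y z)" "\<lambda>_. 0" z])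
    have "linear (\<lambda>z. gtr (inner_deriv w y z))"
      using linear_compose[OF linear_inner_deriv linear_gtr] by (simp add: o_def)
    then show "real_polynomial_function (\<lambda>z. gtr (inner_deriv w y z))"
      by (intro real_polynomial_function.intros(1)) (simp add: linear_conv_bounded_linear)
    fix x assume "reg x"
    then show "gtr (inner_deriv w y x) = 0" using Dbc_inner_deriv[of x 1 w y] Dbc_1 jrank_pos by simp
  qed (rule real_polynomial_function.intros(2))
qed

lemmas gtr_assoc = trace_functional_assoc[OF trace_functional_gtr]

lemma gtr_Dpw: "gtr (pw x j \<star> Dpw (Suc m) x u) = real (Suc m) * gtr (pw x (j + m) \<star> u)"
proof (induction m arbitrary: j)
  case 0 show ?case by (simp add: mul_simps)
next
  case (Suc m)
  have "gtr (pw x j \<star> (x \<star> Dpw (Suc m) x u)) = gtr (pw x (Suc j) \<star> Dpw (Suc m) x u)"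
    by (metis gtr_assoc mul_commute pw_Suc)
  also have "\<dots> = real (Suc m) * gtr (pw x (Suc j + m) \<star> u)" by (rule Suc)
  finally have 1: "gtr (pw x j \<star> (x \<star> Dpw (Suc m) x u)) = real (Suc m) * gtr (pw x (j + Suc m) \<star> u)" by simp
  have "gtr (pw x j \<star> (u \<star> pw x (Suc m))) = gtr (pw x (j + Suc m) \<star> u)"
    by (metis gtr_assoc mul_commute pw_add)
  then show ?case
    by (subst Dpw.simps(2)) (simp only: mul_simps linear_add[OF linear_gtr] 1, simp add: algebra_simps)
qed

text \<open>Differentiating Newton's identities expresses the derivatives of all generic coefficients through the
generic trace, by associativity of its form.\<close>

lemma Dbc_formula:
  assumes "k < jrank V"
  shows "Dbc (Suc k) x u = - (\<Sum>i\<le>k. bc (k - i) x * gtr (pw x i \<star> u))"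
  using assms
proof (induction k rule: less_induct)
  case (less k)
  define S where "S m = (\<Sum>i\<le>m. bc (m - i) x * gtr (pw x i \<star> u))" for m
  have Dgtr: "((\<lambda>x. gtr (pw x (Suc i))) has_derivative (\<lambda>u. real (Suc i) * gtr (pw x i \<star> u))) (at x)" for i
  proof -
    have "((\<lambda>x. gtr (pw x (Suc i))) has_derivative (\<lambda>u. gtr (Dpw (Suc i) x u))) (at x)"
      by (rule has_derivative_compose[OF has_derivative_pw linear_imp_has_derivative[OF linear_gtr]])
    moreover have "(\<lambda>u. gtr (Dpw (Suc i) x u)) = (\<lambda>u. real (Suc i) * gtr (pw x i \<star> u))"
      using gtr_Dpw[of x 0 i] by (simp add: fun_eq_iff del: Dpw.simps of_nat_Suc)
    ultimately show ?thesis by simp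
  qed
  have "((\<lambda>x. real (Suc k) * bc (Suc k) x) has_derivative (\<lambda>u. real (Suc k) * Dbc (Suc k) x u)) (at x)"
    by (rule has_derivative_mult_right[OF has_derivative_bc])
  moreover have "(\<lambda>x. real (Suc k) * bc (Suc k) x) = (\<lambda>x. - (\<Sum>i\<le>k. bc (k - i) x * gtr (pw x (Suc i))))"
    using generic_newton[OF less.prems] by auto
  moreover have "((\<lambda>x. - (\<Sum>i\<le>k. bc (k - i) x * gtr (pw x (Suc i)))) has_derivative
     (\<lambda>u. - (\<Sum>i\<le>k. bc (k - i) x * (real (Suc i) * gtr (pw x i \<star> u)) + Dbc (k - i) x u * gtr (pw x (Suc i))))) (at x)"
    by (rule has_derivative_minus, rule has_derivative_sum, rule has_derivative_mult[OF has_derivative_bc Dgtr])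
  ultimately have "(\<lambda>u. real (Suc k) * Dbc (Suc k) x u) =
     (\<lambda>u. - (\<Sum>i\<le>k. bc (k - i) x * (real (Suc i) * gtr (pw x i \<star> u)) + Dbc (k - i) x u * gtr (pw x (Suc i))))"
    using has_derivative_unique by (metis (no_types, lifting))
  from fun_cong[OF this, of u]
  have eq: "real (Suc k) * Dbc (Suc k) x u =
     - ((\<Sum>i\<le>k. real (Suc i) * (bc (k - i) x * gtr (pw x i \<star> u))) + (\<Sum>i\<le>k. Dbc (k - i) x u * gtr (pw x (Suc i))))"
    by (simp add: sum.distrib algebra_simps)
  have D: "Dbc m x u = (case m of 0 \<Rightarrow> 0 | Suc l \<Rightarrow> - S l)" if "m \<le> k" for m
    using that less.IH less.prems by (cases m) (simp_all add: Dbc_0 S_def)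
  have "(\<Sum>i\<le>k. Dbc (k - i) x u * gtr (pw x (Suc i))) = - (\<Sum>i<k. S (k - Suc i) * gtr (pw x (Suc i)))"
  proof -
    have "(\<Sum>i\<le>k. Dbc (k - i) x u * gtr (pw x (Suc i))) = (\<Sum>i<k. Dbc (k - i) x u * gtr (pw x (Suc i)))"
      by (simp add: lessThan_Suc_atMost[symmetric] Dbc_0)
    also have "\<dots> = (\<Sum>i<k. - (S (k - Suc i) * gtr (pw x (Suc i))))"
    proof (rule sum.cong[OF refl])
      fix i assume "i \<in> {..<k}"
      then have "k - i = Suc (k - Suc i)" by auto
      then show "Dbc (k - i) x u * gtr (pw x (Suc i)) = - (S (k - Suc i) * gtr (pw x (Suc i)))"
        using D[of "k - i"] by simp
    qed
    finally show ?thesis by (simp add: sum_negf)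
  qed
  also have "(\<Sum>i<k. S (k - Suc i) * gtr (pw x (Suc i)))
      = (\<Sum>i<k. \<Sum>j<k - i. (bc (k - Suc i - j) x * gtr (pw x (Suc i))) * gtr (pw x j \<star> u))"
  proof (rule sum.cong[OF refl])
    fix i assume "i \<in> {..<k}"
    then have "{..k - Suc i} = {..<k - i}" by auto
    then show "S (k - Suc i) * gtr (pw x (Suc i)) = (\<Sum>j<k - i. (bc (k - Suc i - j) x * gtr (pw x (Suc i))) * gtr (pw x j \<star> u))"
      unfolding S_def by (simp add: sum_distrib_right sum_distrib_left mult_ac)
  qed
  also have "\<dots> = (\<Sum>j<k. \<Sum>i<k - j. (bc (k - Suc i - j) x * gtr (pw x (Suc i))) * gtr (pw x j \<star> u))"
    unfolding sum.Sigma[OF finite_lessThan ballI[OF finite_lessThan]]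
    by (rule sum.reindex_bij_witness[of _ "\<lambda>(i, j). (j, i)" "\<lambda>(i, j). (j, i)"]) auto
  also have "\<dots> = (\<Sum>j<k. - (real (k - j) * bc (k - j) x) * gtr (pw x j \<star> u))"
  proof (rule sum.cong[OF refl])
    fix j assume j: "j \<in> {..<k}"
    then have e: "{..<k - j} = {..k - Suc j}" "k - j = Suc (k - Suc j)" by auto
    have "(\<Sum>i<k - j. bc (k - Suc i - j) x * gtr (pw x (Suc i))) = (\<Sum>i\<le>k - Suc j. bc (k - Suc j - i) x * gtr (pw x (Suc i)))"
      unfolding e(1) by (rule sum.cong) (auto simp: add.commute diff_diff_eq)
    also have "\<dots> = - (real (k - j) * bc (k - j) x)"
    proof -
      have "k - Suc j < jrank V" using less.prems j by auto
      from generic_newton[OF this, of x, folded e(2)] show ?thesis by simp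
    qed
    finally show "(\<Sum>i<k - j. (bc (k - Suc i - j) x * gtr (pw x (Suc i))) * gtr (pw x j \<star> u)) = - (real (k - j) * bc (k - j) x) * gtr (pw x j \<star> u)"
      by (simp add: sum_distrib_right[symmetric])
  qed
  also have "\<dots> = (\<Sum>j\<le>k. - (real (k - j) * bc (k - j) x) * gtr (pw x j \<star> u))"
    by (simp add: lessThan_Suc_atMost[symmetric])
  finally have T: "(\<Sum>i\<le>k. Dbc (k - i) x u * gtr (pw x (Suc i))) = (\<Sum>j\<le>k. real (k - j) * (bc (k - j) x * gtr (pw x j \<star> u)))"
    by (simp add: sum_negf mult.assoc)
  have "real (Suc k) * Dbc (Suc k) x u = - (\<Sum>i\<le>k. real (Suc i) * (bc (k - i) x * gtr (pw x i \<star> u)) + real (k - i) * (bc (k - i) x * gtr (pw x i \<star> u)))"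
    unfolding eq T by (simp add: sum.distrib)
  also have "(\<Sum>i\<le>k. real (Suc i) * (bc (k - i) x * gtr (pw x i \<star> u)) + real (k - i) * (bc (k - i) x * gtr (pw x i \<star> u)))
      = (\<Sum>i\<le>k. real (Suc k) * (bc (k - i) x * gtr (pw x i \<star> u)))"
    by (rule sum.cong) (auto simp: of_nat_diff algebra_simps)
  finally have "real (Suc k) * Dbc (Suc k) x u = real (Suc k) * - (\<Sum>i\<le>k. bc (k - i) x * gtr (pw x i \<star> u))"
    by (simp add: sum_distrib_left)
  moreover have "real (Suc k) \<noteq> 0" by simp
  ultimately show ?case by (metis mult_left_cancel)
qed

section \<open>Adjoint and inverse\<close>

text \<open>The generic minimal polynomial without its constant term, divided by the indeterminate and with the sign
that makes \<open>x adj(x) = det(x) e\<close>.\<close>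

definition adjp :: "'a \<Rightarrow> real poly" where
  "adjp x = (\<Sum>i\<le>jrank V - 1. Polynomial.monom ((- 1) ^ (jrank V + 1) * bc (jrank V - 1 - i) x) i)"

definition adj :: "'a \<Rightarrow> 'a" where "adj x = pl (adjp x) x"

lemma adj_eq: "adj x = (\<Sum>i\<le>jrank V - 1. ((- 1) ^ (jrank V + 1) * bc (jrank V - 1 - i) x) *\<^sub>R pw x i)"
proof -
  have c: "Polynomial.coeff (adjp x) j = (if j \<le> jrank V - 1 then (- 1) ^ (jrank V + 1) * bc (jrank V - 1 - j) x else 0)" for j
    unfolding adjp_def by (rule coeff_sum_monom)
  have "Polynomial.degree (adjp x) \<le> jrank V - 1" by (rule degree_le) (simp add: c)
  from pl_bound[OF this, of x] show ?thesis unfolding adj_def by (simp add: c)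
qed

lemma mul_adj: "x \<star> adj x = jdet V x *\<^sub>R \<ee>"
proof -
  let ?r = "jrank V"
  obtain n where n: "?r = Suc n" using jrank_pos by (metis Suc_pred)
  have "0 = (\<Sum>k\<le>Suc n. bc k x *\<^sub>R pw x (Suc n - k))" using generic_cayley_hamilton[of x] n by simp
  also have "\<dots> = (\<Sum>k\<le>n. bc k x *\<^sub>R pw x (Suc n - k)) + bc (Suc n) x *\<^sub>R \<ee>" by simp
  also have "(\<Sum>k\<le>n. bc k x *\<^sub>R pw x (Suc n - k)) = (\<Sum>i\<le>n. bc (n - i) x *\<^sub>R pw x (Suc i))"
    by (rule sum.reindex_bij_witness[of _ "\<lambda>k. n - k" "\<lambda>k. n - k"]) (auto simp: Suc_diff_le)
  finally have ch: "(\<Sum>i\<le>n. bc (n - i) x *\<^sub>R pw x (Suc i)) = - (bc (Suc n) x *\<^sub>R \<ee>)"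
    by (simp add: eq_neg_iff_add_eq_0)
  have "x \<star> adj x = (- 1) ^ (Suc n + 1) *\<^sub>R (\<Sum>i\<le>n. bc (n - i) x *\<^sub>R pw x (Suc i))"
    by (simp add: adj_eq n mul_sum_right mul_simps scaleR_sum_right pw_Suc)
  also have "\<dots> = jdet V x *\<^sub>R \<ee>" unfolding ch by (simp add: jdet_bc n)
  finally show ?thesis .
qed

lemma has_derivative_jdet: "(jdet V has_derivative (\<lambda>u. gtr (adj x \<star> u))) (at x)"
proof -
  obtain n where n: "jrank V = Suc n" using jrank_pos by (metis Suc_pred)
  have "((\<lambda>x. (- 1) ^ jrank V * bc (jrank V) x) has_derivative (\<lambda>u. (- 1) ^ jrank V * Dbc (jrank V) x u)) (at x)"
    by (rule has_derivative_mult_right[OF has_derivative_bc])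
  moreover have "(\<lambda>x. (- 1) ^ jrank V * bc (jrank V) x) = jdet V" by (rule ext) (simp add: jdet_bc)
  moreover have "(\<lambda>u. (- 1) ^ jrank V * Dbc (jrank V) x u) = (\<lambda>u. gtr (adj x \<star> u))"
  proof
    fix u
    have "(- 1) ^ jrank V * Dbc (jrank V) x u = (\<Sum>i\<le>n. ((- 1) ^ (jrank V + 1) * bc (n - i) x) * gtr (pw x i \<star> u))"
      using Dbc_formula[of n x u] n by (simp add: sum_distrib_left sum_negf mult.assoc)
    also have "\<dots> = gtr (adj x \<star> u)"
      by (simp add: adj_eq n mul_sum_left mul_simps linear_sum[OF linear_gtr] linear_scale[OF linear_gtr]
         linear_neg[OF linear_gtr] sum_negf)
    finally show "(- 1) ^ jrank V * Dbc (jrank V) x u = gtr (adj x \<star> u)" .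
  qed
  ultimately show ?thesis by simp
qed

lemma polynomial_adj: "real_polynomial_function (\<lambda>x. inner (adj x) b)"
  unfolding adj_eq inner_sum_left inner_scaleR_left
  by (intro real_polynomial_function_sum' real_polynomial_function.intros(4) real_polynomial_function.intros(2)
     bc_poly real_polynomial_function_pw)

definition jinv :: "'a \<Rightarrow> 'a" where "jinv x = (1 / jdet V x) *\<^sub>R adj x"

lemma inverse_pair_jinv: assumes "jdet V x \<noteq> 0" shows "inverse_pair x (jinv x)"
proof -
  have "x \<star> jinv x = \<ee>" using assms by (simp add: jinv_def mul_simps mul_adj)
  moreover have "jinv x = pl (Polynomial.smult (1 / jdet V x) (adjp x)) x" by (simp add: jinv_def adj_def pl_smult)
  ultimately show ?thesis unfolding inverse_pair_def by blast
qed

text \<open>The unit need not be regular. Along \<open>e + s x\<close> with \<open>x\<close> regular, the determinant is the polynomial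
\<open>\<Prod> (1 + s \<rho>\<^sub>i)\<close> in \<open>s\<close>, whose value at \<open>s = 0\<close> is 1.\<close>

lemma jdet_unit: "jdet V \<ee> = 1"
proof -
  obtain x where r: "reg x" using ex_reg by blast
  obtain \<rho> where \<rho>: "has_roots x \<rho>" using ex_roots[OF r] by blast
  obtain G where G: "\<And>s. jdet V (\<ee> + s *\<^sub>R x) = poly G s"
    by (rule real_polynomial_function_line_poly[OF jdet_prop(1)]) blast
  define H where "H = (\<Prod>i<jrank V. [:1, \<rho> i:])"
  have sg: "(- 1) ^ n * (\<Prod>i<n. - f i) = (\<Prod>i<n. f i)" for n and f :: "nat \<Rightarrow> complex"
    by (induction n) simp_all
  have eq: "poly (cpoly G) (complex_of_real s) = poly H (complex_of_real s)" if s: "s \<noteq> 0" for s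
  proof -
    have e: "pl [:1, s:] x = \<ee> + s *\<^sub>R x" by (simp add: pl_pCons mul_simps)
    have r': "reg (pl [:1, s:] x)"
    proof (rule reg_pl_of_degree[OF r])
      fix p :: "real poly" assume "p \<noteq> 0"
      have d: "Polynomial.degree (pcompose p [:1, s:]) = Polynomial.degree p" using s by (simp add: degree_pcompose)
      have "lead_coeff (pcompose p [:1, s:]) \<noteq> 0"
        using s \<open>p \<noteq> 0\<close> lead_coeff_comp[of "[:1, s:]" p] by simp
      then show "pcompose p [:1, s:] \<noteq> 0 \<and> Polynomial.degree (pcompose p [:1, s:]) = Polynomial.degree p" using d by auto
    qed
    have c: "cpoly [:1, s:] = [:1, complex_of_real s:]" by (rule poly_eqI) (simp add: coeff_pCons split: nat.splits)
    have "has_roots (\<ee> + s *\<^sub>R x) (\<lambda>i. 1 + complex_of_real s * \<rho> i)"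
      using has_roots_pl[OF \<rho> r r'] unfolding c e by (simp add: mult.commute)
    then have m: "cpoly (mp (\<ee> + s *\<^sub>R x)) = (\<Prod>i<jrank V. [:- (1 + complex_of_real s * \<rho> i), 1:])" by (simp add: has_roots_def)
    have "complex_of_real (jdet V (\<ee> + s *\<^sub>R x)) = (- 1) ^ jrank V * Polynomial.coeff (cpoly (mp (\<ee> + s *\<^sub>R x))) 0"
      using r' unfolding e by (simp add: jdet_prop(2))
    also have "\<dots> = (- 1) ^ jrank V * (\<Prod>i<jrank V. - (1 + complex_of_real s * \<rho> i))"
      unfolding m poly_0_coeff_0[symmetric] by (simp add: poly_prod)
    also have "\<dots> = (\<Prod>i<jrank V. 1 + complex_of_real s * \<rho> i)" by (rule sg)
    also have "\<dots> = poly H (complex_of_real s)" by (simp add: H_def poly_prod)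
    finally show ?thesis
      unfolding G by (simp add: cpoly_def)
  qed
  have "cpoly G - H = 0"
  proof (rule ccontr)
    assume "cpoly G - H \<noteq> 0"
    then have "finite {z. poly (cpoly G - H) z = 0}" by (rule poly_roots_finite)
    moreover have "complex_of_real ` (UNIV - {0}) \<subseteq> {z. poly (cpoly G - H) z = 0}" using eq by auto
    ultimately have "finite (complex_of_real ` (UNIV - {0}))" by (rule rev_finite_subset)
    then have "finite (UNIV - {0 :: real})" by (rule finite_imageD) (simp add: inj_on_def)
    then show False using infinite_UNIV_char_0[where 'a=real] by simp
  qed
  then have "poly (cpoly G) 0 = poly H 0" by simp
  moreover have "poly H 0 = 1" by (simp add: H_def poly_prod)
  ultimately have "complex_of_real (jdet V \<ee>) = 1" using G[of 0] by (simp add: poly_0_coeff_0)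
  then show ?thesis by (simp only: of_real_eq_1_iff)
qed

text \<open>Differentiability is clear from the formula by the adjoint; the value of the derivative is forced
by the relations between an element and its inverse.\<close>

lemma has_derivative_jinv:
  assumes "jdet V x \<noteq> 0"
  shows "(jinv has_derivative (\<lambda>u. - Pop (jinv x) u)) (at x)"
proof -
  have "adj differentiable at x"
    unfolding differentiable_componentwise_within[of adj]
    using differentiable_at_real_polynomial_function[OF polynomial_adj] by blast
  moreover have "(\<lambda>x. 1 / jdet V x) differentiable at x"
    using assms differentiable_at_real_polynomial_function[OF jdet_prop(1)]
    by (intro differentiable_divide) auto
  ultimately have "jinv differentiable at x"
    unfolding jinv_def[abs_def] by (intro differentiable_scaleR)
  then obtain D where D: "(jinv has_derivative D) (at x)" unfolding differentiable_def by blast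
  note I = inverse_pair_jinv[OF assms]
  have "open {y. jdet V y \<noteq> 0}"
  proof -
    have "continuous_on UNIV (jdet V)"
      using jdet_prop(1) by (simp add: continuous_on_polymonial_function real_polynomial_function_eq)
    from open_Collect_neq[OF this continuous_on_const] show ?thesis .
  qed
  then have ev: "\<forall>\<^sub>F y in nhds x. Pop y (jinv y) = y"
    unfolding eventually_nhds
    using assms Pop_mul_inverse[OF inverse_pair_jinv, of _ \<ee>] by (intro exI[of _ "{y. jdet V y \<noteq> 0}"]) simp
  have "((\<lambda>y. Pop y (jinv y)) has_derivative (\<lambda>u. 2 *\<^sub>R jP V x u (jinv x) + Pop x (D u))) (at x)"
  proof -
    note B = bounded_bilinear.FDERIV[OF mul_bounded_bilinear]
    have id: "((\<lambda>y. y) has_derivative (\<lambda>u. u)) (at x)" by (rule has_derivative_ident)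
    have 1: "((\<lambda>y. y \<star> jinv y) has_derivative (\<lambda>u. x \<star> D u + u \<star> jinv x)) (at x)" by (rule B[OF id D])
    have 2: "((\<lambda>y. y \<star> (y \<star> jinv y)) has_derivative (\<lambda>u. x \<star> (x \<star> D u + u \<star> jinv x) + u \<star> (x \<star> jinv x))) (at x)"
      by (rule B[OF id 1])
    have 3: "((\<lambda>y. (y \<star> y) \<star> jinv y) has_derivative (\<lambda>u. (x \<star> x) \<star> D u + (x \<star> u + u \<star> x) \<star> jinv x)) (at x)"
      by (rule B[OF B[OF id id] D])
    have "((\<lambda>y. 2 *\<^sub>R (y \<star> (y \<star> jinv y)) - (y \<star> y) \<star> jinv y) has_derivative
       (\<lambda>u. 2 *\<^sub>R (x \<star> (x \<star> D u + u \<star> jinv x) + u \<star> (x \<star> jinv x)) - ((x \<star> x) \<star> D u + (x \<star> u + u \<star> x) \<star> jinv x))) (at x)"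
      by (intro has_derivative_diff has_derivative_scaleR_right 2 3)
    moreover have "(\<lambda>u. 2 *\<^sub>R (x \<star> (x \<star> D u + u \<star> jinv x) + u \<star> (x \<star> jinv x)) - ((x \<star> x) \<star> D u + (x \<star> u + u \<star> x) \<star> jinv x))
      = (\<lambda>u. 2 *\<^sub>R jP V x u (jinv x) + Pop x (D u))"
      proof
      fix u
      have c: "u \<star> x = x \<star> u" by (rule mul_commute)
      show "2 *\<^sub>R (x \<star> (x \<star> D u + u \<star> jinv x) + u \<star> (x \<star> jinv x)) - ((x \<star> x) \<star> D u + (x \<star> u + u \<star> x) \<star> jinv x)
        = 2 *\<^sub>R jP V x u (jinv x) + Pop x (D u)"
        unfolding c by (simp add: jP_def mul_simps scaleR_2 algebra_simps)
    qed
    ultimately show ?thesis by (simp add: Pop_eq)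
  qed
  then have "((\<lambda>y. y) has_derivative (\<lambda>u. 2 *\<^sub>R jP V x u (jinv x) + Pop x (D u))) (at x)"
    by (rule has_derivative_transform_eventually) (use ev eventually_nhds_x_imp_x[OF ev] in \<open>auto simp: eventually_at_filter elim: eventually_mono\<close>)
  then have "(\<lambda>u. 2 *\<^sub>R jP V x u (jinv x) + Pop x (D u)) = (\<lambda>u. u)"
    by (rule has_derivative_unique) (rule has_derivative_ident)
  then have eq: "2 *\<^sub>R jP V x u (jinv x) + Pop x (D u) = u" for u by (rule fun_cong)
  have "jP V x u (jinv x) = u" for u
    using inverse_pairD(1)[OF I] op_commuteD[OF inverse_pairD(2)[OF I], of u]
    by (simp add: jP_def mul_commute[of u "jinv x"] mul_commute[of "x \<star> u" "jinv x"])
  then have "Pop x (D u) = - u" for u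
    using eq[of u] by (simp add: scaleR_2 add.assoc eq_neg_iff_add_eq_0 add.commute)
  then have "D u = - Pop (jinv x) u" for u
    by (metis Pop_inverse'[OF I] linear_neg[OF linear_jP3])
  then have "D = (\<lambda>u. - Pop (jinv x) u)" by (rule ext)
  then show ?thesis using D by simp
qed

end

section \<open>Eigenvectors of symmetric forms\<close>

text \<open>The Rayleigh quotient of two symmetric forms attains its maximum on the unit sphere of \<open>W\<close>, and a
maximum is an eigenvector.\<close>

lemma form_eigenvector:
  fixes \<beta> \<gamma> :: "'a::euclidean_space \<Rightarrow> 'a \<Rightarrow> real"
  assumes W: "subspace W" "W \<noteq> {0}"
    and b: "bilinear \<beta>" and g: "bilinear \<gamma>"
    and sym: "\<And>x y. \<beta> x y = \<beta> y x" "\<And>x y. \<gamma> x y = \<gamma> y x"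
    and pos: "\<And>x. x \<in> W \<Longrightarrow> x \<noteq> 0 \<Longrightarrow> \<beta> x x > 0"
  obtains v \<rho> where "v \<in> W" "v \<noteq> 0" "\<And>w. w \<in> W \<Longrightarrow> \<gamma> v w = \<rho> * \<beta> v w"
proof -
  let ?S = "W \<inter> sphere 0 1" and ?f = "\<lambda>x. \<gamma> x x / \<beta> x x"
  have comp: "compact ?S" by (rule closed_Int_compact[OF closed_subspace[OF W(1)] compact_sphere])
  obtain u where u: "u \<in> W" "u \<noteq> 0" using W subspace_0 by blast
  then have "(1 / norm u) *\<^sub>R u \<in> ?S" using W(1) by (simp add: subspace_scale)
  then have ne: "?S \<noteq> {}" by blast
  have cont: "continuous_on ?S (\<lambda>x. \<kappa> x x)" if "bilinear \<kappa>" for \<kappa> :: "'a \<Rightarrow> 'a \<Rightarrow> real"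
    using that by (intro bounded_bilinear.continuous_on[of \<kappa>] continuous_intros) (simp add: bilinear_conv_bounded_bilinear)
  have nz: "\<beta> x x \<noteq> 0" if "x \<in> ?S" for x using pos[of x] that by force
  have "continuous_on ?S ?f" by (intro continuous_on_divide cont b g) (use nz in blast)
  from continuous_attains_sup[OF comp ne this] obtain v where v: "v \<in> ?S" "\<And>y. y \<in> ?S \<Longrightarrow> ?f y \<le> ?f v" by blast
  define \<rho> where "\<rho> = ?f v"
  have vW: "v \<in> W" "v \<noteq> 0" using v(1) by auto
  have le: "\<gamma> x x \<le> \<rho> * \<beta> x x" if "x \<in> W" for x
  proof (cases "x = 0")
    case True then show ?thesis by (simp add: bilinear_lzero[OF b] bilinear_lzero[OF g])
  next
    case False
    let ?c = "1 / norm x"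
    have m: "?c *\<^sub>R x \<in> ?S" using that W(1) False by (simp add: subspace_scale)
    have "?f (?c *\<^sub>R x) = ?f x" using False
      by (simp add: bilinear_lmul[OF b] bilinear_rmul[OF b] bilinear_lmul[OF g] bilinear_rmul[OF g])
    then have "?f x \<le> \<rho>" using v(2)[OF m] by (simp add: \<rho>_def)
    then show ?thesis using pos[OF that False] by (simp add: divide_le_eq)
  qed
  have "\<gamma> v w = \<rho> * \<beta> v w" if w: "w \<in> W" for w
  proof -
    define L C where "L = \<gamma> v w - \<rho> * \<beta> v w" and "C = \<gamma> w w - \<rho> * \<beta> w w"
    have C: "C \<le> 0" using le[OF w] by (simp add: C_def)
    have vv: "\<gamma> v v = \<rho> * \<beta> v v" using nz[OF v(1)] by (simp add: \<rho>_def)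
    have q: "2 * s * L + s * s * C \<le> 0" for s
    proof -
      have "v + s *\<^sub>R w \<in> W" using vW w W(1) by (simp add: subspace_add subspace_scale)
      from le[OF this] have "\<gamma> v v + 2 * s * \<gamma> v w + s * s * \<gamma> w w \<le> \<rho> * (\<beta> v v + 2 * s * \<beta> v w + s * s * \<beta> w w)"
        by (simp add: bilinear_ladd[OF b] bilinear_radd[OF b] bilinear_ladd[OF g] bilinear_radd[OF g]
          bilinear_lmul[OF b] bilinear_rmul[OF b] bilinear_lmul[OF g] bilinear_rmul[OF g] sym(1)[of w v] sym(2)[of w v] algebra_simps)
      then show ?thesis using vv by (simp add: L_def C_def algebra_simps)
    qed
    define k where "k = 1 - C"
    have k: "k \<ge> 1" using C by (simp add: k_def)
    have "0 \<ge> 2 * (L / k) * L + (L / k) * (L / k) * C" by (rule q)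
    also have "2 * (L / k) * L + (L / k) * (L / k) * C = L * L * (2 * k + C) / (k * k)"
      using k by (simp add: field_simps)
    also have "\<dots> = L * L * (2 - C) / (k * k)" by (simp add: k_def)
    finally have le0: "L * L * (2 - C) / (k * k) \<le> 0" .
    have "L = 0"
    proof (rule ccontr)
      assume "L \<noteq> 0"
      then have "L * L > 0" using not_real_square_gt_zero by blast
      then have "L * L * (2 - C) / (k * k) > 0"
        by (rule divide_pos_pos[OF mult_pos_pos mult_pos_pos]) (use C k in auto)
      then show False using le0 by simp
    qed
    then show ?thesis by (simp add: L_def)
  qed
  from that[OF vW this] show thesis .
qed

lemma isCont_nonzero_near_0:
  assumes "isCont f (0::real)" "f 0 \<noteq> (0::real)" shows "\<exists>d>0. \<forall>s. \<bar>s\<bar> < d \<longrightarrow> f s \<noteq> 0"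
proof -
  have "\<forall>\<^sub>F s in at 0. f s \<noteq> 0" using assms unfolding isCont_def by (rule tendsto_imp_eventually_ne)
  then obtain d where d: "d > 0" "\<And>s. s \<noteq> 0 \<Longrightarrow> \<bar>s\<bar> < d \<Longrightarrow> f s \<noteq> 0"
    unfolding eventually_at by (auto simp: dist_real_def)
  then show ?thesis using assms(2) by metis
qed

context jordan_alg begin

section \<open>Involutive automorphisms\<close>

definition involutive_aut :: "('a \<Rightarrow> 'a) \<Rightarrow> bool" where
  "involutive_aut \<sigma> \<longleftrightarrow> linear \<sigma> \<and> (\<forall>x y. \<sigma> (x \<star> y) = \<sigma> x \<star> \<sigma> y) \<and> (\<forall>x. \<sigma> (\<sigma> x) = x)"

context
  fixes \<sigma> assumes \<sigma>: "involutive_aut \<sigma>"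
begin

lemma aut_linear: "linear \<sigma>" and aut_mul: "\<sigma> (x \<star> y) = \<sigma> x \<star> \<sigma> y" and aut_aut: "\<sigma> (\<sigma> x) = x"
  using \<sigma> by (simp_all add: involutive_aut_def)

lemma aut_unit: "\<sigma> \<ee> = \<ee>"
proof -
  have "\<sigma> (\<sigma> \<ee> \<star> \<ee>) = \<ee> \<star> \<sigma> \<ee>" by (simp only: aut_mul aut_aut)
  then show ?thesis by (simp add: aut_aut)
qed

lemma aut_eq_iff: "\<sigma> x = \<sigma> y \<longleftrightarrow> x = y" by (metis aut_aut)

lemma linear_trace_aut: "linear T \<Longrightarrow> linear_trace (\<lambda>v. \<sigma> (T (\<sigma> v))) = linear_trace T"
proof -
  assume T: "linear T"
  have "linear (\<lambda>v. T (\<sigma> v))" using linear_compose[OF aut_linear T] by (simp add: o_def)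
  from linear_trace_comp_commute[OF aut_linear this] show ?thesis by (simp add: aut_aut)
qed

lemma trL_aut: "trL (\<sigma> x) = trL x"
proof -
  have "(\<lambda>v. \<sigma> x \<star> v) = (\<lambda>v. \<sigma> (x \<star> \<sigma> v))" by (simp add: aut_mul aut_aut)
  then show ?thesis unfolding trL_def using linear_trace_aut[OF linear_mul_right] by simp
qed

lemma jtr_aut: "jtr V (\<sigma> x) = jtr V x" using trL_aut by (simp add: jtr_def trL_def)

lemma pl_aut: "pl p (\<sigma> x) = \<sigma> (pl p x)"
  by (induction p) (simp_all add: pl_pCons linear_0[OF aut_linear] linear_add[OF aut_linear] linear_scale[OF aut_linear]
     aut_unit aut_mul)

lemma min_poly_aut: "mp (\<sigma> x) = mp x"
proof -
  have "pl p (\<sigma> x) = 0 \<longleftrightarrow> pl p x = 0" for p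
    using aut_eq_iff[of "pl p x" 0] by (simp add: pl_aut linear_0[OF aut_linear])
  then show ?thesis unfolding min_poly_def by simp
qed

lemma gtr_aut: "gtr (\<sigma> x) = gtr x"
proof (rule poly_identity_reg[of "\<lambda>x. gtr (\<sigma> x)" gtr x])
  have "linear (\<lambda>z. gtr (\<sigma> z))" using linear_compose[OF aut_linear linear_gtr] by (simp add: o_def)
  then show "real_polynomial_function (\<lambda>x. gtr (\<sigma> x))"
    by (intro real_polynomial_function.intros(1)) (simp add: linear_conv_bounded_linear)
  fix x assume "reg x"
  then show "gtr (\<sigma> x) = gtr x" using bc_reg[of x 1] bc_reg[of "\<sigma> x" 1] by (simp add: gtr_def min_poly_aut)
qed (rule gtr_poly)

end

lemma gtr_unit: "gtr \<ee> = real (jrank V)"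
proof -
  obtain x where r: "reg x" using ex_reg by blast
  obtain \<rho> where \<rho>: "has_roots x \<rho>" using ex_roots[OF r] by blast
  have "cpoly 1 = 1" by (rule poly_eqI) simp
  then have "complex_of_real (gtr \<ee>) = of_nat (jrank V)" using gtr_pl_roots[OF \<rho> r, of 1] by simp
  then show ?thesis by (metis of_real_eq_iff of_real_of_nat_eq)
qed

lemma jtr_unit: "jtr V \<ee> = real (jrank V)"
proof -
  have "linear_trace (\<lambda>x::'a. x) = real DIM('a)" by (simp add: linear_trace_def inner_same_Basis)
  moreover have e: "jmult V \<ee> = (\<lambda>x. x)" by (rule ext) simp
  ultimately show ?thesis unfolding jtr_def e by simp
qed

end

section \<open>Cartan involutions\<close>

locale cartan_jordan = jordan_alg V for V :: "'a::euclidean_space jalg" +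
  fixes \<theta> :: "'a \<Rightarrow> 'a"
  assumes simple: "jsimple_on V UNIV" and cartan: "cartan_involution V \<theta>"
begin

lemma theta_aut: "involutive_aut \<theta>"
  using cartan unfolding cartan_involution_def involutive_aut_def by blast

lemmas linear_theta = aut_linear[OF theta_aut] and theta_mul = aut_mul[OF theta_aut]
  and theta_theta = aut_aut[OF theta_aut]

lemma tau_theta_pos: "x \<noteq> 0 \<Longrightarrow> tau x (\<theta> x) > 0"
  using cartan unfolding cartan_involution_def by blast

abbreviation Vp :: "'a set" where "Vp \<equiv> plus_space \<theta>"

lemma Vp_iff: "x \<in> Vp \<longleftrightarrow> \<theta> x = x" by (simp add: plus_space_def)

lemma subspace_Vp: "subspace Vp"
  by (simp add: subspace_def Vp_iff linear_0[OF linear_theta] linear_add[OF linear_theta] linear_scale[OF linear_theta])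

lemma unit_Vp: "\<ee> \<in> Vp" by (simp add: Vp_iff aut_unit[OF theta_aut])

lemma mul_Vp: "x \<in> Vp \<Longrightarrow> y \<in> Vp \<Longrightarrow> x \<star> y \<in> Vp" by (simp add: Vp_iff theta_mul)

lemma tau_pos: "x \<in> Vp \<Longrightarrow> x \<noteq> 0 \<Longrightarrow> tau x x > 0" using tau_theta_pos[of x] by (simp add: Vp_iff)

lemma tau_nondegenerate: "(\<And>y. tau x y = 0) \<Longrightarrow> x = 0" using tau_theta_pos[of x] by force

lemma tau_eqI: "(\<And>y. tau x y = tau x' y) \<Longrightarrow> x = x'"
  using tau_nondegenerate[of "x - x'"] by (simp add: tau_simps)

lemma tau_representation:
  assumes "linear f" obtains w where "\<And>x. f x = tau w x"
proof -
  define T where "T w = (\<Sum>b\<in>Basis. tau w b *\<^sub>R b)" for w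
  have lin: "linear T" unfolding T_def
    by (rule linearI) (simp_all add: tau_simps scaleR_add_left sum.distrib scaleR_sum_right)
  have ext: "tau w x = (\<Sum>b\<in>Basis. inner x b * tau w b)" for w x
  proof -
    have "tau w x = tau w (\<Sum>b\<in>Basis. inner x b *\<^sub>R b)" by (simp add: euclidean_representation)
    then show ?thesis by (simp only: tau_sum tau_simps)
  qed
  have Tb: "inner (T w) b = tau w b" if "b \<in> Basis" for w b unfolding T_def using that by simp
  have "inj T"
  proof (rule linear_injective_0[THEN iffD2, OF lin], intro allI impI)
    fix w assume "T w = 0"
    then have "tau w b = 0" if "b \<in> Basis" for b using Tb[OF that, of w] by simp
    then have "tau w x = 0" for x by (subst ext) simp
    then show "w = 0" by (rule tau_nondegenerate)
  qed
  then have "surj T" using lin by (metis eucl.linear_inj_imp_surj)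
  from surjD[OF this, of "\<Sum>b\<in>Basis. f b *\<^sub>R b"]
  obtain w where "(\<Sum>b\<in>Basis. f b *\<^sub>R b) = T w" by blast
  then have w: "T w = (\<Sum>b\<in>Basis. f b *\<^sub>R b)" by simp
  have "tau w b = f b" if "b \<in> Basis" for b
  proof -
    have "tau w b = inner (\<Sum>b\<in>Basis. f b *\<^sub>R b) b" using Tb[OF that, of w] w by simp
    also have "\<dots> = f b" using that by simp
    finally show ?thesis .
  qed
  then have "f x = tau w x" for x
    by (subst ext, subst linear_expand_Basis[OF assms]) (simp add: mult.commute)
  then show thesis using that by blast
qed

text \<open>Any trace functional invariant under the Cartan involution is a multiple of the trace: the
difference with a suitable multiple has a radical that meets \<open>V\<^sup>+\<close>, and the radical is an ideal.
Invariance under the involution rules out, for complex algebras, the imaginary part of the complex trace.\<close>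

lemma trace_functional_unique:
  assumes f: "trace_functional f" and inv: "\<And>x. f (\<theta> x) = f x"
  obtains \<rho> where "\<And>x. f x = \<rho> * jtr V x"
proof -
  have lf: "linear f" using f by (simp add: trace_functional_def)
  let ?g = "\<lambda>x y. f (x \<star> y)"
  have bil: "bilinear ?g"
    by (auto simp: bilinear_def mul_simps linear_add[OF lf] linear_scale[OF lf] intro!: linearI)
  have "Vp \<noteq> {0}" using unit_Vp unit_nonzero by blast
  from form_eigenvector[OF subspace_Vp this bilinear_tau bil tau_commute _ tau_pos]
  obtain v \<rho> where v: "v \<in> Vp" "v \<noteq> 0" "\<And>w. w \<in> Vp \<Longrightarrow> f (v \<star> w) = \<rho> * tau v w"
    by (metis (no_types, lifting) mul_commute)
  let ?R = "{x. \<forall>y. f (x \<star> y) = \<rho> * jtr V (x \<star> y)}"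
  have "jideal_in V UNIV ?R"
    unfolding jideal_in_def
  proof (intro conjI ballI)
    show "subspace ?R"
      by (simp add: subspace_def mul_simps linear_0[OF lf] linear_0[OF linear_jtr] linear_add[OF lf] linear_add[OF linear_jtr]
        linear_scale[OF lf] linear_scale[OF linear_jtr] algebra_simps)
    fix x y assume y: "y \<in> ?R"
    have "f ((x \<star> y) \<star> z) = \<rho> * jtr V ((x \<star> y) \<star> z)" for z
    proof -
      have "f ((x \<star> y) \<star> z) = f (y \<star> (x \<star> z))"
        using trace_functional_assoc[OF f, of y x z] by (simp add: mul_commute[of x y])
      also have "\<dots> = \<rho> * jtr V (y \<star> (x \<star> z))" using y by simp
      also have "jtr V (y \<star> (x \<star> z)) = jtr V ((x \<star> y) \<star> z)"
        using trace_functional_assoc[OF trace_functional_jtr, of y x z] by (simp add: mul_commute[of x y])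
      finally show ?thesis .
    qed
    then show "x \<star> y \<in> ?R" by simp
  qed simp
  moreover have "v \<in> ?R"
  proof (simp, intro allI)
    fix y
    let ?a = "(1/2) *\<^sub>R (y + \<theta> y)" and ?b = "(1/2) *\<^sub>R (y - \<theta> y)"
    have y: "y = ?a + ?b" by (simp add: algebra_simps scaleR_2[symmetric])
    have a: "?a \<in> Vp" by (simp add: Vp_iff linear_scale[OF linear_theta] linear_add[OF linear_theta] theta_theta add.commute)
    have b: "\<theta> ?b = - ?b" by (simp add: linear_scale[OF linear_theta] linear_diff[OF linear_theta] theta_theta algebra_simps)
    have "\<theta> (v \<star> ?b) = - (v \<star> ?b)" unfolding theta_mul b using v(1) by (simp only: Vp_iff mul_simps(6))
    then have "f (v \<star> ?b) = - f (v \<star> ?b)" "jtr V (v \<star> ?b) = - jtr V (v \<star> ?b)"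
      using inv[of "v \<star> ?b"] jtr_aut[OF theta_aut, of "v \<star> ?b"] by (simp_all add: linear_neg[OF lf] linear_neg[OF linear_jtr])
    then have z: "f (v \<star> ?b) = 0" "jtr V (v \<star> ?b) = 0" by simp_all
    have "f (v \<star> (?a + ?b)) = \<rho> * jtr V (v \<star> (?a + ?b))"
      using v(3)[OF a] z by (simp only: mul_simps(2) linear_add[OF lf] linear_add[OF linear_jtr]) (simp add: jtau_def)
    then show "f (v \<star> y) = \<rho> * jtr V (v \<star> y)" using y by simp
  qed
  ultimately have "?R = UNIV" using simple v(2) unfolding jsimple_on_def by blast
  then have "f (\<ee> \<star> x) = \<rho> * jtr V (\<ee> \<star> x)" for x by blast
  then have "f x = \<rho> * jtr V x" for x by simp
  then show thesis by (rule that)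
qed

text \<open>The constant of proportionality is found at the unit, where both traces are the rank.\<close>

lemma gtr_eq_jtr: "gtr x = jtr V x"
proof -
  obtain \<rho> where \<rho>: "\<And>x. gtr x = \<rho> * jtr V x"
    using trace_functional_unique[OF trace_functional_gtr gtr_aut[OF theta_aut]] by blast
  have "\<rho> = 1" using \<rho>[of \<ee>] gtr_unit jtr_unit jrank_pos by simp
  then show ?thesis using \<rho> by simp
qed

lemma has_derivative_jdet_tau: "(jdet V has_derivative (\<lambda>u. tau (adj x) u)) (at x)"
  using has_derivative_jdet[of x] by (simp add: gtr_eq_jtr jtau_def)

lemma adj_mul_tau: "tau (adj z) (y \<star> z) = jtr V y * jdet V z"
proof -
  have "tau (adj z) (y \<star> z) = tau y (z \<star> adj z)" by (simp only: tau_commute[of "adj z"] tau_assoc)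
  then show ?thesis by (simp add: mul_adj jtau_def mul_simps linear_scale[OF linear_jtr])
qed

section \<open>Quadratic operators in the structure group\<close>

lemma Pop_curve: "Pop (\<ee> + s *\<^sub>R x) z = z + (2 * s) *\<^sub>R (x \<star> z) + (s * s) *\<^sub>R Pop x z"
  by (simp only: Pop_add Pop_scale jP_unit mul_simps) simp

lemma continuous_jdet: "continuous_on UNIV (jdet V)"
  using jdet_prop(1) by (simp add: continuous_on_polymonial_function real_polynomial_function_eq)

text \<open>For \<open>a = e + s x\<close> the derivative of \<open>det P(a) z\<close> with respect to \<open>s\<close> is a multiple of \<open>det P(a) z\<close> by a
factor independent of \<open>z\<close>, so the quotient by \<open>det P(a) e\<close> is constant in \<open>s\<close>.\<close>

lemma jdet_Pop_curve:
  obtains \<epsilon> where "\<epsilon> > 0" "\<And>s. \<bar>s\<bar> < \<epsilon> \<Longrightarrow> jdet V (\<ee> + s *\<^sub>R x) \<noteq> 0"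
    "\<And>s. \<bar>s\<bar> < \<epsilon> \<Longrightarrow> jdet V (Pop (\<ee> + s *\<^sub>R x) \<ee>) \<noteq> 0"
    "\<And>s z. \<bar>s\<bar> < \<epsilon> \<Longrightarrow> jdet V (Pop (\<ee> + s *\<^sub>R x) z) = jdet V (Pop (\<ee> + s *\<^sub>R x) \<ee>) * jdet V z"
proof -
  define a where "a s = \<ee> + s *\<^sub>R x" for s
  define G where "G z s = jdet V (Pop (a s) z)" for z s
  have cont: "isCont (\<lambda>s. jdet V (a s)) 0" "isCont (G z) 0" for z
  proof -
    have j: "isCont (jdet V) y" for y using continuous_jdet by (simp add: continuous_on_eq_continuous_at)
    show "isCont (\<lambda>s. jdet V (a s)) 0" unfolding a_def
      by (rule isCont_o2[OF _ j]) (intro continuous_intros)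
    show "isCont (G z) 0" unfolding G_def a_def Pop_curve
      by (rule isCont_o2[OF _ j]) (intro continuous_intros)
  qed
  have "jdet V (a 0) \<noteq> 0" "G \<ee> 0 \<noteq> 0" by (simp_all add: a_def G_def jdet_unit)
  then obtain d1 d2 where d: "d1 > 0" "\<And>s. \<bar>s\<bar> < d1 \<Longrightarrow> jdet V (a s) \<noteq> 0" "d2 > 0" "\<And>s. \<bar>s\<bar> < d2 \<Longrightarrow> G \<ee> s \<noteq> 0"
    using isCont_nonzero_near_0[OF cont(1)] isCont_nonzero_near_0[OF cont(2)[of \<ee>]] by blast
  define \<epsilon> where "\<epsilon> = min d1 d2"
  have \<epsilon>: "\<epsilon> > 0" "\<And>s. \<bar>s\<bar> < \<epsilon> \<Longrightarrow> jdet V (a s) \<noteq> 0 \<and> G \<ee> s \<noteq> 0"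
    using d by (simp_all add: \<epsilon>_def)
  have der: "(G z has_real_derivative 2 * jtr V (jinv (a s) \<star> x) * G z s) (at s)" if s: "\<bar>s\<bar> < \<epsilon>" for s z
  proof -
    let ?c = "\<lambda>s. z + (2 * s) *\<^sub>R (x \<star> z) + (s * s) *\<^sub>R Pop x z"
    have c: "(?c has_derivative (\<lambda>h. (2 * h) *\<^sub>R (x \<star> z) + (h * s + s * h) *\<^sub>R Pop x z)) (at s)"
      by (auto intro!: derivative_eq_intros)
    have e: "(2 * h) *\<^sub>R (x \<star> z) + (h * s + s * h) *\<^sub>R Pop x z = (2 * h) *\<^sub>R jP V (a s) x z" for h
      by (simp add: a_def jP_add1 jP_scale1 scaleR_add_right algebra_simps)
    have "((\<lambda>s. jdet V (?c s)) has_derivative (\<lambda>h. tau (adj (?c s)) ((2 * h) *\<^sub>R jP V (a s) x z))) (at s)"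
      using has_derivative_compose[OF c has_derivative_jdet_tau] by (simp only: e)
    moreover have "tau (adj (?c s)) ((2 * h) *\<^sub>R jP V (a s) x z) = (2 * jtr V (jinv (a s) \<star> x) * G z s) * h" for h
    proof -
      have I: "inverse_pair (a s) (jinv (a s))" using \<epsilon>(2)[OF s] by (intro inverse_pair_jinv) simp
      have "jP V (a s) x z = (jinv (a s) \<star> x) \<star> Pop (a s) z" by (rule jP_curve[OF I a_def[of s]])
      then show ?thesis by (simp add: Pop_curve[symmetric] a_def[symmetric] tau_simps adj_mul_tau G_def)
    qed
    ultimately have "((\<lambda>s. jdet V (?c s)) has_derivative (\<lambda>h. (2 * jtr V (jinv (a s) \<star> x) * G z s) * h)) (at s)"
      by (simp only:)
    then show ?thesis unfolding has_field_derivative_def G_def a_def Pop_curve by simp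
  qed
  have "G z s / G \<ee> s = G z 0 / G \<ee> 0" if s: "\<bar>s\<bar> < \<epsilon>" for s z
  proof (rule DERIV_isconst3[of "-\<epsilon>" \<epsilon> s 0 "\<lambda>s. G z s / G \<ee> s"])
    fix s assume s: "s \<in> {- \<epsilon><..<\<epsilon>}"
    then have s': "\<bar>s\<bar> < \<epsilon>" by auto
    have nz: "G \<ee> s \<noteq> 0" using \<epsilon>(2)[OF s'] by simp
    show "((\<lambda>s. G z s / G \<ee> s) has_real_derivative 0) (at s)"
      by (rule DERIV_cong[OF DERIV_divide[OF der[OF s'] der[OF s'] nz]]) simp
  qed (use s \<epsilon>(1) in auto)
  note quot = this
  have "G z s = G \<ee> s * jdet V z" if s: "\<bar>s\<bar> < \<epsilon>" for s z
  proof -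
    have "G z 0 = jdet V z" "G \<ee> 0 = 1" by (simp_all add: G_def a_def jdet_unit)
    then show ?thesis using quot[OF s, of z] \<epsilon>(2)[OF s] by (simp add: field_simps)
  qed
  note G_eq = this
  show thesis
  proof (rule that[of \<epsilon>])
    show "\<epsilon> > 0" by (rule \<epsilon>(1))
    fix s assume s: "\<bar>s\<bar> < \<epsilon>"
    show "jdet V (\<ee> + s *\<^sub>R x) \<noteq> 0" using \<epsilon>(2)[OF s] unfolding a_def by (rule conjunct1)
    show "jdet V (Pop (\<ee> + s *\<^sub>R x) \<ee>) \<noteq> 0" using \<epsilon>(2)[OF s] unfolding a_def G_def by (rule conjunct2)
    fix z
    show "jdet V (Pop (\<ee> + s *\<^sub>R x) z) = jdet V (Pop (\<ee> + s *\<^sub>R x) \<ee>) * jdet V z"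
      using G_eq[OF s, of z] unfolding a_def G_def .
  qed
qed

definition PL :: "'a \<Rightarrow> 'a \<Rightarrow>\<^sub>L 'a" where "PL a = Blinfun (Pop a)"

lemma PL_apply [simp]: "blinfun_apply (PL a) = Pop a"
  unfolding PL_def using linear_jP3 by (simp add: bounded_linear_Blinfun_apply linear_conv_bounded_linear)

lemma id_Str: "id_blinfun \<in> Str V"
  by (auto simp: Str_def bij_def inj_on_def intro!: exI[of _ 1])

lemma Str_compose:
  assumes "g \<in> Str V" "h \<in> Str V" shows "g o\<^sub>L h \<in> Str V"
proof -
  obtain k l where "k \<noteq> 0" "\<And>x. jdet V (g x) = k * jdet V x" "l \<noteq> 0" "\<And>x. jdet V (h x) = l * jdet V x"
    using assms unfolding Str_def by blast
  then have "k * l \<noteq> 0 \<and> (\<forall>x. jdet V ((g o\<^sub>L h) x) = (k * l) * jdet V x)" by simp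
  moreover have "bij (blinfun_apply (g o\<^sub>L h))"
  proof -
    have "blinfun_apply (g o\<^sub>L h) = blinfun_apply g \<circ> blinfun_apply h" by (rule ext) simp
    then show ?thesis using assms bij_comp unfolding Str_def by (simp add: bij_comp)
  qed
  ultimately show ?thesis unfolding Str_def by blast
qed

lemma Str_id_subset: "Str_id V \<subseteq> Str V"
  unfolding Str_id_def by (rule connected_component_subset)

lemma Str_id_compose:
  assumes "g \<in> Str_id V" "h \<in> Str_id V" shows "g o\<^sub>L h \<in> Str_id V"
proof -
  let ?T = "(\<lambda>g. g o\<^sub>L h) ` Str_id V"
  have "connected ?T"
    unfolding Str_id_def
    by (intro connected_continuous_image continuous_intros connected_connected_component)
  moreover have "?T \<subseteq> Str V" using Str_compose Str_id_subset assms by blast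
  moreover have "id_blinfun \<in> Str_id V" unfolding Str_id_def using id_Str by (simp add: connected_component_refl)
  then have "h \<in> ?T" by (intro image_eqI[of _ _ id_blinfun]) (auto intro!: blinfun_eqI)
  ultimately have "?T \<subseteq> connected_component_set (Str V) h" by (intro connected_component_maximal)
  also have "\<dots> = Str_id V" using assms(2) unfolding Str_id_def by (metis connected_component_eq)
  finally show ?thesis using assms(1) by blast
qed

text \<open>The operators \<open>P(e + s x)\<close> for small \<open>s\<close> form a connected set through the identity.\<close>

lemma PL_Str_id: obtains \<epsilon> where "\<epsilon> > 0" "\<And>s. \<bar>s\<bar> < \<epsilon> \<Longrightarrow> PL (\<ee> + s *\<^sub>R x) \<in> Str_id V"
proof -
  obtain \<epsilon> where \<epsilon>: "\<epsilon> > 0" "\<And>s. \<bar>s\<bar> < \<epsilon> \<Longrightarrow> jdet V (\<ee> + s *\<^sub>R x) \<noteq> 0"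
    "\<And>s. \<bar>s\<bar> < \<epsilon> \<Longrightarrow> jdet V (Pop (\<ee> + s *\<^sub>R x) \<ee>) \<noteq> 0"
    "\<And>s z. \<bar>s\<bar> < \<epsilon> \<Longrightarrow> jdet V (Pop (\<ee> + s *\<^sub>R x) z) = jdet V (Pop (\<ee> + s *\<^sub>R x) \<ee>) * jdet V z"
    by (rule jdet_Pop_curve[of x]) (rule that; assumption)
  let ?T = "(\<lambda>s. PL (\<ee> + s *\<^sub>R x)) ` {-\<epsilon><..<\<epsilon>}"
  have eq: "PL (\<ee> + s *\<^sub>R x) = id_blinfun + (2 * s) *\<^sub>R Blinfun (\<lambda>z. x \<star> z) + (s * s) *\<^sub>R PL x" for s
    by (rule blinfun_eqI)
       (use linear_mul_right[of x] in \<open>simp add: Pop_curve blinfun.add_left blinfun.scaleR_left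
          bounded_linear_Blinfun_apply linear_conv_bounded_linear\<close>)
  have "connected ?T" unfolding eq by (intro connected_continuous_image continuous_intros) simp
  moreover have "?T \<subseteq> Str V"
  proof (rule image_subsetI)
    fix s assume "s \<in> {-\<epsilon><..<\<epsilon>}"
    then have s: "\<bar>s\<bar> < \<epsilon>" by (simp add: abs_less_iff)
    have I: "inverse_pair (\<ee> + s *\<^sub>R x) (jinv (\<ee> + s *\<^sub>R x))" by (rule inverse_pair_jinv[OF \<epsilon>(2)[OF s]])
    have "bij (Pop (\<ee> + s *\<^sub>R x))" by (rule o_bij[of "Pop (jinv (\<ee> + s *\<^sub>R x))"]) (auto simp: Pop_inverse[OF I] Pop_inverse'[OF I])
    then show "PL (\<ee> + s *\<^sub>R x) \<in> Str V" unfolding Str_def mem_Collect_eq PL_apply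
      by (intro conjI exI[of _ "jdet V (Pop (\<ee> + s *\<^sub>R x) \<ee>)"] allI \<epsilon>(3)[OF s] \<epsilon>(4)[OF s])
  qed
  moreover have "id_blinfun \<in> ?T"
    by (rule image_eqI[of _ _ 0]) (use \<epsilon>(1) eq[of 0] in auto)
  ultimately have "?T \<subseteq> Str_id V" unfolding Str_id_def by (intro connected_component_maximal)
  note sub = this
  show thesis
  proof (rule that[OF \<epsilon>(1)])
    fix s assume "\<bar>s\<bar> < \<epsilon>"
    then have "s \<in> {-\<epsilon><..<\<epsilon>}" by (simp add: abs_less_iff minus_less_iff)
    then show "PL (\<ee> + s *\<^sub>R x) \<in> Str_id V" using sub by blast
  qed
qed

text \<open>An element of the structure group and its adjoint for the trace form intertwine the
quadratic representation: the gradient of \<open>log det\<close> is the inverse, whose derivative is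
\<open>- P\<^sup>-\<^sup>1\<close>. That proves the relation at inverses of values of \<open>g\<close>, in particular on a segment of the line from
the unit to \<open>\<xi>\<close>, and both sides are quadratic along this line.\<close>

lemma Str_adjoint:
  assumes "g \<in> Str V"
  obtains h where "linear h" "\<And>x y. tau (blinfun_apply g x) y = tau x (h y)"
    "\<And>\<xi> u. h (Pop \<xi> (blinfun_apply g u)) = Pop (h \<xi>) u"
proof -
  obtain \<kappa> where \<kappa>: "\<kappa> \<noteq> 0" "\<And>x. jdet V (g x) = \<kappa> * jdet V x" and bij: "bij (blinfun_apply g)"
    using assms unfolding Str_def by blast
  have lg: "linear (blinfun_apply g)" by (simp add: blinfun.bounded_linear_right bounded_linear.linear)
  have "\<exists>w. \<forall>x. tau (g x) y = tau w x" for y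
  proof -
    have "linear (\<lambda>x. tau (g x) y)" by (rule linearI) (simp_all add: linear_add[OF lg] linear_scale[OF lg] tau_simps)
    from tau_representation[OF this] show ?thesis by metis
  qed
  then have "\<exists>h. \<forall>y x. tau (g x) y = tau (h y) x" by (intro choice allI)
  then obtain h where h': "\<And>x y. tau (g x) y = tau (h y) x" by blast
  have h: "tau (g x) y = tau x (h y)" for x y using h'[of x y] by (simp add: tau_commute)
  have lh: "linear h"
    by (rule linearI; rule tau_eqI) (simp_all add: tau_simps h'[symmetric])
  have ker: "h (jinv (g z)) = jinv z" if z: "jdet V z \<noteq> 0" for z
  proof -
    have "((\<lambda>z. jdet V (g z)) has_derivative (\<lambda>u. tau (adj (g z)) (g u))) (at z)"
      by (rule has_derivative_compose[OF linear_imp_has_derivative[OF lg] has_derivative_jdet_tau])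
    moreover have "((\<lambda>z. \<kappa> * jdet V z) has_derivative (\<lambda>u. \<kappa> * tau (adj z) u)) (at z)"
      by (rule has_derivative_mult_right[OF has_derivative_jdet_tau])
    ultimately have "(\<lambda>u. tau (adj (g z)) (g u)) = (\<lambda>u. \<kappa> * tau (adj z) u)"
      unfolding \<kappa>(2) by (rule has_derivative_unique)
    then have "tau (h (adj (g z))) u = tau (\<kappa> *\<^sub>R adj z) u" for u
      by (metis h' tau_commute tau_simps(7))
    then have "h (adj (g z)) = \<kappa> *\<^sub>R adj z" by (rule tau_eqI)
    then show ?thesis using \<kappa> z by (simp add: jinv_def linear_scale[OF lh])
  qed
  have op: "open {y. jdet V y \<noteq> 0}" by (rule open_Collect_neq[OF continuous_jdet continuous_on_const])
  have inter: "h (Pop (jinv (g z)) (g u)) = Pop (h (jinv (g z))) u" if z: "jdet V z \<noteq> 0" for z u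
  proof -
    have gz: "jdet V (g z) \<noteq> 0" using z \<kappa> by simp
    have "((\<lambda>z. h (jinv (g z))) has_derivative (\<lambda>u. h (- Pop (jinv (g z)) (g u)))) (at z)"
      by (rule has_derivative_compose[OF has_derivative_compose[OF linear_imp_has_derivative[OF lg] has_derivative_jinv[OF gz]]
          linear_imp_has_derivative[OF lh]])
    moreover have "((\<lambda>z. h (jinv (g z))) has_derivative (\<lambda>u. - Pop (jinv z) u)) (at z)"
      by (rule has_derivative_transform_within_open[OF has_derivative_jinv[OF z] op]) (use z ker in auto)
    ultimately have "(\<lambda>u. h (- Pop (jinv (g z)) (g u))) = (\<lambda>u. - Pop (jinv z) u)" by (rule has_derivative_unique)
    from fun_cong[OF this, of u] show ?thesis using ker[OF z] by (simp add: linear_neg[OF lh])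
  qed
  have "h (Pop \<xi> (g u)) = Pop (h \<xi>) u" for \<xi> u
  proof -
    define x where "x = \<xi> - \<ee>"
    obtain \<epsilon> where \<epsilon>: "\<epsilon> > 0" "\<And>s. \<bar>s\<bar> < \<epsilon> \<Longrightarrow> jdet V (\<ee> + s *\<^sub>R x) \<noteq> 0"
      "\<And>s z. \<bar>s\<bar> < \<epsilon> \<Longrightarrow> jdet V (Pop (\<ee> + s *\<^sub>R x) z) = jdet V (Pop (\<ee> + s *\<^sub>R x) \<ee>) * jdet V z"
      by (rule jdet_Pop_curve[of x]) (rule that; assumption)
    define F where "F s = h (Pop (\<ee> + s *\<^sub>R x) (g u)) - Pop (h (\<ee> + s *\<^sub>R x)) u" for s
    have F0: "F s = 0" if s: "\<bar>s\<bar> < \<epsilon>" for s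
    proof -
      let ?a = "\<ee> + s *\<^sub>R x"
      let ?b = "jinv ?a"
      have I: "inverse_pair ?a ?b" by (rule inverse_pair_jinv[OF \<epsilon>(2)[OF s]])
      have "Pop ?a ?b = ?a" using Pop_mul_inverse[OF I, of \<ee>] by simp
      then have b: "jdet V ?b \<noteq> 0" using \<epsilon>(3)[OF s, of ?b] \<epsilon>(2)[OF s] by auto
      have J: "inverse_pair ?b (jinv ?b)" by (rule inverse_pair_jinv[OF b])
      have "Pop ?b ?a = 2 *\<^sub>R (?b \<star> (?a \<star> ?b)) - ?a \<star> (?b \<star> ?b)"
        by (simp only: Pop_eq mul_commute[of ?b ?a] mul_commute[of "?b \<star> ?b" ?a])
      also have "\<dots> = ?b" using inverse_pairD(1,7)[OF I] by (simp add: scaleR_2)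
      also have "\<dots> = Pop ?b (jinv ?b)" using Pop_mul_inverse[OF J, of \<ee>] by simp
      finally have "?a = jinv ?b" by (metis Pop_inverse'[OF J])
      moreover obtain z where z: "?b = g z" using bij by (metis bij_pointE)
      moreover have "jdet V z \<noteq> 0" using b \<kappa>(2)[of z] unfolding z by auto
      ultimately show ?thesis using inter[of z u] by (simp add: F_def)
    qed
    obtain A B C where F: "\<And>s. F s = A + s *\<^sub>R B + (s * s) *\<^sub>R C"
    proof
      fix s
      have 1: "h (Pop (\<ee> + s *\<^sub>R x) (g u)) = h (g u) + (2 * s) *\<^sub>R h (x \<star> g u) + (s * s) *\<^sub>R h (Pop x (g u))"
        unfolding Pop_curve by (simp add: linear_add[OF lh] linear_scale[OF lh])
      have 2: "Pop (h (\<ee> + s *\<^sub>R x)) u = Pop (h \<ee>) u + (2 * s) *\<^sub>R jP V (h \<ee>) (h x) u + (s * s) *\<^sub>R Pop (h x) u"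
        by (simp only: linear_add[OF lh] linear_scale[OF lh] Pop_add Pop_scale) (simp add: jP_scale2)
      show "F s = (h (g u) - Pop (h \<ee>) u) + s *\<^sub>R (2 *\<^sub>R h (x \<star> g u) - 2 *\<^sub>R jP V (h \<ee>) (h x) u)
          + (s * s) *\<^sub>R (h (Pop x (g u)) - Pop (h x) u)"
        unfolding F_def 1 2 by (simp add: algebra_simps)
    qed
    have A: "A = 0" using F0[of 0] F[of 0] \<epsilon>(1) by simp
    let ?s = "\<epsilon> / 2"
    have p: "?s *\<^sub>R B + (?s * ?s) *\<^sub>R C = 0" using F0[of ?s] F[of ?s] \<epsilon>(1) A by simp
    have m: "- (?s *\<^sub>R B) + (?s * ?s) *\<^sub>R C = 0" using F0[of "- ?s"] F[of "- ?s"] \<epsilon>(1) A by simp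
    have "(?s *\<^sub>R B + (?s * ?s) *\<^sub>R C) + (- (?s *\<^sub>R B) + (?s * ?s) *\<^sub>R C) = 0" unfolding p m by simp
    then have "(2 * (?s * ?s)) *\<^sub>R C = 0" by (simp add: scaleR_left_distrib[symmetric])
    then have C: "C = 0" using \<epsilon>(1) by simp
    then have "B = 0" using p \<epsilon>(1) by simp
    then have "F 1 = 0" using F[of 1] A C by simp
    then show ?thesis by (simp add: F_def x_def)
  qed
  then show thesis using that[OF lh h] by blast
qed

end

context cartan_jordan begin

section \<open>The spectral theorem in \<open>V\<^sup>+\<close>\<close>

text \<open>The trace form is positive definite on \<open>V\<^sup>+\<close> and \<open>L(u)\<close> is symmetric for it; split off eigenvectors one
by one.\<close>

lemma invariant_subspace_eigenspan:
  assumes "subspace W" "W \<subseteq> Vp" "\<And>w. w \<in> W \<Longrightarrow> u \<star> w \<in> W" "w \<in> W"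
  shows "w \<in> span {v \<in> W. \<exists>\<rho>. u \<star> v = \<rho> *\<^sub>R v}"
  using assms
proof (induction "dim W" arbitrary: W w rule: less_induct)
  case less
  show ?case
  proof (cases "W = {0}")
    case True
    then show ?thesis using less.prems(4) by (simp add: span_zero)
  next
    case False
    have bil: "bilinear (\<lambda>x y. tau (u \<star> x) y)"
      by (auto simp: bilinear_def mul_simps tau_simps intro!: linearI)
    have sym: "tau (u \<star> x) y = tau (u \<star> y) x" for x y by (metis tau_commute tau_mul)
    have pos: "tau x x > 0" if "x \<in> W" "x \<noteq> 0" for x using that less.prems(2) tau_pos by blast
    have "\<exists>v \<rho>. v \<in> W \<and> v \<noteq> 0 \<and> (\<forall>w\<in>W. tau (u \<star> v) w = \<rho> * tau v w)"
      by (rule form_eigenvector[OF less.prems(1) False bilinear_tau bil tau_commute sym]) (use pos in blast)+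
    then obtain v \<rho> where v: "v \<in> W" "v \<noteq> 0" "\<And>w. w \<in> W \<Longrightarrow> tau (u \<star> v) w = \<rho> * tau v w" by blast
    have "u \<star> v - \<rho> *\<^sub>R v \<in> W" using less.prems(1,3) v(1) by (simp add: subspace_diff subspace_scale)
    moreover from v(3)[OF this] have "tau (u \<star> v - \<rho> *\<^sub>R v) (u \<star> v - \<rho> *\<^sub>R v) = 0" by (simp add: tau_simps(3,7))
    ultimately have "u \<star> v - \<rho> *\<^sub>R v = 0" using pos[of "u \<star> v - \<rho> *\<^sub>R v"] by force
    then have eig: "u \<star> v = \<rho> *\<^sub>R v" by simp
    have tv: "tau v v > 0" using pos v by blast
    define W' where "W' = {w \<in> W. tau w v = 0}"
    have W': "subspace W'"
      using less.prems(1) unfolding W'_def subspace_def by (auto simp: tau_simps)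
    have sub: "W' \<subseteq> W" by (auto simp: W'_def)
    have "v \<notin> W'" using tv by (simp add: W'_def)
    then have "W' \<noteq> W" using v(1) by blast
    then have dim: "dim W' < dim W"
      using sub subspace_dim_equal[OF W' less.prems(1) sub] by (metis dim_subset linorder_not_less)
    have inv: "u \<star> w \<in> W'" if "w \<in> W'" for w
    proof -
      have "tau (u \<star> w) v = tau w (u \<star> v)" by (rule tau_mul)
      also have "\<dots> = 0" using that by (simp add: eig tau_simps W'_def)
      finally show ?thesis using that less.prems(3) by (simp add: W'_def)
    qed
    define k where "k = tau w v / tau v v"
    have "w - k *\<^sub>R v \<in> W'"
      using less.prems(1,4) v(1) tv by (simp add: W'_def subspace_diff subspace_scale tau_simps k_def)
    from less.hyps[OF dim W' _ inv this] have "w - k *\<^sub>R v \<in> span {v \<in> W'. \<exists>\<rho>. u \<star> v = \<rho> *\<^sub>R v}"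
      using sub less.prems(2) by blast
    then have 1: "w - k *\<^sub>R v \<in> span {v \<in> W. \<exists>\<rho>. u \<star> v = \<rho> *\<^sub>R v}"
      by (rule subsetD[OF span_mono, rotated]) (use sub in auto)
    have 2: "k *\<^sub>R v \<in> span {v \<in> W. \<exists>\<rho>. u \<star> v = \<rho> *\<^sub>R v}"
      by (rule span_scale, rule span_base) (use v(1) eig in auto)
    show ?thesis using span_add[OF 1 2] by simp
  qed
qed

lemma pl_Vp: "u \<in> Vp \<Longrightarrow> pl q u \<in> Vp"
  by (induction q) (auto simp: pl_pCons subspace_0[OF subspace_Vp] intro!: subspace_add[OF subspace_Vp]
     subspace_scale[OF subspace_Vp] unit_Vp mul_Vp)

text \<open>An eigenvector of \<open>L(u)\<close> in the associative algebra generated by \<open>u\<close> is a multiple of an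
idempotent, since its square is a non-zero multiple of itself. Each idempotent is recorded as a
multiple of \<open>u\<close>, so that it lies in the Peirce spaces that contain \<open>u\<close>.\<close>

lemma spectral_span:
  assumes u: "u \<in> Vp"
  shows "u \<in> span {p \<in> Vp. p \<star> p = p \<and> (\<exists>q. p = u \<star> pl q u)}" (is "u \<in> span ?I")
proof -
  define W where "W = range (\<lambda>q. pl q u)"
  have W: "subspace W"
    unfolding W_def subspace_def
    by (auto simp: image_iff) (metis pl_0, metis pl_add, metis pl_smult)
  have sub: "W \<subseteq> Vp" using pl_Vp[OF u] by (auto simp: W_def)
  have inv: "u \<star> w \<in> W" if "w \<in> W" for w
  proof -
    obtain q where "w = pl q u" using \<open>w \<in> W\<close> by (auto simp: W_def)
    then have "u \<star> w = pl ([:0, 1:] * q) u" by (simp only: pl_mult pl_X)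
    then show ?thesis unfolding W_def by (rule image_eqI) simp
  qed
  have "pl 1 u \<in> W" unfolding W_def by (rule rangeI)
  then have eW: "\<ee> \<in> W" by simp
  have "u \<star> w \<in> span ?I" if "w \<in> span {v \<in> W. \<exists>\<rho>. u \<star> v = \<rho> *\<^sub>R v}" for w
    using that
  proof (induction w rule: span_induct)
    case base
    show ?case
      unfolding subspace_def by (auto simp: mul_simps span_zero span_add span_scale)
  next
    case (step v)
    then obtain \<rho> where v: "v \<in> W" "u \<star> v = \<rho> *\<^sub>R v" by blast
    then obtain q where q: "v = pl q u" by (auto simp: W_def)
    have act: "pl p u \<star> v = poly p \<rho> *\<^sub>R v" for p
    proof (induction p)
      case (pCons a p)
      have "(u \<star> pl p u) \<star> v = pl ([:0,1:] * p * q) u" by (simp only: pl_mult pl_X q)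
      also have "\<dots> = u \<star> (pl p u \<star> v)" by (simp only: mult.assoc pl_mult pl_X q)
      finally show ?case using pCons v(2) by (simp add: pl_pCons mul_simps algebra_simps)
    qed (simp add: mul_simps)
    show ?case
    proof (cases "\<rho> = 0 \<or> v = 0")
      case True then show ?thesis using v(2) by (auto simp: span_zero)
    next
      case False
      define k where "k = poly q \<rho>"
      have vv: "v \<star> v = k *\<^sub>R v" using act[of q] by (simp add: q k_def)
      have "tau v v > 0" using False v(1) sub tau_pos by blast
      then have k: "k \<noteq> 0" by (auto simp: jtau_def vv linear_0[OF linear_jtr])
      let ?p = "(1 / k) *\<^sub>R v"
      have "?p \<star> ?p = ?p" using k by (simp add: mul_simps vv)
      moreover have "?p = u \<star> pl (Polynomial.smult (1 / (\<rho> * k)) q) u"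
        using False v(2) by (simp add: pl_smult mul_simps q[symmetric])
      moreover have "?p \<in> Vp" using v(1) sub subspace_scale[OF subspace_Vp] by blast
      ultimately have "?p \<in> ?I" by blast
      then have "(\<rho> * k) *\<^sub>R ?p \<in> span ?I" by (intro span_scale span_base)
      then show ?thesis using v(2) k by simp
    qed
  qed
  from this[OF invariant_subspace_eigenspan[OF W sub inv eW]] show ?thesis by simp
qed

section \<open>Frames of \<open>V\<^sup>+\<close>\<close>

abbreviation primitive :: "'a \<Rightarrow> bool" where "primitive p \<equiv> primitive_idempotent_on V Vp p"

lemma primitiveD: "primitive p \<Longrightarrow> p \<in> Vp" "primitive p \<Longrightarrow> p \<noteq> 0" "primitive p \<Longrightarrow> p \<star> p = p"
  by (auto simp: primitive_idempotent_on_def jidempotent_def)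

lemma primitive_split:
  "primitive p \<Longrightarrow> a \<in> Vp \<Longrightarrow> b \<in> Vp \<Longrightarrow> a \<star> a = a \<Longrightarrow> b \<star> b = b \<Longrightarrow> a \<star> b = 0 \<Longrightarrow> p = a + b \<Longrightarrow> a = 0 \<or> b = 0"
  unfolding primitive_idempotent_on_def jidempotent_def by blast

lemma pl_peirce:
  assumes "c \<star> c = c" "u \<in> peirce c l" "l = 0 \<or> l = 1" shows "u \<star> pl q u \<in> peirce c l"
proof (induction q)
  case 0 then show ?case by (simp add: mul_simps)
next
  case (pCons a q)
  have "u \<star> (u \<star> pl q u) \<in> peirce c l"
    using assms(2,3) pCons.IH peirce_0_0[OF assms(1), of u "u \<star> pl q u"] peirce_1_1[OF assms(1), of u "u \<star> pl q u"]
    by auto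
  from peirce_add[OF peirce_scale[OF assms(2), of a] this] show ?case
    by (simp add: pl_pCons mul_simps)
qed

text \<open>The idempotents spanning \<open>u\<close> lie in the same Peirce space and split \<open>f\<close>, so they are \<open>0\<close> or \<open>f\<close>.\<close>

lemma Vp_peirce_1_primitive:
  assumes f: "primitive f" and u: "u \<in> Vp" "u \<in> peirce f 1"
  obtains t where "u = t *\<^sub>R f"
proof -
  note ff = primitiveD(3)[OF f]
  have "{p \<in> Vp. p \<star> p = p \<and> (\<exists>q. p = u \<star> pl q u)} \<subseteq> span {f}"
  proof
    fix p assume "p \<in> {p \<in> Vp. p \<star> p = p \<and> (\<exists>q. p = u \<star> pl q u)}"
    then obtain q where p: "p \<in> Vp" "p \<star> p = p" "p = u \<star> pl q u" by blast
    have "p \<in> peirce f 1" unfolding p(3) by (rule pl_peirce[OF ff u(2)]) simp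
    then have fp: "f \<star> p = p" by simp
    have pf: "p \<star> f = p" using fp by (simp add: mul_commute)
    have "p = 0 \<or> f - p = 0"
    proof (rule primitive_split[OF f p(1) _ p(2)])
      show "f - p \<in> Vp" using primitiveD(1)[OF f] p(1) by (rule subspace_diff[OF subspace_Vp])
    qed (simp_all add: mul_simps p(2) ff fp pf)
    then have "p = 0 \<or> p = f" by auto
    then show "p \<in> span {f}" using span_zero span_base[of f "{f}"] by auto
  qed
  from span_minimal[OF this subspace_span] have "u \<in> span {f}" using spectral_span[OF u(1)] by (rule subsetD)
  then obtain t where "u = t *\<^sub>R f" by (auto simp: span_singleton)
  then show thesis by (rule that)
qed

lemma orth_peirce: "f \<star> f = f \<Longrightarrow> f \<star> g = 0 \<Longrightarrow> f \<in> peirce f 1 \<and> g \<in> peirce f 0"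
  by (simp add: mul_commute)

definition orth_system :: "'a set \<Rightarrow> 'a \<Rightarrow> bool" where
  "orth_system F q \<longleftrightarrow> finite F \<and> (\<forall>p\<in>F. primitive p) \<and> (\<forall>p\<in>F. \<forall>p'\<in>F. p \<noteq> p' \<longrightarrow> p \<star> p' = 0) \<and> \<Sum>F = q"

lemma orth_system_mul_sum:
  assumes "orth_system F q" "p \<in> F" "G \<subseteq> F" shows "\<Sum>G \<star> p = (if p \<in> G then p else 0)"
proof -
  have fin: "finite G" using assms by (auto simp: orth_system_def intro: finite_subset)
  have "\<Sum>G \<star> p = (\<Sum>g\<in>G. if g = p then p else 0)"
    unfolding mul_sum_left using assms primitiveD(3) by (intro sum.cong) (auto simp: orth_system_def subset_iff)
  then show ?thesis using fin by simp
qed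

lemma orth_system_union:
  assumes a: "orth_system A a" and b: "orth_system B b" and ab: "a \<star> b = 0" "a \<star> a = a" "b \<star> b = b"
  shows "orth_system (A \<union> B) (a + b)" "A \<inter> B = {}"
proof -
  have cross: "p \<star> p' = 0" if "p \<in> A" "p' \<in> B" for p p'
  proof -
    have 1: "a \<star> p = p" using orth_system_mul_sum[OF a that(1), of A] a that by (simp add: orth_system_def)
    have 2: "b \<star> p' = p'" using orth_system_mul_sum[OF b that(2), of B] b that by (simp add: orth_system_def)
    have "p' \<star> a = 0" by (rule peirce_1_0[OF ab(3)]) (use 2 ab(1) in \<open>auto simp: mul_commute\<close>)
    then show ?thesis by (intro peirce_1_0[OF ab(2)]) (use 1 in \<open>auto simp: mul_commute\<close>)
  qed
  show disj: "A \<inter> B = {}"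
  proof (rule equals0I)
    fix p assume "p \<in> A \<inter> B"
    then show False using cross[of p p] primitiveD[of p] a by (auto simp: orth_system_def)
  qed
  have cross': "p' \<star> p = 0" if "p \<in> A" "p' \<in> B" for p p' using cross[OF that] by (simp add: mul_commute)
  show "orth_system (A \<union> B) (a + b)"
    using a b cross cross' disj unfolding orth_system_def
    by (auto simp: sum.union_disjoint)
qed

text \<open>Split \<open>q\<close> until all parts are primitive; the dimension of the Peirce 1-space in \<open>V\<^sup>+\<close> decreases.\<close>

lemma ex_orth_system:
  assumes "q \<in> Vp" "q \<star> q = q" shows "\<exists>F. orth_system F q"
  using assms
proof (induction "dim (Vp \<inter> peirce q 1)" arbitrary: q rule: less_induct)
  case less
  consider "q = 0" | "primitive q" | "q \<noteq> 0" "\<not> primitive q" by blast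
  then show ?case
  proof cases
    case 1 then show ?thesis by (intro exI[of _ "{}"]) (simp add: orth_system_def)
  next
    case 2 then show ?thesis by (intro exI[of _ "{q}"]) (simp add: orth_system_def)
  next
    case 3
    then obtain a b where ab: "a \<in> Vp" "b \<in> Vp" "a \<noteq> 0" "b \<noteq> 0" "a \<star> a = a" "b \<star> b = b" "a \<star> b = 0" "q = a + b"
      using less.prems unfolding primitive_idempotent_on_def jidempotent_def by blast
    have dims: "dim (Vp \<inter> peirce a 1) < dim (Vp \<inter> peirce q 1)"
      if ab: "a \<in> Vp" "b \<in> Vp" "b \<noteq> 0" "a \<star> a = a" "b \<star> b = b" "a \<star> b = 0" "q = a + b" for a b
    proof -
      have sub: "Vp \<inter> peirce a 1 \<subseteq> Vp \<inter> peirce q 1"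
      proof
        fix x assume x: "x \<in> Vp \<inter> peirce a 1"
        have "x \<star> b = 0" by (rule peirce_1_0[OF ab(4)]) (use x ab in auto)
        then show "x \<in> Vp \<inter> peirce q 1" using x ab by (auto simp: mul_simps mul_commute)
      qed
      have "b \<in> Vp \<inter> peirce q 1" "b \<notin> Vp \<inter> peirce a 1" using ab by (auto simp: mul_simps)
      then have ne: "Vp \<inter> peirce a 1 \<noteq> Vp \<inter> peirce q 1" by blast
      have s: "subspace (Vp \<inter> peirce x 1)" for x by (intro subspace_inter subspace_Vp subspace_peirce)
      show ?thesis using subspace_dim_equal[OF s s sub] ne by (metis dim_subset linorder_not_less sub)
    qed
    obtain A where A: "orth_system A a" using less.hyps[OF dims[of a b]] ab by blast
    obtain B where B: "orth_system B b"
      using less.hyps[OF dims[of b a]] ab by (metis add.commute mul_commute)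
    show ?thesis using orth_system_union(1)[OF A B ab(7,5,6)] ab(8) by blast
  qed
qed

text \<open>For orthogonal idempotents \<open>4 L(f) L(g)\<close> is the projection to the joint 1/2-space.\<close>

lemma orth_mixed:
  assumes "f \<star> f = f" "g \<star> g = g" "f \<star> g = 0"
  shows "f \<star> (g \<star> z) = g \<star> (f \<star> z)" "f \<star> (g \<star> z) \<in> peirce f (1/2)" "f \<star> (g \<star> z) \<in> peirce g (1/2)"
proof -
  have *: "f \<star> (g \<star> z) = g \<star> (f \<star> z) \<and> f \<star> (g \<star> z) \<in> peirce f (1/2)"
    if f: "f \<star> f = f" and g: "g \<star> g = g" and fg: "f \<star> g = 0" for f g
  proof -
    note o = orth_peirce[OF f fg]
    have "op_commute f g" using op_commute_1_0[OF f] o by blast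
    then have c: "f \<star> (g \<star> z) = g \<star> (f \<star> z)" by (rule op_commuteD)
    have 1: "g \<star> Pi1 f z = 0" using peirce_1_0[OF f Pi_mem(1)[OF f], of g] o by (simp add: mul_commute)
    have h: "g \<star> Pih f z \<in> peirce f (1/2)" by (rule peirce_0_h[OF f _ Pi_mem(2)[OF f]]) (use o in blast)
    have "f \<star> (g \<star> z) = g \<star> (f \<star> (Pi1 f z + Pih f z + Pi0 f z))" unfolding c by (simp only: Pi_sum)
    also have "\<dots> = (1/2) *\<^sub>R (g \<star> Pih f z)"
      using Pi_mem[OF f, of z] 1 by (simp add: mul_simps)
    finally show ?thesis using c peirce_scale[OF h, of "1/2"] by simp
  qed
  show "f \<star> (g \<star> z) = g \<star> (f \<star> z)" "f \<star> (g \<star> z) \<in> peirce f (1/2)" using *[OF assms] by blast+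
  have "g \<star> f = 0" using assms(3) by (simp add: mul_commute)
  from *[OF assms(2,1) this] show "f \<star> (g \<star> z) \<in> peirce g (1/2)" by metis
qed

text \<open>The trace of \<open>L(u)\<close> compressed to the 1/2-space of \<open>f\<close>.\<close>

definition mixed_trace :: "'a \<Rightarrow> 'a \<Rightarrow> real" where
  "mixed_trace f u = linear_trace (\<lambda>z. Pih f (u \<star> z))"

lemma linear_mixed_trace: "linear (mixed_trace f)"
  by (rule linearI) (simp_all add: mixed_trace_def mul_simps linear_add[OF linear_Pi(2)] linear_scale[OF linear_Pi(2)]
     linear_trace_add linear_trace_scaleR)

lemma mixed_trace_dim:
  assumes "f \<star> f = f" "g \<star> g = g" "f \<star> g = 0"
  shows "mixed_trace f g = real (dim (peirce f (1/2) \<inter> peirce g (1/2))) / 2"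
proof -
  define E where "E z = 4 *\<^sub>R (f \<star> (g \<star> z))" for z
  have E: "linear E" unfolding E_def by (rule linearI) (simp_all add: mul_simps algebra_simps)
  have E_id: "E z = z" if "z \<in> peirce f (1/2) \<inter> peirce g (1/2)" for z
    using that by (simp add: E_def mul_simps)
  have mem: "E z \<in> peirce f (1/2) \<inter> peirce g (1/2)" for z
    unfolding E_def using orth_mixed(2,3)[OF assms] by (intro IntI peirce_scale)
  have range: "range E = peirce f (1/2) \<inter> peirce g (1/2)"
  proof
    show "range E \<subseteq> peirce f (1/2) \<inter> peirce g (1/2)" using mem by blast
    show "peirce f (1/2) \<inter> peirce g (1/2) \<subseteq> range E"
    proof
      fix z assume "z \<in> peirce f (1/2) \<inter> peirce g (1/2)"
      from E_id[OF this, symmetric] show "z \<in> range E" by (rule range_eqI)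
    qed
  qed
  have eq: "Pih f (g \<star> z) = (1/2) *\<^sub>R E z" for z
  proof -
    have "f \<star> (f \<star> (g \<star> z)) = (1/2) *\<^sub>R (f \<star> (g \<star> z))" using orth_mixed(2)[OF assms, of z] by simp
    then show ?thesis by (simp add: Pih_def E_def)
       (rule vector_eqI_inner, simp add: inner_simps)
  qed
  show ?thesis
    unfolding mixed_trace_def eq linear_trace_scaleR
    using linear_trace_projection[OF E E_id[OF mem]] range by simp
qed

lemma mixed_trace_aut:
  assumes \<sigma>: "involutive_aut \<sigma>" shows "mixed_trace (\<sigma> f) (\<sigma> u) = mixed_trace f u"
proof -
  have "Pih (\<sigma> f) (\<sigma> u \<star> z) = \<sigma> (Pih f (u \<star> \<sigma> z))" for z
    unfolding Pih_def
    by (simp add: linear_diff[OF aut_linear[OF \<sigma>]] linear_scale[OF aut_linear[OF \<sigma>]] aut_mul[OF \<sigma>] aut_aut[OF \<sigma>])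
  then have "mixed_trace (\<sigma> f) (\<sigma> u) = linear_trace (\<lambda>z. \<sigma> (Pih f (u \<star> \<sigma> z)))" by (simp add: mixed_trace_def)
  also have "\<dots> = mixed_trace f u"
    unfolding mixed_trace_def
    by (rule linear_trace_aut[OF \<sigma>])
       (rule linear_compose[OF linear_mul_right linear_Pi(2), unfolded o_def])
  finally show ?thesis .
qed

text \<open>Orthogonal primitive idempotents joined by a non-zero element of \<open>V\<^sup>+\<close> are exchanged by a
Peirce reflection: \<open>a\<^sup>2\<close> is a positive multiple of \<open>f + g\<close>, so a multiple of \<open>a\<close> completed by \<open>e - f - g\<close>
is an involution \<open>s\<close>, and the reflection in the idempotent \<open>(s + e)/2\<close> is the required automorphism.\<close>

lemma primitive_swap:
  assumes f: "primitive f" and g: "primitive g" and fg: "f \<star> g = 0"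
    and a: "a \<in> Vp" "a \<noteq> 0" "a \<in> peirce f (1/2)" "a \<in> peirce g (1/2)"
  obtains \<sigma> where "involutive_aut \<sigma>" "\<sigma> f = g" "\<sigma> g = f" "\<And>h. f \<star> h = 0 \<Longrightarrow> g \<star> h = 0 \<Longrightarrow> \<sigma> h = h"
    "\<And>z. z \<in> Vp \<Longrightarrow> \<sigma> z \<in> Vp"
proof -
  note ff = primitiveD(3)[OF f] and gg = primitiveD(3)[OF g]
  have gf: "g \<star> f = 0" using fg by (simp add: mul_commute)
  define q where "q = f + g"
  have qq: "q \<star> q = q" by (simp add: q_def mul_simps ff gg fg gf)
  have qa: "q \<star> a = a" using a(3,4) by (simp add: q_def mul_simps scaleR_2[symmetric] flip: scaleR_left_distrib)
  have qa2: "q \<star> (a \<star> a) = a \<star> a" using peirce_1_1[OF qq, of a a] qa by simp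
  have a2V: "a \<star> a \<in> Vp" using a mul_Vp by blast
  define x y where "x = Pi1 f (a \<star> a)" and "y = Pi0 f (a \<star> a)"
  have xy: "a \<star> a = x + y"
    using Pi_sum[of f "a \<star> a"] peirce_h_h[OF ff a(3,3)] by (simp add: x_def y_def)
  have x1: "x \<in> peirce f 1" and y0: "y \<in> peirce f 0" unfolding x_def y_def by (rule Pi_mem[OF ff])+
  have xV: "x \<in> Vp"
    unfolding x_def Pi1_def using a(1) primitiveD(1)[OF f] by (intro subspace_diff[OF subspace_Vp] subspace_scale[OF subspace_Vp] mul_Vp)
  obtain \<alpha> where \<alpha>: "x = \<alpha> *\<^sub>R f" using Vp_peirce_1_primitive[OF f xV x1] by blast
  have yV: "y \<in> Vp" using xy xV a2V subspace_diff[OF subspace_Vp, of "a \<star> a" x] by simp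
  have "q \<star> y = y"
  proof -
    have "y = a \<star> a - \<alpha> *\<^sub>R f" using xy \<alpha> by simp
    moreover have "q \<star> f = f" by (simp add: q_def mul_simps ff gf)
    ultimately show ?thesis using qa2 by (simp add: mul_simps)
  qed
  then have "g \<star> y = y" using y0 by (simp add: q_def mul_simps)
  then have "y \<in> peirce g 1" by simp
  then obtain \<beta> where \<beta>: "y = \<beta> *\<^sub>R g" using Vp_peirce_1_primitive[OF g yV] by blast
  have a2: "a \<star> a = \<alpha> *\<^sub>R f + \<beta> *\<^sub>R g" using xy \<alpha> \<beta> by simp
  have fa: "f \<star> a = (1/2) *\<^sub>R a" "g \<star> a = (1/2) *\<^sub>R a" using a(3,4) by simp_all
  have a3: "a \<star> (a \<star> a) = ((\<alpha> + \<beta>) / 2) *\<^sub>R a"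
    unfolding a2 by (simp add: mul_simps mul_commute[of a f] mul_commute[of a g] fa add_divide_distrib scaleR_left_distrib)
  have "(a \<star> a) \<star> (a \<star> a) = a \<star> (a \<star> (a \<star> a))"
    using square_mul_pw[of a 2] by (simp add: pw_Suc numeral_2_eq_2 numeral_3_eq_3)
  then have "(\<alpha> * \<alpha>) *\<^sub>R f + (\<beta> * \<beta>) *\<^sub>R g = ((\<alpha> + \<beta>) / 2) *\<^sub>R (\<alpha> *\<^sub>R f + \<beta> *\<^sub>R g)"
    unfolding a3 by (simp only: mul_simps a2) (simp add: mul_simps ff gg fg gf)
  from arg_cong[OF this, of "\<lambda>z. f \<star> z"] have "(\<alpha> * \<alpha>) *\<^sub>R f = ((\<alpha> + \<beta>) / 2 * \<alpha>) *\<^sub>R f"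
    by (simp add: mul_simps ff fg)
  then have "\<alpha> * \<alpha> = (\<alpha> + \<beta>) / 2 * \<alpha> \<or> f = 0" by (rule scaleR_cancel_right[THEN iffD1])
  then have ab: "\<alpha> * \<alpha> = (\<alpha> + \<beta>) / 2 * \<alpha>" using primitiveD(2)[OF f] by blast
  have "(a \<star> a) \<star> f = \<alpha> *\<^sub>R f" by (simp add: a2 mul_simps ff gf)
  then have "\<alpha> * tau f f = tau (a \<star> a) f" by (simp add: jtau_def ff linear_scale[OF linear_jtr])
  also have "\<dots> = tau a (f \<star> a)" using tau_assoc[of a a f] by (simp only: mul_commute[of a f])
  also have "\<dots> = tau a a / 2" by (simp add: fa tau_simps)
  finally have "\<alpha> * tau f f > 0" using tau_pos[OF a(1,2)] by simp
  then have \<alpha>0: "\<alpha> > 0" using tau_pos[OF primitiveD(1)[OF f] primitiveD(2)[OF f]] by (simp add: zero_less_mult_iff)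
  then have \<alpha>\<beta>: "\<alpha> = \<beta>" using ab by (simp add: field_simps)
  define b where "b = (1 / sqrt \<alpha>) *\<^sub>R a"
  have bb: "b \<star> b = q"
    using \<alpha>0 by (simp add: b_def mul_simps a2 \<alpha>\<beta>[symmetric] q_def scaleR_add_right)
  have fb: "f \<star> b = (1/2) *\<^sub>R b" "g \<star> b = (1/2) *\<^sub>R b" "q \<star> b = b" by (simp_all add: b_def mul_simps fa qa)
  have bq: "b \<star> q = b" "b \<star> f = (1/2) *\<^sub>R b" using fb by (simp_all add: mul_commute)
  have bV: "b \<in> Vp" unfolding b_def by (rule subspace_scale[OF subspace_Vp a(1)])
  \<comment> \<open>A square root of the unit that exchanges \<open>f\<close> and \<open>g\<close>.\<close>
  define s where "s = b + (\<ee> - q)"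
  have qV: "q \<in> Vp" unfolding q_def using primitiveD(1) f g by (intro subspace_add[OF subspace_Vp])
  have sV: "s \<in> Vp" unfolding s_def using bV qV unit_Vp by (intro subspace_add[OF subspace_Vp] subspace_diff[OF subspace_Vp])
  have ss: "s \<star> s = \<ee>" unfolding s_def by (simp add: mul_simps bb qq fb(3) bq(1))
  define k where "k = (1/2) *\<^sub>R (s + \<ee>)"
  have kk: "k \<star> k = k"
  proof -
    have "k \<star> k = (1/2) *\<^sub>R ((1/2) *\<^sub>R (s + \<ee>) + (1/2) *\<^sub>R (s + \<ee>))"
      by (simp only: k_def mul_simps ss unit_mul add.commute[of \<ee> s])
    also have "(1/2) *\<^sub>R (s + \<ee>) + (1/2) *\<^sub>R (s + \<ee>) = s + \<ee>" by (simp flip: scaleR_left_distrib)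
    finally show ?thesis by (simp add: k_def)
  qed
  have refl: "reflect k z = 2 *\<^sub>R (s \<star> (s \<star> z)) - z" for z
  proof -
    have kv: "k \<star> v = (1/2) *\<^sub>R (s \<star> v + v)" for v by (simp add: k_def mul_simps)
    have "reflect k z = z - 2 *\<^sub>R (4 *\<^sub>R (k \<star> z) - 4 *\<^sub>R (k \<star> (k \<star> z)))"
      by (simp only: reflect_def[OF kk] Pih_def)
    also have "\<dots> = 2 *\<^sub>R (s \<star> (s \<star> z)) - z"
      by (simp only: kv mul_simps) (rule vector_eqI_inner, simp only: inner_simps, simp, argo)
    finally show ?thesis .
  qed
  have sf: "s \<star> f = (1/2) *\<^sub>R b" by (simp add: s_def mul_simps bq q_def ff gf)
  have sb: "s \<star> b = q" by (simp add: s_def mul_simps bb fb(3))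
  have \<sigma>: "involutive_aut (reflect k)"
    unfolding involutive_aut_def by (intro conjI allI linear_reflect[OF kk] reflect_mul[OF kk] reflect_reflect[OF kk])
  have \<sigma>f: "reflect k f = g" unfolding refl by (simp add: sf sb mul_simps q_def)
  show thesis
  proof (rule that[OF \<sigma> \<sigma>f])
    show "reflect k g = f" using aut_aut[OF \<sigma>, of f] \<sigma>f by simp
    fix h assume h: "f \<star> h = 0" "g \<star> h = 0"
    have "q \<star> h = 0" using h by (simp add: q_def mul_simps)
    then have "b \<star> h = 0" by (intro peirce_1_0[OF qq]) (use fb in auto)
    then have "s \<star> h = h" using \<open>q \<star> h = 0\<close> by (simp add: s_def mul_simps)
    then show "reflect k h = h" unfolding refl by (simp add: scaleR_2)
  next
    fix z assume "z \<in> Vp"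
    then show "reflect k z \<in> Vp" unfolding refl using sV
      by (intro subspace_diff[OF subspace_Vp] subspace_scale[OF subspace_Vp] mul_Vp)
  qed
qed

end

section \<open>Simple \<open>V\<^sup>+\<close>\<close>

locale cartan_jordan_simple = cartan_jordan V \<theta> for V :: "'a::euclidean_space jalg" and \<theta> +
  assumes Vp_simple: "jsimple_on V (plus_space \<theta>)"
begin

text \<open>The swaps make being joined to \<open>f\<close> a transitive relation on the frame. The sum \<open>k\<close> of the class of \<open>f\<close>
has no 1/2-space in \<open>V\<^sup>+\<close>, so its 1-space is an ideal of \<open>V\<^sup>+\<close>, and \<open>k\<close> is the unit by simplicity.\<close>

lemma frame_connected:
  assumes F: "orth_system F \<ee>" and f: "f \<in> F" and g: "g \<in> F" "f \<noteq> g"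
  obtains a where "a \<in> Vp" "a \<noteq> 0" "a \<in> peirce f (1/2)" "a \<in> peirce g (1/2)"
proof -
  have prim: "\<And>p. p \<in> F \<Longrightarrow> primitive p" and orth: "\<And>p p'. p \<in> F \<Longrightarrow> p' \<in> F \<Longrightarrow> p \<noteq> p' \<Longrightarrow> p \<star> p' = 0"
    and fin: "finite F" and sumF: "\<Sum>F = \<ee>" using F by (auto simp: orth_system_def)
  define conn where "conn j h \<longleftrightarrow> (\<exists>a. a \<in> Vp \<and> a \<noteq> 0 \<and> a \<in> peirce j (1/2) \<and> a \<in> peirce h (1/2))" for j h
  define K where "K = {g \<in> F. g = f \<or> conn f g}"
  define k where "k = \<Sum>K"
  have K: "K \<subseteq> F" "f \<in> K" using f by (auto simp: K_def)
  have kp: "k \<star> p = (if p \<in> K then p else 0)" if "p \<in> F" for p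
    unfolding k_def by (rule orth_system_mul_sum[OF F that K(1)])
  have finK: "finite K" using fin K(1) finite_subset by blast
  have kk: "k \<star> k = k"
  proof -
    have "k \<star> \<Sum>K = (\<Sum>p\<in>K. k \<star> p)" by (rule mul_sum_right)
    also have "\<dots> = \<Sum>K" using kp K(1) by (intro sum.cong) auto
    finally show ?thesis by (simp add: k_def)
  qed
  have kV: "k \<in> Vp" unfolding k_def using K(1) prim primitiveD(1) by (intro subspace_sum[OF subspace_Vp]) blast
  have no: "\<not> conn j h" if j: "j \<in> K" and h: "h \<in> F" "h \<notin> K" for j h
  proof
    assume c: "conn j h"
    have jF: "j \<in> F" using j K by blast
    show False
    proof (cases "j = f")
      case True then show False using c h by (auto simp: K_def)
    next
      case False
      then have "conn f j" using j by (auto simp: K_def)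
      then obtain a where a: "a \<in> Vp" "a \<noteq> 0" "a \<in> peirce f (1/2)" "a \<in> peirce j (1/2)" by (auto simp: conn_def)
      have fj: "f \<star> j = 0" by (rule orth[OF f jF]) (use False in auto)
      obtain \<sigma> where \<sigma>: "involutive_aut \<sigma>" "\<sigma> f = j" "\<sigma> j = f" "\<And>h. f \<star> h = 0 \<Longrightarrow> j \<star> h = 0 \<Longrightarrow> \<sigma> h = h"
        "\<And>z. z \<in> Vp \<Longrightarrow> \<sigma> z \<in> Vp"
        by (rule primitive_swap[OF prim[OF f] prim[OF jF] fj a]) (rule that; assumption)
      obtain x where x: "x \<in> Vp" "x \<noteq> 0" "j \<star> x = (1/2) *\<^sub>R x" "h \<star> x = (1/2) *\<^sub>R x" using c by (auto simp: conn_def)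
      have "f \<noteq> h" "j \<noteq> h" using h K j by auto
      then have "\<sigma> h = h" using orth f jF h by (intro \<sigma>(4)) auto
      then have "f \<star> \<sigma> x = (1/2) *\<^sub>R \<sigma> x" "h \<star> \<sigma> x = (1/2) *\<^sub>R \<sigma> x"
        using aut_mul[OF \<sigma>(1), of j x] aut_mul[OF \<sigma>(1), of h x] x \<sigma>(3)
        by (simp_all add: linear_scale[OF aut_linear[OF \<sigma>(1)]])
      moreover have "\<sigma> x \<noteq> 0" using x(2) aut_eq_iff[OF \<sigma>(1), of x 0] by (simp add: linear_0[OF aut_linear[OF \<sigma>(1)]])
      ultimately have "conn f h" using \<sigma>(5)[OF x(1)] by (auto simp: conn_def)
      then show False using h by (auto simp: K_def)
    qed
  qed
  have half: "b = 0" if b: "b \<in> Vp" "k \<star> b = (1/2) *\<^sub>R b" for b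
  proof -
    have z: "j \<star> (h \<star> b) = 0" if "j \<in> K" "h \<in> F - K" for j h
    proof (rule ccontr)
      assume ne: "j \<star> (h \<star> b) \<noteq> 0"
      have jF: "j \<in> F" and jh: "j \<noteq> h" using that K by auto
      have m: "j \<star> (h \<star> b) \<in> peirce j (1/2)" "j \<star> (h \<star> b) \<in> peirce h (1/2)"
        using orth_mixed(2,3)[OF primitiveD(3)[OF prim[OF jF]] primitiveD(3)[OF prim[of h]] orth[OF jF _ jh], of b] that by auto
      have "j \<star> (h \<star> b) \<in> Vp" using b(1) prim[OF jF] prim[of h] that primitiveD(1) by (intro mul_Vp) auto
      then have "conn j h" using m ne unfolding conn_def by blast
      then show False using no that by blast
    qed
    have "\<ee> - k = \<Sum>(F - K)" using sumF sum_diff[OF fin K(1), of "\<lambda>x. x"] by (simp add: k_def)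
    then have "k \<star> ((\<ee> - k) \<star> b) = (\<Sum>j\<in>K. \<Sum>h\<in>F - K. j \<star> (h \<star> b))"
      by (simp only: k_def mul_sum_left mul_sum_right) (rule sum.swap)
    also have "\<dots> = 0" using z by (intro sum.neutral ballI) blast
    finally have "k \<star> ((\<ee> - k) \<star> b) = 0" .
    moreover have "k \<star> ((\<ee> - k) \<star> b) = (1/4) *\<^sub>R b" using b(2) by (simp add: mul_simps)
       (rule vector_eqI_inner, simp add: inner_simps)
    ultimately show ?thesis by simp
  qed
  have "jideal_in V Vp (Vp \<inter> peirce k 1)"
    unfolding jideal_in_def
  proof (intro conjI ballI)
    show "subspace (Vp \<inter> peirce k 1)" by (intro subspace_inter subspace_Vp subspace_peirce)
    fix x y assume x: "x \<in> Vp" and y: "y \<in> Vp \<inter> peirce k 1"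
    have "Pih k x = 0"
    proof (rule half)
      show "Pih k x \<in> Vp" unfolding Pih_def using x kV
        by (intro subspace_diff[OF subspace_Vp] subspace_scale[OF subspace_Vp] mul_Vp)
      show "k \<star> Pih k x = (1/2) *\<^sub>R Pih k x" using Pi_mem(2)[OF kk, of x] by simp
    qed
    then have xe: "Pi1 k x + Pi0 k x = x" using Pi_sum[of k x] by simp
    have "x \<star> y = (Pi1 k x + Pi0 k x) \<star> y" by (simp only: xe)
    also have "\<dots> = Pi1 k x \<star> y + Pi0 k x \<star> y" by (rule mul_simps(1))
    also have "Pi0 k x \<star> y = 0" using peirce_1_0[OF kk _ Pi_mem(3)[OF kk], of y x] y by (simp add: mul_commute)
    finally have "x \<star> y = Pi1 k x \<star> y" by simp
    then have "x \<star> y \<in> peirce k 1" using peirce_1_1[OF kk Pi_mem(1)[OF kk], of y x] y by simp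
    then show "x \<star> y \<in> Vp \<inter> peirce k 1" using x y mul_Vp by blast
  qed simp
  then have "Vp \<inter> peirce k 1 = {0} \<or> Vp \<inter> peirce k 1 = Vp" using Vp_simple unfolding jsimple_on_def by blast
  moreover have "f \<in> Vp \<inter> peirce k 1" "f \<noteq> 0" using kp[OF f] K(2) primitiveD[OF prim[OF f]] by auto
  ultimately have "Vp \<inter> peirce k 1 = Vp" by blast
  then have "\<ee> \<in> Vp \<inter> peirce k 1" using unit_Vp by blast
  then have "k = \<ee>" by simp
  then have "g \<in> K" using kp[OF g(1)] primitiveD(2)[OF prim[OF g(1)]] by (auto split: if_splits)
  then have "conn f g" using g(2) by (auto simp: K_def)
  then obtain a where a: "a \<in> Vp" "a \<noteq> 0" "a \<in> peirce f (1/2)" "a \<in> peirce g (1/2)"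
    unfolding conn_def by blast
  then show thesis by (rule that)
qed

lemma frame_swap:
  assumes F: "orth_system F \<ee>" and f: "f \<in> F" and g: "g \<in> F" "f \<noteq> g"
  obtains \<sigma> where "involutive_aut \<sigma>" "\<sigma> f = g" "\<sigma> g = f" "\<And>h. h \<in> F \<Longrightarrow> h \<noteq> f \<Longrightarrow> h \<noteq> g \<Longrightarrow> \<sigma> h = h"
proof -
  obtain a where a: "a \<in> Vp" "a \<noteq> 0" "a \<in> peirce f (1/2)" "a \<in> peirce g (1/2)"
    by (rule frame_connected[OF F f g]) (rule that; assumption)
  have o: "\<And>p p'. p \<in> F \<Longrightarrow> p' \<in> F \<Longrightarrow> p \<noteq> p' \<Longrightarrow> p \<star> p' = 0" and prim: "primitive f" "primitive g"
    using F f g by (simp_all add: orth_system_def)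
  have fg: "f \<star> g = 0" by (rule o[OF f g])
  have orth: "f \<star> h = 0 \<and> g \<star> h = 0" if "h \<in> F" "h \<noteq> f" "h \<noteq> g" for h
    using o[OF f that(1)] o[OF g(1) that(1)] that by auto
  obtain \<sigma> where \<sigma>: "involutive_aut \<sigma>" "\<sigma> f = g" "\<sigma> g = f" "\<And>h. f \<star> h = 0 \<Longrightarrow> g \<star> h = 0 \<Longrightarrow> \<sigma> h = h"
    by (rule primitive_swap[OF prim fg a]) (rule that; assumption)
  show thesis by (rule that[OF \<sigma>(1-3)]) (use \<sigma>(4) orth in blast)
qed

text \<open>Traces and multiplicities are invariant under the automorphisms that exchange members of the frame.\<close>

lemma frame_homogeneous:
  assumes F: "orth_system F \<ee>" and "f \<in> F" "g \<in> F" "f \<noteq> g" "f' \<in> F" "g' \<in> F" "f' \<noteq> g'"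
  shows "mixed_trace f g = mixed_trace f' g'" "jtr V f = jtr V f'"
proof -
  have second: "mixed_trace f g = mixed_trace f h" if hyp: "f \<in> F" "g \<in> F" "h \<in> F" "f \<noteq> g" "f \<noteq> h" for f g h
  proof (cases "g = h")
    case False
    obtain \<sigma> where \<sigma>: "involutive_aut \<sigma>" "\<sigma> g = h" "\<And>h'. h' \<in> F \<Longrightarrow> h' \<noteq> g \<Longrightarrow> h' \<noteq> h \<Longrightarrow> \<sigma> h' = h'"
      by (rule frame_swap[OF F hyp(2,3) False]) (rule that; assumption)
    have "\<sigma> f = f" using \<sigma>(3) hyp by blast
    then show ?thesis using mixed_trace_aut[OF \<sigma>(1), of f g] \<sigma>(2) by simp
  qed simp
  have swap: "mixed_trace f g = mixed_trace g f \<and> jtr V f = jtr V g" if fg: "f \<in> F" "g \<in> F" "f \<noteq> g" for f g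
  proof -
    obtain \<sigma> where \<sigma>: "involutive_aut \<sigma>" "\<sigma> f = g" "\<sigma> g = f"
      by (rule frame_swap[OF F fg]) (rule that; assumption)
    show ?thesis using mixed_trace_aut[OF \<sigma>(1), of f g] jtr_aut[OF \<sigma>(1), of f] \<sigma>(2,3) by simp
  qed
  show "mixed_trace f g = mixed_trace f' g'"
  proof (cases "f = f'")
    case True then show ?thesis using second[OF assms(2,3) _ assms(4), of g'] assms(6,7) by simp
  next
    case False
    have "mixed_trace f g = mixed_trace f f'" by (rule second[OF assms(2,3,5,4) False])
    also have "\<dots> = mixed_trace f' f" by (rule conjunct1[OF swap[OF assms(2,5) False]])
    also have "\<dots> = mixed_trace f' g'" by (rule second[OF assms(5,2,6) _ assms(7)]) (use False in simp)
    finally show ?thesis .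
  qed
  show "jtr V f = jtr V f'"
  proof (cases "f = f'")
    case False
    from swap[OF assms(2,5) this] show ?thesis by (rule conjunct2)
  qed simp
qed

text \<open>Both identities add up a quantity that is constant over the frame. Together they show that the number
of members of a frame and the mixed traces are determined by \<open>f\<close> alone.\<close>

lemma frame_counts:
  assumes F: "orth_system F \<ee>" and f: "f \<in> F" and g: "g \<in> F" "f \<noteq> g"
  shows "real (card F) * jtr V f = real (jrank V)"
    "(real (card F) - 1) * mixed_trace f g = linear_trace (Pih f) / 2"
proof -
  have fin: "finite F" and sumF: "\<Sum>F = \<ee>" and ff: "f \<star> f = f" using F f primitiveD(3) by (auto simp: orth_system_def)
  have "jtr V h = jtr V f" if "h \<in> F" for h
  proof (cases "h = f")
    case False then show ?thesis using frame_homogeneous(2)[OF F that f, of f] f g that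
      by (metis frame_homogeneous(2)[OF F])
  qed simp
  then have "(\<Sum>h\<in>F. jtr V h) = real (card F) * jtr V f" by simp
  then show "real (card F) * jtr V f = real (jrank V)"
    using linear_sum[OF linear_jtr, of "\<lambda>x. x" F] sumF jtr_unit by simp
  have "mixed_trace f (\<ee> - f) = (\<Sum>h\<in>F - {f}. mixed_trace f h)"
  proof -
    have "\<ee> - f = \<Sum>(F - {f})" using sumF sum_diff1[OF fin, of "\<lambda>x. x" f] f by simp
    then show ?thesis by (simp only: linear_sum[OF linear_mixed_trace])
  qed
  also have "\<dots> = (\<Sum>h\<in>F - {f}. mixed_trace f g)"
    by (rule sum.cong[OF refl]) (use frame_homogeneous(1)[OF F f _ _ f g] in auto)
  also have "\<dots> = (real (card F) - 1) * mixed_trace f g"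
    using fin f card_gt_0_iff[of F] by (auto simp: of_nat_diff)
  finally have 1: "mixed_trace f (\<ee> - f) = (real (card F) - 1) * mixed_trace f g" .
  have "Pih f ((\<ee> - f) \<star> z) = (1/2) *\<^sub>R Pih f z" for z
  proof -
    have "Pih f ((\<ee> - f) \<star> z) = Pih f z - f \<star> Pih f z" by (simp add: Pih_def mul_simps algebra_simps)
    moreover have "f \<star> Pih f z = (1/2) *\<^sub>R Pih f z" using Pi_mem(2)[OF ff, of z] by simp
    ultimately show ?thesis by simp (rule vector_eqI_inner, simp add: inner_simps)
  qed
  then have "mixed_trace f (\<ee> - f) = linear_trace (Pih f) / 2"
    by (simp add: mixed_trace_def linear_trace_scaleR)
  then show "(real (card F) - 1) * mixed_trace f g = linear_trace (Pih f) / 2" using 1 by simp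
qed

text \<open>The trace identity that singles out the parameter \<open>\<lambda>\<^sub>1\<close>. Both sides are linear and invariant under the
Cartan involution, so \<open>u\<close> may be taken in \<open>V\<^sup>+\<close>; by the spectral theorem it may be taken to be an
idempotent, then a primitive one. A primitive idempotent orthogonal to \<open>c\<close> belongs to some frame containing \<open>c\<close>,
and the counts for frames through \<open>c\<close> give the constant.\<close>

lemma mixed_trace_eq_jtr:
  assumes F: "orth_system F \<ee>" and c: "c \<in> F" and g: "g \<in> F" "c \<noteq> g" and u: "u \<in> peirce c 0"
  shows "mixed_trace c u = (mixed_trace c g * real (card F) / real (jrank V)) * jtr V u"
proof -
  have cp: "primitive c" using F c by (auto simp: orth_system_def)
  note cc = primitiveD(3)[OF cp] and cV = primitiveD(1)[OF cp]
  define k where "k = mixed_trace c g * real (card F) / real (jrank V)"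
  define l where "l u = mixed_trace c u - k * jtr V u" for u
  have ll: "linear l" unfolding l_def
    by (rule linearI) (simp_all add: linear_add[OF linear_mixed_trace] linear_scale[OF linear_mixed_trace]
        linear_add[OF linear_jtr] linear_scale[OF linear_jtr] algebra_simps)
  have r: "real (jrank V) > 0" using jrank_pos by simp
  have finF: "finite F" using F by (simp add: orth_system_def)
  have "card {c, g} \<le> card F" by (rule card_mono[OF finF]) (use c g in auto)
  then have cF: "card F > 1" using g by simp
  have frame: "l p = 0" if F': "orth_system F' \<ee>" "c \<in> F'" "p \<in> F'" "p \<noteq> c" for F' p
  proof -
    note n = frame_counts[OF F c g] and n' = frame_counts[OF F'(1,2,3)]
    have e1: "real (card F') * jtr V c = real (jrank V)" "(real (card F') - 1) * mixed_trace c p = linear_trace (Pih c) / 2"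
      using n' that by auto
    have "jtr V c \<noteq> 0" using n(1) r by auto
    then have card: "real (card F') = real (card F)" using n(1) e1(1) by (metis mult_right_cancel)
    have nz: "real (card F) - 1 \<noteq> 0" using cF by simp
    have "(real (card F) - 1) * mixed_trace c p = (real (card F) - 1) * mixed_trace c g"
      using n(2) e1(2) card by (simp only:)
    then have m: "mixed_trace c p = mixed_trace c g" by (rule mult_left_cancel[OF nz, THEN iffD1])
    have "jtr V p = jtr V c" by (rule frame_homogeneous(2)[OF F'(1,3,2) _ F'(2,3)]) (use that in auto)
    then have "jtr V p = real (jrank V) / real (card F)" using n(1) cF by (simp add: field_simps)
    then show ?thesis using m cF r by (simp add: l_def k_def)
  qed
  have idem: "l q = 0" if q: "q \<in> Vp" "q \<star> q = q" "c \<star> q = 0" for q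
  proof -
    define w where "w = \<ee> - c - q"
    have qc: "q \<star> c = 0" using q by (simp add: mul_commute)
    have wV: "w \<in> Vp" unfolding w_def using cV q unit_Vp by (intro subspace_diff[OF subspace_Vp])
    have ww: "w \<star> w = w" "q \<star> w = 0" "c \<star> (q + w) = 0" "(q + w) \<star> (q + w) = q + w"
      by (simp_all add: w_def mul_simps cc q qc)
    obtain A where A: "orth_system A q" using ex_orth_system[OF q(1,2)] by blast
    obtain B where B: "orth_system B w" using ex_orth_system[OF wV ww(1)] by blast
    have C: "orth_system {c} c" using cp by (simp add: orth_system_def)
    note AB = orth_system_union[OF A B ww(2) q(2) ww(1)]
    note CAB = orth_system_union[OF C AB(1) ww(3) cc ww(4)]
    have "c + (q + w) = \<ee>" by (simp add: w_def)
    then have fr: "orth_system ({c} \<union> (A \<union> B)) \<ee>" using CAB(1) by simp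
    have "l p = 0" if "p \<in> A" for p by (rule frame[OF fr]) (use that CAB(2) in auto)
    moreover have "l q = (\<Sum>p\<in>A. l p)" using A linear_sum[OF ll, of "\<lambda>x. x" A] by (simp add: orth_system_def)
    ultimately show ?thesis by simp
  qed
  have plus: "l u = 0" if u: "u \<in> Vp" "u \<in> peirce c 0" for u
  proof (rule span_induct[OF spectral_span[OF u(1)]])
    show "subspace {u. l u = 0}" by (simp add: subspace_def linear_0[OF ll] linear_add[OF ll] linear_scale[OF ll])
    fix p assume "p \<in> {p \<in> Vp. p \<star> p = p \<and> (\<exists>q. p = u \<star> pl q u)}"
    then obtain q where p: "p \<in> Vp" "p \<star> p = p" "p = u \<star> pl q u" by blast
    have "p \<in> peirce c 0" unfolding p(3) by (rule pl_peirce[OF cc u(2)]) simp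
    then show "l p = 0" using idem[OF p(1,2)] by simp
  qed
  have tc: "\<theta> c = c" using cV by (simp add: Vp_iff)
  have "mixed_trace c (\<theta> u) = mixed_trace c u" using mixed_trace_aut[OF theta_aut, of c u] tc by simp
  then have lt: "l (\<theta> u) = l u" using jtr_aut[OF theta_aut, of u] by (simp add: l_def)
  have "c \<star> \<theta> u = \<theta> (c \<star> u)" by (simp add: theta_mul tc)
  then have "u + \<theta> u \<in> peirce c 0" using u by (simp add: mul_simps linear_0[OF linear_theta])
  moreover have "u + \<theta> u \<in> Vp" by (simp add: Vp_iff linear_add[OF linear_theta] theta_theta add.commute)
  ultimately have "l (u + \<theta> u) = 0" by (intro plus)
  then have "l u = 0" by (simp add: linear_add[OF ll] lt)
  then show ?thesis by (simp add: l_def k_def)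
qed

end

context cartan_jordan begin

section \<open>Dual bases\<close>

abbreviation dual :: "'a \<Rightarrow> 'a" where "dual b \<equiv> dual_basis V b"

lemma tau_dual: "b \<in> Basis \<Longrightarrow> b' \<in> Basis \<Longrightarrow> tau b' (dual b) = of_bool (b' = b)"
proof -
  assume b: "b \<in> Basis"
  have lin: "linear (\<lambda>x. inner x b)" by (simp add: bounded_linear.linear bounded_linear_inner_left)
  obtain w where w: "\<And>x. inner x b = tau w x" using tau_representation[OF lin] by blast
  let ?P = "\<lambda>y. \<forall>b'\<in>Basis. tau b' y = of_bool (b' = b)"
  have "?P w" using b w by (simp add: tau_commute[of _ w] w[symmetric] inner_Basis)
  moreover have "y = w" if "?P y" for y
  proof (rule tau_eqI)
    fix x
    have "tau y x = (\<Sum>b'\<in>Basis. inner x b' * tau b' y)"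
      using tau_sum(2)[of y "\<lambda>b'. inner x b' *\<^sub>R b'" Basis] by (simp add: euclidean_representation tau_simps tau_commute)
    also have "\<dots> = (\<Sum>b'\<in>Basis. inner x b' * tau b' w)" using that \<open>?P w\<close> by simp
    also have "\<dots> = tau w x"
      using tau_sum(2)[of w "\<lambda>b'. inner x b' *\<^sub>R b'" Basis] by (simp add: euclidean_representation tau_simps tau_commute)
    finally show "tau y x = tau w x" .
  qed
  ultimately have "\<exists>!y. ?P y" by (rule ex1I)
  from theI'[OF this] have "?P (dual b)" unfolding dual_basis_def .
  then show "b' \<in> Basis \<Longrightarrow> tau b' (dual b) = of_bool (b' = b)" by blast
qed

lemma inner_eq_tau_dual: "b \<in> Basis \<Longrightarrow> inner x b = tau x (dual b)"
proof -
  assume b: "b \<in> Basis"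
  have "tau x (dual b) = (\<Sum>b'\<in>Basis. inner x b' * tau b' (dual b))"
    using tau_sum(1)[of "\<lambda>b'. inner x b' *\<^sub>R b'" Basis] by (simp add: euclidean_representation tau_simps)
  also have "\<dots> = (\<Sum>b'\<in>Basis. if b' = b then inner x b' else 0)" by (rule sum.cong) (auto simp: tau_dual b)
  finally show ?thesis using b by simp
qed

lemma basis_expand: "(\<Sum>b\<in>Basis. tau x (dual b) *\<^sub>R b) = x"
  using euclidean_representation[of x] by (simp add: inner_eq_tau_dual)

lemma dual_expand: "(\<Sum>b\<in>Basis. tau x b *\<^sub>R dual b) = x"
proof (rule tau_eqI)
  fix y
  have "tau (\<Sum>b\<in>Basis. tau x b *\<^sub>R dual b) y = (\<Sum>b\<in>Basis. tau x b * tau y (dual b))"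
    by (simp add: tau_sum tau_simps tau_commute)
  also have "\<dots> = tau x (\<Sum>b\<in>Basis. tau y (dual b) *\<^sub>R b)" by (simp add: tau_sum tau_simps mult.commute)
  finally show "tau (\<Sum>b\<in>Basis. tau x b *\<^sub>R dual b) y = tau x y" by (simp only: basis_expand)
qed

lemma bilinear_sums:
  assumes "bilinear (\<kappa> :: 'a \<Rightarrow> 'a \<Rightarrow> real)"
  shows "\<kappa> (\<Sum>i\<in>I. f i *\<^sub>R g i) y = (\<Sum>i\<in>I. f i * \<kappa> (g i) y)" "\<kappa> x (\<Sum>i\<in>I. f i *\<^sub>R g i) = (\<Sum>i\<in>I. f i * \<kappa> x (g i))"
  by (induction I rule: infinite_finite_induct)
     (simp_all add: bilinear_lzero[OF assms] bilinear_rzero[OF assms] bilinear_ladd[OF assms] bilinear_radd[OF assms]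
       bilinear_lmul[OF assms] bilinear_rmul[OF assms])

text \<open>The tensor \<open>\<Sum> b\<^sup>* \<otimes> b\<close> is inverse to the symmetric form \<open>\<tau>\<close>, hence symmetric itself. The next lemma
uses the same invariance to move a linear map from one leg to its adjoint on the other.\<close>

lemma casimir_swap:
  assumes "bilinear (\<kappa> :: 'a \<Rightarrow> 'a \<Rightarrow> real)"
  shows "(\<Sum>b\<in>Basis. \<kappa> (dual b) b) = (\<Sum>b\<in>Basis. \<kappa> b (dual b))"
proof -
  have "(\<Sum>b\<in>Basis. \<kappa> (dual b) b) = (\<Sum>b\<in>Basis. \<Sum>a\<in>Basis. tau (dual b) (dual a) * \<kappa> a b)"
  proof (rule sum.cong[OF refl])
    fix b :: 'a
    have "\<kappa> (dual b) b = \<kappa> (\<Sum>a\<in>Basis. tau (dual b) (dual a) *\<^sub>R a) b" by (simp only: basis_expand)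
    then show "\<kappa> (dual b) b = (\<Sum>a\<in>Basis. tau (dual b) (dual a) * \<kappa> a b)" by (simp only: bilinear_sums[OF assms])
  qed
  also have "\<dots> = (\<Sum>a\<in>Basis. \<Sum>b\<in>Basis. tau (dual a) (dual b) * \<kappa> a b)"
    by (subst sum.swap) (simp add: tau_commute)
  also have "\<dots> = (\<Sum>a\<in>Basis. \<kappa> a (\<Sum>b\<in>Basis. tau (dual a) (dual b) *\<^sub>R b))" by (simp only: bilinear_sums[OF assms])
  finally show ?thesis by (simp only: basis_expand)
qed

lemma casimir_move:
  assumes k: "bilinear (\<kappa> :: 'a \<Rightarrow> 'a \<Rightarrow> real)" and adj: "\<And>x y. tau (A x) y = tau x (A' y)"
  shows "(\<Sum>b\<in>Basis. \<kappa> (dual b) (A b)) = (\<Sum>b\<in>Basis. \<kappa> (A' (dual b)) b)"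
proof -
  have "(\<Sum>b\<in>Basis. \<kappa> (dual b) (A b)) = (\<Sum>b\<in>Basis. \<Sum>a\<in>Basis. tau (A b) (dual a) * \<kappa> (dual b) a)"
  proof (rule sum.cong[OF refl])
    fix b :: 'a
    have "\<kappa> (dual b) (A b) = \<kappa> (dual b) (\<Sum>a\<in>Basis. tau (A b) (dual a) *\<^sub>R a)" by (simp only: basis_expand)
    then show "\<kappa> (dual b) (A b) = (\<Sum>a\<in>Basis. tau (A b) (dual a) * \<kappa> (dual b) a)" by (simp only: bilinear_sums[OF k])
  qed
  also have "\<dots> = (\<Sum>a\<in>Basis. \<Sum>b\<in>Basis. tau (A' (dual a)) b * \<kappa> (dual b) a)"
    by (subst sum.swap) (simp add: adj tau_commute)
  also have "\<dots> = (\<Sum>a\<in>Basis. \<kappa> (\<Sum>b\<in>Basis. tau (A' (dual a)) b *\<^sub>R dual b) a)" by (simp only: bilinear_sums[OF k])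
  finally show ?thesis by (simp only: dual_expand)
qed

lemma linear_trace_dual: assumes "linear T" shows "linear_trace T = (\<Sum>b\<in>Basis. tau (T (dual b)) b)"
proof -
  have k: "bilinear (\<lambda>x y. tau (T x) y)"
    by (auto simp: bilinear_def tau_simps linear_add[OF assms] linear_scale[OF assms] intro!: linearI)
  have "linear_trace T = (\<Sum>b\<in>Basis. tau (T b) (dual b))" by (simp add: linear_trace_def inner_eq_tau_dual)
  then show ?thesis using casimir_swap[OF k] by simp
qed

text \<open>Exchanges the arguments of the second-order coefficients of the Bessel operator with the base point and
the component, so that one of the two dual bases can be summed away.\<close>

lemma tau_jP_rotate: "tau (jP V a b z) c = tau a (jP V c z b)"
proof -
  have 1: "tau (a \<star> (b \<star> z)) c = tau a (c \<star> (z \<star> b))"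
    using tau_assoc[of a "b \<star> z" c] by (simp only: mul_commute[of b z] mul_commute[of c "z \<star> b"])
  have 2: "tau (b \<star> (a \<star> z)) c = tau a (z \<star> (c \<star> b))"
    using tau_mul[of b "a \<star> z" c] tau_assoc[of a z "b \<star> c"] by (simp only: mul_commute[of b c])
  have 3: "tau ((a \<star> b) \<star> z) c = tau a ((c \<star> z) \<star> b)"
    using tau_assoc[of "a \<star> b" z c] tau_assoc[of a b "z \<star> c"]
    by (simp only: mul_commute[of z c] mul_commute[of b "c \<star> z"])
  show ?thesis by (simp only: jP_def tau_simps 1 2 3)
qed

lemma double_casimir:
  assumes "bilinear \<beta>"
  shows "(\<Sum>a\<in>Basis. \<Sum>b\<in>Basis. \<beta> a b * tau (jP V (dual a) (dual b) z) c) = (\<Sum>b\<in>Basis. \<beta> (jP V c z (dual b)) b)"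
proof -
  have "(\<Sum>a\<in>Basis. \<Sum>b\<in>Basis. \<beta> a b * tau (jP V (dual a) (dual b) z) c)
      = (\<Sum>b\<in>Basis. \<Sum>a\<in>Basis. tau (jP V c z (dual b)) (dual a) * \<beta> a b)"
    by (subst sum.swap) (simp only: tau_jP_rotate[of "dual _"] tau_commute[of "dual _" "jP V c _ _"] mult.commute)
  also have "\<dots> = (\<Sum>b\<in>Basis. \<beta> (\<Sum>a\<in>Basis. tau (jP V c z (dual b)) (dual a) *\<^sub>R a) b)"
    by (simp only: bilinear_sums[OF assms])
  finally show ?thesis by (simp only: basis_expand)
qed

text \<open>The second-order symbol of the Bessel operator is equivariant under the structure group; \<open>h\<close> is the
adjoint of \<open>g\<close>. It reduces computations at a point \<open>g c\<close> of the orbit to \<open>c\<close>.\<close>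

lemma bessel_symbol_transform:
  fixes \<beta> :: "'a \<Rightarrow> 'a \<Rightarrow> real"
  assumes b: "bilinear \<beta>" and lg: "linear g" and lh: "linear h" and adj: "\<And>x y. tau (g x) y = tau x (h y)"
    and inter: "\<And>\<xi> u. h (Pop \<xi> (g u)) = Pop (h \<xi>) u"
  shows "(\<Sum>a\<in>Basis. \<Sum>b\<in>Basis. \<beta> a b * tau (jP V (dual a) (dual b) (g z)) (g c))
    = (\<Sum>a\<in>Basis. \<Sum>b\<in>Basis. \<beta> (g a) (g b) * tau (jP V (dual a) (dual b) z) c)"
proof -
  have interP: "h (jP V \<xi> \<eta> (g u)) = jP V (h \<xi>) (h \<eta>) u" for \<xi> \<eta> u
  proof -
    have hadd: "h (x + y) = h x + h y" and hsc: "h (2 *\<^sub>R x) = 2 *\<^sub>R h x" for x y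
      using linear_add[OF lh, of x y] linear_scale[OF lh, of 2 x] by simp_all
    have "h (Pop (\<xi> + \<eta>) (g u)) = h (Pop \<xi> (g u)) + 2 *\<^sub>R h (jP V \<xi> \<eta> (g u)) + h (Pop \<eta> (g u))"
      unfolding Pop_add hadd hsc ..
    moreover have "h (Pop (\<xi> + \<eta>) (g u)) = Pop (h \<xi>) u + 2 *\<^sub>R jP V (h \<xi>) (h \<eta>) u + Pop (h \<eta>) u"
      using inter[of "\<xi> + \<eta>" u] unfolding hadd[of \<xi> \<eta>] Pop_add[of "h \<xi>"] .
    ultimately have "2 *\<^sub>R h (jP V \<xi> \<eta> (g u)) = 2 *\<^sub>R jP V (h \<xi>) (h \<eta>) u"
      by (simp only: inter[of \<xi>] inter[of \<eta>] add_right_cancel add_left_cancel)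
    then show ?thesis by simp
  qed
  have e: "tau (jP V (dual a) (dual b) (g z)) (g c) = tau (jP V (h (dual a)) (h (dual b)) z) c" for a b
    by (metis adj interP tau_commute)
  have k1: "bilinear (\<lambda>x y. \<beta> y b * tau (jP V x (h (dual b)) z) c)" for b
    by (auto simp: bilinear_def tau_simps jP_add1 jP_scale1 bilinear_ladd[OF b] bilinear_lmul[OF b] algebra_simps intro!: linearI)
  have k2: "bilinear (\<lambda>x y. \<beta> (g a) y * tau (jP V (dual a) x z) c)" for a
    by (auto simp: bilinear_def tau_simps jP_add2 jP_scale2 bilinear_radd[OF b] bilinear_rmul[OF b] algebra_simps intro!: linearI)
  have "(\<Sum>a\<in>Basis. \<Sum>b\<in>Basis. \<beta> a b * tau (jP V (dual a) (dual b) (g z)) (g c))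
     = (\<Sum>b\<in>Basis. \<Sum>a\<in>Basis. \<beta> a b * tau (jP V (h (dual a)) (h (dual b)) z) c)"
    unfolding e by (rule sum.swap)
  also have "\<dots> = (\<Sum>b\<in>Basis. \<Sum>a\<in>Basis. \<beta> (g a) b * tau (jP V (dual a) (h (dual b)) z) c)"
    by (rule sum.cong[OF refl], rule casimir_move[OF k1 adj, symmetric])
  also have "\<dots> = (\<Sum>a\<in>Basis. \<Sum>b\<in>Basis. \<beta> (g a) b * tau (jP V (dual a) (h (dual b)) z) c)" by (rule sum.swap)
  also have "\<dots> = (\<Sum>a\<in>Basis. \<Sum>b\<in>Basis. \<beta> (g a) (g b) * tau (jP V (dual a) (dual b) z) c)"
    by (rule sum.cong[OF refl], rule casimir_move[OF k2 adj, symmetric])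
  finally show ?thesis .
qed

end

section \<open>Tangentiality: the algebraic core\<close>

context cartan_jordan_simple begin

text \<open>Here \<open>\<alpha>\<close> and \<open>\<beta>\<close> stand for the first and second derivatives at \<open>c\<close> of a function vanishing on the
orbit; the hypotheses are the relations obtained along curves, where \<open>V c\<close> is the tangent
space. By them \<open>\<alpha>\<close> is \<open>\<tau>(w, \<cdot>)\<close> for some \<open>w\<close> in the 0-space, and \<open>\<beta>\<close> on tangent vectors is a multiple
of \<open>\<tau>(w, \<cdot>)\<close> of the product of their components in the 1/2-space. The sum is then minus twice the trace
of \<open>L(w) L(z\<^sub>0)\<close> on the 1/2-space. Symmetrising, the representation property of the 0-space makes it
minus the mixed trace of \<open>w z\<^sub>0\<close>, hence a multiple of \<open>\<tau>(w, z) = \<alpha>(z)\<close>.\<close>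

lemma tangential_core:
  fixes \<alpha> :: "'a \<Rightarrow> real" and \<beta> :: "'a \<Rightarrow> 'a \<Rightarrow> real"
  assumes F: "orth_system F \<ee>" and c: "c \<in> F" and g: "g \<in> F" "c \<noteq> g"
    and la: "linear \<alpha>" and b: "bilinear \<beta>"
    and first: "\<And>x. \<alpha> (x \<star> c) = 0" and second: "\<And>x y. \<beta> (x \<star> c) (y \<star> c) = - \<alpha> (x \<star> (y \<star> c))"
  shows "(\<Sum>a\<in>Basis. \<Sum>b\<in>Basis. \<beta> a b * tau (jP V (dual a) (dual b) z) c)
     + (mixed_trace c g * real (card F) / real (jrank V)) * \<alpha> z = 0"
proof -
  have cp: "primitive c" using F c by (auto simp: orth_system_def)
  note cc = primitiveD(3)[OF cp]
  define l where "l = mixed_trace c g * real (card F) / real (jrank V)"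
  define M where "M v = jP V c z v" for v
  have lM: "linear M" unfolding M_def by (rule linear_jP3)
  have M_adj: "tau (M x) y = tau x (M y)" for x y unfolding M_def by (rule tau_jP)
  note P1 = Pi_mem(1)[OF cc] and Ph = Pi_mem(2)[OF cc] and P0 = Pi_mem(3)[OF cc]
  have c1: "c \<star> Pi1 c v = Pi1 c v" and ch: "c \<star> Pih c v = (1/2) *\<^sub>R Pih c v" and c0: "c \<star> Pi0 c v = 0" for v
    using P1[of v] Ph[of v] P0[of v] by simp_all
  have dec: "v = Pi1 c v + Pih c v + Pi0 c v" for v by (rule Pi_sum[symmetric])
  \<comment> \<open>\<open>M\<close> kills the 0-space, hence by symmetry takes values in the tangent space.\<close>
  have M0: "M (Pi0 c v) = 0" for v
  proof -
    have 1: "Pi1 c z \<star> Pi0 c v = 0" by (rule peirce_1_0[OF cc P1 P0])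
    have h: "c \<star> (Pih c z \<star> Pi0 c v) = (1/2) *\<^sub>R (Pih c z \<star> Pi0 c v)" using peirce_h_0[OF cc Ph P0] by simp
    have 0: "c \<star> (Pi0 c z \<star> Pi0 c v) = 0" using peirce_0_0[OF cc P0 P0] by simp
    have "M (Pi0 c v) = c \<star> (z \<star> Pi0 c v) - (c \<star> z) \<star> Pi0 c v" by (simp add: M_def jP_def c0 mul_simps)
    also have "z \<star> Pi0 c v = Pih c z \<star> Pi0 c v + Pi0 c z \<star> Pi0 c v"
      by (subst dec[of z]) (simp only: mul_simps 1 add_0)
    also have "(c \<star> z) \<star> Pi0 c v = (1/2) *\<^sub>R (Pih c z \<star> Pi0 c v)"
      by (subst dec[of z]) (simp only: mul_simps c1 ch c0 1 add_0 add_0_right)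
    finally show ?thesis by (simp add: mul_simps h 0)
  qed
  have PM: "Pi0 c (M v) = 0" for v
    by (rule tau_nondegenerate) (simp add: tau_Pi M_adj M0 tau_simps)
  have a1: "\<alpha> v = 0" if "v \<in> peirce c 1" for v using first[of v] that by (simp add: mul_commute)
  have ah: "\<alpha> v = 0" if "v \<in> peirce c (1/2)" for v
    using first[of "2 *\<^sub>R v"] that by (simp add: mul_simps mul_commute[of v c])
  have \<beta>T: "\<beta> u v = - 2 * \<alpha> (Pih c u \<star> Pih c v)" if u: "Pi0 c u = 0" and v: "Pi0 c v = 0" for u v
  proof -
    have tc: "w = (Pi1 c w + 2 *\<^sub>R Pih c w) \<star> c" if "Pi0 c w = 0" for w
    proof -
      have "c \<star> (Pi1 c w + 2 *\<^sub>R Pih c w) = Pi1 c w + Pih c w" by (simp add: mul_simps c1 ch)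
      then show ?thesis using dec[of w] that by (simp add: mul_commute)
    qed
    have dv: "v = Pi1 c v + Pih c v" using dec[of v] v by simp
    define u' v' where "u' = Pi1 c u + 2 *\<^sub>R Pih c u" and "v' = Pi1 c v + 2 *\<^sub>R Pih c v"
    have uu: "u' \<star> c = u" and vv: "v' \<star> c = v" using tc[OF u] tc[OF v] by (simp_all only: u'_def v'_def)
    have "\<beta> u v = - \<alpha> ((Pi1 c u + 2 *\<^sub>R Pih c u) \<star> v)"
      using second[of u' v'] unfolding uu vv by (simp only: u'_def)
    also have "(Pi1 c u + 2 *\<^sub>R Pih c u) \<star> v = (Pi1 c u + 2 *\<^sub>R Pih c u) \<star> (Pi1 c v + Pih c v)"
      by (rule arg_cong[OF dv])
    also have "\<dots> = Pi1 c u \<star> Pi1 c v + Pi1 c u \<star> Pih c v + 2 *\<^sub>R (Pih c u \<star> Pi1 c v) + 2 *\<^sub>R (Pih c u \<star> Pih c v)"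
      by (simp add: mul_simps scaleR_add_right)
    finally show ?thesis
      using a1[OF peirce_1_1[OF cc P1 P1, of u v]] ah[OF peirce_1_h[OF cc P1 Ph, of u v]] ah[OF peirce_h_1[OF cc Ph P1, of u v]]
      by (simp add: linear_add[OF la] linear_scale[OF la])
  qed
  obtain w where w: "\<And>x. \<alpha> x = tau w x" using tau_representation[OF la] by blast
  have w1: "Pi1 c w = 0" by (rule tau_nondegenerate) (simp add: tau_Pi w[symmetric] a1[OF P1])
  have wh: "Pih c w = 0" by (rule tau_nondegenerate) (simp add: tau_Pi w[symmetric] ah[OF Ph])
  have w0: "w \<in> peirce c 0" using dec[of w] P0[of w] w1 wh by simp
  define A where "A v = Pih c (w \<star> Pih c v)" for v
  define B where "B v = Pih c (Pi0 c z \<star> Pih c v)" for v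
  define C where "C v = Pih c (M v)" for v
  have lA: "linear A" and lB: "linear B" and lC: "linear C" unfolding A_def B_def C_def
    by (rule linearI; simp add: linear_add[OF linear_Pi(2)] linear_scale[OF linear_Pi(2)] linear_add[OF lM] linear_scale[OF lM] mul_simps)+
  have PP: "Pih c (Pih c v) = Pih c v" for v using Pi_on_peirce(2)[OF Ph[of v]] by blast
  have stay: "Pih c (y \<star> Pih c v) = y \<star> Pih c v" if "y \<in> peirce c 0" for y v
    using Pi_on_peirce(2)[OF peirce_0_h[OF cc that Ph[of v]]] by blast
  have sum1: "(\<Sum>b\<in>Basis. \<beta> (M (dual b)) b) = - 2 * linear_trace (\<lambda>v. A (C v))"
  proof -
    have k: "bilinear (\<lambda>x y. \<beta> (M x) y)"
      by (auto simp: bilinear_def linear_add[OF lM] linear_scale[OF lM] bilinear_ladd[OF b] bilinear_radd[OF b]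
         bilinear_lmul[OF b] bilinear_rmul[OF b] intro!: linearI)
    have "(\<Sum>b\<in>Basis. \<beta> (M (dual b)) (Pi0 c b)) = (\<Sum>b\<in>Basis. \<beta> (M (Pi0 c (dual b))) b)"
      by (rule casimir_move[OF k]) (rule tau_Pi)
    also have "\<dots> = 0" by (simp add: M0 bilinear_lzero[OF b])
    finally have z0: "(\<Sum>b\<in>Basis. \<beta> (M (dual b)) (Pi0 c b)) = 0" .
    have step: "\<beta> (M (dual b)) b = \<beta> (M (dual b)) (Pi0 c b) + - 2 * tau (A (C (dual b))) b" for b :: 'a
    proof -
      have p: "Pi0 c (b - Pi0 c b) = 0" "Pih c (b - Pi0 c b) = Pih c b"
        using Pi_on_peirce(3)[OF P0[of b]] by (simp_all add: linear_diff[OF linear_Pi(3)] linear_diff[OF linear_Pi(2)])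
      have "\<beta> (M (dual b)) (b - Pi0 c b) = - 2 * \<alpha> (Pih c (M (dual b)) \<star> Pih c b)"
        using \<beta>T[OF PM p(1)] by (simp add: p(2))
      also have "\<alpha> (Pih c (M (dual b)) \<star> Pih c b) = tau (w \<star> Pih c (M (dual b))) (Pih c b)"
        by (simp only: w tau_assoc)
      also have "\<dots> = tau (A (C (dual b))) b" by (simp only: A_def C_def PP tau_Pi)
      finally show ?thesis by (simp add: bilinear_rsub[OF b])
    qed
    have lAC: "linear (\<lambda>v. A (C v))" using linear_compose[OF lC lA] by (simp add: o_def)
    have "(\<Sum>b\<in>Basis. \<beta> (M (dual b)) b) = (\<Sum>b\<in>Basis. - 2 * tau (A (C (dual b))) b)"
      by (subst step) (simp only: sum.distrib z0 add_0)
    also have "\<dots> = - 2 * (\<Sum>b\<in>Basis. tau (A (C (dual b))) b)" by (simp only: sum_distrib_left)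
    finally show ?thesis by (simp only: linear_trace_dual[OF lAC])
  qed
  have "linear_trace (\<lambda>v. A (C v)) = linear_trace (\<lambda>v. Pih c (A (C v)))" by (simp only: A_def PP)
  also have "\<dots> = linear_trace (\<lambda>v. A (C (Pih c v)))"
    using linear_trace_comp_commute[OF linear_Pi(2)[of c] linear_compose[OF lC lA]] by (simp add: o_def)
  also have "(\<lambda>v. A (C (Pih c v))) = (\<lambda>v. A (B v))"
  proof
    fix v
    let ?v = "Pih c v"
    have "Pih c (c \<star> y) = c \<star> Pih c y" for y by (simp add: Pih_def mul_simps)
    then have pc: "Pih c (c \<star> y) = (1/2) *\<^sub>R Pih c y" for y by (simp add: ch)
    have "C ?v = Pih c (c \<star> (z \<star> ?v)) + Pih c (z \<star> (c \<star> ?v)) - Pih c ((c \<star> z) \<star> ?v)"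
      by (simp add: C_def M_def jP_def linear_add[OF linear_Pi(2)] linear_diff[OF linear_Pi(2)])
    also have "Pih c (c \<star> (z \<star> ?v)) + Pih c (z \<star> (c \<star> ?v)) = Pih c (z \<star> ?v)"
      by (simp add: pc ch mul_simps linear_scale[OF linear_Pi(2)] flip: scaleR_left_distrib)
    also have "Pih c (z \<star> ?v) - Pih c ((c \<star> z) \<star> ?v) = Pih c ((z - c \<star> z) \<star> ?v)"
      by (simp only: mul_simps linear_diff[OF linear_Pi(2)])
    also have "z - c \<star> z = (1/2) *\<^sub>R Pih c z + Pi0 c z"
    proof -
      have "c \<star> z = Pi1 c z + (1/2) *\<^sub>R Pih c z" by (subst dec[of z]) (simp only: mul_simps c1 ch c0 add_0_right)
      then have "z - c \<star> z = (Pi1 c z + Pih c z + Pi0 c z) - (Pi1 c z + (1/2) *\<^sub>R Pih c z)" by (simp only: Pi_sum)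
      then show ?thesis by simp (rule vector_eqI_inner, simp add: inner_simps)
    qed
    also have "Pih c (((1/2) *\<^sub>R Pih c z + Pi0 c z) \<star> ?v) = (1/2) *\<^sub>R Pih c (Pih c z \<star> ?v) + Pih c (Pi0 c z \<star> ?v)"
      by (simp only: mul_simps linear_add[OF linear_Pi(2)] linear_scale[OF linear_Pi(2)])
    also have "\<dots> = B v" by (simp add: peirce_h_h[OF cc Ph Ph] B_def)
    finally show "A (C ?v) = A (B v)" by simp
  qed
  finally have AC: "linear_trace (\<lambda>v. A (C v)) = linear_trace (\<lambda>v. A (B v))" .
  have "linear_trace (\<lambda>v. A (B v)) + linear_trace (\<lambda>v. A (B v)) = linear_trace (\<lambda>v. A (B v)) + linear_trace (\<lambda>v. B (A v))"
    using linear_trace_comp_commute[OF lA lB] by simp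
  also have "\<dots> = linear_trace (\<lambda>v. Pih c ((w \<star> Pi0 c z) \<star> Pih c v))"
  proof -
    have "A (B v) + B (A v) = Pih c ((w \<star> Pi0 c z) \<star> Pih c v)" for v
    proof -
      have "A (B v) = w \<star> (Pi0 c z \<star> Pih c v)" and "B (A v) = Pi0 c z \<star> (w \<star> Pih c v)"
        unfolding A_def B_def using stay[OF w0] stay[OF P0] by metis+
      moreover have "Pih c ((w \<star> Pi0 c z) \<star> Pih c v) = (w \<star> Pi0 c z) \<star> Pih c v"
        by (rule stay[OF peirce_0_0[OF cc w0 P0]])
      ultimately show ?thesis using peirce_0_rep[OF cc w0 P0 Ph, of z v] by simp
    qed
    then show ?thesis by (simp only: linear_trace_add[symmetric])
  qed
  also have "\<dots> = mixed_trace c (w \<star> Pi0 c z)"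
    using linear_trace_comp_commute[OF linear_compose[OF linear_mul_right linear_Pi(2)], of "Pih c" c "w \<star> Pi0 c z"] linear_Pi(2)[of c]
    by (simp add: o_def mixed_trace_def PP)
  also have "\<dots> = l * jtr V (w \<star> Pi0 c z)"
    unfolding l_def by (rule mixed_trace_eq_jtr[OF F c g peirce_0_0[OF cc w0 P0]])
  also have "jtr V (w \<star> Pi0 c z) = tau w z"
    using tau_Pi(3)[of c w z] Pi_on_peirce(3)[OF w0] by (simp add: jtau_def)
  finally have two: "2 * linear_trace (\<lambda>v. A (B v)) = l * tau w z" by simp
  have "(\<Sum>a\<in>Basis. \<Sum>b\<in>Basis. \<beta> a b * tau (jP V (dual a) (dual b) z) c) = (\<Sum>b\<in>Basis. \<beta> (M (dual b)) b)"
    unfolding M_def by (rule double_casimir[OF b])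
  also have "\<dots> = - (l * \<alpha> z)" using sum1 AC two w[of z] by simp
  finally show ?thesis by (simp add: l_def)
qed

end

section \<open>Calculus of smooth functions\<close>

lemma dir_deriv_eqI: "(f has_derivative f') (at x) \<Longrightarrow> dir_deriv v f x = f' v"
  by (simp add: dir_deriv_def frechet_derivative_at[of f f' x, symmetric])

lemma has_derivative_dir_deriv: "f differentiable (at x) \<Longrightarrow> (f has_derivative (\<lambda>v. dir_deriv v f x)) (at x)"
  using frechet_derivative_works[of f "at x"] by (simp add: dir_deriv_def)

text \<open>Stated for the relation \<open>has_derivative\<close>, so that it carries over to the total function
\<open>frechet_derivative\<close>, whatever its value at points without a derivative.\<close>

lemma has_derivative_cong_open:
  assumes "open U" "x \<in> U" "\<And>y. y \<in> U \<Longrightarrow> f y = g y"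
  shows "(f has_derivative f') (at x) \<longleftrightarrow> (g has_derivative f') (at x)"
  using assms has_derivative_transform_within_open[of f f' x UNIV U g] has_derivative_transform_within_open[of g f' x UNIV U f] by auto

lemma dir_deriv_cong:
  assumes "open U" "x \<in> U" "\<And>y. y \<in> U \<Longrightarrow> f y = g y"
  shows "dir_deriv v f x = dir_deriv v g x"
  using has_derivative_cong_open[of U x f g, OF assms] by (simp add: dir_deriv_def frechet_derivative_def)

lemma dir_deriv_linear: "linear f \<Longrightarrow> dir_deriv v f x = f v"
  by (rule dir_deriv_eqI) (rule linear_imp_has_derivative)

lemma dir_deriv_const: "dir_deriv v (\<lambda>x. k) x = 0"
  by (rule dir_deriv_eqI[where f' = "\<lambda>v. 0"]) (rule has_derivative_const)

lemma dir_deriv_add: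
  assumes "f differentiable (at x)" "g differentiable (at x)"
  shows "dir_deriv v (\<lambda>x. f x + g x) x = dir_deriv v f x + dir_deriv v g x"
  by (rule dir_deriv_eqI) (rule has_derivative_add[OF assms[THEN has_derivative_dir_deriv]])

lemma dir_deriv_mult:
  assumes "f differentiable (at x)" "g differentiable (at x)"
  shows "dir_deriv v (\<lambda>x. f x * g x) x = f x * dir_deriv v g x + dir_deriv v f x * g x"
  by (rule dir_deriv_eqI) (rule has_derivative_mult[OF assms[THEN has_derivative_dir_deriv]])

lemma dir_deriv_cmult:
  assumes "f differentiable (at x)" shows "dir_deriv v (\<lambda>x. k * f x) x = k * dir_deriv v f x"
  using dir_deriv_mult[of "\<lambda>x. k" x f v] assms by (simp add: dir_deriv_const)

lemma dir_deriv_sum: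
  assumes "\<And>i. i \<in> I \<Longrightarrow> f i differentiable (at x)"
  shows "dir_deriv v (\<lambda>x. \<Sum>i\<in>I. f i x) x = (\<Sum>i\<in>I. dir_deriv v (f i) x)"
  by (rule dir_deriv_eqI) (rule has_derivative_sum[OF assms[THEN has_derivative_dir_deriv]])

lemma linear_dir_deriv: "f differentiable (at x) \<Longrightarrow> linear (\<lambda>v. dir_deriv v f x)"
  by (rule has_derivative_linear[OF has_derivative_dir_deriv])

lemma dir_deriv_sum_dir:
  assumes "f differentiable (at x)"
  shows "dir_deriv (\<Sum>i\<in>I. k i *\<^sub>R v i) f x = (\<Sum>i\<in>I. k i * dir_deriv (v i) f x)"
  using linear_sum[OF linear_dir_deriv[OF assms], of "\<lambda>i. k i *\<^sub>R v i" I] linear_scale[OF linear_dir_deriv[OF assms]]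
  by (simp cong: sum.cong)

lemma Ck_on_subset: "V \<subseteq> U \<Longrightarrow> Ck_on k U f \<Longrightarrow> Ck_on k V f"
  by (induction k arbitrary: f) (auto intro: continuous_on_subset)

lemma Ck_on_cong: "open U \<Longrightarrow> (\<And>y. y \<in> U \<Longrightarrow> f y = g y) \<Longrightarrow> Ck_on k U f \<Longrightarrow> Ck_on k U g"
proof (induction k arbitrary: f g)
  case 0 then show ?case using continuous_on_cong[of U U f g] by simp
next
  case (Suc k)
  have "g differentiable (at x)" if "x \<in> U" for x
    using Suc.prems that has_derivative_cong_open[of U x f g] unfolding Ck_on.simps differentiable_def by blast
  moreover have "Ck_on k U (dir_deriv v g)" for v
    using Suc.IH[of "dir_deriv v f" "dir_deriv v g"] Suc.prems dir_deriv_cong[of U _ f g v] by auto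
  ultimately show ?case by simp
qed

lemma Ck_on_Suc: "Ck_on (Suc k) U f \<Longrightarrow> Ck_on k U f"
proof (induction k arbitrary: f)
  case 0
  then have "\<And>x. x \<in> U \<Longrightarrow> f differentiable (at x)" by simp
  then show ?case by (auto intro!: continuous_at_imp_continuous_on differentiable_imp_continuous_within)
next
  case (Suc k) then show ?case by (metis Ck_on.simps(2))
qed

lemma Ck_on_add: "open U \<Longrightarrow> Ck_on k U f \<Longrightarrow> Ck_on k U g \<Longrightarrow> Ck_on k U (\<lambda>x. f x + g x)"
proof (induction k arbitrary: f g)
  case 0 then show ?case by (simp add: continuous_on_add)
next
  case (Suc k)
  have "Ck_on k U (dir_deriv v (\<lambda>x. f x + g x))" for v
    by (rule Ck_on_cong[OF Suc.prems(1) _ Suc.IH[OF Suc.prems(1), of "dir_deriv v f" "dir_deriv v g"]])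
       (use Suc.prems in \<open>simp_all add: dir_deriv_add\<close>)
  then show ?case using Suc.prems by simp
qed

text \<open>Leibniz' rule expresses the derivative through products of functions that are of one class lower.\<close>

lemma Ck_on_mult: "open U \<Longrightarrow> Ck_on k U f \<Longrightarrow> Ck_on k U g \<Longrightarrow> Ck_on k U (\<lambda>x. f x * g x)"
proof (induction k arbitrary: f g)
  case 0 then show ?case by (simp add: continuous_on_mult)
next
  case (Suc k)
  have fg: "Ck_on k U f" "Ck_on k U g" using Suc.prems Ck_on_Suc by blast+
  have "Ck_on k U (dir_deriv v (\<lambda>x. f x * g x))" for v
    by (rule Ck_on_cong[OF Suc.prems(1) _ Ck_on_add[OF Suc.prems(1)
          Suc.IH[OF Suc.prems(1) fg(1), of "dir_deriv v g"] Suc.IH[OF Suc.prems(1) _ fg(2), of "dir_deriv v f"]]])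
       (use Suc.prems in \<open>simp_all add: dir_deriv_mult\<close>)
  then show ?case using Suc.prems by simp
qed

lemma Ck_on_const: "Ck_on k U (\<lambda>x. c)"
  by (induction k arbitrary: c) (simp_all add: dir_deriv_const[abs_def] dir_deriv_def)

lemma Ck_on_linear: assumes "linear f" shows "Ck_on k U f"
proof (cases k)
  case 0 then show ?thesis using assms by (simp add: linear_continuous_on linear_conv_bounded_linear)
next
  case (Suc k)
  have "dir_deriv v f = (\<lambda>x. f v)" for v using dir_deriv_linear[OF assms] by auto
  then show ?thesis using assms Suc by (simp add: Ck_on_const linear_imp_differentiable)
qed

lemma smooth_on_open: "smooth_on U f \<Longrightarrow> open U" by (simp add: smooth_on_def)

lemma smooth_on_differentiable: "smooth_on U f \<Longrightarrow> x \<in> U \<Longrightarrow> f differentiable (at x)"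
  unfolding smooth_on_def by (metis Ck_on.simps(2))

lemma smooth_on_dir_deriv: "smooth_on U f \<Longrightarrow> smooth_on U (dir_deriv v f)"
  unfolding smooth_on_def by (metis Ck_on.simps(2))

lemma smooth_on_continuous: "smooth_on U f \<Longrightarrow> continuous_on U f"
  unfolding smooth_on_def by (metis Ck_on.simps(1))

lemma smooth_on_subset: "smooth_on U f \<Longrightarrow> open W \<Longrightarrow> W \<subseteq> U \<Longrightarrow> smooth_on W f"
  unfolding smooth_on_def using Ck_on_subset by blast

lemma smooth_on_cong: "smooth_on U f \<Longrightarrow> (\<And>y. y \<in> U \<Longrightarrow> f y = g y) \<Longrightarrow> smooth_on U g"
  unfolding smooth_on_def using Ck_on_cong by blast

lemma smooth_on_add: "smooth_on U f \<Longrightarrow> smooth_on U g \<Longrightarrow> smooth_on U (\<lambda>x. f x + g x)"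
  unfolding smooth_on_def using Ck_on_add by blast

lemma smooth_on_mult: "smooth_on U f \<Longrightarrow> smooth_on U g \<Longrightarrow> smooth_on U (\<lambda>x. f x * g x)"
  unfolding smooth_on_def using Ck_on_mult by blast

lemma smooth_on_const: "open U \<Longrightarrow> smooth_on U (\<lambda>x. c)"
  unfolding smooth_on_def by (simp add: Ck_on_const)

lemma smooth_on_linear: "open U \<Longrightarrow> linear f \<Longrightarrow> smooth_on U f"
  unfolding smooth_on_def by (simp add: Ck_on_linear)

lemma smooth_on_cmult: "smooth_on U f \<Longrightarrow> smooth_on U (\<lambda>x. c * f x)"
  by (rule smooth_on_mult[OF smooth_on_const[OF smooth_on_open]])

lemma smooth_on_sum: "open U \<Longrightarrow> (\<And>i. i \<in> I \<Longrightarrow> smooth_on U (f i)) \<Longrightarrow> smooth_on U (\<lambda>x. \<Sum>i\<in>I. f i x)"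
  by (induction I rule: infinite_finite_induct) (simp_all add: smooth_on_const smooth_on_add)

lemma line_derivative:
  assumes "smooth_on U f" "p + s *\<^sub>R v \<in> U"
  shows "((\<lambda>s. f (p + s *\<^sub>R v)) has_real_derivative dir_deriv v f (p + s *\<^sub>R v)) (at s)"
proof -
  have d: "f differentiable (at (p + s *\<^sub>R v))" using smooth_on_differentiable assms by blast
  have "((\<lambda>s. p + s *\<^sub>R v) has_derivative (\<lambda>h. h *\<^sub>R v)) (at s)" by (auto intro!: derivative_eq_intros)
  from has_derivative_compose[OF this has_derivative_dir_deriv[OF d]]
  have "((\<lambda>s. f (p + s *\<^sub>R v)) has_derivative (\<lambda>h. dir_deriv (h *\<^sub>R v) f (p + s *\<^sub>R v))) (at s)" .
  moreover have "(\<lambda>h. dir_deriv (h *\<^sub>R v) f (p + s *\<^sub>R v)) = (*) (dir_deriv v f (p + s *\<^sub>R v))"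
    using linear_scale[OF linear_dir_deriv[OF d]] by (auto simp: fun_eq_iff)
  ultimately show ?thesis by (simp add: has_field_derivative_def)
qed

lemma quadratic_curve_derivative:
  assumes "smooth_on U f" "p \<in> U"
  shows "((\<lambda>s. f (p + s *\<^sub>R v + (s * s) *\<^sub>R w)) has_real_derivative dir_deriv v f p) (at 0)"
proof -
  have d: "f differentiable (at p)" using smooth_on_differentiable assms by blast
  have c: "((\<lambda>s. p + s *\<^sub>R v + (s * s) *\<^sub>R w) has_derivative (\<lambda>h. h *\<^sub>R v)) (at (0::real))" by (auto intro!: derivative_eq_intros)
  have "((\<lambda>s. f (p + s *\<^sub>R v + (s * s) *\<^sub>R w)) has_derivative (\<lambda>h. dir_deriv (h *\<^sub>R v) f p)) (at 0)"
    by (rule has_derivative_compose[OF c]) (simp add: has_derivative_dir_deriv[OF d])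
  moreover have "(\<lambda>h. dir_deriv (h *\<^sub>R v) f p) = (*) (dir_deriv v f p)"
    using linear_scale[OF linear_dir_deriv[OF d]] by (auto simp: fun_eq_iff)
  ultimately show ?thesis by (simp add: has_field_derivative_def)
qed

text \<open>The mean value theorem, once in each direction.\<close>

lemma second_difference:
  assumes f: "smooth_on U f" and h: "(h::real) > 0"
    and sq: "\<And>s t. 0 \<le> s \<Longrightarrow> s \<le> h \<Longrightarrow> 0 \<le> t \<Longrightarrow> t \<le> h \<Longrightarrow> x + s *\<^sub>R a + t *\<^sub>R b \<in> U"
  obtains s t where "0 \<le> s" "s \<le> h" "0 \<le> t" "t \<le> h"
    "f (x + h *\<^sub>R a + h *\<^sub>R b) - f (x + h *\<^sub>R a) - f (x + h *\<^sub>R b) + f x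
       = h * h * dir_deriv b (dir_deriv a f) (x + s *\<^sub>R a + t *\<^sub>R b)"
proof -
  define g where "g s = f ((x + h *\<^sub>R b) + s *\<^sub>R a) - f (x + s *\<^sub>R a)" for s
  have g: "(g has_real_derivative dir_deriv a f ((x + h *\<^sub>R b) + s *\<^sub>R a) - dir_deriv a f (x + s *\<^sub>R a)) (at s)"
    if "0 \<le> s" "s \<le> h" for s
    unfolding g_def
    using sq[OF that, of h] sq[OF that, of 0] h by (intro DERIV_diff line_derivative[OF f]) (simp_all add: ac_simps)
  obtain s where s: "0 < s" "s < h"
    "g h - g 0 = (h - 0) * (dir_deriv a f ((x + h *\<^sub>R b) + s *\<^sub>R a) - dir_deriv a f (x + s *\<^sub>R a))"
    using MVT2[OF h, of g "\<lambda>s. dir_deriv a f ((x + h *\<^sub>R b) + s *\<^sub>R a) - dir_deriv a f (x + s *\<^sub>R a)"] g by blast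
  define k where "k t = dir_deriv a f ((x + s *\<^sub>R a) + t *\<^sub>R b)" for t
  have k: "(k has_real_derivative dir_deriv b (dir_deriv a f) ((x + s *\<^sub>R a) + t *\<^sub>R b)) (at t)" if "0 \<le> t" "t \<le> h" for t
    unfolding k_def using sq[of s t] that s by (intro line_derivative[OF smooth_on_dir_deriv[OF f]]) simp
  obtain t where t: "0 < t" "t < h" "k h - k 0 = (h - 0) * dir_deriv b (dir_deriv a f) ((x + s *\<^sub>R a) + t *\<^sub>R b)"
    using MVT2[OF h, of k "\<lambda>t. dir_deriv b (dir_deriv a f) ((x + s *\<^sub>R a) + t *\<^sub>R b)"] k by blast
  have e: "dir_deriv a f ((x + h *\<^sub>R b) + s *\<^sub>R a) = k h" "dir_deriv a f (x + s *\<^sub>R a) = k 0" by (simp_all add: k_def ac_simps)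
  have gg: "g h - g 0 = f (x + h *\<^sub>R a + h *\<^sub>R b) - f (x + h *\<^sub>R a) - f (x + h *\<^sub>R b) + f x" by (simp add: g_def ac_simps)
  show ?thesis
  proof (rule that[of s t])
    show "f (x + h *\<^sub>R a + h *\<^sub>R b) - f (x + h *\<^sub>R a) - f (x + h *\<^sub>R b) + f x
       = h * h * dir_deriv b (dir_deriv a f) (x + s *\<^sub>R a + t *\<^sub>R b)"
      using s(3) t(3) unfolding gg[symmetric] e by simp
  qed (use s t in simp_all)
qed

text \<open>The second difference is symmetric in the two directions; divided by \<open>h\<^sup>2\<close> it is close to either mixed
derivative by continuity.\<close>

lemma mixed_partials_commute:
  assumes f: "smooth_on U f" and x: "x \<in> U"
  shows "dir_deriv a (dir_deriv b f) x = dir_deriv b (dir_deriv a f) x"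
proof (rule ccontr)
  let ?A = "dir_deriv a (dir_deriv b f)" and ?B = "dir_deriv b (dir_deriv a f)"
  assume ne: "?A x \<noteq> ?B x"
  define e where "e = \<bar>?A x - ?B x\<bar> / 2"
  have e: "e > 0" using ne by (simp add: e_def)
  have U: "open U" by (rule smooth_on_open[OF f])
  have op: "open (k -` ball (k x) e \<inter> U)" if "smooth_on U k" for k
    using continuous_on_open_vimage[OF U, of k] smooth_on_continuous[OF that] by blast
  have sA: "smooth_on U ?A" and sB: "smooth_on U ?B" using f by (simp_all add: smooth_on_dir_deriv)
  have "open ((?A -` ball (?A x) e \<inter> U) \<inter> (?B -` ball (?B x) e \<inter> U))" using op[OF sA] op[OF sB] by (rule open_Int)
  moreover have "x \<in> (?A -` ball (?A x) e \<inter> U) \<inter> (?B -` ball (?B x) e \<inter> U)" using x e by simp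
  ultimately obtain \<delta> where \<delta>: "\<delta> > 0" "ball x \<delta> \<subseteq> (?A -` ball (?A x) e \<inter> U) \<inter> (?B -` ball (?B x) e \<inter> U)"
    by (meson open_contains_ball)
  define m where "m = norm a + norm b + 1"
  define h where "h = \<delta> / m"
  have m: "m > 0" unfolding m_def by (simp add: add_nonneg_pos)
  have h: "h > 0" using m \<delta> by (simp add: h_def)
  have near: "x + s *\<^sub>R a + t *\<^sub>R b \<in> ball x \<delta>" if "0 \<le> s" "s \<le> h" "0 \<le> t" "t \<le> h" for s t
  proof -
    have "norm (s *\<^sub>R a + t *\<^sub>R b) \<le> s * norm a + t * norm b" using norm_triangle_ineq[of "s *\<^sub>R a" "t *\<^sub>R b"] that by simp
    also have "\<dots> \<le> h * norm a + h * norm b" using that by (intro add_mono mult_right_mono) simp_all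
    also have "\<dots> < h * m" using h by (simp add: m_def distrib_left)
    also have "\<dots> = \<delta>" using m by (simp add: h_def)
    finally show ?thesis by (simp add: dist_norm add.assoc norm_minus_commute[of x] norm_minus_cancel[of "s *\<^sub>R a + t *\<^sub>R b", symmetric] del: norm_minus_cancel)
  qed
  have near': "x + s *\<^sub>R b + t *\<^sub>R a \<in> ball x \<delta>" if "0 \<le> s" "s \<le> h" "0 \<le> t" "t \<le> h" for s t
    using near[OF that(3,4,1,2)] by (simp only: ac_simps)
  have inU: "ball x \<delta> \<subseteq> U" using \<delta> by blast
  obtain s t where 1: "0 \<le> s" "s \<le> h" "0 \<le> t" "t \<le> h"
    "f (x + h *\<^sub>R a + h *\<^sub>R b) - f (x + h *\<^sub>R a) - f (x + h *\<^sub>R b) + f x = h * h * ?B (x + s *\<^sub>R a + t *\<^sub>R b)"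
    using second_difference[OF f h, of x a b] near inU by blast
  obtain s' t' where 2: "0 \<le> s'" "s' \<le> h" "0 \<le> t'" "t' \<le> h"
    "f (x + h *\<^sub>R b + h *\<^sub>R a) - f (x + h *\<^sub>R b) - f (x + h *\<^sub>R a) + f x = h * h * ?A (x + s' *\<^sub>R b + t' *\<^sub>R a)"
    using second_difference[OF f h, of x b a] near' inU by blast
  have sw: "x + h *\<^sub>R b + h *\<^sub>R a = x + h *\<^sub>R a + h *\<^sub>R b" by (simp only: ac_simps)
  have "h * h * ?B (x + s *\<^sub>R a + t *\<^sub>R b) = h * h * ?A (x + s' *\<^sub>R b + t' *\<^sub>R a)"
    using 1(5) 2(5)[unfolded sw] by linarith
  then have eq: "?B (x + s *\<^sub>R a + t *\<^sub>R b) = ?A (x + s' *\<^sub>R b + t' *\<^sub>R a)" using h by simp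
  have "?B (x + s *\<^sub>R a + t *\<^sub>R b) \<in> ball (?B x) e" using subsetD[OF \<delta>(2) near[OF 1(1-4)]] by simp
  moreover have "?A (x + s' *\<^sub>R b + t' *\<^sub>R a) \<in> ball (?A x) e" using subsetD[OF \<delta>(2) near'[OF 2(1-4)]] by simp
  ultimately have "\<bar>?B x - ?A (x + s' *\<^sub>R b + t' *\<^sub>R a)\<bar> < e" "\<bar>?A x - ?A (x + s' *\<^sub>R b + t' *\<^sub>R a)\<bar> < e"
    unfolding eq by (simp_all only: mem_ball dist_real_def)
  moreover have "\<bar>?A x - ?B x\<bar> \<le> \<bar>?A x - ?A (x + s' *\<^sub>R b + t' *\<^sub>R a)\<bar> + \<bar>?B x - ?A (x + s' *\<^sub>R b + t' *\<^sub>R a)\<bar>"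
    using abs_triangle_ineq4[of "?A x - ?A (x + s' *\<^sub>R b + t' *\<^sub>R a)" "?B x - ?A (x + s' *\<^sub>R b + t' *\<^sub>R a)"] by simp
  moreover have "p < r / 2 \<Longrightarrow> q < r / 2 \<Longrightarrow> r \<le> q + p \<Longrightarrow> False" for p q r :: real by linarith
  ultimately show False unfolding e_def by blast
qed

lemma bilinear_second_derivative:
  assumes f: "smooth_on U f" and x: "x \<in> U"
  shows "bilinear (\<lambda>a b. dir_deriv a (dir_deriv b f) x)"
proof -
  have l: "linear (\<lambda>a. dir_deriv a (dir_deriv b f) x)" for b
    by (rule linear_dir_deriv[OF smooth_on_differentiable[OF smooth_on_dir_deriv[OF f] x]])
  moreover have "linear (\<lambda>b. dir_deriv a (dir_deriv b f) x)" for a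
    unfolding mixed_partials_commute[OF f x, of a] by (rule l)
  ultimately show ?thesis by (simp add: bilinear_def)
qed

text \<open>The form in which symmetry of higher derivatives is used: an innermost direction moves to the
outside.\<close>

lemma third_derivative_rotate:
  assumes f: "smooth_on U f" and x: "x \<in> U"
  shows "dir_deriv a (dir_deriv b (dir_deriv v f)) x = dir_deriv v (dir_deriv a (dir_deriv b f)) x"
proof -
  have "dir_deriv a (dir_deriv b (dir_deriv v f)) x = dir_deriv a (dir_deriv v (dir_deriv b f)) x"
    by (rule dir_deriv_cong[OF smooth_on_open[OF f] x]) (rule mixed_partials_commute[OF f])
  then show ?thesis using mixed_partials_commute[OF smooth_on_dir_deriv[OF f] x] by simp
qed

lemma double_sum_swap:
  "(\<Sum>a\<in>A. \<Sum>b\<in>A. \<Sum>c\<in>A. \<Sum>d\<in>A. f a b c d) = (\<Sum>a\<in>A. \<Sum>b\<in>A. \<Sum>c\<in>A. \<Sum>d\<in>A. f c d a b :: real)"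
proof -
  have p: "(\<Sum>a\<in>A. \<Sum>b\<in>A. g a b) = (\<Sum>p\<in>A\<times>A. g (fst p) (snd p) :: real)" for g
    by (simp add: sum.cartesian_product case_prod_beta')
  show ?thesis unfolding p by (rule sum.swap)
qed

lemma triple_sum_rotate:
  "(\<Sum>a\<in>A. \<Sum>b\<in>A. \<Sum>c\<in>A. f a b c) = (\<Sum>a\<in>A. \<Sum>b\<in>A. \<Sum>c\<in>A. f b c a :: real)"
proof -
  have "(\<Sum>a\<in>A. \<Sum>b\<in>A. \<Sum>c\<in>A. f b c a) = (\<Sum>b\<in>A. \<Sum>a\<in>A. \<Sum>c\<in>A. f b c a)" by (rule sum.swap)
  also have "\<dots> = (\<Sum>b\<in>A. \<Sum>c\<in>A. \<Sum>a\<in>A. f b c a)" by (rule sum.cong[OF refl]) (rule sum.swap)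
  finally show ?thesis by simp
qed

context cartan_jordan begin

section \<open>Commutation relations of Bessel operators\<close>

text \<open>The component \<open>B\<^sub>z\<close> of the Bessel operator.\<close>

definition bessel_comp :: "real \<Rightarrow> 'a \<Rightarrow> ('a \<Rightarrow> real) \<Rightarrow> 'a \<Rightarrow> real" where
  "bessel_comp l z F x = tau z (bessel V l F x)"

text \<open>The operator \<open>T\<^sub>z\<close>, the degree zero part of the conformal action: for \<open>z = e\<close> it is twice the
Euler operator plus a constant.\<close>

definition euler_op :: "real \<Rightarrow> 'a \<Rightarrow> ('a \<Rightarrow> real) \<Rightarrow> 'a \<Rightarrow> real" where
  "euler_op l z F x = 2 * dir_deriv (x \<star> z) F x + (l * tau z \<ee>) * F x"

lemma linear_tau: "linear (tau w)" by (rule linearI) (simp_all add: tau_simps)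

lemma dir_deriv_basis: "F differentiable (at x) \<Longrightarrow> dir_deriv z F x = (\<Sum>a\<in>Basis. tau z (dual a) * dir_deriv a F x)"
  using dir_deriv_sum_dir[of F x "\<lambda>a. tau z (dual a)" "\<lambda>a. a" Basis] by (simp only: basis_expand)

context
  fixes U :: "'a set" and F :: "'a \<Rightarrow> real" and x :: 'a
  assumes F: "smooth_on U F" and x: "x \<in> U"
begin

lemmas smooth_first = smooth_on_dir_deriv[OF F]
lemmas smooth_second = smooth_on_dir_deriv[OF smooth_first]
lemmas differentiable_zeroth = smooth_on_differentiable[OF F x]
lemmas differentiable_first = smooth_on_differentiable[OF smooth_first x]
lemmas open_domain = smooth_on_open[OF F]

lemma bessel_comp_sum:
  "bessel_comp l z F x = (\<Sum>a\<in>Basis. \<Sum>b\<in>Basis. dir_deriv a (dir_deriv b F) x * tau (jP V (dual a) (dual b) z) x) + l * dir_deriv z F x"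
  unfolding bessel_comp_def bessel_def dir_deriv_basis[OF differentiable_zeroth, of z]
  by (simp only: tau_simps tau_sum tau_jP[of _ _ z x]) (simp only: mult.commute)

text \<open>One of the dual bases is summed away; used to compare second-order operators.\<close>

lemma bessel_comp_casimir:
  "bessel_comp l z F x = (\<Sum>b\<in>Basis. dir_deriv (jP V x z (dual b)) (dir_deriv b F) x) + l * dir_deriv z F x"
  unfolding bessel_comp_sum by (simp only: double_casimir[OF bilinear_second_derivative[OF F x]])

lemma euler_op_sum:
  "euler_op l z F x = 2 * (\<Sum>v\<in>Basis. tau (z \<star> dual v) x * dir_deriv v F x) + (l * tau z \<ee>) * F x"
  unfolding euler_op_def dir_deriv_basis[OF differentiable_zeroth, of "x \<star> z"]
  by (simp only: tau_assoc[of x z] tau_commute[of x])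

lemma dir_deriv2_tau:
  "dir_deriv a (dir_deriv b (\<lambda>x. tau w x * F x)) x
     = tau w x * dir_deriv a (dir_deriv b F) x + tau w a * dir_deriv b F x + tau w b * dir_deriv a F x"
proof -
  have "dir_deriv a (dir_deriv b (\<lambda>x. tau w x * F x)) x = dir_deriv a (\<lambda>y. tau w y * dir_deriv b F y + tau w b * F y) x"
    by (rule dir_deriv_cong[OF open_domain x])
       (simp add: dir_deriv_mult[OF linear_imp_differentiable[OF linear_tau] smooth_on_differentiable[OF F]] dir_deriv_linear[OF linear_tau])
  also have "\<dots> = dir_deriv a (\<lambda>y. tau w y * dir_deriv b F y) x + dir_deriv a (\<lambda>y. tau w b * F y) x"
    by (rule dir_deriv_add) (auto intro!: differentiable_mult linear_imp_differentiable[OF linear_tau] differentiable_first differentiable_zeroth)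
  also have "\<dots> = tau w x * dir_deriv a (dir_deriv b F) x + tau w a * dir_deriv b F x + tau w b * dir_deriv a F x"
    by (simp add: dir_deriv_mult[OF linear_imp_differentiable[OF linear_tau] differentiable_first] dir_deriv_linear[OF linear_tau] dir_deriv_cmult[OF differentiable_zeroth])
  finally show ?thesis .
qed

end

lemma smooth_bessel_comp: assumes F: "smooth_on U F" shows "smooth_on U (bessel_comp l z F)"
proof (rule smooth_on_cong)
  show "smooth_on U (\<lambda>x. (\<Sum>a\<in>Basis. \<Sum>b\<in>Basis. dir_deriv a (dir_deriv b F) x * tau (jP V (dual a) (dual b) z) x) + l * dir_deriv z F x)"
    using smooth_on_open[OF F]
    by (intro smooth_on_add smooth_on_sum smooth_on_mult smooth_on_linear linear_tau smooth_on_cmult smooth_on_dir_deriv F)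
qed (simp add: bessel_comp_sum[OF F])

lemma smooth_euler_op: assumes F: "smooth_on U F" shows "smooth_on U (euler_op l z F)"
proof (rule smooth_on_cong)
  show "smooth_on U (\<lambda>x. 2 * (\<Sum>v\<in>Basis. tau (z \<star> dual v) x * dir_deriv v F x) + (l * tau z \<ee>) * F x)"
    using smooth_on_open[OF F]
    by (intro smooth_on_add smooth_on_sum smooth_on_mult smooth_on_linear linear_tau smooth_on_cmult smooth_on_dir_deriv F)
qed (simp add: euler_op_sum[OF F])

lemma smooth_tau_mult: assumes F: "smooth_on U F" shows "smooth_on U (\<lambda>x. tau z x * F x)"
  using smooth_on_open[OF F] by (intro smooth_on_mult smooth_on_linear linear_tau F)

lemma bessel_cong:
  assumes "open U" "x \<in> U" "\<And>y. y \<in> U \<Longrightarrow> F y = G y" shows "bessel V l F x = bessel V l G x"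
proof -
  have "dir_deriv b F y = dir_deriv b G y" if "y \<in> U" for y b by (rule dir_deriv_cong[OF assms(1) that assms(3)])
  then have "dir_deriv a (dir_deriv b F) x = dir_deriv a (dir_deriv b G) x" for a b
    by (rule dir_deriv_cong[OF assms(1,2)])
  then show ?thesis unfolding bessel_def using dir_deriv_cong[OF assms] by simp
qed

lemma bessel_comp_cong: "open U \<Longrightarrow> x \<in> U \<Longrightarrow> (\<And>y. y \<in> U \<Longrightarrow> F y = G y) \<Longrightarrow> bessel_comp l z F x = bessel_comp l z G x"
  unfolding bessel_comp_def using bessel_cong[of U x F G] by simp

lemma bessel_comp_add:
  assumes F: "smooth_on U F" and G: "smooth_on U G" and x: "x \<in> U"
  shows "bessel_comp l z (\<lambda>x. F x + G x) x = bessel_comp l z F x + bessel_comp l z G x"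
proof -
  have "dir_deriv a (dir_deriv b (\<lambda>x. F x + G x)) x = dir_deriv a (dir_deriv b F) x + dir_deriv a (dir_deriv b G) x" for a b
  proof -
    have "dir_deriv a (dir_deriv b (\<lambda>x. F x + G x)) x = dir_deriv a (\<lambda>x. dir_deriv b F x + dir_deriv b G x) x"
      by (rule dir_deriv_cong[OF smooth_on_open[OF F] x])
         (rule dir_deriv_add[OF smooth_on_differentiable[OF F] smooth_on_differentiable[OF G]])
    then show ?thesis by (simp only: dir_deriv_add[OF differentiable_first[OF F x] differentiable_first[OF G x]])
  qed
  then show ?thesis
    by (simp only: bessel_comp_sum[OF smooth_on_add[OF F G] x] bessel_comp_sum[OF F x] bessel_comp_sum[OF G x] dir_deriv_add[OF differentiable_zeroth[OF F x] differentiable_zeroth[OF G x]]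
        distrib_right distrib_left sum.distrib add_ac)
qed

lemma bessel_comp_cmult:
  assumes F: "smooth_on U F" and x: "x \<in> U" shows "bessel_comp l z (\<lambda>x. k * F x) x = k * bessel_comp l z F x"
proof -
  have "dir_deriv a (dir_deriv b (\<lambda>x. k * F x)) x = k * dir_deriv a (dir_deriv b F) x" for a b
  proof -
    have "dir_deriv a (dir_deriv b (\<lambda>x. k * F x)) x = dir_deriv a (\<lambda>x. k * dir_deriv b F x) x"
      by (rule dir_deriv_cong[OF smooth_on_open[OF F] x])
         (rule dir_deriv_cmult[OF smooth_on_differentiable[OF F]])
    then show ?thesis by (simp only: dir_deriv_cmult[OF differentiable_first[OF F x]])
  qed
  then show ?thesis
    by (simp only: bessel_comp_sum[OF smooth_on_cmult[OF F] x] bessel_comp_sum[OF F x] dir_deriv_cmult[OF differentiable_zeroth[OF F x]]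
        distrib_left sum_distrib_left mult_ac)
qed

lemma bessel_comp_setsum:
  assumes U: "open U" "x \<in> U" and f: "\<And>i. i \<in> I \<Longrightarrow> smooth_on U (f i)"
  shows "bessel_comp l z (\<lambda>x. \<Sum>i\<in>I. f i x) x = (\<Sum>i\<in>I. bessel_comp l z (f i) x)"
proof -
  have z: "bessel_comp l z (\<lambda>x. 0) x = 0" using bessel_comp_cmult[OF smooth_on_const[OF U(1), of 0] U(2), of l z 0] by simp
  show ?thesis using f
  proof (induction I rule: infinite_finite_induct)
    case (insert i I)
    have "bessel_comp l z (\<lambda>x. \<Sum>i\<in>insert i I. f i x) x = bessel_comp l z (\<lambda>x. f i x + (\<Sum>i\<in>I. f i x)) x" using insert(1,2) by simp
    also have "\<dots> = bessel_comp l z (f i) x + bessel_comp l z (\<lambda>x. \<Sum>i\<in>I. f i x) x"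
      using insert(4) by (intro bessel_comp_add[OF _ _ U(2)] smooth_on_sum U(1)) auto
    finally show ?case using insert by simp
  qed (simp_all add: z)
qed

text \<open>The commutator with a linear function is of first order: by symmetry of the symbol both mixed terms of the
second derivative of a product contribute the same.\<close>

lemma bessel_comp_mult_tau:
  assumes F: "smooth_on U F" and x: "x \<in> U"
  shows "bessel_comp l z (\<lambda>x. tau w x * F x) x = tau w x * bessel_comp l z F x + 2 * dir_deriv (jP V x z w) F x + l * tau w z * F x"
proof -
  let ?K = "\<lambda>a b. tau (jP V (dual a) (dual b) z) x"
  have b: "bilinear (\<lambda>a b. tau w a * dir_deriv b F x)"
    by (auto simp: bilinear_def tau_simps linear_add[OF linear_dir_deriv[OF differentiable_zeroth[OF F x]]]
        linear_scale[OF linear_dir_deriv[OF differentiable_zeroth[OF F x]]] algebra_simps intro!: linearI)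
  have 1: "(\<Sum>a\<in>Basis. \<Sum>b\<in>Basis. (tau w a * dir_deriv b F x) * ?K a b) = dir_deriv (jP V x z w) F x"
  proof -
    have "(\<Sum>a\<in>Basis. \<Sum>b\<in>Basis. (tau w a * dir_deriv b F x) * ?K a b) = (\<Sum>b\<in>Basis. tau w (jP V x z (dual b)) * dir_deriv b F x)"
      by (rule double_casimir[OF b])
    also have "\<dots> = (\<Sum>b\<in>Basis. tau (jP V x z w) (dual b) * dir_deriv b F x)" by (simp only: tau_jP[of x z w])
    finally show ?thesis by (simp only: dir_deriv_basis[OF differentiable_zeroth[OF F x], of "jP V x z w"])
  qed
  have "(\<Sum>a\<in>Basis. \<Sum>b\<in>Basis. (tau w b * dir_deriv a F x) * ?K a b) = (\<Sum>a\<in>Basis. \<Sum>b\<in>Basis. (tau w a * dir_deriv b F x) * ?K a b)"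
    by (subst sum.swap, intro sum.cong refl, subst jP_sym, rule refl)
  then have 2: "(\<Sum>a\<in>Basis. \<Sum>b\<in>Basis. (tau w b * dir_deriv a F x) * ?K a b) = dir_deriv (jP V x z w) F x" using 1 by simp
  have "bessel_comp l z (\<lambda>x. tau w x * F x) x = (\<Sum>a\<in>Basis. \<Sum>b\<in>Basis. tau w x * (dir_deriv a (dir_deriv b F) x * ?K a b)
      + (tau w a * dir_deriv b F x) * ?K a b + (tau w b * dir_deriv a F x) * ?K a b) + l * (tau w x * dir_deriv z F x + tau w z * F x)"
    unfolding bessel_comp_sum[OF smooth_tau_mult[OF F] x] dir_deriv2_tau[OF F x]
    by (simp add: dir_deriv_mult[OF linear_imp_differentiable[OF linear_tau] differentiable_zeroth[OF F x]] dir_deriv_linear[OF linear_tau] distrib_right mult.assoc)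
  also have "\<dots> = tau w x * (\<Sum>a\<in>Basis. \<Sum>b\<in>Basis. dir_deriv a (dir_deriv b F) x * ?K a b)
      + 2 * dir_deriv (jP V x z w) F x + l * (tau w x * dir_deriv z F x + tau w z * F x)"
    by (simp only: sum.distrib 1 2 sum_distrib_left)
  finally show ?thesis by (simp add: bessel_comp_sum[OF F x] algebra_simps)
qed

lemma jP_unit3: "jP V x z \<ee> = x \<star> z"
  by (simp only: jP_def mul_commute[of _ \<ee>] unit_mul mul_commute[of z x]) simp

lemma bessel_comp_unit_tau_mult:
  assumes F: "smooth_on U F" and x: "x \<in> U"
  shows "bessel_comp l \<ee> (\<lambda>x. tau z x * F x) x = tau z x * bessel_comp l \<ee> F x + euler_op l z F x"
  using bessel_comp_mult_tau[OF F x, of l \<ee> z] by (simp add: euler_op_def)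

lemma bessel_comp_tau_mult_unit:
  assumes F: "smooth_on U F" and x: "x \<in> U"
  shows "bessel_comp l z (\<lambda>x. tau \<ee> x * F x) x = tau \<ee> x * bessel_comp l z F x + euler_op l z F x"
  using bessel_comp_mult_tau[OF F x, of l z \<ee>] by (simp add: euler_op_def jP_unit3 tau_commute[of \<ee> z])

lemma euler_op_tau_mult_unit:
  assumes F: "smooth_on U F" and x: "x \<in> U"
  shows "euler_op l z (\<lambda>x. tau \<ee> x * F x) x = tau \<ee> x * euler_op l z F x + 2 * (tau z x * F x)"
proof -
  have "tau \<ee> (x \<star> z) = tau z x" using tau_assoc[of \<ee> x z] by (simp add: tau_commute)
  then show ?thesis
    by (simp only: euler_op_def dir_deriv_mult[OF linear_imp_differentiable[OF linear_tau] differentiable_zeroth[OF F x]] dir_deriv_linear[OF linear_tau])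
       (simp add: algebra_simps)
qed

text \<open>Commuting a constant vector field past \<open>B\<^sub>z\<close> differentiates only the linear coefficients of the
second-order part.\<close>

lemma dir_deriv_bessel_comp:
  assumes F: "smooth_on U F" and x: "x \<in> U"
  shows "dir_deriv v (bessel_comp l z F) x = bessel_comp l z (dir_deriv v F) x
     + (\<Sum>a\<in>Basis. \<Sum>b\<in>Basis. dir_deriv a (dir_deriv b F) x * tau (jP V (dual a) (dual b) z) v)"
proof -
  have d2: "dir_deriv a (dir_deriv b F) differentiable (at x)" for a b by (rule smooth_on_differentiable[OF smooth_second[OF F x] x])
  note lt = linear_imp_differentiable[OF linear_tau]
  let ?K = "\<lambda>a b. tau (jP V (dual a) (dual b) z)"
  have "dir_deriv v (bessel_comp l z F) x
    = dir_deriv v (\<lambda>x. (\<Sum>a\<in>Basis. \<Sum>b\<in>Basis. dir_deriv a (dir_deriv b F) x * ?K a b x) + l * dir_deriv z F x) x"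
    by (rule dir_deriv_cong[OF smooth_on_open[OF F] x]) (rule bessel_comp_sum[OF F])
  also have "\<dots> = dir_deriv v (\<lambda>x. \<Sum>a\<in>Basis. \<Sum>b\<in>Basis. dir_deriv a (dir_deriv b F) x * ?K a b x) x + dir_deriv v (\<lambda>x. l * dir_deriv z F x) x"
    by (rule dir_deriv_add) (auto intro!: differentiable_sum differentiable_mult d2 lt differentiable_first[OF F x])
  also have "dir_deriv v (\<lambda>x. \<Sum>a\<in>Basis. \<Sum>b\<in>Basis. dir_deriv a (dir_deriv b F) x * ?K a b x) x
    = (\<Sum>a\<in>Basis. dir_deriv v (\<lambda>x. \<Sum>b\<in>Basis. dir_deriv a (dir_deriv b F) x * ?K a b x) x)"
    by (rule dir_deriv_sum) (auto intro!: differentiable_sum differentiable_mult d2 lt)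
  also have "\<dots> = (\<Sum>a\<in>Basis. \<Sum>b\<in>Basis. dir_deriv v (\<lambda>x. dir_deriv a (dir_deriv b F) x * ?K a b x) x)"
    by (rule sum.cong[OF refl], rule dir_deriv_sum) (auto intro!: differentiable_mult d2 lt)
  also have "\<dots> = (\<Sum>a\<in>Basis. \<Sum>b\<in>Basis. dir_deriv a (dir_deriv b (dir_deriv v F)) x * ?K a b x
     + dir_deriv a (dir_deriv b F) x * ?K a b v)"
    by (intro sum.cong refl) (simp add: dir_deriv_mult[OF d2 lt] dir_deriv_linear[OF linear_tau] third_derivative_rotate[OF F x])
  also have "dir_deriv v (\<lambda>x. l * dir_deriv z F x) x = l * dir_deriv z (dir_deriv v F) x"
    by (simp only: dir_deriv_cmult[OF differentiable_first[OF F x]] mixed_partials_commute[OF F x, of v])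
  finally show ?thesis by (simp only: bessel_comp_sum[OF smooth_first[OF F x] x] sum.distrib add_ac)
qed

text \<open>Expand \<open>T\<^sub>z\<close> as \<open>\<Sum> 2 X\<^sub>y \<partial>\<^sub>v + \<lambda> \<tau>(z, e)\<close> with \<open>y = z v\<^sup>*\<close> and commute each factor. What remains is a sum of
second derivatives, in which the order of \<open>L(x)\<close> and \<open>L(z)\<close> does not matter because both are symmetric
for \<open>\<tau>\<close>.\<close>

lemma bessel_comp_unit_euler_op:
  assumes F: "smooth_on U F" and x: "x \<in> U"
  shows "bessel_comp l \<ee> (euler_op l z F) x = euler_op l z (bessel_comp l \<ee> F) x + 2 * bessel_comp l z F x"
proof -
  note U = smooth_on_open[OF F]
  define D where "D a b = dir_deriv a (dir_deriv b F) x" for a b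
  have D: "bilinear D" unfolding D_def by (rule bilinear_second_derivative[OF F x])
  have Ds: "D a b = D b a" for a b unfolding D_def by (rule mixed_partials_commute[OF F x])
  define Q where "Q v = (\<Sum>a\<in>Basis. \<Sum>b\<in>Basis. D a b * tau (dual a \<star> dual b) v)" for v
  have L: "bessel_comp l \<ee> (euler_op l z F) x = 2 * (\<Sum>v\<in>Basis. tau (z \<star> dual v) x * bessel_comp l \<ee> (dir_deriv v F) x)
      + 2 * (\<Sum>v\<in>Basis. euler_op l (z \<star> dual v) (dir_deriv v F) x) + (l * tau z \<ee>) * bessel_comp l \<ee> F x"
  proof -
    have s: "smooth_on U (\<lambda>x. \<Sum>v\<in>Basis. tau (z \<star> dual v) x * dir_deriv v F x)"
      by (intro smooth_on_sum U smooth_tau_mult smooth_on_dir_deriv F)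
    have "bessel_comp l \<ee> (euler_op l z F) x = bessel_comp l \<ee> (\<lambda>x. 2 * (\<Sum>v\<in>Basis. tau (z \<star> dual v) x * dir_deriv v F x) + (l * tau z \<ee>) * F x) x"
      by (rule bessel_comp_cong[OF U x]) (rule euler_op_sum[OF F])
    also have "\<dots> = bessel_comp l \<ee> (\<lambda>x. 2 * (\<Sum>v\<in>Basis. tau (z \<star> dual v) x * dir_deriv v F x)) x + bessel_comp l \<ee> (\<lambda>x. (l * tau z \<ee>) * F x) x"
      by (rule bessel_comp_add[OF smooth_on_cmult[OF s] smooth_on_cmult[OF F] x])
    also have "\<dots> = 2 * bessel_comp l \<ee> (\<lambda>x. \<Sum>v\<in>Basis. tau (z \<star> dual v) x * dir_deriv v F x) x + (l * tau z \<ee>) * bessel_comp l \<ee> F x"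
      by (simp only: bessel_comp_cmult[OF s x] bessel_comp_cmult[OF F x])
    also have "bessel_comp l \<ee> (\<lambda>x. \<Sum>v\<in>Basis. tau (z \<star> dual v) x * dir_deriv v F x) x = (\<Sum>v\<in>Basis. bessel_comp l \<ee> (\<lambda>x. tau (z \<star> dual v) x * dir_deriv v F x) x)"
      by (rule bessel_comp_setsum[OF U x]) (intro smooth_tau_mult smooth_first[OF F x])
    also have "\<dots> = (\<Sum>v\<in>Basis. tau (z \<star> dual v) x * bessel_comp l \<ee> (dir_deriv v F) x + euler_op l (z \<star> dual v) (dir_deriv v F) x)"
      by (simp only: bessel_comp_unit_tau_mult[OF smooth_first[OF F x] x])
    finally show ?thesis by (simp only: sum.distrib distrib_left add.assoc)
  qed
  have R: "euler_op l z (bessel_comp l \<ee> F) x = 2 * (\<Sum>v\<in>Basis. tau (z \<star> dual v) x * bessel_comp l \<ee> (dir_deriv v F) x)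
      + 2 * (\<Sum>v\<in>Basis. tau (z \<star> dual v) x * Q v) + (l * tau z \<ee>) * bessel_comp l \<ee> F x"
    unfolding euler_op_sum[OF smooth_bessel_comp[OF F] x] dir_deriv_bessel_comp[OF F x] Q_def D_def jP_unit3
    by (simp only: distrib_left sum.distrib)
  have q: "(\<Sum>v\<in>Basis. tau (z \<star> dual v) x * Q v) = (\<Sum>b\<in>Basis. D ((x \<star> z) \<star> dual b) b)"
  proof -
    have lQ: "linear Q" unfolding Q_def
      by (rule linearI) (simp_all add: tau_simps distrib_left sum.distrib sum_distrib_left mult_ac)
    have "(\<Sum>v\<in>Basis. tau (z \<star> dual v) x * Q v) = (\<Sum>v\<in>Basis. tau (x \<star> z) (dual v) * Q v)"
      by (simp only: tau_assoc[of x z] tau_commute[of x])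
    also have "\<dots> = Q (\<Sum>v\<in>Basis. tau (x \<star> z) (dual v) *\<^sub>R v)" by (simp add: linear_sum[OF lQ] linear_scale[OF lQ])
    also have "\<dots> = Q (x \<star> z)" by (simp only: basis_expand)
    also have "\<dots> = (\<Sum>a\<in>Basis. \<Sum>b\<in>Basis. D a b * tau (jP V (dual a) (dual b) \<ee>) (x \<star> z))" by (simp only: Q_def jP_unit3)
    also have "\<dots> = (\<Sum>b\<in>Basis. D (jP V (x \<star> z) \<ee> (dual b)) b)" by (rule double_casimir[OF D])
    finally show ?thesis by (simp only: jP_unit)
  qed
  have t: "(\<Sum>v\<in>Basis. euler_op l (z \<star> dual v) (dir_deriv v F) x) = 2 * (\<Sum>b\<in>Basis. D (x \<star> (z \<star> dual b)) b) + l * dir_deriv z F x"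
  proof -
    have u: "tau (z \<star> dual v) \<ee> = tau z (dual v)" for v by (simp only: tau_assoc mul_commute[of _ \<ee>] unit_mul)
    have "(\<Sum>v\<in>Basis. euler_op l (z \<star> dual v) (dir_deriv v F) x)
       = (\<Sum>b\<in>Basis. 2 * D (x \<star> (z \<star> dual b)) b + l * (tau z (dual b) * dir_deriv b F x))"
      by (simp only: euler_op_def D_def u mult.assoc)
    then show ?thesis unfolding dir_deriv_basis[OF differentiable_zeroth[OF F x], of z] by (simp only: sum.distrib sum_distrib_left)
  qed
  have sym: "(\<Sum>b\<in>Basis. D (x \<star> (z \<star> dual b)) b) = (\<Sum>b\<in>Basis. D (z \<star> (x \<star> dual b)) b)"
  proof -
    have k: "bilinear (\<lambda>p q. D p (z \<star> (x \<star> q)))"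
      by (auto simp: bilinear_def mul_simps bilinear_ladd[OF D] bilinear_lmul[OF D] bilinear_radd[OF D] bilinear_rmul[OF D] intro!: linearI)
    have adj: "tau (z \<star> (x \<star> p)) q = tau p (x \<star> (z \<star> q))" for p q by (simp only: tau_mul)
    have "(\<Sum>b\<in>Basis. D (x \<star> (z \<star> dual b)) b) = (\<Sum>b\<in>Basis. D (dual b) (z \<star> (x \<star> b)))"
      by (rule casimir_move[OF D adj, symmetric])
    also have "\<dots> = (\<Sum>b\<in>Basis. D b (z \<star> (x \<star> dual b)))" by (rule casimir_swap[OF k])
    also have "\<dots> = (\<Sum>b\<in>Basis. D (z \<star> (x \<star> dual b)) b)" by (rule sum.cong[OF refl]) (rule Ds)
    finally show ?thesis .
  qed
  have "bessel_comp l z F x = (\<Sum>b\<in>Basis. D (x \<star> (z \<star> dual b)) b + D (z \<star> (x \<star> dual b)) b - D ((x \<star> z) \<star> dual b) b) + l * dir_deriv z F x"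
    unfolding bessel_comp_casimir[OF F x] D_def[symmetric] jP_def by (simp only: bilinear_ladd[OF D] bilinear_lsub[OF D])
  then have B: "bessel_comp l z F x = 2 * (\<Sum>b\<in>Basis. D (x \<star> (z \<star> dual b)) b) - (\<Sum>b\<in>Basis. D ((x \<star> z) \<star> dual b) b) + l * dir_deriv z F x"
    using sym by (simp add: sum.distrib sum_subtractf)
  show ?thesis unfolding L R q t B by simp
qed

text \<open>A symmetrisation of \<open>\<phi>\<close> over all permutations is the polarization of its diagonal; with symmetry in
the first two arguments only the cyclic sum is left.\<close>

lemma polarize_cubic:
  fixes \<phi> :: "'a \<Rightarrow> 'a \<Rightarrow> 'a \<Rightarrow> real"
  assumes add: "\<And>a a' b c. \<phi> (a + a') b c = \<phi> a b c + \<phi> a' b c" "\<And>a b b' c. \<phi> a (b + b') c = \<phi> a b c + \<phi> a b' c"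
      "\<And>a b c c'. \<phi> a b (c + c') = \<phi> a b c + \<phi> a b c'"
    and sym: "\<And>a b c. \<phi> a b c = \<phi> b a c" and cube: "\<And>a. \<phi> a a a = 0"
  shows "\<phi> a b c + \<phi> b c a + \<phi> c a b = 0"
proof -
  have 2: "\<phi> a a b + 2 * \<phi> a b a + \<phi> b b a + 2 * \<phi> a b b = 0" for a b
    using cube[of "a + b"] cube[of a] cube[of b] sym[of b a a] sym[of b a b] unfolding add by linarith
  show ?thesis
    using cube[of "a + b + c"] cube[of a] cube[of b] cube[of c] 2[of a b] 2[of a c] 2[of b c]
      sym[of b a a] sym[of b a b] sym[of b a c] sym[of c a a] sym[of c a b] sym[of c a c] sym[of c b a] sym[of c b b] sym[of c b c]
    unfolding add by linarith
qed

text \<open>Sorted by the order of differentiation. All lines but the last are symmetric in \<open>w\<close> and \<open>z\<close>.\<close>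

lemma bessel_comp_bessel_comp_expand:
  assumes F: "smooth_on U F" and x: "x \<in> U"
  defines "K \<equiv> \<lambda>z a b. jP V (dual a) (dual b) z"
  shows "bessel_comp l w (bessel_comp l z F) x =
     (\<Sum>a\<in>Basis. \<Sum>b\<in>Basis. \<Sum>c\<in>Basis. \<Sum>d\<in>Basis.
        tau (K z a b) x * tau (K w c d) x * dir_deriv a (dir_deriv b (dir_deriv c (dir_deriv d F))) x)
     + l * ((\<Sum>a\<in>Basis. \<Sum>b\<in>Basis. tau (K z a b) x * dir_deriv w (dir_deriv a (dir_deriv b F)) x)
          + (\<Sum>a\<in>Basis. \<Sum>b\<in>Basis. tau (K w a b) x * dir_deriv z (dir_deriv a (dir_deriv b F)) x))
     + l * (\<Sum>a\<in>Basis. \<Sum>b\<in>Basis. tau (K z a b) w * dir_deriv a (dir_deriv b F) x)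
     + l * l * dir_deriv w (dir_deriv z F) x
     + 2 * (\<Sum>a\<in>Basis. \<Sum>b\<in>Basis. dir_deriv (jP V x w (K z a b)) (dir_deriv a (dir_deriv b F)) x)"
proof -
  note U = smooth_on_open[OF F]
  define G where "G a b = dir_deriv a (dir_deriv b F)" for a b
  have G: "smooth_on U (G a b)" for a b unfolding G_def by (rule smooth_second[OF F x])
  have four: "dir_deriv c (dir_deriv d (G a b)) x = dir_deriv a (dir_deriv b (G c d)) x" for a b c d
  proof -
    have "dir_deriv c (dir_deriv d (G a b)) x = dir_deriv a (dir_deriv c (dir_deriv d (dir_deriv b F))) x"
      unfolding G_def by (rule third_derivative_rotate[OF smooth_first[OF F x] x])
    also have "\<dots> = dir_deriv a (dir_deriv b (G c d)) x"
      unfolding G_def by (rule dir_deriv_cong[OF U x]) (rule third_derivative_rotate[OF F])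
    finally show ?thesis .
  qed
  have sKG: "smooth_on U (\<lambda>y. tau (K z a b) y * G a b y)" for a b by (rule smooth_tau_mult[OF G])
  have sS: "smooth_on U (\<lambda>y. \<Sum>b\<in>Basis. tau (K z a b) y * G a b y)" for a by (intro smooth_on_sum U sKG)
  have "bessel_comp l w (bessel_comp l z F) x = bessel_comp l w (\<lambda>y. (\<Sum>a\<in>Basis. \<Sum>b\<in>Basis. tau (K z a b) y * G a b y) + l * dir_deriv z F y) x"
    by (rule bessel_comp_cong[OF U x]) (simp only: bessel_comp_sum[OF F] K_def G_def mult.commute)
  also have "\<dots> = bessel_comp l w (\<lambda>y. \<Sum>a\<in>Basis. \<Sum>b\<in>Basis. tau (K z a b) y * G a b y) x + bessel_comp l w (\<lambda>y. l * dir_deriv z F y) x"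
    by (rule bessel_comp_add[OF _ smooth_on_cmult[OF smooth_first[OF F x]] x]) (intro smooth_on_sum U sKG)
  also have "bessel_comp l w (\<lambda>y. \<Sum>a\<in>Basis. \<Sum>b\<in>Basis. tau (K z a b) y * G a b y) x = (\<Sum>a\<in>Basis. \<Sum>b\<in>Basis. bessel_comp l w (\<lambda>y. tau (K z a b) y * G a b y) x)"
    by (simp only: bessel_comp_setsum[OF U x sS] bessel_comp_setsum[OF U x sKG])
  also have "\<dots> = (\<Sum>a\<in>Basis. \<Sum>b\<in>Basis. (\<Sum>c\<in>Basis. \<Sum>d\<in>Basis. tau (K z a b) x * tau (K w c d) x * dir_deriv a (dir_deriv b (G c d)) x)
      + l * (tau (K z a b) x * dir_deriv w (G a b) x) + 2 * dir_deriv (jP V x w (K z a b)) (G a b) x + l * (tau (K z a b) w * G a b x))"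
  proof (intro sum.cong refl)
    fix a b :: 'a
    have "bessel_comp l w (G a b) x = (\<Sum>c\<in>Basis. \<Sum>d\<in>Basis. dir_deriv a (dir_deriv b (G c d)) x * tau (K w c d) x) + l * dir_deriv w (G a b) x"
      unfolding bessel_comp_sum[OF G x] four[of _ _ a b] K_def ..
    then show "bessel_comp l w (\<lambda>y. tau (K z a b) y * G a b y) x = (\<Sum>c\<in>Basis. \<Sum>d\<in>Basis. tau (K z a b) x * tau (K w c d) x * dir_deriv a (dir_deriv b (G c d)) x)
      + l * (tau (K z a b) x * dir_deriv w (G a b) x) + 2 * dir_deriv (jP V x w (K z a b)) (G a b) x + l * (tau (K z a b) w * G a b x)"
      unfolding bessel_comp_mult_tau[OF G x] by (simp only: distrib_left sum_distrib_left mult_ac)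
  qed
  also have "bessel_comp l w (\<lambda>y. l * dir_deriv z F y) x = l * ((\<Sum>a\<in>Basis. \<Sum>b\<in>Basis. tau (K w a b) x * dir_deriv z (G a b) x) + l * dir_deriv w (dir_deriv z F) x)"
    unfolding bessel_comp_cmult[OF smooth_first[OF F x] x] bessel_comp_sum[OF smooth_first[OF F x] x] third_derivative_rotate[OF F x] K_def G_def by (simp only: mult.commute)
  finally show ?thesis unfolding G_def
    by (simp only: sum.distrib sum_distrib_left[symmetric] distrib_left mult.assoc add_ac)
qed

text \<open>Only the third-order part of the commutator could survive. Its coefficient \<open>\<phi>\<close> is contracted with the
symmetric tensor of third derivatives, so only the cyclic sum of \<open>\<phi>\<close> matters, which vanishes by
polarization of the cubic identity for \<open>P\<close>.\<close>

lemma bessel_comp_commute_unit: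
  assumes F: "smooth_on U F" and x: "x \<in> U"
  shows "bessel_comp l \<ee> (bessel_comp l z F) x = bessel_comp l z (bessel_comp l \<ee> F) x"
proof -
  define \<phi> where "\<phi> \<xi> \<eta> \<zeta> = tau (x \<star> jP V \<xi> \<eta> z) \<zeta> - tau (jP V x z (\<xi> \<star> \<eta>)) \<zeta>" for \<xi> \<eta> \<zeta>
  define D where "D a b c = dir_deriv c (dir_deriv a (dir_deriv b F)) x" for a b c
  have Dr: "D b c a = D a b c" for a b c unfolding D_def by (rule third_derivative_rotate[OF F x])
  have cyc: "\<phi> a b c + \<phi> b c a + \<phi> c a b = 0" for a b c
  proof (rule polarize_cubic)
    fix a :: 'a
    have "tau (x \<star> Pop a z) a = tau x (a \<star> Pop a z)" by (simp only: tau_assoc mul_commute[of a])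
    moreover have "tau (jP V x z (a \<star> a)) a = tau x (a \<star> Pop a z)"
      by (simp only: tau_jP_rotate jP_sym[of a "a \<star> a"] jP_square_mul)
    ultimately show "\<phi> a a a = 0" by (simp add: \<phi>_def)
  next
    show "\<phi> a b c = \<phi> b a c" for a b c by (simp only: \<phi>_def jP_sym[of a b] mul_commute[of a b])
  qed (simp_all add: \<phi>_def tau_simps mul_simps jP_add1 jP_add2 jP_add3)
  define S where "S = (\<Sum>a\<in>Basis. \<Sum>b\<in>Basis. \<Sum>c\<in>Basis. \<phi> (dual a) (dual b) (dual c) * D a b c)"
  have S1: "S = (\<Sum>a\<in>Basis. \<Sum>b\<in>Basis. \<Sum>c\<in>Basis. \<phi> (dual b) (dual c) (dual a) * D a b c)"
    unfolding S_def by (subst triple_sum_rotate) (simp only: Dr)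
  have S2: "S = (\<Sum>a\<in>Basis. \<Sum>b\<in>Basis. \<Sum>c\<in>Basis. \<phi> (dual c) (dual a) (dual b) * D a b c)"
    unfolding S1 by (subst triple_sum_rotate) (simp only: Dr)
  have "S + S + S = (\<Sum>a\<in>Basis. \<Sum>b\<in>Basis. \<Sum>c\<in>Basis.
      (\<phi> (dual a) (dual b) (dual c) + \<phi> (dual b) (dual c) (dual a) + \<phi> (dual c) (dual a) (dual b)) * D a b c)"
    unfolding distrib_right sum.distrib S_def[symmetric] S1[symmetric] S2[symmetric] ..
  then have S0: "S = 0" by (simp add: cyc)
  have ex: "dir_deriv u (dir_deriv a (dir_deriv b F)) x = (\<Sum>c\<in>Basis. tau u (dual c) * D a b c)" for u a b
    unfolding D_def by (rule dir_deriv_basis[OF smooth_on_differentiable[OF smooth_second[OF F x] x]])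
  have Q: "(\<Sum>a\<in>Basis. \<Sum>b\<in>Basis. dir_deriv (jP V x \<ee> (jP V (dual a) (dual b) z)) (dir_deriv a (dir_deriv b F)) x)
      - (\<Sum>a\<in>Basis. \<Sum>b\<in>Basis. dir_deriv (jP V x z (jP V (dual a) (dual b) \<ee>)) (dir_deriv a (dir_deriv b F)) x) = S"
    unfolding S_def \<phi>_def ex jP_unit jP_unit3 by (simp only: sum_subtractf left_diff_distrib)
  have s1: "(\<Sum>a\<in>Basis. \<Sum>b\<in>Basis. \<Sum>c\<in>Basis. \<Sum>d\<in>Basis.
        tau (jP V (dual a) (dual b) z) x * tau (jP V (dual c) (dual d) w) x * dir_deriv a (dir_deriv b (dir_deriv c (dir_deriv d F))) x)
    = (\<Sum>a\<in>Basis. \<Sum>b\<in>Basis. \<Sum>c\<in>Basis. \<Sum>d\<in>Basis.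
        tau (jP V (dual a) (dual b) w) x * tau (jP V (dual c) (dual d) z) x * dir_deriv a (dir_deriv b (dir_deriv c (dir_deriv d F))) x)" for w
  proof -
    have four: "dir_deriv c (dir_deriv d (dir_deriv a (dir_deriv b F))) x = dir_deriv a (dir_deriv b (dir_deriv c (dir_deriv d F))) x" for a b c d
    proof -
      have "dir_deriv c (dir_deriv d (dir_deriv a (dir_deriv b F))) x = dir_deriv a (dir_deriv c (dir_deriv d (dir_deriv b F))) x"
        by (rule third_derivative_rotate[OF smooth_first[OF F x] x])
      also have "\<dots> = dir_deriv a (dir_deriv b (dir_deriv c (dir_deriv d F))) x"
        by (rule dir_deriv_cong[OF smooth_on_open[OF F] x]) (rule third_derivative_rotate[OF F])
      finally show ?thesis .
    qed
    show ?thesis by (subst double_sum_swap) (simp only: four mult_ac)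
  qed
  have s2: "(\<Sum>a\<in>Basis. \<Sum>b\<in>Basis. tau (jP V (dual a) (dual b) z) w * dir_deriv a (dir_deriv b F) x)
     = (\<Sum>a\<in>Basis. \<Sum>b\<in>Basis. tau (jP V (dual a) (dual b) w) z * dir_deriv a (dir_deriv b F) x)" for w
    by (simp only: tau_jP[of _ _ z w] tau_commute[of z])
  show ?thesis
    unfolding bessel_comp_bessel_comp_expand[OF F x, of l \<ee> z] bessel_comp_bessel_comp_expand[OF F x, of l z \<ee>] s1[of \<ee>] s2[of \<ee>]
    using Q S0 mixed_partials_commute[OF F x, of \<ee> z] by (simp add: algebra_simps)
qed

end

section \<open>Tangentiality of the Bessel operator\<close>

lemma quadratic_curve_in_open:
  fixes p v w :: "'a::euclidean_space"
  assumes U: "open U" and p: "p \<in> U"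
  obtains \<delta> where "\<delta> > 0" "\<And>s. \<bar>s\<bar> < \<delta> \<Longrightarrow> p + s *\<^sub>R v + (s * s) *\<^sub>R w \<in> U"
proof -
  define q where "q s = p + s *\<^sub>R v + (s * s) *\<^sub>R w" for s :: real
  have "continuous_on UNIV q" unfolding q_def by (intro continuous_intros)
  then have "open (q -` U)" using U by (simp add: continuous_on_open_vimage)
  moreover have "0 \<in> q -` U" using p by (simp add: q_def)
  ultimately obtain \<delta> where d: "\<delta> > 0" "ball 0 \<delta> \<subseteq> q -` U" by (meson open_contains_ball)
  show ?thesis
  proof (rule that[OF d(1)])
    fix s :: real assume "\<bar>s\<bar> < \<delta>"
    then have "s \<in> ball 0 \<delta>" by simp
    then have "q s \<in> U" using d(2) by blast
    then show "p + s *\<^sub>R v + (s * s) *\<^sub>R w \<in> U" by (simp only: q_def)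
  qed
qed

context cartan_jordan begin

context
  fixes U :: "'a set" and F :: "'a \<Rightarrow> real" and c :: 'a
  assumes F: "smooth_on U F" and vanish: "\<And>y. y \<in> U \<inter> Str_orbit V c \<Longrightarrow> F y = 0"
begin

text \<open>The curve \<open>g P(e + s y) c\<close> stays in the orbit and has velocity \<open>2 g(y c)\<close> at \<open>s = 0\<close>.\<close>

lemma tangent_first:
  assumes g: "g \<in> Str_id V" and gc: "blinfun_apply g c \<in> U"
  shows "dir_deriv (blinfun_apply g (y \<star> c)) F (blinfun_apply g c) = 0"
proof -
  let ?q = "\<lambda>s. g c + s *\<^sub>R (2 *\<^sub>R g (y \<star> c)) + (s * s) *\<^sub>R g (Pop y c)"
  obtain \<epsilon> where e: "\<epsilon> > 0" "\<And>s. \<bar>s\<bar> < \<epsilon> \<Longrightarrow> PL (\<ee> + s *\<^sub>R y) \<in> Str_id V" by (rule PL_Str_id[of y]) (rule that; assumption)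
  obtain \<delta> where d: "\<delta> > 0" "\<And>s. \<bar>s\<bar> < \<delta> \<Longrightarrow> ?q s \<in> U"
    by (rule quadratic_curve_in_open[OF smooth_on_open[OF F] gc]) (rule that; assumption)
  have z: "F (?q s) = 0" if s: "\<bar>s\<bar> < min \<epsilon> \<delta>" for s
  proof -
    have "(g o\<^sub>L PL (\<ee> + s *\<^sub>R y)) c = ?q s"
      by (simp add: Pop_curve blinfun.add_right blinfun.scaleR_right mult.commute)
    moreover have "g o\<^sub>L PL (\<ee> + s *\<^sub>R y) \<in> Str_id V" using s by (intro Str_id_compose g e) simp
    ultimately have "?q s \<in> Str_orbit V c" unfolding Str_orbit_def by (metis imageI)
    then show ?thesis using d(2)[of s] s by (intro vanish) simp
  qed
  have "dir_deriv (2 *\<^sub>R g (y \<star> c)) F (g c) = 0"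
  proof (rule DERIV_local_const[OF quadratic_curve_derivative[OF F gc]])
    show "0 < min \<epsilon> \<delta>" using e d by simp
    show "\<forall>s. \<bar>0 - s\<bar> < min \<epsilon> \<delta> \<longrightarrow> F (?q 0) = F (?q s)" using z z[of 0] e(1) d(1) by simp
  qed
  then show ?thesis using linear_scale[OF linear_dir_deriv[OF smooth_on_differentiable[OF F gc]], of 2] by simp
qed

text \<open>The first-order relation holds at every point of the curve \<open>g P(e + s x) c\<close>; differentiate it once more
along this curve.\<close>

lemma tangent_second:
  assumes g: "g \<in> Str_id V" and gc: "blinfun_apply g c \<in> U"
  shows "dir_deriv (blinfun_apply g (x \<star> c)) (dir_deriv (blinfun_apply g (y \<star> c)) F) (blinfun_apply g c)
     = - dir_deriv (blinfun_apply g (x \<star> (y \<star> c))) F (blinfun_apply g c)"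
proof -
  let ?q = "\<lambda>s. g c + s *\<^sub>R (2 *\<^sub>R g (x \<star> c)) + (s * s) *\<^sub>R g (Pop x c)"
  define D where "D i = dir_deriv (case i of 0 \<Rightarrow> g (y \<star> c) | Suc 0 \<Rightarrow> g (x \<star> (y \<star> c)) | _ \<Rightarrow> g (Pop x (y \<star> c))) F" for i :: nat
  have D: "D 0 = dir_deriv (g (y \<star> c)) F" "D 1 = dir_deriv (g (x \<star> (y \<star> c))) F" "D 2 = dir_deriv (g (Pop x (y \<star> c))) F"
    by (simp_all add: D_def numeral_2_eq_2)
  obtain \<epsilon> where e: "\<epsilon> > 0" "\<And>s. \<bar>s\<bar> < \<epsilon> \<Longrightarrow> PL (\<ee> + s *\<^sub>R x) \<in> Str_id V" by (rule PL_Str_id[of x]) (rule that; assumption)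
  obtain \<delta> where d: "\<delta> > 0" "\<And>s. \<bar>s\<bar> < \<delta> \<Longrightarrow> ?q s \<in> U"
    by (rule quadratic_curve_in_open[OF smooth_on_open[OF F] gc]) (rule that; assumption)
  define h where "h s = D 0 (?q s) + 2 * (s * D 1 (?q s)) + s * s * D 2 (?q s)" for s
  have z: "h s = 0" if s: "\<bar>s\<bar> < min \<epsilon> \<delta>" for s
  proof -
    let ?g = "g o\<^sub>L PL (\<ee> + s *\<^sub>R x)"
    have gq: "?g c = ?q s" by (simp add: Pop_curve blinfun.add_right blinfun.scaleR_right mult.commute)
    have gU: "?g c \<in> U" unfolding gq using s d by simp
    have "?g \<in> Str_id V" using s by (intro Str_id_compose g e) simp
    from tangent_first[OF this gU, of y] have t: "dir_deriv (?g (y \<star> c)) F (?g c) = 0" .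
    have e: "?g (y \<star> c) = g (y \<star> c) + (2 * s) *\<^sub>R g (x \<star> (y \<star> c)) + (s * s) *\<^sub>R g (Pop x (y \<star> c))"
      by (simp add: Pop_curve blinfun.add_right blinfun.scaleR_right)
    note lL = linear_dir_deriv[OF smooth_on_differentiable[OF F gU]]
    have "dir_deriv (g (y \<star> c)) F (?g c) + (2 * s) * dir_deriv (g (x \<star> (y \<star> c))) F (?g c)
        + (s * s) * dir_deriv (g (Pop x (y \<star> c))) F (?g c) = 0"
      using t unfolding e by (simp only: linear_add[OF lL] linear_scale[OF lL] real_scaleR_def)
    then show ?thesis unfolding h_def D gq by (simp only: mult.assoc)
  qed
  note q' = quadratic_curve_derivative[where v = "2 *\<^sub>R g (x \<star> c)" and w = "g (Pop x c)", OF smooth_on_dir_deriv[OF F] gc]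
  have q'': "((\<lambda>s. D i (?q s)) has_real_derivative dir_deriv (2 *\<^sub>R g (x \<star> c)) (D i) (g c)) (at 0)" for i
    unfolding D_def by (rule q')
  have "(h has_real_derivative dir_deriv (2 *\<^sub>R g (x \<star> c)) (D 0) (g c) + 2 * D 1 (g c)) (at 0)"
    unfolding h_def by (rule derivative_eq_intros q'' refl)+ simp
  then have "dir_deriv (2 *\<^sub>R g (x \<star> c)) (D 0) (g c) + 2 * D 1 (g c) = 0"
  proof (rule DERIV_local_const)
    show "0 < min \<epsilon> \<delta>" using e d by simp
    show "\<forall>s. \<bar>0 - s\<bar> < min \<epsilon> \<delta> \<longrightarrow> h 0 = h s" using z z[of 0] e(1) d(1) by simp
  qed
  moreover have "dir_deriv (2 *\<^sub>R g (x \<star> c)) (D 0) (g c) = 2 * dir_deriv (g (x \<star> c)) (D 0) (g c)"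
    unfolding D using linear_scale[OF linear_dir_deriv[OF smooth_on_differentiable[OF smooth_on_dir_deriv[OF F] gc]], of 2] by simp
  ultimately show ?thesis unfolding D by simp
qed

end

end

context cartan_jordan_simple begin

text \<open>The structure group carries the statement to the base point \<open>c\<close>, where it is the algebraic identity
above. Every component vanishes because \<open>g\<close> is onto.\<close>

theorem bessel_tangential:
  assumes Fr: "orth_system Fr \<ee>" and c: "c \<in> Fr" and f: "f \<in> Fr" "c \<noteq> f"
    and F: "smooth_on U F" and vanish: "\<And>y. y \<in> U \<inter> Str_orbit V c \<Longrightarrow> F y = 0"
    and x: "x \<in> U \<inter> Str_orbit V c"
  shows "bessel V (mixed_trace c f * real (card Fr) / real (jrank V)) F x = 0"
proof -
  define l where "l = mixed_trace c f * real (card Fr) / real (jrank V)"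
  obtain g where g: "g \<in> Str_id V" and xg: "x = blinfun_apply g c" using x by (auto simp: Str_orbit_def)
  have gc: "blinfun_apply g c \<in> U" using x xg by simp
  have gS: "g \<in> Str V" using g Str_id_subset by blast
  obtain h where h: "linear h" "\<And>x y. tau (blinfun_apply g x) y = tau x (h y)"
      "\<And>\<xi> u. h (Pop \<xi> (blinfun_apply g u)) = Pop (h \<xi>) u"
    by (rule Str_adjoint[OF gS]) (rule that; assumption)
  have lg: "linear (blinfun_apply g)" by (simp add: blinfun.bounded_linear_right bounded_linear.linear)
  define D where "D a b = dir_deriv a (dir_deriv b F) (g c)" for a b
  have D: "bilinear D" unfolding D_def by (rule bilinear_second_derivative[OF F gc])
  have lF: "linear (\<lambda>v. dir_deriv v F (g c))" by (rule linear_dir_deriv[OF smooth_on_differentiable[OF F gc]])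
  have "tau (g z) (bessel V l F x) = 0" for z
  proof -
    have "tau (g z) (bessel V l F x) = (\<Sum>a\<in>Basis. \<Sum>b\<in>Basis. D a b * tau (jP V (dual a) (dual b) (g z)) (g c)) + l * dir_deriv (g z) F (g c)"
      using bessel_comp_sum[OF F gc, of l "g z"] by (simp only: bessel_comp_def xg D_def)
    also have "\<dots> = (\<Sum>a\<in>Basis. \<Sum>b\<in>Basis. D (g a) (g b) * tau (jP V (dual a) (dual b) z) c) + l * dir_deriv (g z) F (g c)"
      by (simp only: bessel_symbol_transform[OF D lg h])
    also have "\<dots> = 0" unfolding l_def
    proof (rule tangential_core[OF Fr c f])
      show "linear (\<lambda>z. dir_deriv (g z) F (g c))" using linear_compose[OF lg lF] by (simp add: o_def)
      show "bilinear (\<lambda>a b. D (g a) (g b))"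
        by (auto simp: bilinear_def linear_add[OF lg] linear_scale[OF lg] bilinear_ladd[OF D] bilinear_lmul[OF D]
            bilinear_radd[OF D] bilinear_rmul[OF D] intro!: linearI)
      show "dir_deriv (g (x \<star> c)) F (g c) = 0" for x by (rule tangent_first[OF F vanish g gc])
      show "D (g (x \<star> c)) (g (y \<star> c)) = - dir_deriv (g (x \<star> (y \<star> c))) F (g c)" for x y
        unfolding D_def by (rule tangent_second[OF F vanish g gc])
    qed
    finally show ?thesis .
  qed
  note zero = this
  have sur: "surj (blinfun_apply g)" using gS by (auto simp: Str_def bij_def)
  have "bessel V l F x = 0"
  proof (rule tau_nondegenerate)
    fix z
    obtain u where u: "z = g u" using sur by (rule surjE)
    show "tau (bessel V l F x) z = 0" unfolding u using zero[of u] by (simp only: tau_commute[of "bessel V l F x"])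
  qed
  then show ?thesis by (simp only: l_def)
qed

end

section \<open>Words in two families of operators\<close>

text \<open>The value at \<open>x\<close> of a formal linear combination of words, each word \<open>w\<close> standing for the function \<open>g w\<close>.
Functions are extensional on \<open>M\<close>.\<close>

definition lincomb :: "'x set \<Rightarrow> (real \<times> 'w) list \<Rightarrow> ('w \<Rightarrow> 'x \<Rightarrow> real) \<Rightarrow> 'x \<Rightarrow> real" where
  "lincomb M ps g = (\<lambda>x\<in>M. \<Sum>p\<leftarrow>ps. fst p * g (snd p) x)"

definition zero_fun :: "'x set \<Rightarrow> 'x \<Rightarrow> real" where "zero_fun M = (\<lambda>x\<in>M. 0)"

lemma zero_fun_apply [simp]: "x \<in> M \<Longrightarrow> zero_fun M x = 0" by (simp add: zero_fun_def)

lemma lincomb_eq_zero: "lincomb M ps g = zero_fun M \<longleftrightarrow> (\<forall>x\<in>M. lincomb M ps g x = 0)"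
  by (auto simp: fun_eq_iff lincomb_def zero_fun_def)

text \<open>A linear space of extensional functions, with addition and scalars taken pointwise on \<open>M\<close>.\<close>

locale function_space =
  fixes M :: "'x set" and S :: "('x \<Rightarrow> real) set"
  assumes S_ext: "S \<subseteq> extensional M"
    and S_zero: "zero_fun M \<in> S"
    and S_comb: "f \<in> S \<Longrightarrow> g \<in> S \<Longrightarrow> (\<lambda>x\<in>M. a * f x + b * g x) \<in> S"
begin

definition lin_op :: "(('x \<Rightarrow> real) \<Rightarrow> 'x \<Rightarrow> real) \<Rightarrow> bool" where
  "lin_op A \<longleftrightarrow> (\<forall>f\<in>S. A f \<in> S) \<and>
     (\<forall>f\<in>S. \<forall>g\<in>S. \<forall>a b. A (\<lambda>x\<in>M. a * f x + b * g x) = (\<lambda>x\<in>M. a * A f x + b * A g x))"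

lemma lin_opD: "lin_op A \<Longrightarrow> f \<in> S \<Longrightarrow> A f \<in> S"
  "lin_op A \<Longrightarrow> f \<in> S \<Longrightarrow> g \<in> S \<Longrightarrow> A (\<lambda>x\<in>M. a * f x + b * g x) = (\<lambda>x\<in>M. a * A f x + b * A g x)"
  by (auto simp: lin_op_def)

lemma lin_op_zero: "lin_op A \<Longrightarrow> A (zero_fun M) = zero_fun M"
proof -
  assume A: "lin_op A"
  have e: "(\<lambda>x\<in>M. 0 * f x + 0 * g x) = zero_fun M" for f g :: "'x \<Rightarrow> real" by (rule ext) (simp add: zero_fun_def)
  show ?thesis using lin_opD(2)[OF A S_zero S_zero, of 0 0] unfolding e .
qed

lemma S_eqI: "f \<in> S \<Longrightarrow> g \<in> S \<Longrightarrow> (\<And>x. x \<in> M \<Longrightarrow> f x = g x) \<Longrightarrow> f = g"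
  using S_ext by (metis extensionalityI subsetD)

lemma lincomb_Nil: "lincomb M [] g = zero_fun M" by (simp add: lincomb_eq_zero) (simp add: lincomb_def)

lemma lincomb_Cons:
  "lincomb M (p # ps) g = (\<lambda>x\<in>M. fst p * g (snd p) x + 1 * lincomb M ps g x)"
  by (auto simp: lincomb_def)

lemma lincomb_S: "(\<And>p. p \<in> set ps \<Longrightarrow> g (snd p) \<in> S) \<Longrightarrow> lincomb M ps g \<in> S"
proof (induction ps)
  case Nil then show ?case using S_zero by (simp add: lincomb_Nil)
next
  case (Cons p ps) show ?case unfolding lincomb_Cons by (rule S_comb) (use Cons in auto)
qed

lemma lin_op_lincomb:
  "lin_op A \<Longrightarrow> (\<And>p. p \<in> set ps \<Longrightarrow> g (snd p) \<in> S) \<Longrightarrow> A (lincomb M ps g) = lincomb M ps (\<lambda>w. A (g w))"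
proof (induction ps)
  case Nil then show ?case using lin_op_zero by (simp add: lincomb_Nil)
next
  case (Cons p ps)
  have tl: "g (snd q) \<in> S" if "q \<in> set ps" for q using Cons.prems(2)[of q] that by simp
  have g: "g (snd p) \<in> S" "lincomb M ps g \<in> S" using Cons.prems(2)[of p] lincomb_S[of ps g] tl by simp_all
  have IH: "A (lincomb M ps g) = lincomb M ps (\<lambda>w. A (g w))" by (rule Cons.IH[OF Cons.prems(1) tl])
  show ?case unfolding lincomb_Cons lin_opD(2)[OF Cons.prems(1) g] IH ..
qed

lemma foldr_S: "(\<And>a. lin_op (A a)) \<Longrightarrow> f \<in> S \<Longrightarrow> foldr A w f \<in> S"
  by (induction w) (auto intro: lin_opD)

lemma foldr_lin_op: "(\<And>a. lin_op (A a)) \<Longrightarrow> lin_op (foldr A w)"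
  by (induction w) (auto simp: lin_op_def S_comb)

text \<open>The formal polynomial \<open>ps\<close> in non-commuting indeterminates, one for each index, evaluates to the zero
operator on \<open>A\<close>.\<close>

definition annihilates :: "('z \<Rightarrow> ('x \<Rightarrow> real) \<Rightarrow> 'x \<Rightarrow> real) \<Rightarrow> (real \<times> 'z list) list \<Rightarrow> bool" where
  "annihilates A ps \<longleftrightarrow> (\<forall>f\<in>S. lincomb M ps (\<lambda>w. foldr A w f) = zero_fun M)"

lemma lincomb_filter: "x \<in> M \<Longrightarrow> lincomb M ps g x = lincomb M (filter P ps) g x + lincomb M (filter (\<lambda>p. \<not> P p) ps) g x"
  by (simp add: lincomb_def) (induction ps, auto)

lemma lincomb_append: "x \<in> M \<Longrightarrow> lincomb M (ps @ qs) g x = lincomb M ps g x + lincomb M qs g x"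
  by (simp add: lincomb_def)

end

text \<open>The commutator with \<open>E\<close> leads from \<open>X\<close> to \<open>T\<close>, from \<open>T\<close> to \<open>2 B\<close>, and kills \<open>B\<close>.\<close>

locale ad_chain = function_space M S for M :: "'x set" and S +
  fixes X T B :: "'z \<Rightarrow> ('x \<Rightarrow> real) \<Rightarrow> 'x \<Rightarrow> real" and E :: "('x \<Rightarrow> real) \<Rightarrow> 'x \<Rightarrow> real"
  assumes lin: "lin_op (X z)" "lin_op (T z)" "lin_op (B z)" "lin_op E"
    and EX: "f \<in> S \<Longrightarrow> x \<in> M \<Longrightarrow> E (X z f) x = X z (E f) x + T z f x"
    and ET: "f \<in> S \<Longrightarrow> x \<in> M \<Longrightarrow> E (T z f) x = T z (E f) x + 2 * B z f x"
    and EB: "f \<in> S \<Longrightarrow> x \<in> M \<Longrightarrow> E (B z f) x = B z (E f) x"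
begin

text \<open>The operator \<open>ad(E)\<^sup>k / k!\<close> applied to the word \<open>w\<close> in the \<open>X\<close>: the sum over all ways of choosing \<open>X\<close>, \<open>T\<close>
or \<open>B\<close> for each letter with weights 0, 1, 2 adding up to \<open>k\<close>. Integer indices make it vanish
uniformly below 0.\<close>

fun W :: "'z list \<Rightarrow> int \<Rightarrow> ('x \<Rightarrow> real) \<Rightarrow> 'x \<Rightarrow> real" where
  "W [] k f = (if k = 0 then f else zero_fun M)"
| "W (a # w) k f = (\<lambda>x\<in>M. X a (W w k f) x + T a (W w (k - 1) f) x + B a (W w (k - 2) f) x)"

lemma S_add3: "f \<in> S \<Longrightarrow> g \<in> S \<Longrightarrow> h \<in> S \<Longrightarrow> (\<lambda>x\<in>M. f x + g x + h x) \<in> S"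
  using S_comb[OF S_comb[of f g 1 1], of h 1 1] by (simp cong: restrict_cong)

lemma W_S: "f \<in> S \<Longrightarrow> W w k f \<in> S"
  by (induction w arbitrary: k) (auto intro!: S_zero S_add3 lin_opD(1)[OF lin(1)] lin_opD(1)[OF lin(2)] lin_opD(1)[OF lin(3)])

lemmas lin_zero = lin_op_zero[OF lin(1)] lin_op_zero[OF lin(2)] lin_op_zero[OF lin(3)] lin_op_zero[OF lin(4)]

lemma W_zero: "f \<in> S \<Longrightarrow> k < 0 \<or> k > 2 * int (length w) \<Longrightarrow> W w k f = zero_fun M"
proof (induction w arbitrary: k)
  case (Cons a w)
  then have z: "W w k f = zero_fun M" "W w (k - 1) f = zero_fun M" "W w (k - 2) f = zero_fun M" by auto
  show ?case unfolding W.simps z lin_zero by (rule ext) (simp add: zero_fun_def)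
qed auto

lemma S_restrict: "f \<in> S \<Longrightarrow> (\<lambda>x\<in>M. f x) = f"
  using S_ext by (simp add: extensional_restrict subset_eq)

lemma W_bottom: "f \<in> S \<Longrightarrow> W w 0 f = foldr X w f"
proof (induction w)
  case (Cons a w)
  have "X a (foldr X w f) \<in> S" using foldr_S[of X f w] lin Cons.prems lin_opD(1) by blast
  then show ?case using Cons by (simp add: W_zero lin_zero S_restrict cong: restrict_cong)
qed simp

lemma W_top: "f \<in> S \<Longrightarrow> W w (2 * int (length w)) f = foldr B w f"
proof (induction w)
  case (Cons a w)
  have "B a (foldr B w f) \<in> S" using foldr_S[of B f w] lin Cons.prems lin_opD(1) by blast
  then show ?case using Cons by (simp add: W_zero lin_zero S_restrict cong: restrict_cong)
qed simp

lemma lin_add3: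
  assumes A: "lin_op A" and "f \<in> S" "g \<in> S" "h \<in> S" "x \<in> M"
  shows "A (\<lambda>x\<in>M. f x + g x + h x) x = A f x + A g x + A h x"
proof -
  have "(\<lambda>x\<in>M. f x + g x + h x) = (\<lambda>x\<in>M. 1 * (\<lambda>x\<in>M. 1 * f x + 1 * g x) x + 1 * h x)" by auto
  then show ?thesis using lin_opD(2)[OF A S_comb[OF assms(2,3), of 1 1] assms(4), of 1 1] lin_opD(2)[OF A assms(2,3), of 1 1] assms(5)
    by simp
qed

text \<open>The commutator is a derivation, and raising the weight of one letter accounts for the factor
\<open>k + 1\<close>, since the \<open>X\<close>, \<open>T\<close> and \<open>B\<close> form a chain with multiplicities 1 and 2.\<close>

lemma ad_W: "f \<in> S \<Longrightarrow> x \<in> M \<Longrightarrow> E (W w k f) x = W w k (E f) x + (of_int k + 1) * W w (k + 1) f x"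
proof (induction w arbitrary: k x)
  case Nil then show ?case by (auto simp: lin_zero)
next
  case (Cons a w)
  note f = Cons.prems(1) and x = Cons.prems(2)
  have Ef: "E f \<in> S" using f lin(4) lin_opD(1) by blast
  have step: "E (W w k f) = (\<lambda>x\<in>M. 1 * W w k (E f) x + (of_int k + 1) * W w (k + 1) f x)" for k
    by (rule S_eqI[OF lin_opD(1)[OF lin(4) W_S[OF f]] S_comb[OF W_S[OF Ef] W_S[OF f]]]) (simp add: Cons.IH[OF f])
  have mv: "A (E (W w k f)) x = A (W w k (E f)) x + (of_int k + 1) * A (W w (k + 1) f) x" if "lin_op A" for A k
    unfolding step lin_opD(2)[OF that W_S[OF Ef] W_S[OF f]] using x by simp
  note SS = lin_opD(1)[OF lin(1) W_S[OF f]] lin_opD(1)[OF lin(2) W_S[OF f]] lin_opD(1)[OF lin(3) W_S[OF f]]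
  have "E (W (a # w) k f) x = E (X a (W w k f)) x + E (T a (W w (k - 1) f)) x + E (B a (W w (k - 2) f)) x"
    unfolding W.simps by (rule lin_add3[OF lin(4) SS x])
  also have "\<dots> = W (a # w) k (E f) x + (of_int k + 1) * W (a # w) (k + 1) f x"
    using x by (simp add: EX[OF W_S[OF f] x] ET[OF W_S[OF f] x] EB[OF W_S[OF f] x] mv[OF lin(1)] mv[OF lin(2)] mv[OF lin(3)] algebra_simps)
  finally show ?case .
qed

text \<open>The combination vanishes for all weights \<open>k\<close> by induction, and for \<open>k = 2 m\<close> only the words of maximal
length \<open>m\<close> contribute, each with the pure word in \<open>B\<close>.\<close>

lemma annihilates_top:
  assumes X: "annihilates X ps" and m: "\<And>p. p \<in> set ps \<Longrightarrow> length (snd p) \<le> m"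
  shows "annihilates B (filter (\<lambda>p. length (snd p) = m) ps)"
proof -
  have W0: "\<forall>f\<in>S. lincomb M ps (\<lambda>w. W w (int k) f) = zero_fun M" for k
  proof (induction k)
    case 0 show ?case using X by (simp add: annihilates_def W_bottom)
  next
    case (Suc k)
    show ?case
    proof
      fix f assume f: "f \<in> S"
      have Ef: "E f \<in> S" using f lin(4) lin_opD(1) by blast
      have "E (lincomb M ps (\<lambda>w. W w (int k) f)) = lincomb M ps (\<lambda>w. E (W w (int k) f))"
        by (rule lin_op_lincomb[OF lin(4)]) (rule W_S[OF f])
      then have 1: "lincomb M ps (\<lambda>w. E (W w (int k) f)) = zero_fun M" using Suc f by (simp add: lin_zero)
      have "lincomb M ps (\<lambda>w. W w (int (Suc k)) f) x = 0" if x: "x \<in> M" for x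
      proof -
        have "lincomb M ps (\<lambda>w. E (W w (int k) f)) x
          = lincomb M ps (\<lambda>w. W w (int k) (E f)) x + (of_int (int k) + 1) * lincomb M ps (\<lambda>w. W w (int k + 1) f) x"
          using x by (simp add: lincomb_def ad_W[OF f x] distrib_left sum_list_addf mult.left_commute flip: sum_list_const_mult)
        then have "(real k + 1) * lincomb M ps (\<lambda>w. W w (int k + 1) f) x = 0" using 1 Suc Ef x by simp
        then have "lincomb M ps (\<lambda>w. W w (int k + 1) f) x = 0" by (simp add: add_nonneg_eq_0_iff)
        then show ?thesis by (simp add: add.commute)
      qed
      then show "lincomb M ps (\<lambda>w. W w (int (Suc k)) f) = zero_fun M" by (simp add: lincomb_eq_zero)
    qed
  qed
  show ?thesis unfolding annihilates_def
  proof
    fix f assume f: "f \<in> S"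
    have "lincomb M (filter (\<lambda>p. length (snd p) = m) ps) (\<lambda>w. foldr B w f) = lincomb M ps (\<lambda>w. W w (int (2 * m)) f)"
    proof -
      have "(\<Sum>p\<leftarrow>filter (\<lambda>p. length (snd p) = m) ps. fst p * foldr B (snd p) f x) = (\<Sum>p\<leftarrow>ps. fst p * W (snd p) (int (2 * m)) f x)"
        if x: "x \<in> M" for x
        using m
      proof (induction ps)
        case (Cons p ps)
        have "W (snd p) (int (2 * m)) f x = (if length (snd p) = m then foldr B (snd p) f x else 0)"
          using Cons.prems[of p] W_top[OF f, of "snd p"] W_zero[OF f, of "int (2 * m)" "snd p"] x by auto
        then show ?case using Cons by auto
      qed simp
      then show ?thesis by (auto simp: lincomb_def)
    qed
    then show "lincomb M (filter (\<lambda>p. length (snd p) = m) ps) (\<lambda>w. foldr B w f) = zero_fun M" using W0[of "2 * m"] f by simp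
  qed
qed

end

text \<open>Two chains in opposite directions. The operators in degree zero may differ, by a sign in the
application.\<close>

locale ad_pair = up: ad_chain M S X T B E + down: ad_chain M S B T' X E'
  for M :: "'x set" and S and X T B :: "'z \<Rightarrow> ('x \<Rightarrow> real) \<Rightarrow> 'x \<Rightarrow> real" and E T' E'
begin

text \<open>Induction on a bound for the length of the words. The part of top length vanishes in \<open>B\<close> by the first
chain, hence in \<open>X\<close> by the second one, and can be removed.\<close>

lemma annihilates_step: "up.annihilates X ps \<Longrightarrow> up.annihilates B ps"
proof -
  have "up.annihilates X ps \<Longrightarrow> (\<And>p. p \<in> set ps \<Longrightarrow> length (snd p) < m) \<Longrightarrow> up.annihilates B ps" for m
  proof (induction m arbitrary: ps)
    case 0
    then have "ps = []" by (cases ps) auto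
    then show ?case by (simp add: up.annihilates_def up.lincomb_Nil)
  next
    case (Suc m)
    let ?t = "filter (\<lambda>p. length (snd p) = m) ps" and ?r = "filter (\<lambda>p. length (snd p) \<noteq> m) ps"
    have B: "up.annihilates B ?t" by (rule up.annihilates_top[OF Suc.prems(1)]) (use Suc.prems(2) in force)
    have "up.annihilates X (filter (\<lambda>p. length (snd p) = m) ?t)" by (rule down.annihilates_top[OF B]) auto
    then have X: "up.annihilates X ?t" by simp
    have "up.annihilates X ?r" unfolding up.annihilates_def
    proof
      fix f assume f: "f \<in> S"
      have "lincomb M ?r (\<lambda>w. foldr X w f) x = 0" if "x \<in> M" for x
        using up.lincomb_filter[OF that, of ps "\<lambda>w. foldr X w f" "\<lambda>p. length (snd p) = m"] X Suc.prems(1) f that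
        by (simp add: up.annihilates_def)
      then show "lincomb M ?r (\<lambda>w. foldr X w f) = zero_fun M" by (simp add: lincomb_eq_zero)
    qed
    then have Br: "up.annihilates B ?r" by (rule Suc.IH) (use Suc.prems(2) in force)
    show ?case unfolding up.annihilates_def
    proof
      fix f assume f: "f \<in> S"
      have "lincomb M ps (\<lambda>w. foldr B w f) x = 0" if "x \<in> M" for x
        using up.lincomb_filter[OF that, of ps "\<lambda>w. foldr B w f" "\<lambda>p. length (snd p) = m"] B Br f that
        by (simp add: up.annihilates_def)
      then show "lincomb M ps (\<lambda>w. foldr B w f) = zero_fun M" by (simp add: lincomb_eq_zero)
    qed
  qed
  moreover have "length (snd p) < Suc (Max ((\<lambda>p. length (snd p)) ` set ps))" if "p \<in> set ps" for p
    using that by (simp add: less_Suc_eq_le)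
  ultimately show "up.annihilates X ps \<Longrightarrow> up.annihilates B ps" by blast
qed

end

context ad_pair begin

lemma annihilates_iff: "up.annihilates X ps \<longleftrightarrow> up.annihilates B ps"
proof -
  interpret rev: ad_pair M S B T' X E' T E by unfold_locales
  show ?thesis using annihilates_step rev.annihilates_step by blast
qed

end

section \<open>Bessel operators on smooth functions of the orbit\<close>

definition extends_on :: "'a::euclidean_space set \<Rightarrow> ('a \<Rightarrow> real) \<Rightarrow> 'a set \<Rightarrow> ('a \<Rightarrow> real) \<Rightarrow> bool" where
  "extends_on M f U F \<longleftrightarrow> smooth_on U F \<and> (\<forall>y\<in>U \<inter> M. F y = f y)"

lemma smooth_functionsE:
  assumes "f \<in> smooth_functions M" "x \<in> M" obtains U F where "x \<in> U" "extends_on M f U F"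
  using assms unfolding smooth_functions_def local_extension_def extends_on_def by blast

lemma smooth_functionsI:
  assumes "f \<in> extensional M" "\<And>x. x \<in> M \<Longrightarrow> \<exists>U F. x \<in> U \<and> extends_on M f U F" shows "f \<in> smooth_functions M"
  using assms unfolding smooth_functions_def local_extension_def extends_on_def by blast

lemma extends_on_comb:
  assumes "extends_on M f U F" "extends_on M g W G"
  shows "extends_on M (\<lambda>x\<in>M. a * f x + b * g x) (U \<inter> W) (\<lambda>x. a * F x + b * G x)"
proof -
  have o: "open (U \<inter> W)" using assms smooth_on_open unfolding extends_on_def by blast
  have "smooth_on (U \<inter> W) F" "smooth_on (U \<inter> W) G" using assms smooth_on_subset[OF _ o] unfolding extends_on_def by blast+
  then show ?thesis using assms by (auto simp: extends_on_def intro!: smooth_on_add smooth_on_cmult)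
qed

lemma function_space_smooth: "function_space M (smooth_functions M)"
proof
  show "smooth_functions M \<subseteq> extensional M" by (auto simp: smooth_functions_def)
  show "zero_fun M \<in> smooth_functions M"
  proof (rule smooth_functionsI)
    show "zero_fun M \<in> extensional M" by (simp add: zero_fun_def)
    show "\<exists>U F. x \<in> U \<and> extends_on M (zero_fun M) U F" for x
      by (rule exI[of _ UNIV], rule exI[of _ "\<lambda>x. 0"]) (simp add: extends_on_def smooth_on_const)
  qed
next
  fix f g :: "'a \<Rightarrow> real" and a b :: real assume fg: "f \<in> smooth_functions M" "g \<in> smooth_functions M"
  show "(\<lambda>x\<in>M. a * f x + b * g x) \<in> smooth_functions M"
  proof (rule smooth_functionsI)
    fix x assume x: "x \<in> M"
    obtain U F where "x \<in> U" "extends_on M f U F" by (rule smooth_functionsE[OF fg(1) x])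
    moreover obtain W G where "x \<in> W" "extends_on M g W G" by (rule smooth_functionsE[OF fg(2) x])
    ultimately show "\<exists>U F. x \<in> U \<and> extends_on M (\<lambda>x\<in>M. a * f x + b * g x) U F"
      using extends_on_comb[of M f U F g W G a b] by blast
  qed simp
qed

text \<open>The remaining argument needs only tangentiality, on any set and for any parameter.\<close>

locale tangential_bessel = cartan_jordan V \<theta> for V :: "'a::euclidean_space jalg" and \<theta> +
  fixes M :: "'a set" and l :: real
  assumes tangential: "\<And>U F x. smooth_on U F \<Longrightarrow> (\<And>y. y \<in> U \<inter> M \<Longrightarrow> F y = 0) \<Longrightarrow> x \<in> U \<inter> M \<Longrightarrow> bessel V l F x = 0"
begin

sublocale function_space M "smooth_functions M" by (rule function_space_smooth)

text \<open>The difference of two extensions vanishes on \<open>M\<close>, and the Bessel operator is tangential. So the value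
of the induced operator is well defined.\<close>

lemma bessel_extension_unique:
  assumes F: "extends_on M f U F" and G: "extends_on M f W G" and x: "x \<in> U" "x \<in> W" "x \<in> M"
  shows "bessel V l F x = bessel V l G x"
proof -
  have o: "open (U \<inter> W)" using F G smooth_on_open unfolding extends_on_def by blast
  have s: "smooth_on (U \<inter> W) F" "smooth_on (U \<inter> W) G"
    using F G smooth_on_subset[OF _ o] unfolding extends_on_def by blast+
  have sG: "smooth_on (U \<inter> W) (\<lambda>x. (-1) * G x)" by (rule smooth_on_cmult[OF s(2)])
  have xx: "x \<in> U \<inter> W" using x by blast
  have "bessel V l (\<lambda>x. F x + (-1) * G x) x = 0"
  proof (rule tangential)
    show "smooth_on (U \<inter> W) (\<lambda>x. F x + (-1) * G x)" by (rule smooth_on_add[OF s(1) sG])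
    show "F y + (-1) * G y = 0" if "y \<in> U \<inter> W \<inter> M" for y using that F G by (simp add: extends_on_def)
    show "x \<in> U \<inter> W \<inter> M" using x by blast
  qed
  then have "bessel_comp l z F x + (-1) * bessel_comp l z G x = 0" for z
    using bessel_comp_add[OF s(1) sG xx, of l z] bessel_comp_cmult[OF s(2) xx, of l z "-1"] by (simp add: bessel_comp_def tau_simps)
  then show ?thesis unfolding bessel_comp_def by (intro tau_eqI) (simp add: tau_commute)
qed

definition bessel_on :: "'a \<Rightarrow> ('a \<Rightarrow> real) \<Rightarrow> 'a \<Rightarrow> real" where
  "bessel_on z = bessel_operator V l M (tau z)"

definition mult_on :: "'a \<Rightarrow> ('a \<Rightarrow> real) \<Rightarrow> 'a \<Rightarrow> real" where
  "mult_on z f = (\<lambda>x\<in>M. tau z x * f x)"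

text \<open>Defined as a commutator, so that no separate proof of independence of the extension is required.\<close>

definition euler_on :: "'a \<Rightarrow> ('a \<Rightarrow> real) \<Rightarrow> 'a \<Rightarrow> real" where
  "euler_on z f = (\<lambda>x\<in>M. bessel_on \<ee> (mult_on z f) x - mult_on z (bessel_on \<ee> f) x)"

definition neg_euler_on :: "'a \<Rightarrow> ('a \<Rightarrow> real) \<Rightarrow> 'a \<Rightarrow> real" where
  "neg_euler_on z f = (\<lambda>x\<in>M. - euler_on z f x)"

lemma bessel_on_eval:
  assumes f: "f \<in> smooth_functions M" and F: "extends_on M f U F" and x: "x \<in> U" "x \<in> M"
  shows "bessel_on z f x = bessel_comp l z F x"
proof -
  have "bessel_on z f x = (THE y. \<forall>G. local_extension M f x G \<longrightarrow> y = tau z (bessel V l G x))"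
    using f x by (simp add: bessel_on_def bessel_operator_def)
  also have "\<dots> = bessel_comp l z F x"
  proof (rule the_equality)
    show "\<forall>G. local_extension M f x G \<longrightarrow> bessel_comp l z F x = tau z (bessel V l G x)"
    proof (intro allI impI)
      fix G assume "local_extension M f x G"
      then obtain W where W: "x \<in> W" "extends_on M f W G" by (auto simp: local_extension_def extends_on_def)
      show "bessel_comp l z F x = tau z (bessel V l G x)"
        unfolding bessel_comp_def bessel_extension_unique[OF F W(2) x(1) W(1) x(2)] ..
    qed
    fix y assume "\<forall>G. local_extension M f x G \<longrightarrow> y = tau z (bessel V l G x)"
    moreover have "local_extension M f x F" using F x by (auto simp: local_extension_def extends_on_def)
    ultimately show "y = bessel_comp l z F x" by (simp add: bessel_comp_def)
  qed
  finally show ?thesis .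
qed

lemma bessel_on_ext: "f \<in> smooth_functions M \<Longrightarrow> bessel_on z f \<in> extensional M"
  by (simp add: bessel_on_def bessel_operator_def)

lemma bessel_on_extends:
  assumes f: "f \<in> smooth_functions M" and F: "extends_on M f U F" shows "extends_on M (bessel_on z f) U (bessel_comp l z F)"
  unfolding extends_on_def
proof
  show "smooth_on U (bessel_comp l z F)" using F by (simp add: extends_on_def smooth_bessel_comp)
  show "\<forall>y\<in>U \<inter> M. bessel_comp l z F y = bessel_on z f y" using bessel_on_eval[OF f F] by simp
qed

lemma mult_on_extends: assumes F: "extends_on M f U F" shows "extends_on M (mult_on z f) U (\<lambda>x. tau z x * F x)"
  using assms smooth_tau_mult[of U F z] by (simp add: extends_on_def mult_on_def)

lemma bessel_on_S: assumes f: "f \<in> smooth_functions M" shows "bessel_on z f \<in> smooth_functions M"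
proof (rule smooth_functionsI[OF bessel_on_ext[OF f]])
  fix x assume x: "x \<in> M"
  obtain U F where "x \<in> U" "extends_on M f U F" by (rule smooth_functionsE[OF f x])
  then show "\<exists>U F. x \<in> U \<and> extends_on M (bessel_on z f) U F" using bessel_on_extends[OF f] by blast
qed

lemma mult_on_S: assumes f: "f \<in> smooth_functions M" shows "mult_on z f \<in> smooth_functions M"
proof (rule smooth_functionsI)
  show "mult_on z f \<in> extensional M" by (simp add: mult_on_def)
  fix x assume x: "x \<in> M"
  obtain U F where "x \<in> U" "extends_on M f U F" by (rule smooth_functionsE[OF f x])
  then show "\<exists>U F. x \<in> U \<and> extends_on M (mult_on z f) U F" using mult_on_extends by blast
qed

lemma euler_on_extends:
  assumes f: "f \<in> smooth_functions M" and F: "extends_on M f U F" shows "extends_on M (euler_on z f) U (euler_op l z F)"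
  unfolding extends_on_def
proof
  have s: "smooth_on U F" using F by (simp add: extends_on_def)
  show "smooth_on U (euler_op l z F)" by (rule smooth_euler_op[OF s])
  show "\<forall>y\<in>U \<inter> M. euler_op l z F y = euler_on z f y"
  proof
    fix y assume y: "y \<in> U \<inter> M"
    then have y': "y \<in> U" "y \<in> M" by auto
    have "bessel_on \<ee> (mult_on z f) y = bessel_comp l \<ee> (\<lambda>x. tau z x * F x) y" by (rule bessel_on_eval[OF mult_on_S[OF f] mult_on_extends[OF F] y'])
    moreover have "mult_on z (bessel_on \<ee> f) y = tau z y * bessel_comp l \<ee> F y" using bessel_on_eval[OF f F y'] y' by (simp add: mult_on_def)
    ultimately show "euler_op l z F y = euler_on z f y" using bessel_comp_unit_tau_mult[OF s y'(1), of l z] y' by (simp add: euler_on_def)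
  qed
qed

lemma lin_bessel_on: "lin_op (bessel_on z)" unfolding lin_op_def
proof (intro conjI ballI allI)
  show "f \<in> smooth_functions M \<Longrightarrow> bessel_on z f \<in> smooth_functions M" for f by (rule bessel_on_S)
next
  fix f g :: "'a \<Rightarrow> real" and a b :: real assume f: "f \<in> smooth_functions M" and g: "g \<in> smooth_functions M"
  note fg = S_comb[OF f g, of a b]
  show "bessel_on z (\<lambda>x\<in>M. a * f x + b * g x) = (\<lambda>x\<in>M. a * bessel_on z f x + b * bessel_on z g x)"
  proof (rule S_eqI[OF bessel_on_S[OF fg] S_comb[OF bessel_on_S[OF f] bessel_on_S[OF g]]])
    fix x assume x: "x \<in> M"
    obtain U F where F: "x \<in> U" "extends_on M f U F" by (rule smooth_functionsE[OF f x])
    obtain W G where G: "x \<in> W" "extends_on M g W G" by (rule smooth_functionsE[OF g x])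
    have o: "open (U \<inter> W)" using F G smooth_on_open unfolding extends_on_def by blast
    have s: "smooth_on (U \<inter> W) F" "smooth_on (U \<inter> W) G"
      using F G smooth_on_subset[OF _ o] unfolding extends_on_def by blast+
    have xx: "x \<in> U \<inter> W" using F G by blast
    have "bessel_on z (\<lambda>x\<in>M. a * f x + b * g x) x = bessel_comp l z (\<lambda>x. a * F x + b * G x) x"
      by (rule bessel_on_eval[OF fg extends_on_comb[OF F(2) G(2)] xx x])
    also have "\<dots> = a * bessel_comp l z F x + b * bessel_comp l z G x"
      by (simp only: bessel_comp_add[OF smooth_on_cmult[OF s(1)] smooth_on_cmult[OF s(2)] xx] bessel_comp_cmult[OF s(1) xx] bessel_comp_cmult[OF s(2) xx])
    finally show "bessel_on z (\<lambda>x\<in>M. a * f x + b * g x) x = (\<lambda>x\<in>M. a * bessel_on z f x + b * bessel_on z g x) x"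
      using x bessel_on_eval[OF f F(2) F(1) x] bessel_on_eval[OF g G(2) G(1) x] by simp
  qed
qed

lemma lin_mult_on: "lin_op (mult_on z)" unfolding lin_op_def
proof (intro conjI ballI allI)
  show "f \<in> smooth_functions M \<Longrightarrow> mult_on z f \<in> smooth_functions M" for f by (rule mult_on_S)
  show "mult_on z (\<lambda>x\<in>M. a * f x + b * g x) = (\<lambda>x\<in>M. a * mult_on z f x + b * mult_on z g x)" for f g a b
    by (auto simp: mult_on_def fun_eq_iff algebra_simps)
qed

lemma euler_on_S: assumes f: "f \<in> smooth_functions M" shows "euler_on z f \<in> smooth_functions M"
proof -
  have "(\<lambda>x\<in>M. 1 * bessel_on \<ee> (mult_on z f) x + (-1) * mult_on z (bessel_on \<ee> f) x) \<in> smooth_functions M"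
    by (rule S_comb[OF bessel_on_S[OF mult_on_S[OF f]] mult_on_S[OF bessel_on_S[OF f]]])
  then show ?thesis by (simp add: euler_on_def)
qed

lemma lin_euler_on: "lin_op (euler_on z)" unfolding lin_op_def
proof (intro conjI ballI allI)
  show "f \<in> smooth_functions M \<Longrightarrow> euler_on z f \<in> smooth_functions M" for f by (rule euler_on_S)
next
  fix f g :: "'a \<Rightarrow> real" and a b :: real assume f: "f \<in> smooth_functions M" and g: "g \<in> smooth_functions M"
  show "euler_on z (\<lambda>x\<in>M. a * f x + b * g x) = (\<lambda>x\<in>M. a * euler_on z f x + b * euler_on z g x)"
    unfolding euler_on_def lin_opD(2)[OF lin_mult_on f g] lin_opD(2)[OF lin_bessel_on f g] lin_opD(2)[OF lin_bessel_on mult_on_S[OF f] mult_on_S[OF g]]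
      lin_opD(2)[OF lin_mult_on bessel_on_S[OF f] bessel_on_S[OF g]]
    by (rule restrict_ext) (simp add: algebra_simps)
qed

lemma lin_neg_euler_on: "lin_op (neg_euler_on z)" unfolding lin_op_def
proof (intro conjI ballI allI)
  show "neg_euler_on z f \<in> smooth_functions M" if "f \<in> smooth_functions M" for f
  proof -
    have "(\<lambda>x\<in>M. (-1) * euler_on z f x + 0 * euler_on z f x) \<in> smooth_functions M" by (rule S_comb[OF euler_on_S[OF that] euler_on_S[OF that]])
    then show ?thesis by (simp add: neg_euler_on_def)
  qed
next
  fix f g :: "'a \<Rightarrow> real" and a b :: real assume f: "f \<in> smooth_functions M" and g: "g \<in> smooth_functions M"
  show "neg_euler_on z (\<lambda>x\<in>M. a * f x + b * g x) = (\<lambda>x\<in>M. a * neg_euler_on z f x + b * neg_euler_on z g x)"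
    unfolding neg_euler_on_def lin_opD(2)[OF lin_euler_on f g] by (rule restrict_ext) (simp add: algebra_simps)
qed

sublocale ad_pair M "smooth_functions M" mult_on euler_on bessel_on "bessel_on \<ee>" neg_euler_on "mult_on \<ee>"
proof unfold_locales
  fix z and f :: "'a \<Rightarrow> real" and x :: 'a
  assume f: "f \<in> smooth_functions M" and x: "x \<in> M"
  obtain U F where xU: "x \<in> U" and F: "extends_on M f U F" by (rule smooth_functionsE[OF f x])
  have s: "smooth_on U F" using F by (simp add: extends_on_def)
  have Fx: "F x = f x" using F xU x by (simp add: extends_on_def)
  have t: "euler_on z g x = euler_op l z G x" if "g \<in> smooth_functions M" "extends_on M g U G" for g G
    using euler_on_extends[OF that, of z] xU x by (simp add: extends_on_def)
  note bf = bessel_on_eval[OF f F xU x]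
  note bx = bessel_on_eval[OF mult_on_S[OF f] mult_on_extends[OF F] xU x]
  note bb = bessel_on_eval[OF bessel_on_S[OF f] bessel_on_extends[OF f F] xU x]
  note bt = bessel_on_eval[OF euler_on_S[OF f] euler_on_extends[OF f F] xU x]
  show "bessel_on \<ee> (mult_on z f) x = mult_on z (bessel_on \<ee> f) x + euler_on z f x" using x by (simp add: euler_on_def)
  show "bessel_on \<ee> (euler_on z f) x = euler_on z (bessel_on \<ee> f) x + 2 * bessel_on z f x"
    unfolding bt t[OF bessel_on_S[OF f] bessel_on_extends[OF f F]] bf by (rule bessel_comp_unit_euler_op[OF s xU])
  show "bessel_on \<ee> (bessel_on z f) x = bessel_on z (bessel_on \<ee> f) x"
    unfolding bb by (rule bessel_comp_commute_unit[OF s xU])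
  show "mult_on \<ee> (bessel_on z f) x = bessel_on z (mult_on \<ee> f) x + neg_euler_on z f x"
    using bessel_comp_tau_mult_unit[OF s xU, of l z] x unfolding bx neg_euler_on_def by (simp add: mult_on_def bf t[OF f F])
  show "mult_on \<ee> (neg_euler_on z f) x = neg_euler_on z (mult_on \<ee> f) x + 2 * mult_on z f x"
    using euler_op_tau_mult_unit[OF s xU, of l z] x t[OF mult_on_S[OF f] mult_on_extends[OF F], of \<ee>] t[OF f F] Fx
    by (simp add: neg_euler_on_def) (simp add: mult_on_def algebra_simps neg_euler_on_def)
  show "mult_on \<ee> (mult_on z f) x = mult_on z (mult_on \<ee> f) x" using x by (simp add: mult_on_def)
qed (rule lin_mult_on lin_euler_on lin_bessel_on lin_neg_euler_on)+

section \<open>The two rings as quotients of one free algebra\<close>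

text \<open>The polynomial function obtained from a formal non-commutative polynomial by substituting \<open>\<tau>(a, \<cdot>)\<close>
for the letter \<open>a\<close>.\<close>

definition peval :: "(real \<times> 'a list) list \<Rightarrow> 'a \<Rightarrow> real" where
  "peval ps x = (\<Sum>p\<leftarrow>ps. fst p * (\<Prod>a\<leftarrow>snd p. tau a x))"

text \<open>The operator obtained from the same formal polynomial by substituting \<open>B\<^sub>a\<close> for the letter \<open>a\<close>.\<close>

definition beval :: "(real \<times> 'a list) list \<Rightarrow> ('a \<Rightarrow> real) \<Rightarrow> 'a \<Rightarrow> real" where
  "beval ps = (\<lambda>f\<in>smooth_functions M. lincomb M ps (\<lambda>w. foldr bessel_on w f))"

definition neg :: "(real \<times> 'a list) list \<Rightarrow> (real \<times> 'a list) list" where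
  "neg ps = map (\<lambda>p. (- fst p, snd p)) ps"

definition pmul :: "(real \<times> 'a list) list \<Rightarrow> (real \<times> 'a list) list \<Rightarrow> (real \<times> 'a list) list" where
  "pmul ps qs = concat (map (\<lambda>p. map (\<lambda>q. (fst p * fst q, snd p @ snd q)) qs) ps)"

lemma foldr_mult_on: "x \<in> M \<Longrightarrow> foldr mult_on w f x = (\<Prod>a\<leftarrow>w. tau a x) * f x"
  by (induction w) (simp_all add: mult_on_def mult.assoc)

lemma lincomb_mult_on: "x \<in> M \<Longrightarrow> lincomb M ps (\<lambda>w. foldr mult_on w f) x = peval ps x * f x"
  by (simp add: lincomb_def peval_def foldr_mult_on sum_list_mult_const[symmetric] mult.assoc)

lemma one_S: "(\<lambda>x\<in>M. 1) \<in> smooth_functions M"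
proof (rule smooth_functionsI)
  show "\<exists>U F. x \<in> U \<and> extends_on M (\<lambda>x\<in>M. 1) U F" for x
    by (rule exI[of _ UNIV], rule exI[of _ "\<lambda>x. 1"]) (simp add: extends_on_def smooth_on_const)
qed simp

text \<open>Multiplication by a function is zero exactly when the function is, as the constant 1 is smooth.\<close>

lemma annihilates_mult_on: "annihilates mult_on ps \<longleftrightarrow> (\<forall>x\<in>M. peval ps x = 0)"
proof
  assume "annihilates mult_on ps"
  then have "lincomb M ps (\<lambda>w. foldr mult_on w (\<lambda>x\<in>M. 1)) = zero_fun M" using one_S by (simp add: annihilates_def)
  then show "\<forall>x\<in>M. peval ps x = 0" by (simp add: lincomb_eq_zero lincomb_mult_on)
qed (simp add: annihilates_def lincomb_eq_zero lincomb_mult_on)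

lemma lincomb_neg: "x \<in> M \<Longrightarrow> lincomb M (neg ps) g x = - lincomb M ps g x"
  by (induction ps) (simp_all add: neg_def lincomb_def)

lemma lincomb_pmul:
  "x \<in> M \<Longrightarrow> lincomb M (pmul ps qs) g x = (\<Sum>p\<leftarrow>ps. fst p * (\<Sum>q\<leftarrow>qs. fst q * g (snd p @ snd q) x))"
  by (induction ps) (simp_all add: pmul_def lincomb_def o_def sum_list_const_mult mult.assoc)

lemma peval_append: "peval (ps @ qs) x = peval ps x + peval qs x" by (simp add: peval_def)
lemma peval_neg: "peval (neg ps) x = - peval ps x" by (induction ps) (simp_all add: peval_def neg_def)
lemma peval_Nil: "peval [] x = 0" and peval_Cons: "peval (p # ps) x = fst p * (\<Prod>a\<leftarrow>snd p. tau a x) + peval ps x"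
  by (simp_all add: peval_def)
lemma pmul_Nil: "pmul [] qs = []" and pmul_Cons: "pmul (p # ps) qs = map (\<lambda>q. (fst p * fst q, snd p @ snd q)) qs @ pmul ps qs"
  by (simp_all add: pmul_def)
lemma peval_pmul: "peval (pmul ps qs) x = peval ps x * peval qs x"
proof -
  have "peval (map (\<lambda>q. (a * fst q, w @ snd q)) qs) x = (a * (\<Prod>a\<leftarrow>w. tau a x)) * peval qs x" for a w
    by (induction qs) (simp_all add: peval_Nil peval_Cons algebra_simps)
  then show ?thesis by (induction ps) (simp_all add: peval_Nil pmul_Nil peval_Cons pmul_Cons peval_append algebra_simps)
qed

lemma beval_S: "f \<in> smooth_functions M \<Longrightarrow> lincomb M ps (\<lambda>w. foldr bessel_on w f) \<in> smooth_functions M"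
  by (rule lincomb_S) (rule foldr_S[OF lin_bessel_on])

text \<open>The heart of the isomorphism: both evaluations have the same kernel.\<close>

lemma beval_eq_iff: "beval ps = beval qs \<longleftrightarrow> restrict (peval ps) M = restrict (peval qs) M"
proof -
  have "beval ps = beval qs \<longleftrightarrow> annihilates bessel_on (ps @ neg qs)"
  proof
    assume eq: "beval ps = beval qs"
    show "annihilates bessel_on (ps @ neg qs)" unfolding annihilates_def lincomb_eq_zero
    proof (intro ballI)
      fix f x assume f: "f \<in> smooth_functions M" and x: "x \<in> M"
      have "beval ps f x = beval qs f x" by (simp only: eq)
      then show "lincomb M (ps @ neg qs) (\<lambda>w. foldr bessel_on w f) x = 0"
        using f x by (simp add: lincomb_append lincomb_neg beval_def)
    qed
  next
    assume a: "annihilates bessel_on (ps @ neg qs)"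
    show "beval ps = beval qs" unfolding beval_def
    proof (rule restrict_ext)
      fix f assume f: "f \<in> smooth_functions M"
      show "lincomb M ps (\<lambda>w. foldr bessel_on w f) = lincomb M qs (\<lambda>w. foldr bessel_on w f)"
      proof (rule S_eqI[OF beval_S[OF f] beval_S[OF f]])
        fix x assume x: "x \<in> M"
        have "lincomb M (ps @ neg qs) (\<lambda>w. foldr bessel_on w f) x = 0"
          using a f x by (simp add: annihilates_def)
        then show "lincomb M ps (\<lambda>w. foldr bessel_on w f) x = lincomb M qs (\<lambda>w. foldr bessel_on w f) x"
          using x by (simp add: lincomb_append lincomb_neg)
      qed
    qed
  qed
  also have "\<dots> \<longleftrightarrow> annihilates mult_on (ps @ neg qs)" by (rule annihilates_iff[symmetric])
  also have "\<dots> \<longleftrightarrow> (\<forall>x\<in>M. peval ps x = peval qs x)" by (simp add: annihilates_mult_on peval_append peval_neg)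
  also have "\<dots> \<longleftrightarrow> restrict (peval ps) M = restrict (peval qs) M" by (auto simp: fun_eq_iff)
  finally show ?thesis .
qed

abbreviation R where "R \<equiv> operator_ring M"

lemma beval_carrier: "beval ps \<in> carrier R"
proof -
  have "(\<lambda>f\<in>smooth_functions M. lincomb M ps (\<lambda>w. foldr bessel_on w f)) (\<lambda>x\<in>M. a * f x + b * g x)
      = (\<lambda>x\<in>M. a * lincomb M ps (\<lambda>w. foldr bessel_on w f) x + b * lincomb M ps (\<lambda>w. foldr bessel_on w g) x)"
    if f: "f \<in> smooth_functions M" and g: "g \<in> smooth_functions M" for f g a b
  proof -
    have "foldr bessel_on w (\<lambda>x\<in>M. a * f x + b * g x) = (\<lambda>x\<in>M. a * foldr bessel_on w f x + b * foldr bessel_on w g x)" for w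
      by (rule lin_opD(2)[OF foldr_lin_op[OF lin_bessel_on] f g])
    then show ?thesis using S_comb[OF f g, of a b]
      by (auto simp: lincomb_def fun_eq_iff sum_list_const_mult[symmetric] sum_list_addf[symmetric] distrib_left mult_ac)
  qed
  then show ?thesis using beval_S by (auto simp: operator_ring_def beval_def)
qed

lemma beval_add: "beval ps \<oplus>\<^bsub>R\<^esub> beval qs = beval (ps @ qs)"
proof -
  have "(\<lambda>x\<in>M. lincomb M ps g x + lincomb M qs g x) = lincomb M (ps @ qs) g" for g
    by (rule ext) (simp add: lincomb_def)
  then show ?thesis by (simp add: operator_ring_def beval_def cong: restrict_cong)
qed

lemma beval_mult: "beval ps \<otimes>\<^bsub>R\<^esub> beval qs = beval (pmul ps qs)"
proof -
  have "lincomb M ps (\<lambda>w. foldr bessel_on w (lincomb M qs (\<lambda>v. foldr bessel_on v f))) = lincomb M (pmul ps qs) (\<lambda>w. foldr bessel_on w f)"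
    if f: "f \<in> smooth_functions M" for f
  proof (rule S_eqI)
    show "lincomb M ps (\<lambda>w. foldr bessel_on w (lincomb M qs (\<lambda>v. foldr bessel_on v f))) \<in> smooth_functions M"
      by (rule beval_S[OF beval_S[OF f]])
    show "lincomb M (pmul ps qs) (\<lambda>w. foldr bessel_on w f) \<in> smooth_functions M" by (rule beval_S[OF f])
    fix x assume x: "x \<in> M"
    have "foldr bessel_on w (lincomb M qs (\<lambda>v. foldr bessel_on v f)) = lincomb M qs (\<lambda>v. foldr bessel_on w (foldr bessel_on v f))" for w
      by (rule lin_op_lincomb[OF foldr_lin_op[OF lin_bessel_on]]) (rule foldr_S[OF lin_bessel_on f])
    then show "lincomb M ps (\<lambda>w. foldr bessel_on w (lincomb M qs (\<lambda>v. foldr bessel_on v f))) x = lincomb M (pmul ps qs) (\<lambda>w. foldr bessel_on w f) x"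
      using x by (simp add: lincomb_pmul) (simp add: lincomb_def)
  qed
  then show ?thesis using beval_S
    by (simp add: operator_ring_def beval_def compose_def cong: restrict_cong)
qed

lemma beval_one: "\<one>\<^bsub>R\<^esub> = beval [(1, [])]"
proof -
  have "lincomb M [(1, [])] (\<lambda>w. foldr bessel_on w f) = f" if "f \<in> smooth_functions M" for f
    by (rule S_eqI[OF beval_S[OF that] that]) (simp add: lincomb_def)
  then show ?thesis by (simp add: operator_ring_def beval_def cong: restrict_cong)
qed

lemma beval_scalar: "scalar_operator M a = beval [(a, [])]"
  unfolding scalar_operator_def beval_def by (rule restrict_ext) (simp add: lincomb_def)

lemma beval_bessel_on: "bessel_operator V l M (tau z) = beval [(1, [z])]"
proof (rule ext)
  fix f show "bessel_operator V l M (tau z) f = beval [(1, [z])] f"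
  proof (cases "f \<in> smooth_functions M")
    case True
    have "bessel_on z f = lincomb M [(1, [z])] (\<lambda>w. foldr bessel_on w f)"
      by (rule S_eqI[OF bessel_on_S[OF True] beval_S[OF True]]) (simp add: lincomb_def)
    then show ?thesis using True by (simp add: beval_def bessel_on_def)
  qed (simp add: beval_def bessel_operator_def)
qed

text \<open>The negative is an inverse in the additive monoid, and the only one because operators are determined
by their values.\<close>

lemma beval_a_inv: "\<ominus>\<^bsub>R\<^esub> beval ps = beval (neg ps)"
proof -
  have z: "\<zero>\<^bsub>R\<^esub> = (\<lambda>f\<in>smooth_functions M. \<lambda>x\<in>M. 0)" by (simp add: operator_ring_def)
  have ap: "(D \<oplus>\<^bsub>R\<^esub> E) f x = D f x + E f x" if "f \<in> smooth_functions M" "x \<in> M" for D E f x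
    using that by (simp add: operator_ring_def)
  have zero: "beval (ps @ qs) = \<zero>\<^bsub>R\<^esub>" if "\<And>x. peval ps x + peval qs x = 0" for ps qs
  proof -
    have "beval (ps @ qs) = beval [(0, [])]" unfolding beval_eq_iff by (rule restrict_ext) (use that in \<open>simp add: peval_def\<close>)
    also have "\<dots> = \<zero>\<^bsub>R\<^esub>" unfolding beval_scalar[symmetric] scalar_operator_def z by simp
    finally show ?thesis .
  qed
  have "m_inv (add_monoid R) (beval ps) = beval (neg ps)" unfolding m_inv_def
  proof (rule the_equality)
    show "beval (neg ps) \<in> carrier (add_monoid R) \<and> beval ps \<otimes>\<^bsub>add_monoid R\<^esub> beval (neg ps) = \<one>\<^bsub>add_monoid R\<^esub>
        \<and> beval (neg ps) \<otimes>\<^bsub>add_monoid R\<^esub> beval ps = \<one>\<^bsub>add_monoid R\<^esub>"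
      using beval_carrier by (simp add: beval_add zero peval_neg)
  next
    fix D assume "D \<in> carrier (add_monoid R) \<and> beval ps \<otimes>\<^bsub>add_monoid R\<^esub> D = \<one>\<^bsub>add_monoid R\<^esub>
        \<and> D \<otimes>\<^bsub>add_monoid R\<^esub> beval ps = \<one>\<^bsub>add_monoid R\<^esub>"
    then have D: "D \<in> carrier R" and sum: "beval ps \<oplus>\<^bsub>R\<^esub> D = \<zero>\<^bsub>R\<^esub>" by simp_all
    have Dm: "D \<in> smooth_functions M \<rightarrow>\<^sub>E smooth_functions M" using D by (simp add: operator_ring_def)
    show "D = beval (neg ps)"
    proof (rule extensionalityI)
      show "D \<in> extensional (smooth_functions M)" using Dm by (simp add: PiE_def)
      show "beval (neg ps) \<in> extensional (smooth_functions M)" by (simp add: beval_def)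
      fix f assume f: "f \<in> smooth_functions M"
      show "D f = beval (neg ps) f"
      proof (rule S_eqI)
        show "D f \<in> smooth_functions M" using Dm f by (rule PiE_mem)
        show "beval (neg ps) f \<in> smooth_functions M" using beval_S[OF f] f by (simp add: beval_def)
        fix x assume x: "x \<in> M"
        have "beval ps f x + D f x = 0" using ap[OF f x, of "beval ps" D] f x unfolding sum by (simp add: z)
        then show "D f x = beval (neg ps) f x" using f x by (simp add: beval_def lincomb_neg)
      qed
    qed
  qed
  then show ?thesis by (simp add: a_inv_def)
qed

lemma bessel_ring_carrier: "carrier (bessel_ring V l M) = range beval"
proof -
  let ?H = "range (scalar_operator M) \<union> {bessel_operator V l M \<phi> | \<phi>. linear \<phi>}"
  have H: "h \<in> range beval" if "h \<in> ?H" for h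
  proof -
    consider a where "h = scalar_operator M a" | \<phi> where "linear \<phi>" "h = bessel_operator V l M \<phi>" using \<open>h \<in> ?H\<close> by blast
    then show ?thesis
    proof cases
      case 1 then show ?thesis by (simp add: beval_scalar)
    next
      case (2 \<phi>)
      obtain z where z: "\<And>x. \<phi> x = tau z x" using tau_representation[OF 2(1)] by blast
      have "\<phi> = tau z" by (rule ext) (rule z)
      then show ?thesis using 2(2) by (simp add: beval_bessel_on)
    qed
  qed
  have 1: "h \<in> range beval" if "h \<in> generate_ring R ?H" for h
    using that
  proof (induction rule: generate_ring.induct)
    case one then show ?case by (simp add: beval_one)
  next
    case (incl h) then show ?case by (rule H)
  next
    case (a_inv h) then show ?case by (auto simp: beval_a_inv)
  next
    case (eng_add h1 h2) then show ?case by (auto simp: beval_add)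
  next
    case (eng_mult h1 h2) then show ?case by (auto simp: beval_mult)
  qed
  have w: "beval [(a, w)] \<in> generate_ring R ?H" for a w
  proof (induction w)
    case Nil
    have "beval [(a, [])] \<in> ?H" unfolding beval_scalar[symmetric] by (rule UnI1) (rule rangeI)
    then show ?case by (rule generate_ring.incl)
  next
    case (Cons z w)
    have "beval [(1, [z])] \<in> ?H" unfolding beval_bessel_on[symmetric]
      by (rule UnI2, rule CollectI, rule exI, rule conjI, rule refl, rule linear_tau)
    then have "beval [(1, [z])] \<otimes>\<^bsub>R\<^esub> beval [(a, w)] \<in> generate_ring R ?H"
      by (intro generate_ring.eng_mult Cons.IH generate_ring.incl)
    then show ?case by (simp add: beval_mult pmul_def)
  qed
  have 2: "beval ps \<in> generate_ring R ?H" for ps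
  proof (induction ps)
    case Nil
    have "beval [] = beval [(0, [])]" by (simp add: beval_eq_iff peval_def[abs_def])
    then show ?case using w by simp
  next
    case (Cons p ps)
    have "beval [(fst p, snd p)] \<oplus>\<^bsub>R\<^esub> beval ps \<in> generate_ring R ?H" by (intro generate_ring.eng_add w Cons.IH)
    then show ?case by (simp add: beval_add)
  qed
  show ?thesis using 1 2 by (auto simp: bessel_ring_def)
qed

lemma polynomial_restrictions_carrier: "carrier (polynomial_restrictions M) = range (\<lambda>ps. restrict (peval ps) M)"
proof -
  have "\<exists>ps. \<forall>x. p x = peval ps x" if "real_polynomial_function p" for p
    using that
  proof (induction rule: real_polynomial_function.induct)
    case (linear f)
    then obtain z where "\<And>x. f x = tau z x" using tau_representation[of f] bounded_linear.linear by blast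
    then show ?case by (intro exI[of _ "[(1, [z])]"]) (simp add: peval_def)
  next
    case (const c) show ?case by (intro exI[of _ "[(c, [])]"]) (simp add: peval_def)
  next
    case (add f g)
    then obtain ps qs where "\<forall>x. f x = peval ps x" "\<forall>x. g x = peval qs x" by blast
    then show ?case by (intro exI[of _ "ps @ qs"]) (simp add: peval_append)
  next
    case (mult f g)
    then obtain ps qs where "\<forall>x. f x = peval ps x" "\<forall>x. g x = peval qs x" by blast
    then show ?case by (intro exI[of _ "pmul ps qs"]) (simp add: peval_pmul)
  qed
  note poly = this
  have 1: "restrict p M \<in> range (\<lambda>ps. restrict (peval ps) M)" if hyp: "real_polynomial_function p" for p
  proof -
    obtain ps where ps: "\<forall>x. p x = peval ps x" using poly[OF hyp] by (rule exE)
    have "restrict p M = restrict (peval ps) M" by (rule restrict_ext) (simp add: ps)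
    then show ?thesis by (rule image_eqI) (rule UNIV_I)
  qed
  have 2: "real_polynomial_function (peval ps)" for ps
  proof (induction ps)
    case Nil show ?case unfolding peval_def by (simp add: real_polynomial_function.intros(2))
  next
    case (Cons p ps)
    have "real_polynomial_function (\<lambda>x. \<Prod>a\<leftarrow>w. tau a x)" for w
    proof (induction w)
      case Nil show ?case by (simp add: real_polynomial_function.intros(2))
    next
      case (Cons a w)
      have "real_polynomial_function (tau a)"
        using linear_tau by (simp add: real_polynomial_function.intros(1) linear_conv_bounded_linear[symmetric])
      from real_polynomial_function.intros(4)[OF this Cons.IH] show ?case by simp
    qed
    from real_polynomial_function.intros(3)[OF real_polynomial_function.intros(4)[OF real_polynomial_function.intros(2) this] Cons.IH]
    have "real_polynomial_function (\<lambda>x. fst p * (\<Prod>a\<leftarrow>snd p. tau a x) + peval ps x)" .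
    then show ?case by (simp add: peval_def[abs_def])
  qed
  show ?thesis
  proof (rule equalityI; rule subsetI)
    fix f assume "f \<in> carrier (polynomial_restrictions M)"
    then show "f \<in> range (\<lambda>ps. restrict (peval ps) M)" using 1 by (auto simp: polynomial_restrictions_def)
  next
    fix f assume "f \<in> range (\<lambda>ps. restrict (peval ps) M)"
    then show "f \<in> carrier (polynomial_restrictions M)" using 2 by (auto simp: polynomial_restrictions_def)
  qed
qed

text \<open>Both rings are images of the free algebra under evaluations with the same kernel, and the isomorphism
sends one value of a formal polynomial to the other.\<close>

theorem bessel_ring_iso: "bessel_ring V l M \<simeq> polynomial_restrictions M"
proof -
  let ?Q = "polynomial_restrictions M"
  define h where "h D = restrict (peval (SOME ps. beval ps = D)) M" for D
  have h: "h (beval ps) = restrict (peval ps) M" for ps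
  proof -
    have "beval (SOME qs. beval qs = beval ps) = beval ps" by (rule someI[of "\<lambda>qs. beval qs = beval ps" ps]) (rule refl)
    then show ?thesis unfolding h_def beval_eq_iff .
  qed
  have B: "x \<otimes>\<^bsub>bessel_ring V l M\<^esub> y = x \<otimes>\<^bsub>R\<^esub> y" "x \<oplus>\<^bsub>bessel_ring V l M\<^esub> y = x \<oplus>\<^bsub>R\<^esub> y"
      "\<one>\<^bsub>bessel_ring V l M\<^esub> = \<one>\<^bsub>R\<^esub>" for x y
    by (simp_all add: bessel_ring_def)
  have Q: "restrict (peval ps) M \<otimes>\<^bsub>?Q\<^esub> restrict (peval qs) M = restrict (peval (pmul ps qs)) M"
      "restrict (peval ps) M \<oplus>\<^bsub>?Q\<^esub> restrict (peval qs) M = restrict (peval (ps @ qs)) M"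
      "\<one>\<^bsub>?Q\<^esub> = restrict (peval [(1, [])]) M" for ps qs
    by (auto simp: polynomial_restrictions_def peval_pmul peval_append fun_eq_iff) (simp_all add: peval_def)
  have "h \<in> Ring.ring_hom (bessel_ring V l M) ?Q"
    unfolding Ring.ring_hom_def mem_Collect_eq bessel_ring_carrier polynomial_restrictions_carrier
    by (auto simp: h B Q beval_mult beval_add beval_one)
  moreover have "bij_betw h (carrier (bessel_ring V l M)) (carrier ?Q)"
    unfolding bij_betw_def bessel_ring_carrier polynomial_restrictions_carrier
    by (auto simp: inj_on_def h beval_eq_iff image_image)
  ultimately show ?thesis unfolding is_ring_iso_def ring_iso_def by blast
qed

end

section \<open>The orbit of a primitive idempotent\<close>

context cartan_jordan_simple begin

lemma jordan_frame_orth_system: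
  assumes fr: "jordan_frame_on V Vp m c"
  shows "orth_system (c ` {1..m}) \<ee>" "inj_on c {1..m}"
proof -
  have p: "primitive (c i)" if "i \<in> {1..m}" for i using fr that by (simp add: jordan_frame_on_def)
  have o: "c i \<star> c j = 0" if "i \<in> {1..m}" "j \<in> {1..m}" "i \<noteq> j" for i j using fr that by (simp add: jordan_frame_on_def)
  show inj: "inj_on c {1..m}"
  proof (rule inj_onI, rule ccontr)
    fix i j assume ij: "i \<in> {1..m}" "j \<in> {1..m}" "c i = c j" "i \<noteq> j"
    then have "c i \<star> c i = 0" using o[of i j] by simp
    then show False using primitiveD(2,3)[OF p[OF ij(1)]] by simp
  qed
  have orth: "x \<star> y = 0" if "x \<in> c ` {1..m}" "y \<in> c ` {1..m}" "x \<noteq> y" for x y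
  proof -
    obtain i j where "i \<in> {1..m}" "j \<in> {1..m}" "x = c i" "y = c j" using \<open>x \<in> c ` {1..m}\<close> \<open>y \<in> c ` {1..m}\<close> by blast
    then show ?thesis using o[of i j] \<open>x \<noteq> y\<close> by fastforce
  qed
  have prim: "primitive x" if "x \<in> c ` {1..m}" for x using that p by blast
  have sumF: "\<Sum>(c ` {1..m}) = \<ee>" using fr inj by (simp add: sum.reindex jordan_frame_on_def)
  show "orth_system (c ` {1..m}) \<ee>" unfolding orth_system_def
    by (intro conjI ballI impI;
        (rule finite_imageI[OF finite_atLeastAtMost] sumF | (rule prim; assumption) | (rule orth; assumption)))
qed

text \<open>An element of both 1/2-spaces lies in the 1-space of \<open>c\<^sub>i + c\<^sub>j\<close>, which all other members of the frame
annihilate.\<close>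

lemma peirce_space_frame:
  assumes fr: "jordan_frame_on V Vp m c" and i: "i \<in> {1..m}" and j: "j \<in> {1..m}" and ij: "i \<noteq> j"
  shows "peirce_space V m c i j = peirce (c i) (1/2) \<inter> peirce (c j) (1/2)"
proof (rule equalityI; rule subsetI)
  fix x assume x: "x \<in> peirce_space V m c i j"
  have "c i \<star> x = (1/2) *\<^sub>R x" "c j \<star> x = (1/2) *\<^sub>R x"
    using x i j ij unfolding peirce_space_def by force+
  then show "x \<in> peirce (c i) (1/2) \<inter> peirce (c j) (1/2)" by simp
next
  fix x assume x: "x \<in> peirce (c i) (1/2) \<inter> peirce (c j) (1/2)"
  have p: "primitive (c i)" if "i \<in> {1..m}" for i using fr that by (simp add: jordan_frame_on_def)
  have o: "c i \<star> c j = 0" if "i \<in> {1..m}" "j \<in> {1..m}" "i \<noteq> j" for i j using fr that by (simp add: jordan_frame_on_def)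
  have e: "(c i + c j) \<star> (c i + c j) = c i + c j"
    by (simp add: mul_simps primitiveD(3)[OF p[OF i]] primitiveD(3)[OF p[OF j]] o[OF i j ij] o[OF j i ij[symmetric]])
  have x1: "x \<in> peirce (c i + c j) 1" using x by (simp add: mul_simps flip: scaleR_left_distrib)
  have other: "c k \<star> x = 0" if k: "k \<in> {1..m}" "k \<noteq> i" "k \<noteq> j" for k
  proof -
    have "c k \<in> peirce (c i + c j) 0" using o[OF i k(1)] o[OF j k(1)] k by (simp add: mul_simps)
    from peirce_1_0[OF e x1 this] show ?thesis by (simp add: mul_commute[of "c k"])
  qed
  show "x \<in> peirce_space V m c i j" unfolding peirce_space_def
  proof (intro CollectI ballI)
    fix k assume k: "k \<in> {1..m}"
    show "c k \<star> x = ((of_bool (i = k) + of_bool (j = k)) / 2) *\<^sub>R x"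
      using x ij other[OF k] by (cases "k = i"; cases "k = j") auto
  qed
qed

end

theorem theoremC:
  fixes V :: "'a::euclidean_space jalg"
    and \<theta> :: "'a \<Rightarrow> 'a"
    and c :: "nat \<Rightarrow> 'a"
    and i j r r\<^sub>0 d :: nat
    and l\<^sub>1 :: real
    and \<O> :: "'a set"
  assumes "simple_jordan_algebra V"
    and "r = jrank V"
    and "cartan_involution V \<theta>"
    and "jsimple_on V (plus_space \<theta>)"
    and "r\<^sub>0 = split_rank V \<theta>"
    and "r\<^sub>0 > 1"
    and "\<not> (\<exists>p q. p \<ge> 3 \<and> q \<ge> 3 \<and> odd (p + q) \<and>
               lie_isomorphic (conformal_algebra V) (so_algebra p q))"
    and "jordan_frame_on V (plus_space \<theta>) r\<^sub>0 c"
    and "1 \<le> i" and "i < j" and "j \<le> r\<^sub>0"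
    and "d = dim (peirce_space V r\<^sub>0 c i j)"
    and "l\<^sub>1 = real r\<^sub>0 * real d / (2 * real r)"
    and "\<O> = Str_orbit V (c 1)"
  shows "bessel_ring V l\<^sub>1 \<O> \<simeq> polynomial_restrictions \<O>"
proof -
  interpret J: cartan_jordan_simple V \<theta>
    using assms(1,3,4) by unfold_locales (simp_all add: simple_jordan_algebra_def)
  let ?F = "c ` {1..r\<^sub>0}"
  note fr = J.jordan_frame_orth_system[OF assms(8)]
  have i: "i \<in> {1..r\<^sub>0}" and j: "j \<in> {1..r\<^sub>0}" and ij: "i \<noteq> j" and one: "1 \<in> {1..r\<^sub>0}" and two: "2 \<in> {1..r\<^sub>0}"
    using assms(6,9,10,11) by auto
  have mem: "c i \<in> ?F" "c j \<in> ?F" "c 1 \<in> ?F" "c 2 \<in> ?F" using i j one two by blast+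
  have ne: "c i \<noteq> c j" "c 1 \<noteq> c 2"
    using inj_on_contraD[OF fr(2) ij i j] inj_on_contraD[OF fr(2) _ one two] by auto
  have idem: "jmult V (c k) (c k) = c k" if "k \<in> {1..r\<^sub>0}" for k
    using J.primitiveD(3)[of "c k"] assms(8) that by (simp add: jordan_frame_on_def)
  have orth: "jmult V (c i) (c j) = 0" using assms(8) i j ij by (simp add: jordan_frame_on_def)
  \<comment> \<open>The frame is homogeneous, so the multiplicity of the given pair \<open>i, j\<close> may be read off at \<open>c\<^sub>1\<close>.\<close>
  have "J.mixed_trace (c 1) (c 2) = J.mixed_trace (c i) (c j)"
    by (rule J.frame_homogeneous(1)[OF fr(1) mem(3,4) ne(2) mem(1,2) ne(1)])
  also have "\<dots> = real d / 2"
    unfolding assms(12) J.peirce_space_frame[OF assms(8) i j ij] by (rule J.mixed_trace_dim[OF idem[OF i] idem[OF j] orth])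
  finally have mt: "J.mixed_trace (c 1) (c 2) = real d / 2" .
  have l: "J.mixed_trace (c 1) (c 2) * real (card ?F) / real (jrank V) = l\<^sub>1"
    unfolding mt assms(2,13) card_image[OF fr(2)] by (simp add: mult.commute)
  have tan: "bessel V l\<^sub>1 F x = 0"
    if hyp: "smooth_on U F" "\<And>y. y \<in> U \<inter> \<O> \<Longrightarrow> F y = 0" "x \<in> U \<inter> \<O>" for U F x
    using J.bessel_tangential[OF fr(1) mem(3) mem(4) ne(2) hyp(1) hyp(2)[unfolded assms(14)] hyp(3)[unfolded assms(14)]]
    unfolding l .
  interpret T: tangential_bessel V \<theta> \<O> l\<^sub>1
    by unfold_locales (rule tan)
  show ?thesis by (rule T.bessel_ring_iso)
qed

end
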